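(* Let $d=2$, $\Omega\subset\mathbb R^2$ a polygon that is a bounded Lipschitz domain, $p\in\mathbb N_0$, $q\in\mathbb N$. Consider a family of (uniformly) shape-regular, isotropic partitions $\mathcal P^\delta$ of $\overline\Sigma$ into prisms, with parameters $h_\delta,H_\delta>0$, $h_\delta\le\frac{H_\delta}{p+2}$, and continuous piecewise linear hat functions $\phi_\alpha,\phi_\beta$ on $\Omega$ (depending on $\delta$) such that $\int_\Omega\phi_\alpha\,dx=\int_\Omega\phi_\beta\,dx\eqsim H_\delta^2$, $\operatorname{diam}\operatorname{supp}\phi_\alpha\eqsim H_\delta\eqsim\operatorname{diam}\operatorname{supp}\phi_\beta$, $\operatorname{dist}(\operatorname{supp}\phi_\alpha,\operatorname{supp}\phi_\beta)\lesssim H_\delta$, and such that: the restriction of $\mathcal P^\delta$ to $[0,H_\delta]\times\operatorname{supp}\phi_\beta$ is the coarsest partition w.r.t. which $\chi_{(0,H_\delta)}\otimes\phi_\beta$ is piecewise polynomial (i.e. it consists of the prisms $[0,H_\delta]\times T$ with $T$ the triangles underlying $\phi_\beta$), whereas the restriction of $\mathcal P^\delta$ to $[0,H_\delta]\times\operatorname{supp}\phi_\alpha$ is a further refinement of the corresponding coarsest partition for $\chi_{(0,H_\delta)}\otimes\phi_\alpha$ with locally uniform mesh-size $h_\delta$ (in particular its prisms have time intervals $[(i-1)h_\delta,ih_\delta]$, $1\le i\le H_\delta/h_\delta\in\mathbb N$). Let $$X^\delta:=C(\overline\Sigma)\cap L_2(\Xi;H_0^1(\Omega))\cap Q_{1,1}(\mathcal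 P^\delta),\qquad Y^\delta:=L_2(\Xi;H_0^1(\Omega))\cap Q_{p,q}(\mathcal P^\delta).$$ Then $$\gamma_\delta^{\mathrm d_t}\to0\quad\text{as }H_\delta\to0,\qquad\text{and}\qquad\gamma_\delta^{B_e}\to0\quad\text{as }H_\delta\to0\text{ and }\frac{h_\delta}{H_\delta^2\sqrt{|\log H_\delta|}}\to0 .$$
   Context: $\Xi=(0,1)$ (so $\mathrm T=1$), $\Sigma=\Xi\times\Omega$. $\lesssim,\gtrsim,\eqsim$ denote inequalities/equivalences up to positive constants independent of $\delta$. A prism is $P=I_P\times T_P$ with $I_P\subset\overline\Xi$ an interval and $T_P\subset\overline\Omega$ a triangle; shape-regular and isotropic means that the $T_P$ are uniformly shape-regular and $|I_P|\eqsim\operatorname{diam}T_P$. A hat function is the continuous piecewise linear nodal basis function, with value $1$ at one interior vertex and $0$ at all other vertices, of a conforming triangulation of the patch around that vertex. $H=L_2(\Omega)$, $V=H_0^1(\Omega)$, $Y=L_2(\Xi;H_0^1(\Omega))$ equipped with $\|v\|_Y:=\|\nabla_xv\|_{L_2(\Sigma)^2}$, $Y'$ with the dual norm, $X=Y\cap H^1(\Xi;H^{-1}(\Omega))$. $\mathrm d_t\in\mathcal L(X,Y')$, $(\mathrm d_tw)(v)=\int_\Xi(\frac{dw}{dt}(t))(v(t))\,dt$. $A(t)\in\mathcal L(V,V')$ is bounded and coercive uniformly in a.e. $t\in\Xi$, $A\in\mathcal L(Y,Y')$ is $(Aw)(v)=\int_\Xi(A(t)w(t))(v(t))\,dt$,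 $B:=\mathrm d_t+A$, $\gamma_0w:=w(0)$, $B_e:=(B,\gamma_0)\colon X\to Y'\times H$. $Q_{p,q}(\mathcal P^\delta)$ is the space of functions whose restriction to each $P\in\mathcal P^\delta$ belongs to $P_p(I_P)\otimes P_q(T_P)$, where $P_k$ denotes polynomials of degree at most $k$. For $g\in Y'$, $\|g\|_{(Y^\delta)'}:=\sup_{0\ne v\in Y^\delta}g(v)/\|v\|_Y$. Define $$\gamma_\delta^{\mathrm d_t}:=\inf_{\{w\in X^\delta:\ \mathrm d_tw\ne0\}}\frac{\|\mathrm d_tw\|_{(Y^\delta)'}}{\|\mathrm d_tw\|_{Y'}},\qquad(\gamma_\delta^{B_e})^2:=\inf_{0\ne w\in X^\delta}\frac{\|Bw\|_{(Y^\delta)'}^2+\|\gamma_0w\|_H^2}{\|Bw\|_{Y'}^2+\|\gamma_0w\|_H^2}.$$ In the argument for this result (in bounding $\|\phi_\alpha\|_{H^{-1}(\Omega)}$ from below) it is assumed, "without loss of generality", that $\operatorname{supp}\phi_\alpha\subset\{x\in\mathbb R^2:|x|\le H_\delta\}$ and $\{x\in\mathbb R^2:|x|\le1\}\subset\Omega$; this is not listed among the conditions on $\phi_\alpha,\phi_\beta$.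
   Formalization: It is additionally assumed that supp φ_α stays away from the boundary: for some r>0 independent of δ, supp φ_α lies in a ball of radius ≲ H_δ whose centre has distance at least r to ∂Ω (the paper's "without loss of generality"); for patches at distance ~H_δ from ∂Ω the claim can fail. *)

theory Defs
  imports "HOL-Analysis.Analysis"
begin

text \<open>
  Elements of function spaces are represented by functions; all (semi)norms below are invariant
  under changes on null sets.  A function on the space-time cylinder is written in curried form
  \<open>w t x\<close>, and is at the same time the Banach-space valued map \<open>t \<mapsto> w t\<close>.
  A functional on a set \<open>S\<close> of functions is a map on all functions, of which only the values on
  \<open>S\<close> are relevant.
\<close>

section \<open>Domains\<close>

definition lipschitz_boundary :: "(real^2) set \<Rightarrow> bool" where
  "lipschitz_boundary \<Omega> \<longleftrightarrow> (\<forall>x\<in>frontier \<Omega>.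
     \<exists>r>0. \<exists>R::real^2 \<Rightarrow> real^2. \<exists>L. \<exists>g::real \<Rightarrow> real. orthogonal_transformation R \<and> L-lipschitz_on UNIV g \<and>
       (\<forall>y\<in>ball x r. y \<in> \<Omega> \<longleftrightarrow> g (R y $ 1) < R y $ 2))"

definition lipschitz_domain :: "(real^2) set \<Rightarrow> bool" where
  "lipschitz_domain \<Omega> \<longleftrightarrow> open \<Omega> \<and> connected \<Omega> \<and> \<Omega> \<noteq> {} \<and> lipschitz_boundary \<Omega>"

definition polygonal :: "(real^2) set \<Rightarrow> bool" where
  "polygonal \<Omega> \<longleftrightarrow>
     (\<exists>E::((real^2) \<times> (real^2)) set. finite E \<and> frontier \<Omega> = (\<Union>(a, b)\<in>E. closed_segment a b))"

abbreviation \<Xi> :: "real set" where "\<Xi> \<equiv> {0<..<1}"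

section \<open>Sobolev spaces\<close>

primrec C_k :: "nat \<Rightarrow> ('a::euclidean_space \<Rightarrow> real) \<Rightarrow> bool" where
  "C_k 0 f \<longleftrightarrow> continuous_on UNIV f"
| "C_k (Suc k) f \<longleftrightarrow>
     (\<forall>x. f differentiable (at x)) \<and> (\<forall>b\<in>Basis. C_k k (\<lambda>x. frechet_derivative f (at x) b))"

definition supp :: "('a::topological_space \<Rightarrow> real) \<Rightarrow> 'a set" where
  "supp f = closure {x. f x \<noteq> 0}"

definition test_functions :: "'a::euclidean_space set \<Rightarrow> ('a \<Rightarrow> real) set" where
  "test_functions S = {\<phi>. (\<forall>k. C_k k \<phi>) \<and> compact (supp \<phi>) \<and> supp \<phi> \<subseteq> S}"

definition L2 :: "'a::euclidean_space set \<Rightarrow> ('a \<Rightarrow> 'b::euclidean_space) set" where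
  "L2 S = {f. f \<in> borel_measurable (lebesgue_on S) \<and>
              integrable (lebesgue_on S) (\<lambda>x. (norm (f x))\<^sup>2)}"

definition L2_norm :: "'a::euclidean_space set \<Rightarrow> ('a \<Rightarrow> 'b::euclidean_space) \<Rightarrow> real" where
  "L2_norm S f = sqrt (\<integral>x. (norm (f x))\<^sup>2 \<partial>lebesgue_on S)"

definition is_weak_gradient ::
  "(real^2) set \<Rightarrow> (real^2 \<Rightarrow> real) \<Rightarrow> (real^2 \<Rightarrow> real^2) \<Rightarrow> bool" where
  "is_weak_gradient \<Omega> u g \<longleftrightarrow> u \<in> L2 \<Omega> \<and> g \<in> L2 \<Omega> \<and>
     (\<forall>\<phi>\<in>test_functions \<Omega>. \<forall>i.
        (\<integral>x. u x * frechet_derivative \<phi> (at x) (axis i 1) \<partial>lebesgue_on \<Omega>)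
        = - (\<integral>x. g x $ i * \<phi> x \<partial>lebesgue_on \<Omega>))"

definition weak_gradient :: "(real^2) set \<Rightarrow> (real^2 \<Rightarrow> real) \<Rightarrow> real^2 \<Rightarrow> real^2" where
  "weak_gradient \<Omega> u = (SOME g. is_weak_gradient \<Omega> u g)"

definition H1 :: "(real^2) set \<Rightarrow> (real^2 \<Rightarrow> real) set" where
  "H1 \<Omega> = {u. \<exists>g. is_weak_gradient \<Omega> u g}"

definition H1_norm :: "(real^2) set \<Rightarrow> (real^2 \<Rightarrow> real) \<Rightarrow> real" where
  "H1_norm \<Omega> u = sqrt ((L2_norm \<Omega> u)\<^sup>2 + (L2_norm \<Omega> (weak_gradient \<Omega> u))\<^sup>2)"

definition H10 :: "(real^2) set \<Rightarrow> (real^2 \<Rightarrow> real) set" where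
  "H10 \<Omega> = {u \<in> H1 \<Omega>. \<exists>\<phi>::nat \<Rightarrow> real^2 \<Rightarrow> real.
     (\<forall>n. \<phi> n \<in> test_functions \<Omega>) \<and> (\<lambda>n. H1_norm \<Omega> (\<phi> n - u)) \<longlonglongrightarrow> 0}"

definition V_norm :: "(real^2) set \<Rightarrow> (real^2 \<Rightarrow> real) \<Rightarrow> real" where
  "V_norm \<Omega> u = L2_norm \<Omega> (weak_gradient \<Omega> u)"

text \<open>
  The supremum is formed in \<^typ>\<open>ennreal\<close> and converted; the conversion is
  immaterial for bounded functionals, the only ones for which this is used.
  The supremum over \<open>v\<close> and \<open>- v\<close> makes the truncation of negative values immaterial.
\<close>

definition dual_norm :: "'a set \<Rightarrow> ('a \<Rightarrow> real) \<Rightarrow> ('a \<Rightarrow> real) \<Rightarrow> real" where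
  "dual_norm S N g = enn2real (SUP v\<in>{v \<in> S. N v \<noteq> 0}. ennreal (g v / N v))"

definition linear_on_functions :: "('a \<Rightarrow> real) set \<Rightarrow> (('a \<Rightarrow> real) \<Rightarrow> real) \<Rightarrow> bool" where
  "linear_on_functions S g \<longleftrightarrow>
     (\<forall>u\<in>S. \<forall>v\<in>S. g (\<lambda>x. u x + v x) = g u + g v) \<and>
     (\<forall>c. \<forall>u\<in>S. g (\<lambda>x. c * u x) = c * g u)"

definition Hm1 :: "(real^2) set \<Rightarrow> ((real^2 \<Rightarrow> real) \<Rightarrow> real) set" where
  "Hm1 \<Omega> = {g. linear_on_functions (H10 \<Omega>) g \<and> (\<exists>K. \<forall>v\<in>H10 \<Omega>. \<bar>g v\<bar> \<le> K * V_norm \<Omega> v)}"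

definition Hm1_norm :: "(real^2) set \<Rightarrow> ((real^2 \<Rightarrow> real) \<Rightarrow> real) \<Rightarrow> real" where
  "Hm1_norm \<Omega> = dual_norm (H10 \<Omega>) (V_norm \<Omega>)"

section \<open>Bochner spaces\<close>

text \<open>
  The space \<open>L\<^sub>2(J; E)\<close> of strongly measurable, square integrable maps into the seminormed space
  with carrier \<open>E\<close> and seminorm \<open>N\<close>.
\<close>

definition bochner_L2 :: "real set \<Rightarrow> 'a::minus set \<Rightarrow> ('a \<Rightarrow> real) \<Rightarrow> (real \<Rightarrow> 'a) set" where
  "bochner_L2 J E N = {u.
     (AE t in lebesgue_on J. u t \<in> E) \<and>
     (\<exists>s::nat \<Rightarrow> real \<Rightarrow> 'a.
        (\<forall>n. simple_function (lebesgue_on J) (s n) \<and> s n ` J \<subseteq> E) \<and>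
        (AE t in lebesgue_on J. (\<lambda>n. N (s n t - u t)) \<longlonglongrightarrow> 0)) \<and>
     integrable (lebesgue_on J) (\<lambda>t. (N (u t))\<^sup>2)}"

definition Y_space :: "(real^2) set \<Rightarrow> (real \<Rightarrow> real^2 \<Rightarrow> real) set" where
  "Y_space \<Omega> = bochner_L2 \<Xi> (H10 \<Omega>) (V_norm \<Omega>)"

definition Y_norm :: "(real^2) set \<Rightarrow> (real \<Rightarrow> real^2 \<Rightarrow> real) \<Rightarrow> real" where
  "Y_norm \<Omega> v = sqrt (\<integral>t. (L2_norm \<Omega> (weak_gradient \<Omega> (v t)))\<^sup>2 \<partial>lebesgue_on \<Xi>)"

text \<open>
  Weak derivative in \<open>L\<^sub>2(\<Xi>; H\<^sup>-\<^sup>1(\<Omega>))\<close> (unique up to null sets) of \<open>w \<in> Y\<close>, where \<open>w t \<in> L\<^sub>2(\<Omega>)\<close> is identified with the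
  functional \<open>\<eta> \<mapsto> (w t, \<eta>)\<close> in \<open>H\<^sup>-\<^sup>1(\<Omega>)\<close>.
\<close>

definition is_weak_time_derivative ::
  "(real^2) set \<Rightarrow> (real \<Rightarrow> real^2 \<Rightarrow> real) \<Rightarrow> (real \<Rightarrow> (real^2 \<Rightarrow> real) \<Rightarrow> real) \<Rightarrow> bool" where
  "is_weak_time_derivative \<Omega> w g \<longleftrightarrow> g \<in> bochner_L2 \<Xi> (Hm1 \<Omega>) (Hm1_norm \<Omega>) \<and>
     (\<forall>\<psi>\<in>test_functions \<Xi>. \<forall>\<eta>\<in>H10 \<Omega>.
        (\<integral>t. deriv \<psi> t * (\<integral>x. w t x * \<eta> x \<partial>lebesgue_on \<Omega>) \<partial>lebesgue_on \<Xi>)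
        = - (\<integral>t. \<psi> t * g t \<eta> \<partial>lebesgue_on \<Xi>))"

definition X_space :: "(real^2) set \<Rightarrow> (real \<Rightarrow> real^2 \<Rightarrow> real) set" where
  "X_space \<Omega> = {w \<in> Y_space \<Omega>. \<exists>g. is_weak_time_derivative \<Omega> w g}"

definition time_derivative ::
  "(real^2) set \<Rightarrow> (real \<Rightarrow> real^2 \<Rightarrow> real) \<Rightarrow> real \<Rightarrow> (real^2 \<Rightarrow> real) \<Rightarrow> real" where
  "time_derivative \<Omega> w = (SOME g. is_weak_time_derivative \<Omega> w g)"

section \<open>The parabolic operator\<close>

type_synonym functional_family =
  "real \<Rightarrow> (real^2 \<Rightarrow> real) \<Rightarrow> (real^2 \<Rightarrow> real) \<Rightarrow> real"

definition bounded_coercive_family :: "(real^2) set \<Rightarrow> functional_family \<Rightarrow> bool" where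
  "bounded_coercive_family \<Omega> A \<longleftrightarrow>
     (\<forall>u\<in>H10 \<Omega>. \<forall>v\<in>H10 \<Omega>. (\<lambda>t. A t u v) \<in> borel_measurable (lebesgue_on \<Xi>)) \<and>
     (AE t in lebesgue_on \<Xi>.
        (\<forall>u\<in>H10 \<Omega>. A t u \<in> Hm1 \<Omega>) \<and>
        (\<forall>v\<in>H10 \<Omega>. linear_on_functions (H10 \<Omega>) (\<lambda>u. A t u v))) \<and>
     (\<exists>M. AE t in lebesgue_on \<Xi>. \<forall>u\<in>H10 \<Omega>. \<forall>v\<in>H10 \<Omega>.
        \<bar>A t u v\<bar> \<le> M * V_norm \<Omega> u * V_norm \<Omega> v) \<and>
     (\<exists>c>0. AE t in lebesgue_on \<Xi>. \<forall>u\<in>H10 \<Omega>. A t u u \<ge> c * (V_norm \<Omega> u)\<^sup>2)"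

definition dt_op ::
  "(real^2) set \<Rightarrow> (real \<Rightarrow> real^2 \<Rightarrow> real) \<Rightarrow> (real \<Rightarrow> real^2 \<Rightarrow> real) \<Rightarrow> real" where
  "dt_op \<Omega> w v = (\<integral>t. time_derivative \<Omega> w t (v t) \<partial>lebesgue_on \<Xi>)"

definition A_op ::
  "functional_family \<Rightarrow> (real \<Rightarrow> real^2 \<Rightarrow> real) \<Rightarrow> (real \<Rightarrow> real^2 \<Rightarrow> real) \<Rightarrow> real" where
  "A_op A w v = (\<integral>t. A t (w t) (v t) \<partial>lebesgue_on \<Xi>)"

definition B_op :: "(real^2) set \<Rightarrow> functional_family \<Rightarrow>
    (real \<Rightarrow> real^2 \<Rightarrow> real) \<Rightarrow> (real \<Rightarrow> real^2 \<Rightarrow> real) \<Rightarrow> real" where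
  "B_op \<Omega> A w v = dt_op \<Omega> w v + A_op A w v"

text \<open>
  Only applied to functions that are continuous on the closed cylinder, for which the value at
  \<open>t = 0\<close> of the given function is the trace.
\<close>

definition trace0 :: "(real \<Rightarrow> real^2 \<Rightarrow> real) \<Rightarrow> real^2 \<Rightarrow> real" where
  "trace0 w = w 0"

section \<open>Partitions into prisms\<close>

text \<open>The prism \<open>I \<times> T\<close> is represented by the pair \<open>(I, T)\<close>.\<close>

type_synonym prism = "real set \<times> (real^2) set"

definition is_prism :: "(real^2) set \<Rightarrow> prism \<Rightarrow> bool" where
  "is_prism \<Omega> = (\<lambda>(I, T). (\<exists>a b. a < b \<and> I = {a..b}) \<and> I \<subseteq> closure \<Xi> \<and>
     2 simplex T \<and> T \<subseteq> closure \<Omega>)"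

definition prism_partition :: "(real^2) set \<Rightarrow> prism set \<Rightarrow> bool" where
  "prism_partition \<Omega> \<P> \<longleftrightarrow> finite \<P> \<and> (\<forall>P\<in>\<P>. is_prism \<Omega> P) \<and>
     (\<Union>(I, T)\<in>\<P>. I \<times> T) = closure (\<Xi> \<times> \<Omega>) \<and>
     pairwise (\<lambda>(I, T) (I', T'). interior (I \<times> T) \<inter> interior (I' \<times> T') = {}) \<P>"

definition shape_regular_isotropic :: "real \<Rightarrow> prism set \<Rightarrow> bool" where
  "shape_regular_isotropic C \<P> \<longleftrightarrow> (\<forall>(I, T)\<in>\<P>.
     (\<exists>x. cball x (diameter T / C) \<subseteq> T) \<and>
     diameter T / C \<le> measure lborel I \<and> measure lborel I \<le> C * diameter T)"

definition restrict_partition :: "prism set \<Rightarrow> (real \<times> (real^2)) set \<Rightarrow> prism set" where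
  "restrict_partition \<P> S = {(I, T) \<in> \<P>. interior (I \<times> T) \<inter> S \<noteq> {}}"

text \<open>
  Membership of the restriction to each prism in \<open>P\<^sub>p(I) \<otimes> P\<^sub>q(T)\<close>.  Prisms are closed and overlap in
  their boundaries, on which a discontinuous piecewise polynomial is not determined.
\<close>

definition Q_space :: "nat \<Rightarrow> nat \<Rightarrow> prism set \<Rightarrow> (real \<Rightarrow> real^2 \<Rightarrow> real) set" where
  "Q_space p q \<P> = {w. \<forall>(I, T)\<in>\<P>. \<exists>c::nat \<Rightarrow> nat \<Rightarrow> nat \<Rightarrow> real.
     \<forall>t\<in>interior I. \<forall>x\<in>interior T.
       w t x = (\<Sum>i\<le>p. \<Sum>j\<le>q. \<Sum>k\<le>q - j. c i j k * t ^ i * (x $ 1) ^ j * (x $ 2) ^ k)}"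

definition X_disc :: "(real^2) set \<Rightarrow> prism set \<Rightarrow> (real \<Rightarrow> real^2 \<Rightarrow> real) set" where
  "X_disc \<Omega> \<P> =
     {w. continuous_on (closure (\<Xi> \<times> \<Omega>)) (\<lambda>(t, x). w t x)} \<inter> Y_space \<Omega> \<inter> Q_space 1 1 \<P>"

definition Y_disc :: "(real^2) set \<Rightarrow> nat \<Rightarrow> nat \<Rightarrow> prism set \<Rightarrow> (real \<Rightarrow> real^2 \<Rightarrow> real) set" where
  "Y_disc \<Omega> p q \<P> = Y_space \<Omega> \<inter> Q_space p q \<P>"

section \<open>Hat functions\<close>

text \<open>
  \<open>\<T>\<close> is the conforming triangulation of the patch around the interior vertex \<open>z\<close>;
  \<open>\<phi>\<close> is extended by zero outside of this patch.
\<close>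

definition hat_function ::
  "(real^2) set \<Rightarrow> (real^2) set set \<Rightarrow> (real^2 \<Rightarrow> real) \<Rightarrow> bool" where
  "hat_function \<Omega> \<T> \<phi> \<longleftrightarrow>
     triangulation \<T> \<and> (\<forall>T\<in>\<T>. 2 simplex T) \<and> \<Union>\<T> \<subseteq> closure \<Omega> \<and>
     continuous_on UNIV \<phi> \<and> (\<forall>x. x \<notin> \<Union>\<T> \<longrightarrow> \<phi> x = 0) \<and>
     (\<forall>T\<in>\<T>. \<exists>a b. \<forall>x\<in>T. \<phi> x = a \<bullet> x + b) \<and>
     (\<exists>z \<in> interior (\<Union>\<T>). \<phi> z = 1 \<and>
        (\<forall>T\<in>\<T>. z extreme_point_of T \<and> (\<forall>y. y extreme_point_of T \<and> y \<noteq> z \<longrightarrow> \<phi> y = 0)))"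

section \<open>Discrete inf-sup constants\<close>

definition gamma_dt :: "(real^2) set \<Rightarrow> nat \<Rightarrow> nat \<Rightarrow> prism set \<Rightarrow> real" where
  "gamma_dt \<Omega> p q \<P> =
     (INF w\<in>{w \<in> X_disc \<Omega> \<P>. \<exists>v\<in>Y_space \<Omega>. dt_op \<Omega> w v \<noteq> 0}.
        dual_norm (Y_disc \<Omega> p q \<P>) (Y_norm \<Omega>) (dt_op \<Omega> w) /
        dual_norm (Y_space \<Omega>) (Y_norm \<Omega>) (dt_op \<Omega> w))"

definition gamma_Be :: "(real^2) set \<Rightarrow> functional_family \<Rightarrow> nat \<Rightarrow> nat \<Rightarrow> prism set \<Rightarrow> real" where
  "gamma_Be \<Omega> A p q \<P> = sqrt
     (INF w\<in>{w \<in> X_disc \<Omega> \<P>. \<exists>t\<in>\<Xi>. \<exists>x\<in>\<Omega>. w t x \<noteq> 0}.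
        ((dual_norm (Y_disc \<Omega> p q \<P>) (Y_norm \<Omega>) (B_op \<Omega> A w))\<^sup>2 + (L2_norm \<Omega> (trace0 w))\<^sup>2) /
        ((dual_norm (Y_space \<Omega>) (Y_norm \<Omega>) (B_op \<Omega> A w))\<^sup>2 + (L2_norm \<Omega> (trace0 w))\<^sup>2))"

end

(*
  Let psi be the combination of the truncated powers max 0 (t - i h), 0 <= i <= p + 2, with
  alternating binomial coefficients: it is continuous and piecewise linear on the fine time mesh,
  supported in [0, (p + 2) h], a subset of [0, H], and psi' is orthogonal to all polynomials of
  degree p on (0, H).  The trial function is w(t, x) = psi(t) phi_alpha(x).

  On the coarse patch a discrete test function v is a polynomial of degree p in time, so psi' does not
  see it, and d_t w(v) equals the integral of psi' (phi_alpha - phi_beta) v.  Since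
  phi_alpha - phi_beta has mean value zero and lives on a ball of radius of order H, a Poincare
  inequality bounds this by |psi'| H^2 |v|_Y.  On all of Y, however, a test function psi'(t) v0(x)
  with a logarithmic v0 gives |d_t w| >= c |psi'| H^2 sqrt |log H|, because the H^(-1) norm
  of a bump of mass H^2 on a set of diameter H is of this order in two dimensions.  The remaining
  part of B w is bounded by |psi| |grad phi_alpha|, where |psi| <= c h |psi'| and
  |grad phi_alpha| <= c, the latter because the shape regular refinement bounds the angles of
  the triangles underlying phi_alpha from below.
*)
theory Submission
  imports Defs
begin

section \<open>Calculus of smooth functions, the raw material for mollifiers, cut-offs and the
  logarithmic test function\<close>

section \<open>Smooth functions\<close>

text \<open>The order \<open>p + 2\<close> of the binomial combination is dictated by orthogonality:
  integrating \<open>t ^ k\<close> against a unit step at \<open>i h\<close> leaves a constant and a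
  multiple of \<open>(i h) ^ (k + 1)\<close>, and an alternating binomial sum of order m kills the
  powers of \<open>i\<close> below m, so all \<open>k \<le> p\<close> need \<open>m = p + 2\<close>.
  The condition \<open>h \<le> H / (p + 2)\<close> is what lets this spline fit under one coarse
  time step. Both bounds on d_t w carry the factor |psi'| H^2, so the whole gain is the square root
  of the logarithm; relative to it the remainder of B w weighs h / (H^2 sqrt |log H|), which is the
  second smallness condition, and the initial trace vanishes because psi(0) = 0. The logarithm comes
  from stacking dyadic plateau functions between the scales r and C H, with r the fixed radius of a
  ball inside the domain. The formal obstacle: gradients and time derivatives are fixed by a choice
  operator, and dual norms by a supremum whose value infinity is converted to 0. Hence uniqueness
  results precede each computation with an explicit derivative, and an a priori bound precedes each
  lower bound for a dual norm.\<close>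

definition smooth :: "('a::euclidean_space \<Rightarrow> real) \<Rightarrow> bool" where
  "smooth f \<longleftrightarrow> (\<forall>k. C_k k f)"

text \<open>\<open>frechet_derivative\<close> is a choice; uniqueness of derivatives lets any
  explicit derivative \<open>f'\<close> stand for it, so the closure properties below become
  inductions over known derivative formulas.\<close>

lemma C_k_SucI:
  fixes f :: "'a::euclidean_space \<Rightarrow> real"
  assumes "\<And>x. (f has_derivative f' x) (at x)" "\<And>b. b \<in> Basis \<Longrightarrow> C_k k (\<lambda>x. f' x b)"
  shows "C_k (Suc k) f"
proof -
  have "frechet_derivative f (at x) = f' x" for x
    using frechet_derivative_at[OF assms(1)] by simp
  moreover have "f differentiable at x" for x
    using assms(1) by (auto simp: differentiable_def)
  ultimately show ?thesis using assms(2) by simp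
qed

lemma C_k_SucD:
  fixes f :: "'a::euclidean_space \<Rightarrow> real"
  assumes "C_k (Suc k) f"
  shows "(f has_derivative frechet_derivative f (at x)) (at x)"
    and "b \<in> Basis \<Longrightarrow> C_k k (\<lambda>x. frechet_derivative f (at x) b)"
  using assms frechet_derivative_works by auto

lemma C_k_continuous: "C_k k f \<Longrightarrow> continuous_on UNIV f"
  by (cases k) (auto intro!: differentiable_imp_continuous_on simp: differentiable_on_def)

lemma C_k_mono_Suc: "C_k (Suc k) f \<Longrightarrow> C_k k f"
proof (induction k arbitrary: f)
  case 0
  then show ?case using C_k_continuous by fastforce
next
  case (Suc k)
  show ?case
    by (rule C_k_SucI[OF C_k_SucD(1)[OF Suc.prems]]) (intro Suc.IH C_k_SucD(2)[OF Suc.prems])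
qed

lemma C_k_const [simp]: "C_k k (\<lambda>x. c)"
proof (induction k arbitrary: c)
  case (Suc k)
  show ?case by (rule C_k_SucI[OF has_derivative_const Suc])
qed simp

lemma C_k_add: "C_k k f \<Longrightarrow> C_k k g \<Longrightarrow> C_k k (\<lambda>x. f x + g x)"
proof (induction k arbitrary: f g)
  case 0
  then show ?case by (auto intro: continuous_intros)
next
  case (Suc k)
  show ?case
    by (rule C_k_SucI[OF has_derivative_add[OF C_k_SucD(1)[OF Suc.prems(1)] C_k_SucD(1)[OF Suc.prems(2)]]])
      (intro Suc.IH C_k_SucD(2)[OF Suc.prems(1)] C_k_SucD(2)[OF Suc.prems(2)])
qed

lemma C_k_mult:
  fixes f g :: "'a::euclidean_space \<Rightarrow> real"
  shows "C_k k f \<Longrightarrow> C_k k g \<Longrightarrow> C_k k (\<lambda>x. f x * g x)"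
proof (induction k arbitrary: f g)
  case 0
  then show ?case by (auto intro: continuous_intros)
next
  case (Suc k)
  show ?case
    by (rule C_k_SucI[OF has_derivative_mult[OF C_k_SucD(1)[OF Suc.prems(1)] C_k_SucD(1)[OF Suc.prems(2)]]])
      (intro C_k_add Suc.IH C_k_SucD(2)[OF Suc.prems(1)] C_k_SucD(2)[OF Suc.prems(2)]
        C_k_mono_Suc[OF Suc.prems(1)] C_k_mono_Suc[OF Suc.prems(2)])
qed

text \<open>The outer function has a real argument, so its derivative at \<open>g x\<close> is
  multiplication by the number \<open>frechet_derivative f (at (g x)) 1\<close>. The chain rule then
  yields a product of two functions, one of them again a composition, and the induction
  closes.\<close>

lemma C_k_compose:
  fixes f :: "real \<Rightarrow> real" and g :: "'a::euclidean_space \<Rightarrow> real"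
  shows "C_k k f \<Longrightarrow> C_k k g \<Longrightarrow> C_k k (\<lambda>x. f (g x))"
proof (induction k arbitrary: f g)
  case 0
  then have "continuous_on UNIV f" "continuous_on UNIV g" by simp_all
  then have "continuous_on UNIV (\<lambda>x. f (g x))"
    by (rule continuous_on_compose2) simp
  then show ?case by simp
next
  case (Suc k)
  have "((\<lambda>x. f (g x)) has_derivative
      (\<lambda>h. frechet_derivative g (at x) h * frechet_derivative f (at (g x)) 1)) (at x)" for x
  proof -
    from has_derivative_compose[OF C_k_SucD(1)[OF Suc.prems(2), of x] C_k_SucD(1)[OF Suc.prems(1), of "g x"]]
    have "((\<lambda>x. f (g x)) has_derivative
      (\<lambda>h. frechet_derivative f (at (g x)) (frechet_derivative g (at x) h))) (at x)" .
    moreover have "(\<lambda>h. frechet_derivative f (at (g x)) (frechet_derivative g (at x) h)) =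
        (\<lambda>h. frechet_derivative g (at x) h * frechet_derivative f (at (g x)) 1)"
    proof
      fix h
      show "frechet_derivative f (at (g x)) (frechet_derivative g (at x) h) =
          frechet_derivative g (at x) h * frechet_derivative f (at (g x)) 1"
        using linear_scale[OF has_derivative_linear[OF C_k_SucD(1)[OF Suc.prems(1)]],
            of "g x" "frechet_derivative g (at x) h" 1] by simp
    qed
    ultimately show ?thesis by (simp only:)
  qed
  moreover have "C_k k (\<lambda>x. frechet_derivative g (at x) b * frechet_derivative f (at (g x)) 1)"
    if "b \<in> Basis" for b
  proof -
    have 1: "C_k k (\<lambda>y. frechet_derivative f (at y) 1)"
      by (rule C_k_SucD(2)[OF Suc.prems(1)]) simp
    show ?thesis
      by (intro C_k_mult C_k_SucD(2)[OF Suc.prems(2) that] Suc.IH[OF 1 C_k_mono_Suc[OF Suc.prems(2)]])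
  qed
  ultimately show ?case by (rule C_k_SucI)
qed

text \<open>Dilations act on a vector argument and are outside the scope of
  \<open>C_k_compose\<close>; they are needed for the rescaled plateau functions in
  \<open>log_test_function\<close>.\<close>

lemma C_k_affine:
  fixes f :: "'a::euclidean_space \<Rightarrow> real"
  shows "C_k k f \<Longrightarrow> C_k k (\<lambda>x. f (c *\<^sub>R x + a))"
proof (induction k arbitrary: f)
  case 0
  have "continuous_on UNIV (\<lambda>x. f (c *\<^sub>R x + a))"
    by (rule continuous_on_compose2[of UNIV f]) (use 0 in \<open>auto intro!: continuous_intros\<close>)
  then show ?case by simp
next
  case (Suc k)
  have "((\<lambda>x. f (c *\<^sub>R x + a)) has_derivative
      (\<lambda>h. frechet_derivative f (at (c *\<^sub>R x + a)) (c *\<^sub>R h))) (at x)" for x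
    by (rule has_derivative_compose[OF _ C_k_SucD(1)[OF Suc.prems]]) (auto intro!: derivative_eq_intros)
  then have "((\<lambda>x. f (c *\<^sub>R x + a)) has_derivative
      (\<lambda>h. c * frechet_derivative f (at (c *\<^sub>R x + a)) h)) (at x)" for x
    using linear_scale[OF has_derivative_linear[OF C_k_SucD(1)[OF Suc.prems]]] by simp
  then show ?case
    by (rule C_k_SucI) (intro C_k_mult C_k_const Suc.IH[OF C_k_SucD(2)[OF Suc.prems]])
qed

lemma smooth_const [simp, intro]: "smooth (\<lambda>x. c)"
  by (simp add: smooth_def)

lemma smooth_add [intro]: "smooth f \<Longrightarrow> smooth g \<Longrightarrow> smooth (\<lambda>x. f x + g x)"
  by (simp add: smooth_def C_k_add)

lemma smooth_mult [intro]: "smooth f \<Longrightarrow> smooth g \<Longrightarrow> smooth (\<lambda>x. f x * g x)"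
  by (simp add: smooth_def C_k_mult)

lemma smooth_diff [intro]:
  assumes "smooth f" "smooth g" shows "smooth (\<lambda>x. f x - g x)"
proof -
  have "smooth (\<lambda>x. f x + (-1) * g x)"
    by (intro smooth_add smooth_mult smooth_const assms)
  then show ?thesis by simp
qed

lemma smooth_compose: "smooth f \<Longrightarrow> smooth g \<Longrightarrow> smooth (\<lambda>x. f (g x))" for f :: "real \<Rightarrow> real"
  by (simp add: smooth_def C_k_compose)

lemma smooth_affine: "smooth f \<Longrightarrow> smooth (\<lambda>x. f (c *\<^sub>R x + a))"
  by (simp add: smooth_def C_k_affine)

lemma smooth_prod:
  "(\<And>i. i \<in> I \<Longrightarrow> smooth (f i)) \<Longrightarrow> smooth (\<lambda>x. \<Prod>i\<in>I. f i x)"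
  by (induction I rule: infinite_finite_induct) auto

lemma smooth_sum:
  "(\<And>i. i \<in> I \<Longrightarrow> smooth (f i)) \<Longrightarrow> smooth (\<lambda>x. \<Sum>i\<in>I. f i x)"
  by (induction I rule: infinite_finite_induct) auto

lemma smooth_inner_right [intro]: "smooth (\<lambda>x. x \<bullet> b)" for b :: "'a::euclidean_space"
proof -
  have "C_k (Suc k) (\<lambda>x. x \<bullet> b)" for k
    by (rule C_k_SucI[where f' = "\<lambda>x h. h \<bullet> b"]) (auto intro!: derivative_eq_intros)
  then show ?thesis
    unfolding smooth_def using C_k_mono_Suc by blast
qed

lemma smooth_inner_self: "smooth (\<lambda>x::'a::euclidean_space. x \<bullet> x)"
proof -
  have "smooth (\<lambda>x::'a. \<Sum>b\<in>Basis. (x \<bullet> b) * (x \<bullet> b))"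
    by (intro smooth_sum smooth_mult smooth_inner_right)
  then show ?thesis by (simp flip: euclidean_inner)
qed

lemma smooth_continuous: "smooth f \<Longrightarrow> continuous_on UNIV f"
  unfolding smooth_def using C_k_continuous by blast

lemma smooth_has_derivative:
  "smooth f \<Longrightarrow> (f has_derivative frechet_derivative f (at x)) (at x)"
  unfolding smooth_def using C_k_SucD(1) by blast

lemma smooth_frechet_derivative:
  "smooth f \<Longrightarrow> b \<in> Basis \<Longrightarrow> smooth (\<lambda>x. frechet_derivative f (at x) b)"
  unfolding smooth_def using C_k_SucD(2) by blast

subsection \<open>Cut-off functions\<close>

text \<open>Powers of \<open>1 / t\<close> are built into the family because differentiation maps
  \<open>flat n\<close> to a combination of \<open>flat (n + 2)\<close> and
  \<open>flat (Suc n)\<close>: one induction over the order then proves smoothness for all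
  \<open>n\<close> at once.\<close>

definition flat :: "nat \<Rightarrow> real \<Rightarrow> real" where
  "flat n t = (if t > 0 then exp (- 1 / t) / t ^ n else 0)"

lemma tendsto_flat_0: "(flat n \<longlongrightarrow> 0) (at 0)"
proof -
  have "((\<lambda>t. inverse t ^ n / exp (inverse t)) \<longlongrightarrow> (0::real)) (at_right 0)"
    by (rule filterlim_compose[OF tendsto_power_div_exp_0 filterlim_inverse_at_top_right])
  moreover have "\<forall>\<^sub>F t in at_right 0. inverse t ^ n / exp (inverse t) = flat n t"
    unfolding eventually_at_filter
    by (rule always_eventually) (auto simp: flat_def exp_minus field_simps power_inverse)
  ultimately have "(flat n \<longlongrightarrow> 0) (at_right 0)"
    using tendsto_cong by force
  moreover have "(flat n \<longlongrightarrow> 0) (at_left 0)"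
    by (rule tendsto_eventually) (auto simp: eventually_at_filter flat_def)
  ultimately show ?thesis by (simp add: filterlim_split_at)
qed

lemma flat_has_derivative:
  "(flat n has_real_derivative flat (n + 2) t - real n * flat (Suc n) t) (at t)"
proof -
  consider "t > 0" | "t < 0" | "t = 0" by linarith
  then show ?thesis
  proof cases
    case 1
    have "((\<lambda>t. exp (- 1 / t) / t ^ n) has_real_derivative
        exp (- 1 / t) / t ^ (n + 2) - real n * (exp (- 1 / t) / t ^ Suc n)) (at t)"
    proof -
      have n: "real n * t ^ (n - 1) = real n * t ^ n / t"
        using 1 by (cases n) auto
      have e: "((\<lambda>t. exp (- 1 / t)) has_real_derivative exp (- 1 / t) / t\<^sup>2) (at t)"
        using 1 by (auto intro!: derivative_eq_intros simp: field_simps power2_eq_square)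
      have "(exp (- 1 / t) / t\<^sup>2 * t ^ n - exp (- 1 / t) * (real n * t ^ (n - 1))) / (t ^ n * t ^ n)
          = exp (- 1 / t) / t ^ (n + 2) - real n * (exp (- 1 / t) / t ^ Suc n)"
        unfolding n using 1 by (simp add: field_simps power2_eq_square)
      then show ?thesis
        using DERIV_divide[OF e DERIV_pow[of n t]] 1 by simp
    qed
    moreover have "\<forall>\<^sub>F s in nhds t. exp (- 1 / s) / s ^ n = flat n s"
      using 1 by (auto simp: flat_def eventually_nhds intro!: exI[of _ "{0<..}"])
    ultimately have "(flat n has_real_derivative
        exp (- 1 / t) / t ^ (n + 2) - real n * (exp (- 1 / t) / t ^ Suc n)) (at t)"
      using DERIV_cong_ev[OF refl _ refl, of "\<lambda>t. exp (- 1 / t) / t ^ n" "flat n" t] by simp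
    then show ?thesis using 1 by (simp add: flat_def)
  next
    case 2
    have "\<forall>\<^sub>F s in nhds t. flat n s = 0"
      using 2 by (auto simp: flat_def eventually_nhds intro!: exI[of _ "{..<0}"])
    then have "(flat n has_real_derivative 0) (at t)"
      using DERIV_cong_ev[of t t "flat n" "\<lambda>_. 0" 0 0] by simp
    then show ?thesis using 2 by (simp add: flat_def)
  next
    case 3
    \<comment> \<open>At 0 the difference quotient of \<open>flat n\<close> is
      \<open>flat (Suc n)\<close>, and every member of the family tends to 0 there.\<close>
    have "((\<lambda>h. flat n h / h) \<longlongrightarrow> 0) (at 0)"
      by (rule Lim_transform_eventually[OF tendsto_flat_0[of "Suc n"]])
        (auto simp: flat_def eventually_at_filter)
    then show ?thesis
      unfolding 3 DERIV_def by (simp add: flat_def)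
  qed
qed

lemma smooth_flat: "smooth (flat n)"
proof -
  have "C_k k (flat n)" for k
  proof (induction k arbitrary: n)
    case 0
    show ?case
      using flat_has_derivative DERIV_isCont by (force simp: continuous_on_eq_continuous_at)
  next
    case (Suc k)
    have *: "(flat n has_derivative (\<lambda>h. (flat (n + 2) t + - real n * flat (Suc n) t) * h)) (at t)" for t
      using flat_has_derivative[of n t] by (simp add: has_field_derivative_def)
    show ?case
      by (rule C_k_SucI[OF *]) (intro C_k_mult C_k_add Suc C_k_const)
  qed
  then show ?thesis by (simp add: smooth_def)
qed

lemma flat0_pos_iff: "flat 0 t > 0 \<longleftrightarrow> t > 0"
  by (simp add: flat_def)

lemma flat0_nonneg: "flat 0 t \<ge> 0"
  by (simp add: flat_def)

lemma flat0_mono: "s \<le> t \<Longrightarrow> flat 0 s \<le> flat 0 t"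
  by (auto simp: flat_def field_simps)

text \<open>Meant for arguments \<open>s \<ge> 0\<close>: it leaves 0 with slope 1 and is negative
  for \<open>s < 0\<close>. The smooth start of a cut-off comes from the inner function, which is
  always built from \<open>flat 0\<close>.\<close>

definition smooth_step :: "real \<Rightarrow> real" where
  "smooth_step s = 1 - exp 1 * flat 0 (1 - s)"

lemma smooth_smooth_step: "smooth smooth_step"
  unfolding smooth_step_def
  by (intro smooth_diff smooth_mult smooth_const smooth_compose[OF smooth_flat])
    (use smooth_inner_right[of "1::real"] in simp)

lemma smooth_step_0 [simp]: "smooth_step 0 = 0"
  by (simp add: smooth_step_def flat_def flip: exp_add)

lemma smooth_step_ge1 [simp]: "s \<ge> 1 \<Longrightarrow> smooth_step s = 1"
  by (simp add: smooth_step_def flat_def)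

lemma smooth_step_bounds:
  assumes "s \<ge> 0" shows "smooth_step s \<in> {0..1}"
proof -
  have "exp 1 * flat 0 (1 - s) \<le> exp 1 * flat 0 1"
    using assms by (intro mult_left_mono flat0_mono) auto
  also have "\<dots> = 1" by (simp add: flat_def flip: exp_add)
  finally show ?thesis using flat0_nonneg[of "1 - s"] by (simp add: smooth_step_def)
qed

section \<open>L2 over subsets of a Euclidean space: Cauchy-Schwarz, triangle inequality,
  measurability up to null sets\<close>

section \<open>Square integrable functions\<close>

lemma integrable_mult_of_squares:
  fixes f g :: "'a \<Rightarrow> real"
  assumes [measurable]: "f \<in> borel_measurable M" "g \<in> borel_measurable M"
    and "integrable M (\<lambda>x. (f x)\<^sup>2)" "integrable M (\<lambda>x. (g x)\<^sup>2)"
  shows "integrable M (\<lambda>x. f x * g x)"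
proof (rule Bochner_Integration.integrable_bound)
  show "integrable M (\<lambda>x. (f x)\<^sup>2 + (g x)\<^sup>2)"
    using assms by simp
  have "\<bar>f x * g x\<bar> \<le> (f x)\<^sup>2 + (g x)\<^sup>2" for x
  proof -
    have "2 * (\<bar>f x\<bar> * \<bar>g x\<bar>) \<le> (f x)\<^sup>2 + (g x)\<^sup>2"
      using sum_squares_bound[of "\<bar>f x\<bar>" "\<bar>g x\<bar>"] by simp
    moreover have "0 \<le> \<bar>f x\<bar> * \<bar>g x\<bar>" by simp
    ultimately show ?thesis unfolding abs_mult by linarith
  qed
  then show "AE x in M. norm (f x * g x) \<le> norm ((f x)\<^sup>2 + (g x)\<^sup>2)"
    by (auto intro: order_trans)
qed measurable

text \<open>Discriminant argument: the integral of the square of \<open>f + t g\<close> is a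
  nonnegative quadratic polynomial in \<open>t\<close>, evaluated at its minimiser
  \<open>- b / c\<close>.\<close>

lemma Cauchy_Schwarz_integral:
  fixes f g :: "'a \<Rightarrow> real"
  assumes [measurable]: "f \<in> borel_measurable M" "g \<in> borel_measurable M"
    and f: "integrable M (\<lambda>x. (f x)\<^sup>2)" and g: "integrable M (\<lambda>x. (g x)\<^sup>2)"
  shows "\<bar>\<integral>x. f x * g x \<partial>M\<bar> \<le> sqrt (\<integral>x. (f x)\<^sup>2 \<partial>M) * sqrt (\<integral>x. (g x)\<^sup>2 \<partial>M)"
proof -
  define a b c where "a = (\<integral>x. (f x)\<^sup>2 \<partial>M)" and "b = (\<integral>x. f x * g x \<partial>M)" and "c = (\<integral>x. (g x)\<^sup>2 \<partial>M)"
  have fg: "integrable M (\<lambda>x. f x * g x)"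
    using assms by (rule integrable_mult_of_squares)
  have q: "a + 2 * t * b + t\<^sup>2 * c \<ge> 0" for t
  proof -
    have "0 \<le> (\<integral>x. (f x + t * g x)\<^sup>2 \<partial>M)"
      by simp
    also have "\<dots> = (\<integral>x. (f x)\<^sup>2 + 2 * t * (f x * g x) + t\<^sup>2 * (g x)\<^sup>2 \<partial>M)"
      by (rule Bochner_Integration.integral_cong) (auto simp: power2_eq_square algebra_simps)
    also have "\<dots> = a + 2 * t * b + t\<^sup>2 * c"
      using f g fg by (simp add: a_def b_def c_def)
    finally show ?thesis .
  qed
  have "c \<ge> 0" "a \<ge> 0" by (simp_all add: a_def c_def)
  have "b\<^sup>2 \<le> a * c"
  proof (cases "c = 0")
    case True
    have "b = 0"
    proof (rule ccontr)
      assume "b \<noteq> 0"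
      \<comment> \<open>With leading coefficient 0 this value of \<open>t\<close> makes the
        polynomial equal to \<open>- 1\<close>.\<close>
      then show False using q[of "- (a + 1) / (2 * b)"] True by (simp add: field_simps)
    qed
    then show ?thesis using \<open>c \<ge> 0\<close> \<open>a \<ge> 0\<close> by simp
  next
    case False
    then have "c > 0" using \<open>c \<ge> 0\<close> by simp
    have "a + 2 * (- b / c) * b + (- b / c)\<^sup>2 * c = a - b\<^sup>2 / c"
      using \<open>c > 0\<close> by (simp add: field_simps power2_eq_square)
    then have "a - b\<^sup>2 / c \<ge> 0"
      using q[of "- b / c"] by simp
    then show ?thesis using \<open>c > 0\<close> by (simp add: field_simps)
  qed
  then have "\<bar>b\<bar> \<le> sqrt (a * c)"
    by (simp add: real_le_rsqrt)
  then show ?thesis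
    by (simp add: a_def b_def c_def real_sqrt_mult)
qed

lemma L2_norm_nonneg [simp]: "L2_norm S f \<ge> 0"
  by (simp add: L2_norm_def)

lemma L2_norm_power2: "(L2_norm S f)\<^sup>2 = (\<integral>x. (norm (f x))\<^sup>2 \<partial>lebesgue_on S)"
  by (simp add: L2_norm_def)

lemma L2_norm_scaleR: "L2_norm S (\<lambda>x. c *\<^sub>R f x) = \<bar>c\<bar> * L2_norm S f"
  by (simp add: L2_norm_def power_mult_distrib real_sqrt_mult)

lemma L2_scaleR: "f \<in> L2 S \<Longrightarrow> (\<lambda>x. c *\<^sub>R f x) \<in> L2 S"
  by (auto simp: L2_def power_mult_distrib)

lemma L2_add:
  assumes f: "f \<in> L2 S" and g: "g \<in> L2 S"
  shows "(\<lambda>x. f x + g x) \<in> L2 S"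
    and "L2_norm S (\<lambda>x. f x + g x) \<le> L2_norm S f + L2_norm S g"
proof -
  have [measurable]: "f \<in> borel_measurable (lebesgue_on S)" "g \<in> borel_measurable (lebesgue_on S)"
    and i: "integrable (lebesgue_on S) (\<lambda>x. (norm (f x))\<^sup>2)" "integrable (lebesgue_on S) (\<lambda>x. (norm (g x))\<^sup>2)"
    using assms by (auto simp: L2_def)
  have fg: "integrable (lebesgue_on S) (\<lambda>x. norm (f x) * norm (g x))"
    by (rule integrable_mult_of_squares) (use i in auto)
  have le: "(norm (f x + g x))\<^sup>2 \<le> (norm (f x))\<^sup>2 + 2 * (norm (f x) * norm (g x)) + (norm (g x))\<^sup>2" for x
    using power_mono[OF norm_triangle_ineq[of "f x" "g x"], of 2] by (simp add: power2_sum)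
  have int: "integrable (lebesgue_on S)
      (\<lambda>x. (norm (f x))\<^sup>2 + 2 * (norm (f x) * norm (g x)) + (norm (g x))\<^sup>2)"
    using i fg by simp
  have int2: "integrable (lebesgue_on S) (\<lambda>x. (norm (f x + g x))\<^sup>2)"
    by (rule Bochner_Integration.integrable_bound[OF int]) (use le in \<open>auto intro: order_trans[OF _ abs_ge_self]\<close>)
  then show "(\<lambda>x. f x + g x) \<in> L2 S" by (simp add: L2_def)
  have "(L2_norm S (\<lambda>x. f x + g x))\<^sup>2 \<le>
      (\<integral>x. (norm (f x))\<^sup>2 + 2 * (norm (f x) * norm (g x)) + (norm (g x))\<^sup>2 \<partial>lebesgue_on S)"
    unfolding L2_norm_power2 by (rule integral_mono[OF int2 int le])
  also have "\<dots> = (L2_norm S f)\<^sup>2 + 2 * (\<integral>x. norm (f x) * norm (g x) \<partial>lebesgue_on S) + (L2_norm S g)\<^sup>2"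
    using i fg by (simp add: L2_norm_power2)
  also have "\<dots> \<le> (L2_norm S f)\<^sup>2 + 2 * (L2_norm S f * L2_norm S g) + (L2_norm S g)\<^sup>2"
    using Cauchy_Schwarz_integral[of "\<lambda>x. norm (f x)" "lebesgue_on S" "\<lambda>x. norm (g x)"] i
    by (simp add: L2_norm_def)
  also have "\<dots> = (L2_norm S f + L2_norm S g)\<^sup>2"
    by (simp add: power2_sum)
  finally show "L2_norm S (\<lambda>x. f x + g x) \<le> L2_norm S f + L2_norm S g"
    by (rule power2_le_imp_le) simp
qed

lemma L2_bounded:
  assumes "S \<in> lmeasurable" "f \<in> borel_measurable (lebesgue_on S)" "AE x in lebesgue_on S. norm (f x) \<le> B"
  shows "f \<in> L2 S"
proof -
  interpret finite_measure "lebesgue_on S"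
    using assms(1) by (rule finite_measure_lebesgue_on)
  have "AE x in lebesgue_on S. norm ((norm (f x))\<^sup>2) \<le> B\<^sup>2"
    using assms(3) by eventually_elim (simp add: power_mono)
  then have "integrable (lebesgue_on S) (\<lambda>x. (norm (f x))\<^sup>2)"
    by (rule integrable_const_bound) (use assms(2) in simp)
  then show ?thesis using assms(2) by (simp add: L2_def)
qed

lemma L2_norm_le_bound:
  assumes S: "S \<in> lmeasurable" and B: "AE x in lebesgue_on S. norm (f x) \<le> B" "B \<ge> 0"
  shows "(L2_norm S f)\<^sup>2 \<le> B\<^sup>2 * measure lebesgue S"
proof (cases "integrable (lebesgue_on S) (\<lambda>x. (norm (f x))\<^sup>2)")
  case True
  interpret finite_measure "lebesgue_on S"
    using assms(1) by (rule finite_measure_lebesgue_on)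
  have "(L2_norm S f)\<^sup>2 \<le> (\<integral>x. B\<^sup>2 \<partial>lebesgue_on S)"
    unfolding L2_norm_power2
    by (rule integral_mono_AE) (use True B in \<open>auto intro: power_mono\<close>)
  then show ?thesis
    using S by (simp add: measure_restrict_space mult.commute fmeasurable_def)
next
  case False
  \<comment> \<open>A nonintegrable square has integral 0 by convention, so the left-hand side is
    0.\<close>
  then show ?thesis by (simp add: L2_norm_power2 not_integrable_integral_eq)
qed

lemma L2_integrable:
  fixes f :: "'a::euclidean_space \<Rightarrow> 'b::euclidean_space"
  assumes "S \<in> lmeasurable" "f \<in> L2 S"
  shows "integrable (lebesgue_on S) f"
proof -
  interpret finite_measure "lebesgue_on S"
    using assms(1) by (rule finite_measure_lebesgue_on)
  have i: "integrable (lebesgue_on S) (\<lambda>x. 1 + (norm (f x))\<^sup>2)"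
    using assms(2) by (auto simp: L2_def)
  have "norm (f x) \<le> 1 + (norm (f x))\<^sup>2" for x
  proof -
    have "2 * norm (f x) \<le> (norm (f x))\<^sup>2 + 1"
      using zero_le_power2[of "norm (f x) - 1"] by (simp add: power2_diff)
    then show ?thesis using norm_ge_zero[of "f x"] by linarith
  qed
  then show ?thesis
    by (intro Bochner_Integration.integrable_bound[OF i]) (use assms(2) in \<open>auto simp: L2_def\<close>)
qed

lemma L2_integrable_mult:
  fixes f g :: "'a::euclidean_space \<Rightarrow> real"
  assumes "f \<in> L2 S" "g \<in> L2 S"
  shows "integrable (lebesgue_on S) (\<lambda>x. f x * g x)"
  by (rule integrable_mult_of_squares) (use assms in \<open>auto simp: L2_def\<close>)

lemma L2_Cauchy_Schwarz:
  fixes f g :: "'a::euclidean_space \<Rightarrow> real"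
  assumes "f \<in> L2 S" "g \<in> L2 S"
  shows "\<bar>\<integral>x. f x * g x \<partial>lebesgue_on S\<bar> \<le> L2_norm S f * L2_norm S g"
  using Cauchy_Schwarz_integral[of f "lebesgue_on S" g] assms
  by (auto simp: L2_def L2_norm_def)

lemma L2_norm_cong_AE:
  assumes "f \<in> L2 S" "g \<in> L2 S" "AE x in lebesgue_on S. f x = g x"
  shows "L2_norm S f = L2_norm S g"
proof -
  have "(\<integral>x. (norm (f x))\<^sup>2 \<partial>lebesgue_on S) = (\<integral>x. (norm (g x))\<^sup>2 \<partial>lebesgue_on S)"
  proof (rule integral_cong_AE)
    show "AE x in lebesgue_on S. (norm (f x))\<^sup>2 = (norm (g x))\<^sup>2"
      using assms(3) by eventually_elim simp
  qed (use assms in \<open>auto simp: L2_def\<close>)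
  then show ?thesis by (simp add: L2_norm_def)
qed

subsection \<open>Measurability and completeness\<close>

text \<open>Completeness of Lebesgue measure, transferred from the whole space to \<open>S\<close>
  by extension with 0. It covers functions known only almost everywhere, such as chosen time
  derivatives and discrete functions whose values on prism boundaries are unspecified.\<close>

lemma borel_measurable_AE_lebesgue_on:
  fixes f :: "'a::euclidean_space \<Rightarrow> 'b::euclidean_space"
  assumes S: "S \<in> sets lebesgue" and f: "f \<in> borel_measurable (lebesgue_on S)"
    and eq: "AE x in lebesgue_on S. f x = g x"
  shows "g \<in> borel_measurable (lebesgue_on S)"
proof -
  have "(\<lambda>x. if x \<in> S then f x else 0) \<in> borel_measurable lebesgue"
    using borel_measurable_if_I[OF f S] by simp
  moreover have "AE x in lebesgue. (if x \<in> S then f x else 0) = (if x \<in> S then g x else 0)"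
    using eq S by (auto simp: AE_restrict_space_iff elim!: eventually_mono)
  ultimately have "(\<lambda>x. if x \<in> S then g x else 0) \<in> borel_measurable lebesgue"
    by (rule borel_measurable_AE)
  then show ?thesis by (rule borel_measurable_if_D)
qed

lemma borel_measurable_LIMSEQ_AE_lebesgue_on:
  fixes f :: "'a::euclidean_space \<Rightarrow> 'b::euclidean_space"
  assumes S: "S \<in> sets lebesgue" and s: "\<And>n. s n \<in> borel_measurable (lebesgue_on S)"
    and lim: "AE x in lebesgue_on S. (\<lambda>n. s n x) \<longlonglongrightarrow> f x"
  shows "f \<in> borel_measurable (lebesgue_on S)"
proof (rule borel_measurable_AE_lebesgue_on[OF S])
  show "(\<lambda>x. lim (\<lambda>n. s n x)) \<in> borel_measurable (lebesgue_on S)"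
    by (intro borel_measurable_lim_metric s)
  show "AE x in lebesgue_on S. lim (\<lambda>n. s n x) = f x"
    using lim by eventually_elim (rule limI)
qed

lemma continuous_borel_measurable_lebesgue_on:
  fixes f :: "'a::euclidean_space \<Rightarrow> 'b::euclidean_space"
  shows "continuous_on UNIV f \<Longrightarrow> f \<in> borel_measurable (lebesgue_on S)"
  by (intro measurable_restrict_space1 measurable_completion) (auto intro: borel_measurable_continuous_onI)

section \<open>Integrable functions on an open set are determined by their pairing with test
  functions\<close>

section \<open>The fundamental lemma of the calculus of variations\<close>

text \<open>A product of \<open>flat 0\<close> factors is positive exactly on the open box;
  multiplied by \<open>n\<close> and passed through \<open>smooth_step\<close> it equals 1 as soon
  as \<open>n\<close> times its value reaches 1.\<close>

lemma box_indicator_approx: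
  fixes a b :: "'a::euclidean_space"
  obtains u :: "nat \<Rightarrow> 'a \<Rightarrow> real" where "\<And>n. smooth (u n)" "\<And>n x. u n x \<in> {0..1}"
    "\<And>n. supp (u n) \<subseteq> cbox a b" "\<And>x. (\<lambda>n. u n x) \<longlonglongrightarrow> indicator (box a b) x"
proof -
  define \<beta> where "\<beta> x = (\<Prod>c\<in>Basis. flat 0 (x \<bullet> c - a \<bullet> c) * flat 0 (b \<bullet> c - x \<bullet> c))" for x
  have \<beta>_nonneg: "\<beta> x \<ge> 0" for x
    unfolding \<beta>_def by (intro prod_nonneg mult_nonneg_nonneg ballI flat0_nonneg)
  have \<beta>_pos: "\<beta> x > 0" if "x \<in> box a b" for x
    unfolding \<beta>_def using that by (intro prod_pos mult_pos_pos ballI) (auto simp: flat0_pos_iff mem_box)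
  have \<beta>_0: "\<beta> x = 0" if x: "x \<notin> box a b" for x
  proof -
    obtain c where "c \<in> Basis" "\<not> (a \<bullet> c < x \<bullet> c \<and> x \<bullet> c < b \<bullet> c)"
      using x unfolding mem_box by blast
    then have "flat 0 (x \<bullet> c - a \<bullet> c) * flat 0 (b \<bullet> c - x \<bullet> c) = 0"
      by (auto simp: flat_def)
    then show ?thesis unfolding \<beta>_def using \<open>c \<in> Basis\<close> by (intro prod_zero) auto
  qed
  have smooth: "smooth \<beta>"
    unfolding \<beta>_def
    by (intro smooth_prod smooth_mult smooth_compose[OF smooth_flat] smooth_diff smooth_const smooth_inner_right)
  show thesis
  proof
    show "smooth (\<lambda>x. smooth_step (real n * \<beta> x))" for n
      by (intro smooth_compose[OF smooth_smooth_step] smooth_mult smooth smooth_const)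
    show "smooth_step (real n * \<beta> x) \<in> {0..1}" for n x
      by (rule smooth_step_bounds) (simp add: \<beta>_nonneg)
    show "supp (\<lambda>x. smooth_step (real n * \<beta> x)) \<subseteq> cbox a b" for n
      unfolding supp_def
    proof (rule closure_minimal)
      show "{x. smooth_step (real n * \<beta> x) \<noteq> 0} \<subseteq> cbox a b"
        using \<beta>_0 box_subset_cbox by force
    qed (rule closed_cbox)
    show "(\<lambda>n. smooth_step (real n * \<beta> x)) \<longlonglongrightarrow> indicator (box a b) x" for x
    proof (cases "x \<in> box a b")
      case True
      obtain N where N: "real N * \<beta> x \<ge> 1"
        using reals_Archimedean3[OF \<beta>_pos[OF True]] less_imp_le by blast
      have "real n * \<beta> x \<ge> 1" if "n \<ge> N" for n
        using N mult_right_mono[of "real N" "real n" "\<beta> x"] that \<beta>_nonneg[of x] by simp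
      then have "\<forall>\<^sub>F n in sequentially. smooth_step (real n * \<beta> x) = indicator (box a b) x"
        unfolding eventually_sequentially using True by (intro exI[of _ N]) simp
      then show ?thesis by (rule tendsto_eventually)
    qed (simp add: \<beta>_0)
  qed
qed

text \<open>Dynkin class argument for a signed density: boxes are stable under intersection and
  generate the Borel sets, so the integral over each Borel set vanishes, in particular over the sets
  of positivity and negativity. A Borel representative \<open>g\<close> replaces \<open>f\<close>,
  because these two sets must be Borel.\<close>

lemma integral_boxes_zero_imp_AE_zero:
  fixes f :: "'a::euclidean_space \<Rightarrow> real"
  assumes f: "integrable lebesgue f" and zero: "\<And>a b. (\<integral>x. indicator (box a b) x * f x \<partial>lebesgue) = 0"
  shows "AE x in lebesgue. f x = 0"
proof -
  obtain g where g [measurable]: "g \<in> borel_measurable lborel" and eq: "AE x in lborel. f x = g x"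
    using completion_ex_borel_measurable_real[of f lborel] f by auto
  have eq': "AE x in lebesgue. f x = g x"
    using eq by (rule AE_completion)
  have g_int: "integrable lborel g"
  proof -
    have "integrable lebesgue g"
      using integrable_cong_AE_imp[OF f _ eq'] by (simp add: measurable_completion)
    then show ?thesis by (simp add: integrable_completion)
  qed
  have int_A: "integrable lborel (\<lambda>x. indicator A x * g x)" if "A \<in> sets borel" for A
    using integrable_mult_indicator[of A lborel g] that g_int by simp
  have box0: "(\<integral>x. indicator (box a b) x * g x \<partial>lborel) = 0" for a b
  proof -
    have "(\<integral>x. indicator (box a b) x * g x \<partial>lborel) = (\<integral>x. indicator (box a b) x * g x \<partial>lebesgue)"
      by (rule integral_completion[symmetric]) measurable
    also have "\<dots> = (\<integral>x. indicator (box a b) x * f x \<partial>lebesgue)"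
    proof (rule integral_cong_AE)
      show "AE x in lebesgue. indicator (box a b) x * g x = indicator (box a b) x * f x"
        using eq' by eventually_elim simp
      show "(\<lambda>x. indicator (box a b) x * g x) \<in> borel_measurable lebesgue"
        by (rule measurable_completion) measurable
      have "f \<in> borel_measurable lebesgue" using f by blast
      moreover have "(indicator (box a b) :: 'a \<Rightarrow> real) \<in> borel_measurable lebesgue"
        by (rule measurable_completion) measurable
      ultimately show "(\<lambda>x. indicator (box a b) x * f x) \<in> borel_measurable lebesgue"
        by simp
    qed
    finally show ?thesis by (simp add: zero)
  qed
  \<comment> \<open>The whole space is not a box, but complements in the Dynkin class need its
    integral; it is the limit over growing boxes.\<close>
  have total: "(\<integral>x. g x \<partial>lborel) = 0"
  proof -
    have "(\<lambda>n. \<integral>x. indicator (box (- real n *\<^sub>R One) (real n *\<^sub>R One)) x * g x \<partial>lborel) \<longlonglongrightarrow> (\<integral>x. g x \<partial>lborel)"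
    proof (rule integral_dominated_convergence)
      show "integrable lborel (\<lambda>x. \<bar>g x\<bar>)" using g_int by simp
      have "\<exists>N. \<forall>n\<ge>N. x \<in> box (- real n *\<^sub>R One) (real n *\<^sub>R One)" for x :: 'a
      proof -
        obtain N where N: "norm x < real N" using reals_Archimedean2 by blast
        have "\<bar>x \<bullet> i\<bar> < real n" if "n \<ge> N" "i \<in> Basis" for n i
          using Basis_le_norm[OF that(2), of x] N that(1) by linarith
        then have "x \<in> box (- real n *\<^sub>R One) (real n *\<^sub>R One)" if "n \<ge> N" for n
          using that by (force simp: mem_box)
        then show ?thesis by blast
      qed
      then have ev: "\<forall>\<^sub>F n in sequentially. x \<in> box (- real n *\<^sub>R One) (real n *\<^sub>R One)" for x :: 'a
        unfolding eventually_sequentially .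
      have "(\<lambda>n. indicator (box (- real n *\<^sub>R One) (real n *\<^sub>R One)) x * g x) \<longlonglongrightarrow> g x" for x
        by (intro tendsto_eventually eventually_mono[OF ev[of x]]) simp
      then show "AE x in lborel. (\<lambda>n. indicator (box (- real n *\<^sub>R One) (real n *\<^sub>R One)) x * g x) \<longlonglongrightarrow> g x"
        by simp
    qed (auto simp: indicator_def)
    then show ?thesis by (simp add: box0 LIMSEQ_const_iff)
  qed
  have zeroA: "(\<integral>x. indicator A x * g x \<partial>lborel) = 0" if "A \<in> sets borel" for A
  proof -
    have "Int_stable (range (\<lambda>(a, b). box a b :: 'a set))"
      by (auto simp: Int_stable_def box_Int_box)
    moreover have "range (\<lambda>(a, b). box a b :: 'a set) \<subseteq> Pow UNIV" by simp
    moreover have "A \<in> sigma_sets UNIV (range (\<lambda>(a, b). box a b :: 'a set))"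
      using that by (simp add: borel_eq_box)
    ultimately show ?thesis
    proof (induction rule: sigma_sets_induct_disjoint)
      case (basic A)
      then show ?case using box0 by auto
    next
      case (compl A)
      then have A: "A \<in> sets borel" by (simp add: borel_eq_box)
      have "indicator (UNIV - A) x * g x = g x - indicator A x * g x" for x
        by (auto simp: indicator_def)
      then show ?case using g_int int_A[OF A] total compl by simp
    next
      case (union A)
      then have A: "A i \<in> sets borel" for i by (auto simp: borel_eq_box)
      have si: "set_integrable lborel (\<Union>i. A i) g"
        unfolding set_integrable_def using int_A[of "\<Union>i. A i"] A by auto
      have "(LINT x:(\<Union>i. A i)|lborel. g x) = (\<Sum>i. (LINT x:(A i)|lborel. g x))"
        by (rule lebesgue_integral_countable_add[OF _ _ si]) (use A union in \<open>auto simp: disjoint_family_on_def\<close>)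
      then show ?case using union by (simp add: set_lebesgue_integral_def)
    qed simp
  qed
  have "AE x in lborel. g x = 0"
  proof -
    have "AE x in lborel. max 0 (g x) = 0"
    proof -
      have "{x. g x > 0} \<in> sets borel" by measurable
      then have "(\<integral>x. max 0 (g x) \<partial>lborel) = 0"
        using zeroA[of "{x. g x > 0}"]
        by (subst (asm) Bochner_Integration.integral_cong[of lborel lborel _ "\<lambda>x. max 0 (g x)"])
          (auto simp: indicator_def)
      then show ?thesis
        by (subst (asm) integral_nonneg_eq_0_iff_AE) (use g_int in auto)
    qed
    moreover have "AE x in lborel. max 0 (- g x) = 0"
    proof -
      have "{x. g x < 0} \<in> sets borel" by measurable
      then have "(\<integral>x. - max 0 (- g x) \<partial>lborel) = 0"
        using zeroA[of "{x. g x < 0}"]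
        by (subst (asm) Bochner_Integration.integral_cong[of lborel lborel _ "\<lambda>x. - max 0 (- g x)"])
          (auto simp: indicator_def)
      then have "(\<integral>x. max 0 (- g x) \<partial>lborel) = 0" by simp
      then show ?thesis
        by (subst (asm) integral_nonneg_eq_0_iff_AE) (use g_int in auto)
    qed
    ultimately show ?thesis by eventually_elim auto
  qed
  then have "AE x in lebesgue. g x = 0" by (rule AE_completion)
  with eq' show ?thesis by eventually_elim simp
qed

text \<open>Test functions converge boundedly to the indicator of an open box whose closure lies in
  \<open>S\<close>, so \<open>f\<close> integrates to zero over such boxes; countably many closed
  boxes exhaust the open set.\<close>

theorem fundamental_lemma_calculus_of_variations:
  fixes f :: "'a::euclidean_space \<Rightarrow> real"
  assumes S: "open S" and f: "integrable (lebesgue_on S) f"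
    and zero: "\<And>\<phi>. \<phi> \<in> test_functions S \<Longrightarrow> (\<integral>x. f x * \<phi> x \<partial>lebesgue_on S) = 0"
  shows "AE x in lebesgue_on S. f x = 0"
proof -
  have S': "S \<in> sets lebesgue" using S by (simp add: lebesgue_openin)
  have box0: "(\<integral>x. f x * indicator (box a b) x \<partial>lebesgue_on S) = 0" if "cbox a b \<subseteq> S" for a b
  proof -
    obtain u where u: "\<And>n. smooth (u n)" "\<And>n x. u n x \<in> {0..1::real}"
      "\<And>n. supp (u n) \<subseteq> cbox a b" "\<And>x. (\<lambda>n. u n x) \<longlonglongrightarrow> indicator (box a b) x"
      using box_indicator_approx[of a b] by metis
    have "u n \<in> test_functions S" for n
    proof -
      have "compact (cbox a b \<inter> supp (u n))"
        by (intro compact_Int_closed compact_cbox) (simp add: supp_def)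
      moreover have "cbox a b \<inter> supp (u n) = supp (u n)" using u(3)[of n] by blast
      ultimately show ?thesis
        unfolding test_functions_def using u(1)[of n] u(3)[of n] that
        by (auto simp: smooth_def)
    qed
    then have 0: "(\<integral>x. f x * u n x \<partial>lebesgue_on S) = 0" for n
      by (rule zero)
    have "(\<lambda>n. \<integral>x. f x * u n x \<partial>lebesgue_on S) \<longlonglongrightarrow> (\<integral>x. f x * indicator (box a b) x \<partial>lebesgue_on S)"
    proof (rule integral_dominated_convergence[where w = "\<lambda>x. \<bar>f x\<bar>"])
      show "(\<lambda>x. f x * u n x) \<in> borel_measurable (lebesgue_on S)" for n
        using f continuous_borel_measurable_lebesgue_on[OF smooth_continuous[OF u(1)]] by auto
      have [measurable]: "(indicator (box a b) :: 'a \<Rightarrow> real) \<in> borel_measurable (lebesgue_on S)"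
        by (intro measurable_restrict_space1 measurable_completion) measurable
      show "(\<lambda>x. f x * indicator (box a b) x) \<in> borel_measurable (lebesgue_on S)"
        using f by (intro borel_measurable_times) auto
      show "AE x in lebesgue_on S. (\<lambda>n. f x * u n x) \<longlonglongrightarrow> f x * indicator (box a b) x"
        by (intro AE_I2 tendsto_intros u)
      show "AE x in lebesgue_on S. norm (f x * u n x) \<le> \<bar>f x\<bar>" for n
        using u(2) by (intro AE_I2) (auto simp: abs_mult mult_left_le)
    qed (use f in auto)
    then show ?thesis using 0 by (simp add: LIMSEQ_const_iff)
  qed
  have cbox0: "AE x in lebesgue. x \<in> cbox a b \<longrightarrow> f x = 0" if sub: "cbox a b \<subseteq> S" for a b
  proof -
    \<comment> \<open>Cutting off at \<open>box a b\<close> turns the local claim into one on the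
      whole space: a nonempty intersection with another box is a box whose closure still lies in
      \<open>S\<close>.\<close>
    define g where "g x = indicator (box a b) x * (if x \<in> S then f x else 0)" for x
    have fS: "integrable lebesgue (\<lambda>x. if x \<in> S then f x else 0)"
      using f by (simp add: Lebesgue_Measure.integrable_restrict_UNIV[OF S'])
    have g: "integrable lebesgue g"
      unfolding g_def using integrable_mult_indicator[OF _ fS, of "box a b"] by simp
    have "AE x in lebesgue. g x = 0"
    proof (rule integral_boxes_zero_imp_AE_zero[OF g])
      fix c d
      obtain c' d' where cd: "box a b \<inter> box c d = box c' d'"
        by (rule that[OF box_Int_box])
      show "(\<integral>x. indicator (box c d) x * g x \<partial>lebesgue) = 0"
      proof (cases "box c' d' = {}")
        case True
        then have "(\<lambda>x. indicator (box c d) x * g x) = (\<lambda>x. 0)"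
          using cd by (auto simp: g_def fun_eq_iff split: split_indicator)
        then show ?thesis by simp
      next
        case False
        have "cbox c' d' \<subseteq> cbox a b"
          using closure_mono[of "box c' d'" "cbox a b"] box_subset_cbox[of a b] cd
          by (simp add: closure_box[OF False]) blast
        have "(\<integral>x. indicator (box c d) x * g x \<partial>lebesgue)
            = (\<integral>x. (if x \<in> S then f x * indicator (box c' d') x else 0) \<partial>lebesgue)"
          by (rule Bochner_Integration.integral_cong) (auto simp: g_def indicator_def cd[symmetric])
        also have "\<dots> = (\<integral>x. f x * indicator (box c' d') x \<partial>lebesgue_on S)"
          using S' by (simp add: Lebesgue_Measure.integral_restrict_UNIV)
        also have "\<dots> = 0"
          using box0 \<open>cbox c' d' \<subseteq> cbox a b\<close> sub by blast
        finally show ?thesis .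
      qed
    qed
    \<comment> \<open>The cut-off used open boxes, the countable cover below consists of closed
      ones; the difference is a null set.\<close>
    moreover have "AE x in lebesgue. x \<notin> cbox a b - box a b"
    proof -
      have "negligible (cbox a b - box a b)"
        using negligible_frontier_interval[of a b] by simp
      then show ?thesis unfolding negligible_iff_null_sets by (rule AE_not_in)
    qed
    ultimately show ?thesis
      by eventually_elim (use sub in \<open>auto simp: g_def indicator_def split: if_splits\<close>)
  qed
  obtain \<D> where \<D>: "countable \<D>" "\<D> \<subseteq> Pow S" "\<And>X. X \<in> \<D> \<Longrightarrow> \<exists>a b. X = cbox a b" "\<Union>\<D> = S"
    using open_countable_Union_open_cbox[OF S] by metis
  have "AE x in lebesgue. \<forall>X\<in>\<D>. x \<in> X \<longrightarrow> f x = 0"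
    unfolding AE_ball_countable[OF \<D>(1)]
  proof
    fix X assume "X \<in> \<D>"
    then obtain a b where "X = cbox a b" "cbox a b \<subseteq> S" using \<D> by blast
    then show "AE x in lebesgue. x \<in> X \<longrightarrow> f x = 0" using cbox0 by simp
  qed
  then have "AE x in lebesgue. x \<in> S \<longrightarrow> f x = 0"
    by eventually_elim (use \<D>(4) in auto)
  then show ?thesis using S' by (simp add: AE_restrict_space_iff)
qed

section \<open>Integration by parts for Lipschitz functions against test functions\<close>

section \<open>Weak gradients\<close>

lemma lborel_translation:
  fixes F :: "'a::euclidean_space \<Rightarrow> real"
  assumes [measurable]: "F \<in> borel_measurable borel"
  shows "(\<integral>x. F (x + c) \<partial>lborel) = (\<integral>x. F x \<partial>lborel)"
    and "integrable lborel (\<lambda>x. F (x + c)) \<longleftrightarrow> integrable lborel F"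
proof -
  have d: "lborel = distr lborel borel ((+) c)" by (simp add: lborel_distr_plus)
  show "(\<integral>x. F (x + c) \<partial>lborel) = (\<integral>x. F x \<partial>lborel)"
    by (subst (2) d, subst integral_distr) (auto simp: add.commute)
  show "integrable lborel (\<lambda>x. F (x + c)) \<longleftrightarrow> integrable lborel F"
    by (subst (2) d, subst integrable_distr_eq) (auto simp: add.commute)
qed

lemma integrable_lborel_continuous_compact:
  fixes F :: "'a::euclidean_space \<Rightarrow> real"
  assumes "continuous_on UNIV F" "compact S" "\<And>x. x \<notin> S \<Longrightarrow> F x = 0"
  shows "integrable lborel F"
proof -
  have "integrable lborel (\<lambda>x. indicator S x *\<^sub>R F x)"
    by (rule borel_integrable_compact[OF assms(2) continuous_on_subset[OF assms(1)]]) simp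
  moreover have "(\<lambda>x. indicator S x *\<^sub>R F x) = F"
    using assms(3) by (auto simp: fun_eq_iff split: split_indicator)
  ultimately show ?thesis by simp
qed

lemma borel_measurable_LIMSEQ_AE_lebesgue:
  fixes f :: "'a::euclidean_space \<Rightarrow> 'b::euclidean_space"
  assumes "\<And>n. s n \<in> borel_measurable lebesgue" "AE x in lebesgue. (\<lambda>n. s n x) \<longlonglongrightarrow> f x"
  shows "f \<in> borel_measurable lebesgue"
  using borel_measurable_LIMSEQ_AE_lebesgue_on[of UNIV s f] assms
  unfolding lebesgue_on_UNIV_eq by simp

text \<open>Translation invariance and dominated convergence; this replaces Fubini in the integration by parts.\<close>

lemma integral_directional_derivative_zero:
  fixes F D :: "'a::euclidean_space \<Rightarrow> real"
  assumes cont: "continuous_on UNIV F"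
    and supp: "\<And>x. norm x > R \<Longrightarrow> F x = 0"
    and bd: "\<And>x t. 0 < t \<Longrightarrow> t \<le> 1 \<Longrightarrow> \<bar>F (x + t *\<^sub>R b) - F x\<bar> \<le> K * t"
    and lim: "AE x in lebesgue.
      (\<lambda>n. (F (x + inverse (real (Suc n)) *\<^sub>R b) - F x) * real (Suc n)) \<longlonglongrightarrow> D x"
  shows "integrable lebesgue D" and "(\<integral>x. D x \<partial>lebesgue) = 0"
proof -
  define s where "s n x = (F (x + inverse (real (Suc n)) *\<^sub>R b) - F x) * real (Suc n)" for n x
  have F [measurable]: "F \<in> borel_measurable borel"
    using cont by (rule borel_measurable_continuous_onI)
  have F_int: "integrable lborel F"
    by (rule integrable_lborel_continuous_compact[OF cont compact_cball[of 0 R]]) (auto intro: supp)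
  have s_meas: "s n \<in> borel_measurable lborel" for n
    unfolding s_def by measurable
  then have s_meas': "s n \<in> borel_measurable lebesgue" for n
    by (intro measurable_completion)
  have "(\<integral>x. s n x \<partial>lborel) = 0" for n
    unfolding s_def using F_int lborel_translation[OF F] by simp
  then have s_0: "(\<integral>x. s n x \<partial>lebesgue) = 0" for n
    using s_meas by (simp add: integral_completion)
  have s_bd: "norm (s n x) \<le> K * indicator (cball 0 (R + norm b)) x" for n x
  proof (cases "norm x \<le> R + norm b")
    case True
    have "\<bar>s n x\<bar> \<le> K * inverse (real (Suc n)) * real (Suc n)"
      unfolding s_def abs_mult
      by (intro mult_mono bd) (use bd[of 1 x] in \<open>auto simp: field_simps intro: order_trans[OF abs_ge_zero]\<close>)
    also have "\<dots> = K" by (simp add: field_simps del: of_nat_Suc)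
    finally show ?thesis using True by simp
  next
    case False
    have "norm x \<le> norm (x + inverse (real (Suc n)) *\<^sub>R b) + norm (inverse (real (Suc n)) *\<^sub>R b)"
      by (metis add_diff_cancel_right' norm_triangle_ineq4)
    moreover have "norm (inverse (real (Suc n)) *\<^sub>R b) \<le> norm b"
      by (simp add: field_simps mult_left_le)
    ultimately have "norm (x + inverse (real (Suc n)) *\<^sub>R b) > R"
      using False by linarith
    moreover have "norm x > R" using False norm_ge_zero[of b] by linarith
    ultimately show ?thesis using False by (simp add: s_def supp)
  qed
  have w: "integrable lebesgue (\<lambda>x. K * indicator (cball 0 (R + norm b)) x :: real)"
    by (intro integrable_mult_right integrable_real_indicator)
      (use lmeasurable_cball in \<open>auto simp: fmeasurable_def\<close>)
  have D_meas: "D \<in> borel_measurable lebesgue"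
    by (rule borel_measurable_LIMSEQ_AE_lebesgue[OF s_meas']) (use lim in \<open>simp add: s_def\<close>)
  have lim': "AE x in lebesgue. (\<lambda>n. s n x) \<longlonglongrightarrow> D x"
    using lim by (simp add: s_def)
  show "integrable lebesgue D"
    by (rule integrable_dominated_convergence[OF D_meas s_meas' w lim']) (intro AE_I2 s_bd)
  have "(\<lambda>n. \<integral>x. s n x \<partial>lebesgue) \<longlonglongrightarrow> (\<integral>x. D x \<partial>lebesgue)"
    by (rule integral_dominated_convergence[OF D_meas s_meas' w lim']) (intro AE_I2 s_bd)
  then show "(\<integral>x. D x \<partial>lebesgue) = 0"
    by (simp add: s_0 LIMSEQ_const_iff)
qed

text \<open>Sequential form of the directional derivative, as dominated convergence
  requires.\<close>

lemma difference_quotient_LIMSEQ: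
  fixes u :: "'a::euclidean_space \<Rightarrow> real"
  assumes "(u has_derivative D) (at x)"
  shows "(\<lambda>n. (u (x + inverse (real (Suc n)) *\<^sub>R b) - u x) * real (Suc n)) \<longlonglongrightarrow> D b"
proof -
  have "((\<lambda>t. x + t *\<^sub>R b) has_derivative (\<lambda>t. t *\<^sub>R b)) (at 0)"
    by (auto intro!: derivative_eq_intros)
  moreover have "(u has_derivative D) (at (x + 0 *\<^sub>R b))" using assms by simp
  ultimately have "((\<lambda>t. u (x + t *\<^sub>R b)) has_derivative (\<lambda>t. D (t *\<^sub>R b))) (at 0)"
    by (rule has_derivative_compose)
  moreover have "(\<lambda>t. D (t *\<^sub>R b)) = (*) (D b)"
    using linear_scale[OF has_derivative_linear[OF assms]] by (auto simp: mult.commute)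
  ultimately have "((\<lambda>t. u (x + t *\<^sub>R b)) has_real_derivative D b) (at 0)"
    by (simp add: has_field_derivative_def)
  then have "((\<lambda>h. (u (x + h *\<^sub>R b) - u x) / h) \<longlongrightarrow> D b) (at 0)"
    by (simp add: DERIV_def)
  moreover have "filterlim (\<lambda>n. inverse (real (Suc n))) (at 0) sequentially"
    using LIMSEQ_inverse_real_of_nat by (simp add: filterlim_at del: of_nat_Suc)
  ultimately have "(\<lambda>n. (u (x + inverse (real (Suc n)) *\<^sub>R b) - u x) / inverse (real (Suc n))) \<longlonglongrightarrow> D b"
    by (rule filterlim_compose)
  then show ?thesis by (simp add: divide_inverse)
qed

definition grad :: "(real^2 \<Rightarrow> real) \<Rightarrow> real^2 \<Rightarrow> real^2" where
  "grad \<phi> x = (\<chi> i. frechet_derivative \<phi> (at x) (axis i 1))"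

lemma smooth_has_grad:
  assumes "smooth \<phi>" shows "(\<phi> has_derivative (\<lambda>h. grad \<phi> x \<bullet> h)) (at x)"
proof -
  have d: "(\<phi> has_derivative frechet_derivative \<phi> (at x)) (at x)"
    by (rule smooth_has_derivative[OF assms])
  have "frechet_derivative \<phi> (at x) h = grad \<phi> x \<bullet> h" for h
  proof -
    have "frechet_derivative \<phi> (at x) h = frechet_derivative \<phi> (at x) (\<Sum>i\<in>UNIV. h $ i *\<^sub>R axis i 1)"
      using basis_expansion[of h] by (simp add: scalar_mult_eq_scaleR)
    also have "\<dots> = (\<Sum>i\<in>UNIV. h $ i * frechet_derivative \<phi> (at x) (axis i 1))"
      using has_derivative_linear[OF d] by (simp add: linear_sum linear_scale)
    finally show ?thesis by (simp add: grad_def inner_vec_def mult.commute)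
  qed
  then have "frechet_derivative \<phi> (at x) = (\<lambda>h. grad \<phi> x \<bullet> h)" by auto
  with d show ?thesis by simp
qed

lemma smooth_partial_continuous:
  assumes "smooth \<phi>" shows "continuous_on UNIV (\<lambda>x. frechet_derivative \<phi> (at x) (axis i (1::real)))"
  by (intro smooth_continuous smooth_frechet_derivative assms) (simp add: axis_in_Basis_iff)

lemma smooth_grad_continuous: "smooth \<phi> \<Longrightarrow> continuous_on UNIV (grad \<phi>)"
  unfolding grad_def by (intro continuous_on_vec_lambda smooth_partial_continuous)

lemma grad_eq_0_outside_supp:
  assumes "smooth \<phi>" "x \<notin> supp \<phi>" shows "grad \<phi> x = 0"
proof -
  have "open (- supp \<phi>)" by (simp add: supp_def open_Compl)
  have "(\<phi> has_derivative (\<lambda>h. 0)) (at x)"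
  proof (rule has_derivative_transform_within_open[OF has_derivative_const \<open>open (- supp \<phi>)\<close>])
    show "x \<in> - supp \<phi>" using assms by simp
    show "0 = \<phi> y" if "y \<in> - supp \<phi>" for y
      using that closure_subset[of "{x. \<phi> x \<noteq> 0}"] by (auto simp: supp_def)
  qed
  then have "(\<lambda>h. grad \<phi> x \<bullet> h) = (\<lambda>h. 0)"
    using has_derivative_unique[OF smooth_has_grad[OF assms(1)]] by blast
  then have "grad \<phi> x \<bullet> grad \<phi> x = 0" by meson
  then show ?thesis by simp
qed

lemma test_functionsD:
  assumes "\<phi> \<in> test_functions S"
  shows "smooth \<phi>" "compact (supp \<phi>)" "supp \<phi> \<subseteq> S"
  using assms by (auto simp: test_functions_def smooth_def)

lemma test_functionsI: "smooth \<phi> \<Longrightarrow> compact (supp \<phi>) \<Longrightarrow> supp \<phi> \<subseteq> S \<Longrightarrow> \<phi> \<in> test_functions S"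
  by (auto simp: test_functions_def smooth_def)

lemma eq_0_outside_supp: "x \<notin> supp \<phi> \<Longrightarrow> \<phi> x = 0"
  using closure_subset[of "{x. \<phi> x \<noteq> 0}"] by (auto simp: supp_def)

lemma bounded_range_compact_support:
  fixes F :: "'a::euclidean_space \<Rightarrow> 'b::euclidean_space"
  assumes "continuous_on UNIV F" "compact S" "\<And>x. x \<notin> S \<Longrightarrow> F x = 0"
  obtains B where "B \<ge> 0" "\<And>x. norm (F x) \<le> B"
proof -
  have "bounded (F ` S)"
    by (intro compact_imp_bounded compact_continuous_image continuous_on_subset[OF assms(1)] assms) simp
  then obtain B where B: "\<And>x. x \<in> S \<Longrightarrow> norm (F x) \<le> B" by (auto simp: bounded_iff)
  have "norm (F x) \<le> max B 0" for x
    using B[of x] assms(3)[of x] by (cases "x \<in> S") auto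
  then show thesis by (rule that[of "max B 0", rotated]) simp
qed

lemma test_function_Lipschitz:
  fixes \<phi> :: "real^2 \<Rightarrow> real"
  assumes "\<phi> \<in> test_functions S"
  obtains B where "B-lipschitz_on UNIV \<phi>"
proof -
  note \<phi> = test_functionsD[OF assms]
  obtain B where B: "B \<ge> 0" "\<And>x. norm (grad \<phi> x) \<le> B"
    using bounded_range_compact_support[OF smooth_grad_continuous[OF \<phi>(1)] \<phi>(2) grad_eq_0_outside_supp[OF \<phi>(1)]]
    by metis
  have "norm (\<phi> x - \<phi> y) \<le> B * norm (x - y)" for x y
  proof (rule differentiable_bound[of UNIV \<phi> "\<lambda>x h. grad \<phi> x \<bullet> h"])
    show "onorm (\<lambda>h. grad \<phi> x \<bullet> h) \<le> B" for x
      by (rule onorm_bound[OF B(1)])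
        (use order_trans[OF Cauchy_Schwarz_ineq2 mult_right_mono[OF B(2) norm_ge_zero]] in simp)
  qed (auto intro: smooth_has_grad[OF \<phi>(1)])
  then have "B-lipschitz_on UNIV \<phi>"
    using B(1) by (auto simp: lipschitz_on_def dist_norm)
  then show thesis by (rule that)
qed

text \<open>Difference quotients in the direction \<open>g\<close> itself converge to
  \<open>g \<bullet> g\<close> and are at most \<open>L * norm g\<close>.\<close>

lemma AE_gradient_bound:
  assumes L: "L-lipschitz_on UNIV u" and g: "(u has_derivative (\<lambda>h. g \<bullet> h)) (at x)"
  shows "norm (g::real^2) \<le> L"
proof -
  have "g \<bullet> g \<le> L * norm g"
  proof (rule LIMSEQ_le_const2[OF difference_quotient_LIMSEQ[OF g]], intro exI allI impI)
    fix n :: nat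
    have "u (x + inverse (real (Suc n)) *\<^sub>R g) - u x \<le> L * (inverse (real (Suc n)) * norm g)"
      using lipschitz_onD[OF L, of "x + inverse (real (Suc n)) *\<^sub>R g" x] by (simp add: dist_norm)
    then have "(u (x + inverse (real (Suc n)) *\<^sub>R g) - u x) * real (Suc n)
        \<le> L * (inverse (real (Suc n)) * norm g) * real (Suc n)"
      by (rule mult_right_mono) simp
    also have "\<dots> = L * norm g" by simp
    finally show "(u (x + inverse (real (Suc n)) *\<^sub>R g) - u x) * real (Suc n) \<le> L * norm g" .
  qed
  then show ?thesis
    using lipschitz_on_nonneg[OF L] by (cases "g = 0") (auto simp: dot_square_norm power2_eq_square)
qed

text \<open>Each component of \<open>g\<close> is almost everywhere a limit of continuous difference
  quotients.\<close>

lemma Lipschitz_gradient_measurable: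
  fixes u :: "real^2 \<Rightarrow> real"
  assumes L: "L-lipschitz_on UNIV u" and d: "AE x in lebesgue. (u has_derivative (\<lambda>h. g x \<bullet> h)) (at x)"
  shows "g \<in> borel_measurable lebesgue"
  unfolding borel_measurable_euclidean_space[of g]
proof
  fix b :: "real^2" assume "b \<in> Basis"
  have c: "continuous_on UNIV u" using L by (rule lipschitz_on_continuous_on)
  have "(\<lambda>x. (u (x + inverse (real (Suc n)) *\<^sub>R b) - u x) * real (Suc n)) \<in> borel_measurable lborel" for n
  proof -
    have "u \<in> borel_measurable borel" using c by (rule borel_measurable_continuous_onI)
    then show ?thesis by measurable
  qed
  moreover have "AE x in lebesgue. (\<lambda>n. (u (x + inverse (real (Suc n)) *\<^sub>R b) - u x) * real (Suc n)) \<longlonglongrightarrow> g x \<bullet> b"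
    using d by eventually_elim (rule difference_quotient_LIMSEQ)
  ultimately show "(\<lambda>x. g x \<bullet> b) \<in> borel_measurable lebesgue"
    by (rule borel_measurable_LIMSEQ_AE_lebesgue[OF measurable_completion])
qed

locale bounded_open =
  fixes \<Omega> :: "(real^2) set"
  assumes open_\<Omega>: "open \<Omega>" and bounded_\<Omega>: "bounded \<Omega>"
begin

lemma lmeasurable_\<Omega> [simp]: "\<Omega> \<in> lmeasurable"
  using open_\<Omega> bounded_\<Omega> by (simp add: lmeasurable_open)

lemma sets_\<Omega> [simp]: "\<Omega> \<in> sets lebesgue"
  using lmeasurable_\<Omega> by (rule fmeasurableD)

lemma integral_\<Omega>_eq:
  assumes "\<And>x. x \<notin> \<Omega> \<Longrightarrow> f x = (0::real)"
  shows "(\<integral>x. f x \<partial>lebesgue_on \<Omega>) = (\<integral>x. f x \<partial>lebesgue)"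
proof -
  have "(\<lambda>x. if x \<in> \<Omega> then f x else 0) = f" using assms by auto
  then show ?thesis by (metis sets_\<Omega> Lebesgue_Measure.integral_restrict_UNIV)
qed

lemma AE_\<Omega>I: "AE x in lebesgue. P x \<Longrightarrow> AE x in lebesgue_on \<Omega>. P x"
  by (auto simp: AE_restrict_space_iff elim: eventually_mono)

lemma continuous_L2:
  fixes f :: "real^2 \<Rightarrow> 'b::euclidean_space"
  assumes "continuous_on UNIV f" shows "f \<in> L2 \<Omega>"
proof -
  have "compact (closure \<Omega>)" using bounded_\<Omega> by simp
  then have "bounded (f ` closure \<Omega>)"
    by (intro compact_imp_bounded compact_continuous_image continuous_on_subset[OF assms]) auto
  then obtain B where "\<And>x. x \<in> closure \<Omega> \<Longrightarrow> norm (f x) \<le> B" by (auto simp: bounded_iff)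
  then have "\<And>x. x \<in> \<Omega> \<Longrightarrow> norm (f x) \<le> B" using closure_subset by blast
  then show ?thesis
    by (intro L2_bounded[where B = B] continuous_borel_measurable_lebesgue_on[OF assms] lmeasurable_\<Omega> AE_I2) simp
qed

text \<open>By the product rule it suffices that every directional derivative of \<open>u\<close>
  times a test function has integral zero. The Lipschitz constants of both factors give the bound on
  difference quotients that dominated convergence asks for.\<close>

lemma Lipschitz_is_weak_gradient:
  assumes L: "L-lipschitz_on UNIV u"
    and d: "AE x in lebesgue. (u has_derivative (\<lambda>h. g x \<bullet> h)) (at x)"
  shows "is_weak_gradient \<Omega> u g"
  unfolding is_weak_gradient_def
proof (intro conjI ballI allI)
  have c: "continuous_on UNIV u" using L by (rule lipschitz_on_continuous_on)
  show "u \<in> L2 \<Omega>" using c by (rule continuous_L2)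
  have gm: "g \<in> borel_measurable lebesgue"
    using L d by (rule Lipschitz_gradient_measurable)
  have gb: "AE x in lebesgue. norm (g x) \<le> L"
    using d by eventually_elim (rule AE_gradient_bound[OF L])
  show "g \<in> L2 \<Omega>"
    using gm gb by (intro L2_bounded[where B = L] AE_\<Omega>I measurable_restrict_space1) auto
  fix \<phi> :: "real^2 \<Rightarrow> real" and i :: 2
  assume "\<phi> \<in> test_functions \<Omega>"
  note \<phi> = test_functionsD[OF this]
  obtain B where B: "B-lipschitz_on UNIV \<phi>"
    using test_function_Lipschitz[OF \<open>\<phi> \<in> test_functions \<Omega>\<close>] .
  obtain \<Phi> where \<Phi>: "\<Phi> \<ge> 0" "\<And>x. norm (\<phi> x) \<le> \<Phi>"
    using bounded_range_compact_support[where F = \<phi> and S = "supp \<phi>", OF smooth_continuous[OF \<phi>(1)] \<phi>(2)]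
      eq_0_outside_supp[of _ \<phi>] by metis
  obtain R where R: "\<And>x. x \<in> supp \<phi> \<Longrightarrow> norm x \<le> R"
    using compact_imp_bounded[OF \<phi>(2)] by (auto simp: bounded_iff)
  then have R0: "\<phi> x = 0" if "norm x > R" for x
    using that eq_0_outside_supp[of x \<phi>] by force
  \<comment> \<open>\<open>u\<close> itself may be unbounded; only its values near the support of
    the test function enter, and \<open>R + 1\<close> allows for translations of length at most
    1.\<close>
  have "bounded (u ` cball 0 (R + 1))"
    by (intro compact_imp_bounded compact_continuous_image continuous_on_subset[OF c]) auto
  then obtain U where "\<And>x. norm x \<le> R + 1 \<Longrightarrow> \<bar>u x\<bar> \<le> U" by (force simp: bounded_iff)
  then have U: "\<bar>u x\<bar> \<le> max U 0" if "norm x \<le> R + 1" for x using that by force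
  define b :: "real^2" where "b = axis i 1"
  have b: "norm b = 1" by (simp add: b_def norm_axis_1)
  define D where "D x = g x $ i * \<phi> x + u x * frechet_derivative \<phi> (at x) b" for x
  have fd: "frechet_derivative \<phi> (at x) b = grad \<phi> x \<bullet> b" for x
    by (simp add: b_def grad_def inner_axis)
  have bd: "\<bar>u (x + t *\<^sub>R b) * \<phi> (x + t *\<^sub>R b) - u x * \<phi> x\<bar> \<le> (max U 0 * B + \<Phi> * L) * t"
    if "0 < t" "t \<le> 1" for x t
  proof -
    have nt: "norm (t *\<^sub>R b) = t" using that b by simp
    have 1: "\<bar>\<phi> (x + t *\<^sub>R b) - \<phi> x\<bar> \<le> B * t" "\<bar>u (x + t *\<^sub>R b) - u x\<bar> \<le> L * t"
      using lipschitz_onD[OF B, of "x + t *\<^sub>R b" x] lipschitz_onD[OF L, of "x + t *\<^sub>R b" x] nt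
      by (auto simp: dist_norm)
    have 2: "\<bar>u (x + t *\<^sub>R b) * (\<phi> (x + t *\<^sub>R b) - \<phi> x)\<bar> \<le> max U 0 * (B * t)"
    proof (cases "norm (x + t *\<^sub>R b) \<le> R + 1")
      case True
      show ?thesis unfolding abs_mult by (intro mult_mono U 1 True) auto
    next
      case False
      then have "norm x > R" "norm (x + t *\<^sub>R b) > R"
        using norm_triangle_ineq[of x "t *\<^sub>R b"] nt that by linarith+
      then show ?thesis using R0 lipschitz_on_nonneg[OF B] that by simp
    qed
    have 3: "\<bar>\<phi> x * (u (x + t *\<^sub>R b) - u x)\<bar> \<le> \<Phi> * (L * t)"
      unfolding abs_mult by (intro mult_mono 1) (use \<Phi> in auto)
    have "u (x + t *\<^sub>R b) * \<phi> (x + t *\<^sub>R b) - u x * \<phi> x =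
      u (x + t *\<^sub>R b) * (\<phi> (x + t *\<^sub>R b) - \<phi> x) + \<phi> x * (u (x + t *\<^sub>R b) - u x)"
      by (simp add: algebra_simps)
    then show ?thesis using 2 3 by (simp add: algebra_simps)
  qed
  have lim: "AE x in lebesgue. (\<lambda>n. (u (x + inverse (real (Suc n)) *\<^sub>R b) * \<phi> (x + inverse (real (Suc n)) *\<^sub>R b)
      - u x * \<phi> x) * real (Suc n)) \<longlonglongrightarrow> D x"
    using d
  proof eventually_elim
    case (elim x)
    have "((\<lambda>x. u x * \<phi> x) has_derivative (\<lambda>h. u x * (grad \<phi> x \<bullet> h) + (g x \<bullet> h) * \<phi> x)) (at x)"
      by (rule has_derivative_mult[OF elim smooth_has_grad[OF \<phi>(1)]])
    from difference_quotient_LIMSEQ[OF this, of b] show ?case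
      unfolding D_def fd by (simp add: b_def inner_axis add.commute)
  qed
  have cu\<phi>: "continuous_on UNIV (\<lambda>x. u x * \<phi> x)"
    using c smooth_continuous[OF \<phi>(1)] by (rule continuous_on_mult)
  have D: "integrable lebesgue D" "(\<integral>x. D x \<partial>lebesgue) = 0"
    using integral_directional_derivative_zero[OF cu\<phi> _ bd lim] R0 by auto
  have 1: "integrable lebesgue (\<lambda>x. u x * frechet_derivative \<phi> (at x) b)"
  proof -
    have "integrable lborel (\<lambda>x. u x * frechet_derivative \<phi> (at x) b)"
      by (rule integrable_lborel_continuous_compact[OF _ \<phi>(2)])
        (use c smooth_grad_continuous[OF \<phi>(1)] grad_eq_0_outside_supp[OF \<phi>(1)] in
          \<open>auto simp: fd intro!: continuous_on_mult continuous_on_inner\<close>)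
    then show ?thesis using integrable_completion borel_measurable_integrable by blast
  qed
  have 2: "integrable lebesgue (\<lambda>x. g x $ i * \<phi> x)"
    using Bochner_Integration.integrable_diff[OF D(1) 1] by (simp add: D_def)
  have "(\<integral>x. u x * frechet_derivative \<phi> (at x) b \<partial>lebesgue) = - (\<integral>x. g x $ i * \<phi> x \<partial>lebesgue)"
    using D(2) 1 2 unfolding D_def by simp
  moreover have "\<phi> x = 0" "frechet_derivative \<phi> (at x) b = 0" if "x \<notin> \<Omega>" for x
  proof -
    have "x \<notin> supp \<phi>" using that \<phi>(3) by blast
    then show "\<phi> x = 0" "frechet_derivative \<phi> (at x) b = 0"
      by (simp_all add: fd eq_0_outside_supp grad_eq_0_outside_supp[OF \<phi>(1)])
  qed
  ultimately show "(\<integral>x. u x * frechet_derivative \<phi> (at x) (axis i 1) \<partial>lebesgue_on \<Omega>)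
        = - (\<integral>x. g x $ i * \<phi> x \<partial>lebesgue_on \<Omega>)"
    by (subst (1 2) integral_\<Omega>_eq) (auto simp: b_def)
qed

lemma test_function_is_weak_gradient:
  assumes "\<phi> \<in> test_functions \<Omega>" shows "is_weak_gradient \<Omega> \<phi> (grad \<phi>)"
proof -
  obtain B where "B-lipschitz_on UNIV \<phi>"
    using test_function_Lipschitz[OF assms] .
  then show ?thesis
    by (rule Lipschitz_is_weak_gradient) (auto intro: smooth_has_grad test_functionsD[OF assms])
qed

end

section \<open>H1 and H10 as seminormed spaces of functions, and passage from test functions to H10
  by density\<close>

section \<open>Sobolev spaces\<close>

context bounded_open
begin

lemma is_weak_gradientD:
  assumes "is_weak_gradient \<Omega> u g"
  shows "u \<in> L2 \<Omega>" "g \<in> L2 \<Omega>"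
    "\<phi> \<in> test_functions \<Omega> \<Longrightarrow>
      (\<integral>x. u x * frechet_derivative \<phi> (at x) (axis i 1) \<partial>lebesgue_on \<Omega>) = - (\<integral>x. g x $ i * \<phi> x \<partial>lebesgue_on \<Omega>)"
  using assms by (auto simp: is_weak_gradient_def)

lemma L2_component:
  fixes g :: "real^2 \<Rightarrow> real^2"
  assumes "g \<in> L2 \<Omega>" shows "(\<lambda>x. g x $ i) \<in> L2 \<Omega>"
proof -
  have [measurable]: "g \<in> borel_measurable (lebesgue_on \<Omega>)" and i: "integrable (lebesgue_on \<Omega>) (\<lambda>x. (norm (g x))\<^sup>2)"
    using assms by (auto simp: L2_def)
  have m: "(\<lambda>x. g x $ i) \<in> borel_measurable (lebesgue_on \<Omega>)"
    by (rule borel_measurable_continuous_on[of "\<lambda>v. v $ i"]) (auto intro!: continuous_intros)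
  have "integrable (lebesgue_on \<Omega>) (\<lambda>x. (g x $ i)\<^sup>2)"
    by (rule Bochner_Integration.integrable_bound[OF i])
      (use m component_le_norm_cart in \<open>auto simp flip: abs_le_square_iff\<close>)
  then show ?thesis using m by (simp add: L2_def)
qed

lemma test_function_L2: "\<phi> \<in> test_functions \<Omega> \<Longrightarrow> \<phi> \<in> L2 \<Omega>"
  by (intro continuous_L2 smooth_continuous test_functionsD)

lemma test_partial_L2:
  "\<phi> \<in> test_functions \<Omega> \<Longrightarrow> (\<lambda>x. frechet_derivative \<phi> (at x) (axis i 1)) \<in> L2 \<Omega>"
  by (intro continuous_L2 smooth_partial_continuous test_functionsD)

text \<open>The fundamental lemma applied to each component. It frees energies from the choice
  inside \<open>weak_gradient\<close>: by \<open>V_norm_eq\<close> any weak gradient at hand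
  computes the seminorm.\<close>

lemma weak_gradient_unique:
  assumes "is_weak_gradient \<Omega> u g" "is_weak_gradient \<Omega> u k"
  shows "AE x in lebesgue_on \<Omega>. g x = k x"
proof -
  note g = is_weak_gradientD[OF assms(1)] and k = is_weak_gradientD[OF assms(2)]
  have "AE x in lebesgue_on \<Omega>. g x $ i - k x $ i = 0" for i
  proof (rule fundamental_lemma_calculus_of_variations[OF open_\<Omega>])
    show "integrable (lebesgue_on \<Omega>) (\<lambda>x. g x $ i - k x $ i)"
      by (intro Bochner_Integration.integrable_diff L2_integrable[OF lmeasurable_\<Omega>] L2_component g k)
    fix \<phi> :: "real^2 \<Rightarrow> real" assume \<phi>: "\<phi> \<in> test_functions \<Omega>"
    have "(\<integral>x. (g x $ i - k x $ i) * \<phi> x \<partial>lebesgue_on \<Omega>)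
        = (\<integral>x. g x $ i * \<phi> x \<partial>lebesgue_on \<Omega>) - (\<integral>x. k x $ i * \<phi> x \<partial>lebesgue_on \<Omega>)"
      using L2_integrable_mult[OF L2_component[OF g(2)] test_function_L2[OF \<phi>], of i]
        L2_integrable_mult[OF L2_component[OF k(2)] test_function_L2[OF \<phi>], of i]
      by (simp add: left_diff_distrib)
    then show "(\<integral>x. (g x $ i - k x $ i) * \<phi> x \<partial>lebesgue_on \<Omega>) = 0"
      using g(3)[OF \<phi>, of i] k(3)[OF \<phi>, of i] by simp
  qed
  then have "AE x in lebesgue_on \<Omega>. \<forall>i\<in>UNIV. g x $ i - k x $ i = 0"
    by (intro AE_finite_allI) auto
  then show ?thesis by eventually_elim (simp add: vec_eq_iff)
qed

lemma is_weak_gradient_lincomb: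
  assumes "is_weak_gradient \<Omega> u g" "is_weak_gradient \<Omega> v k"
  shows "is_weak_gradient \<Omega> (\<lambda>x. a * u x + b * v x) (\<lambda>x. a *\<^sub>R g x + b *\<^sub>R k x)"
  unfolding is_weak_gradient_def
proof (intro conjI ballI allI)
  note g = is_weak_gradientD[OF assms(1)] and k = is_weak_gradientD[OF assms(2)]
  show "(\<lambda>x. a * u x + b * v x) \<in> L2 \<Omega>"
    using L2_add(1)[OF L2_scaleR[OF g(1), of a] L2_scaleR[OF k(1), of b]] by simp
  show "(\<lambda>x. a *\<^sub>R g x + b *\<^sub>R k x) \<in> L2 \<Omega>"
    by (rule L2_add(1)[OF L2_scaleR[OF g(2)] L2_scaleR[OF k(2)]])
  fix \<phi> :: "real^2 \<Rightarrow> real" and i assume \<phi>: "\<phi> \<in> test_functions \<Omega>"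
  let ?d = "\<lambda>x. frechet_derivative \<phi> (at x) (axis i 1)"
  have "(\<integral>x. (a * u x + b * v x) * ?d x \<partial>lebesgue_on \<Omega>)
      = (\<integral>x. a * (u x * ?d x) + b * (v x * ?d x) \<partial>lebesgue_on \<Omega>)"
    by (simp add: algebra_simps)
  also have "\<dots> = a * (\<integral>x. u x * ?d x \<partial>lebesgue_on \<Omega>) + b * (\<integral>x. v x * ?d x \<partial>lebesgue_on \<Omega>)"
    using L2_integrable_mult[OF g(1) test_partial_L2[OF \<phi>], of i]
      L2_integrable_mult[OF k(1) test_partial_L2[OF \<phi>], of i] by simp
  also have "\<dots> = - (a * (\<integral>x. g x $ i * \<phi> x \<partial>lebesgue_on \<Omega>) + b * (\<integral>x. k x $ i * \<phi> x \<partial>lebesgue_on \<Omega>))"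
    by (simp add: g(3)[OF \<phi>] k(3)[OF \<phi>])
  also have "\<dots> = - (\<integral>x. a * (g x $ i * \<phi> x) + b * (k x $ i * \<phi> x) \<partial>lebesgue_on \<Omega>)"
    using L2_integrable_mult[OF L2_component[OF g(2)] test_function_L2[OF \<phi>], of i]
        L2_integrable_mult[OF L2_component[OF k(2)] test_function_L2[OF \<phi>], of i] by simp
  also have "\<dots> = - (\<integral>x. (a *\<^sub>R g x + b *\<^sub>R k x) $ i * \<phi> x \<partial>lebesgue_on \<Omega>)"
    by (simp add: algebra_simps)
  finally show "(\<integral>x. (a * u x + b * v x) * ?d x \<partial>lebesgue_on \<Omega>)
      = - (\<integral>x. (a *\<^sub>R g x + b *\<^sub>R k x) $ i * \<phi> x \<partial>lebesgue_on \<Omega>)" .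
qed

lemma H1I: "is_weak_gradient \<Omega> u g \<Longrightarrow> u \<in> H1 \<Omega>"
  by (auto simp: H1_def)

lemma H1_weak_gradient: "u \<in> H1 \<Omega> \<Longrightarrow> is_weak_gradient \<Omega> u (weak_gradient \<Omega> u)"
  unfolding H1_def weak_gradient_def using someI_ex[of "is_weak_gradient \<Omega> u"] by auto

lemma H1_L2: "u \<in> H1 \<Omega> \<Longrightarrow> u \<in> L2 \<Omega>"
  using H1_weak_gradient is_weak_gradientD(1) by blast

lemma V_norm_eq:
  assumes "is_weak_gradient \<Omega> u g" shows "V_norm \<Omega> u = L2_norm \<Omega> g"
  unfolding V_norm_def
  by (intro L2_norm_cong_AE weak_gradient_unique[of u] is_weak_gradientD(2)[of u] assms
      H1_weak_gradient[OF H1I[OF assms]])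

lemma V_norm_nonneg [simp]: "V_norm \<Omega> u \<ge> 0"
  by (simp add: V_norm_def)

lemma H1_lincomb:
  assumes "u \<in> H1 \<Omega>" "v \<in> H1 \<Omega>"
  shows "(\<lambda>x. a * u x + b * v x) \<in> H1 \<Omega>"
    and "V_norm \<Omega> (\<lambda>x. a * u x + b * v x) \<le> \<bar>a\<bar> * V_norm \<Omega> u + \<bar>b\<bar> * V_norm \<Omega> v"
proof -
  note u = H1_weak_gradient[OF assms(1)] and v = H1_weak_gradient[OF assms(2)]
  note w = is_weak_gradient_lincomb[OF u v, of a b]
  show "(\<lambda>x. a * u x + b * v x) \<in> H1 \<Omega>" by (rule H1I[OF w])
  show "V_norm \<Omega> (\<lambda>x. a * u x + b * v x) \<le> \<bar>a\<bar> * V_norm \<Omega> u + \<bar>b\<bar> * V_norm \<Omega> v"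
    unfolding V_norm_eq[OF w]
    using L2_add(2)[OF L2_scaleR[OF is_weak_gradientD(2)[OF u], of a] L2_scaleR[OF is_weak_gradientD(2)[OF v], of b]]
    by (simp add: V_norm_eq[OF u] V_norm_eq[OF v] L2_norm_scaleR)
qed

lemma H1_scale:
  assumes "u \<in> H1 \<Omega>"
  shows "(\<lambda>x. c * u x) \<in> H1 \<Omega>" and "V_norm \<Omega> (\<lambda>x. c * u x) = \<bar>c\<bar> * V_norm \<Omega> u"
proof -
  note u = H1_weak_gradient[OF assms(1)]
  have w: "is_weak_gradient \<Omega> (\<lambda>x. c * u x) (\<lambda>x. c *\<^sub>R weak_gradient \<Omega> u x)"
    using is_weak_gradient_lincomb[OF u u, of c 0] by simp
  show "(\<lambda>x. c * u x) \<in> H1 \<Omega>" by (rule H1I[OF w])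
  show "V_norm \<Omega> (\<lambda>x. c * u x) = \<bar>c\<bar> * V_norm \<Omega> u"
    unfolding V_norm_eq[OF w] by (simp add: L2_norm_scaleR V_norm_eq[OF u])
qed

lemma H1_diff:
  assumes "u \<in> H1 \<Omega>" "v \<in> H1 \<Omega>"
  shows "u - v \<in> H1 \<Omega>" and "V_norm \<Omega> (u - v) \<le> V_norm \<Omega> u + V_norm \<Omega> v"
    and "V_norm \<Omega> u \<le> V_norm \<Omega> v + V_norm \<Omega> (u - v)"
proof -
  have eq: "(\<lambda>x. 1 * u x + (-1) * v x) = u - v" by (auto simp: fun_diff_def)
  show 1: "u - v \<in> H1 \<Omega>" and "V_norm \<Omega> (u - v) \<le> V_norm \<Omega> u + V_norm \<Omega> v"
    using H1_lincomb[OF assms, of 1 "-1"] unfolding eq by simp_all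
  have eq: "(\<lambda>x. 1 * v x + 1 * (u - v) x) = u" by (auto simp: fun_diff_def)
  show "V_norm \<Omega> u \<le> V_norm \<Omega> v + V_norm \<Omega> (u - v)"
    using H1_lincomb(2)[OF assms(2) 1, of 1 1] unfolding eq by simp
qed

lemma test_functions_H1: "\<phi> \<in> test_functions \<Omega> \<Longrightarrow> \<phi> \<in> H1 \<Omega>"
  by (rule H1I[OF test_function_is_weak_gradient])

lemma H10_H1: "u \<in> H10 \<Omega> \<Longrightarrow> u \<in> H1 \<Omega>"
  by (simp add: H10_def)

lemma H10I:
  assumes "u \<in> H1 \<Omega>" "\<And>n. \<phi> n \<in> test_functions \<Omega>"
    and "(\<lambda>n. L2_norm \<Omega> (\<phi> n - u)) \<longlonglongrightarrow> 0" "(\<lambda>n. V_norm \<Omega> (\<phi> n - u)) \<longlonglongrightarrow> 0"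
  shows "u \<in> H10 \<Omega>"
proof -
  have "(\<lambda>n. sqrt ((L2_norm \<Omega> (\<phi> n - u))\<^sup>2 + (V_norm \<Omega> (\<phi> n - u))\<^sup>2)) \<longlonglongrightarrow> sqrt (0\<^sup>2 + 0\<^sup>2)"
    by (intro tendsto_intros assms)
  then have "(\<lambda>n. H1_norm \<Omega> (\<phi> n - u)) \<longlonglongrightarrow> 0"
    by (simp add: H1_norm_def V_norm_def)
  then show ?thesis using assms(1,2) by (auto simp: H10_def)
qed

lemma H10E:
  assumes "u \<in> H10 \<Omega>"
  obtains \<phi> where "\<And>n. \<phi> n \<in> test_functions \<Omega>"
    "(\<lambda>n. L2_norm \<Omega> (\<phi> n - u)) \<longlonglongrightarrow> 0" "(\<lambda>n. V_norm \<Omega> (\<phi> n - u)) \<longlonglongrightarrow> 0"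
proof -
  obtain \<phi> where \<phi>: "\<And>n. \<phi> n \<in> test_functions \<Omega>" "(\<lambda>n. H1_norm \<Omega> (\<phi> n - u)) \<longlonglongrightarrow> 0"
    using assms by (auto simp: H10_def)
  have "L2_norm \<Omega> v \<le> H1_norm \<Omega> v" "V_norm \<Omega> v \<le> H1_norm \<Omega> v" for v
    by (auto simp: H1_norm_def V_norm_def)
  then have "(\<lambda>n. L2_norm \<Omega> (\<phi> n - u)) \<longlonglongrightarrow> 0" "(\<lambda>n. V_norm \<Omega> (\<phi> n - u)) \<longlonglongrightarrow> 0"
    by (auto intro!: tendsto_sandwich[OF _ _ tendsto_const \<phi>(2)] always_eventually)
  with \<phi>(1) show thesis by (rule that)
qed

lemma test_functions_H10: "\<phi> \<in> test_functions \<Omega> \<Longrightarrow> \<phi> \<in> H10 \<Omega>"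
proof (rule H10I[of \<phi> "\<lambda>_. \<phi>"])
  assume \<phi>: "\<phi> \<in> test_functions \<Omega>"
  then show "\<phi> \<in> H1 \<Omega>" by (rule test_functions_H1)
  have "\<phi> - \<phi> = (\<lambda>x. 0 * \<phi> x)" by auto
  then have "V_norm \<Omega> (\<phi> - \<phi>) = 0"
    using H1_scale(2)[OF test_functions_H1[OF \<phi>], of 0] by simp
  then show "(\<lambda>n. V_norm \<Omega> (\<phi> - \<phi>)) \<longlonglongrightarrow> 0" by simp
qed (simp_all add: L2_norm_def)

lemma H10_lincomb:
  assumes u: "u \<in> H10 \<Omega>" and v: "v \<in> H10 \<Omega>"
  shows "(\<lambda>x. a * u x + b * v x) \<in> H10 \<Omega>"
proof -
  obtain \<phi> where \<phi>: "\<And>n. \<phi> n \<in> test_functions \<Omega>"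
    "(\<lambda>n. L2_norm \<Omega> (\<phi> n - u)) \<longlonglongrightarrow> 0" "(\<lambda>n. V_norm \<Omega> (\<phi> n - u)) \<longlonglongrightarrow> 0"
    using H10E[OF u] by blast
  obtain \<psi> where \<psi>: "\<And>n. \<psi> n \<in> test_functions \<Omega>"
    "(\<lambda>n. L2_norm \<Omega> (\<psi> n - v)) \<longlonglongrightarrow> 0" "(\<lambda>n. V_norm \<Omega> (\<psi> n - v)) \<longlonglongrightarrow> 0"
    using H10E[OF v] by blast
  define \<zeta> where "\<zeta> n x = a * \<phi> n x + b * \<psi> n x" for n x
  let ?w = "\<lambda>x. a * u x + b * v x"
  note uH = H10_H1[OF u] and vH = H10_H1[OF v]
  have d: "\<zeta> n - ?w = (\<lambda>x. a * (\<phi> n - u) x + b * (\<psi> n - v) x)" for n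
    by (auto simp: \<zeta>_def fun_diff_def algebra_simps)
  have H: "\<phi> n - u \<in> H1 \<Omega>" "\<psi> n - v \<in> H1 \<Omega>" for n
    by (intro H1_diff test_functions_H1 \<phi> \<psi> uH vH)+
  have l: "(\<lambda>n. \<bar>a\<bar> * L2_norm \<Omega> (\<phi> n - u) + \<bar>b\<bar> * L2_norm \<Omega> (\<psi> n - v)) \<longlonglongrightarrow> \<bar>a\<bar> * 0 + \<bar>b\<bar> * 0"
    "(\<lambda>n. \<bar>a\<bar> * V_norm \<Omega> (\<phi> n - u) + \<bar>b\<bar> * V_norm \<Omega> (\<psi> n - v)) \<longlonglongrightarrow> \<bar>a\<bar> * 0 + \<bar>b\<bar> * 0"
    by (intro tendsto_intros \<phi> \<psi>)+
  show ?thesis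
  proof (rule H10I[of _ \<zeta>])
    show "?w \<in> H1 \<Omega>" by (rule H1_lincomb(1)[OF uH vH])
    show "\<zeta> n \<in> test_functions \<Omega>" for n
    proof (rule test_functionsI)
      show "smooth (\<zeta> n)"
        unfolding \<zeta>_def by (intro smooth_add smooth_mult smooth_const test_functionsD[OF \<phi>(1)] test_functionsD[OF \<psi>(1)])
      have "{x. \<zeta> n x \<noteq> 0} \<subseteq> {x. \<phi> n x \<noteq> 0} \<union> {x. \<psi> n x \<noteq> 0}"
        by (auto simp: \<zeta>_def)
      then have sub: "supp (\<zeta> n) \<subseteq> supp (\<phi> n) \<union> supp (\<psi> n)"
        unfolding supp_def by (metis closure_Un closure_mono)
      then show "supp (\<zeta> n) \<subseteq> \<Omega>"
        using test_functionsD(3)[OF \<phi>(1)] test_functionsD(3)[OF \<psi>(1)] by blast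
      have "compact ((supp (\<phi> n) \<union> supp (\<psi> n)) \<inter> supp (\<zeta> n))"
        by (intro compact_Int_closed compact_Un test_functionsD(2)[OF \<phi>(1)] test_functionsD(2)[OF \<psi>(1)])
          (simp add: supp_def)
      then show "compact (supp (\<zeta> n))" using sub by (simp add: inf_absorb2)
    qed
    have "L2_norm \<Omega> (\<zeta> n - ?w) \<le> \<bar>a\<bar> * L2_norm \<Omega> (\<phi> n - u) + \<bar>b\<bar> * L2_norm \<Omega> (\<psi> n - v)" for n
      unfolding d
      using L2_add(2)[OF L2_scaleR[OF H1_L2[OF H(1)], of a] L2_scaleR[OF H1_L2[OF H(2)], of b], of n n]
      by (simp only: real_scaleR_def L2_norm_scaleR[where 'b = real, unfolded real_scaleR_def])
    then show "(\<lambda>n. L2_norm \<Omega> (\<zeta> n - ?w)) \<longlonglongrightarrow> 0"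
      using l(1) by (intro tendsto_sandwich[OF _ _ tendsto_const l(1)[simplified]]) auto
    have "V_norm \<Omega> (\<zeta> n - ?w) \<le> \<bar>a\<bar> * V_norm \<Omega> (\<phi> n - u) + \<bar>b\<bar> * V_norm \<Omega> (\<psi> n - v)" for n
      unfolding d by (rule H1_lincomb(2)[OF H])
    then show "(\<lambda>n. V_norm \<Omega> (\<zeta> n - ?w)) \<longlonglongrightarrow> 0"
      by (intro tendsto_sandwich[OF _ _ tendsto_const l(2)[simplified]]) auto
  qed
qed

lemma H10_scale: "u \<in> H10 \<Omega> \<Longrightarrow> (\<lambda>x. c * u x) \<in> H10 \<Omega>"
  using H10_lincomb[of u u c 0] by simp

lemma H10_diff: "u \<in> H10 \<Omega> \<Longrightarrow> v \<in> H10 \<Omega> \<Longrightarrow> u - v \<in> H10 \<Omega>"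
  using H10_lincomb[of u v 1 "-1"] by (simp add: fun_diff_def)

text \<open>Along an approximating sequence the left side converges because it is continuous in L2,
  the right side because the energies converge. Poincare-type estimates therefore need proof for
  test functions only.\<close>

lemma H10_functional_bound:
  assumes g: "g \<in> L2 \<Omega>" and v: "v \<in> H10 \<Omega>"
    and bound: "\<And>\<phi>. \<phi> \<in> test_functions \<Omega> \<Longrightarrow> \<bar>\<integral>x. g x * \<phi> x \<partial>lebesgue_on \<Omega>\<bar> \<le> K * V_norm \<Omega> \<phi>"
  shows "\<bar>\<integral>x. g x * v x \<partial>lebesgue_on \<Omega>\<bar> \<le> K * V_norm \<Omega> v"
proof -
  obtain \<phi> where \<phi>: "\<And>n. \<phi> n \<in> test_functions \<Omega>"
    "(\<lambda>n. L2_norm \<Omega> (\<phi> n - v)) \<longlonglongrightarrow> 0" "(\<lambda>n. V_norm \<Omega> (\<phi> n - v)) \<longlonglongrightarrow> 0"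
    using H10E[OF v] by blast
  note vH = H10_H1[OF v]
  have "(\<lambda>n. \<integral>x. g x * \<phi> n x \<partial>lebesgue_on \<Omega>) \<longlonglongrightarrow> (\<integral>x. g x * v x \<partial>lebesgue_on \<Omega>)"
  proof (rule LIM_zero_cancel, rule Lim_null_comparison)
    show "(\<lambda>n. L2_norm \<Omega> g * L2_norm \<Omega> (\<phi> n - v)) \<longlonglongrightarrow> 0"
      using tendsto_mult_left[OF \<phi>(2), of "L2_norm \<Omega> g"] by simp
    have "\<bar>(\<integral>x. g x * \<phi> n x \<partial>lebesgue_on \<Omega>) - (\<integral>x. g x * v x \<partial>lebesgue_on \<Omega>)\<bar> \<le> L2_norm \<Omega> g * L2_norm \<Omega> (\<phi> n - v)" for n
    proof -
      have "(\<integral>x. g x * \<phi> n x \<partial>lebesgue_on \<Omega>) - (\<integral>x. g x * v x \<partial>lebesgue_on \<Omega>)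
          = (\<integral>x. g x * (\<phi> n - v) x \<partial>lebesgue_on \<Omega>)"
        using L2_integrable_mult[OF g test_function_L2[OF \<phi>(1)]] L2_integrable_mult[OF g H1_L2[OF vH]]
        by (simp add: right_diff_distrib)
      then show ?thesis
        using L2_Cauchy_Schwarz[OF g H1_L2[OF H1_diff(1)[OF test_functions_H1[OF \<phi>(1)] vH]], of n] by simp
    qed
    then show "\<forall>\<^sub>F n in sequentially. norm ((\<integral>x. g x * \<phi> n x \<partial>lebesgue_on \<Omega>) - (\<integral>x. g x * v x \<partial>lebesgue_on \<Omega>))
        \<le> L2_norm \<Omega> g * L2_norm \<Omega> (\<phi> n - v)"
      by simp
  qed
  then have 1: "(\<lambda>n. \<bar>\<integral>x. g x * \<phi> n x \<partial>lebesgue_on \<Omega>\<bar>) \<longlonglongrightarrow> \<bar>\<integral>x. g x * v x \<partial>lebesgue_on \<Omega>\<bar>"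
    by (rule tendsto_rabs)
  have "(\<lambda>n. V_norm \<Omega> (\<phi> n)) \<longlonglongrightarrow> V_norm \<Omega> v"
  proof (rule LIM_zero_cancel, rule Lim_null_comparison[OF _ \<phi>(3)])
    have "\<bar>V_norm \<Omega> (\<phi> n) - V_norm \<Omega> v\<bar> \<le> V_norm \<Omega> (\<phi> n - v)" for n
    proof -
      have "v - \<phi> n = (\<lambda>x. (-1) * (\<phi> n - v) x)" by auto
      then have "V_norm \<Omega> (v - \<phi> n) = V_norm \<Omega> (\<phi> n - v)"
        using H1_scale(2)[OF H1_diff(1)[OF test_functions_H1[OF \<phi>(1)] vH], of "-1"] by simp
      then show ?thesis
        using H1_diff(3)[OF test_functions_H1[OF \<phi>(1)[of n]] vH] H1_diff(3)[OF vH test_functions_H1[OF \<phi>(1)[of n]]]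
        by simp
    qed
    then show "\<forall>\<^sub>F n in sequentially. norm (V_norm \<Omega> (\<phi> n) - V_norm \<Omega> v) \<le> V_norm \<Omega> (\<phi> n - v)"
      by simp
  qed
  then have 2: "(\<lambda>n. K * V_norm \<Omega> (\<phi> n)) \<longlonglongrightarrow> K * V_norm \<Omega> v"
    by (rule tendsto_mult_left)
  show ?thesis
    by (rule LIMSEQ_le[OF 1 2]) (use bound[OF \<phi>(1)] in blast)
qed

end

section \<open>Translation estimates, and the inequalities of Poincare and Friedrichs drawn from
  them\<close>

section \<open>Poincare-type inequalities\<close>

text \<open>A translation by \<open>z\<close> is split into \<open>N\<close> translations by
  \<open>z / N\<close>. Cauchy-Schwarz for the telescoping sum bounds the left side by the
  integrated square of a difference quotient with step \<open>1 / N\<close>, and \<open>N\<close>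
  tends to infinity.\<close>

lemma integral_translation_difference_le:
  fixes v :: "real^2 \<Rightarrow> real"
  assumes "v \<in> test_functions S"
  shows "integrable lborel (\<lambda>x. (v (x + z) - v x)\<^sup>2)"
    and "(\<integral>x. (v (x + z) - v x)\<^sup>2 \<partial>lborel) \<le> (norm z)\<^sup>2 * (\<integral>x. (norm (grad v x))\<^sup>2 \<partial>lborel)"
proof -
  note v = test_functionsD[OF assms]
  note c = smooth_continuous[OF v(1)]
  have c' [continuous_intros]: "continuous_on UNIV (\<lambda>x. v (f x))" if "continuous_on UNIV f" for f :: "real^2 \<Rightarrow> real^2"
    by (rule continuous_on_compose2[OF c that]) simp
  obtain R where R: "\<And>x. x \<in> supp v \<Longrightarrow> norm x \<le> R"
    using compact_imp_bounded[OF v(2)] by (auto simp: bounded_iff)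
  then have R0: "v x = 0" if "norm x > R" for x
    using that eq_0_outside_supp[of x v] by force
  obtain B where B: "B-lipschitz_on UNIV v"
    using test_function_Lipschitz[OF assms] .
  have sup: "v (x + y) - v x = 0" if "x \<notin> cball 0 (R + norm y)" for x y
  proof -
    have "norm x \<le> norm (x + y) + norm y"
      by (metis add_diff_cancel_right' norm_triangle_ineq4)
    then show ?thesis using that R0[of x] R0[of "x + y"] norm_ge_zero[of y] by simp
  qed
  have int: "integrable lborel (\<lambda>x. (v (x + y) - v x)\<^sup>2)" for y
    by (rule integrable_lborel_continuous_compact[OF _ compact_cball[of 0 "R + norm y"]])
      (auto intro!: continuous_intros simp: sup)
  then show "integrable lborel (\<lambda>x. (v (x + z) - v x)\<^sup>2)" .
  have meas: "(\<lambda>x. (v (x + y) - v x)\<^sup>2) \<in> borel_measurable borel" for y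
    by (intro borel_measurable_continuous_onI) (auto intro!: continuous_intros)
  define s where "s n x = ((v (x + inverse (real (Suc n)) *\<^sub>R z) - v x) * real (Suc n))\<^sup>2" for n x
  have le: "(\<integral>x. (v (x + z) - v x)\<^sup>2 \<partial>lborel) \<le> (\<integral>x. s n x \<partial>lborel)" for n
  proof -
    define N where "N = Suc n"
    define c where "c = inverse (real N)"
    define a where "a j x = v (x + (real (Suc j) * c) *\<^sub>R z) - v (x + (real j * c) *\<^sub>R z)" for j x
    have a_eq: "(a j x)\<^sup>2 = (\<lambda>y. (v (y + c *\<^sub>R z) - v y)\<^sup>2) (x + (real j * c) *\<^sub>R z)" for j x
      by (simp add: a_def algebra_simps)
    have ia: "integrable lborel (\<lambda>x. (a j x)\<^sup>2)" "(\<integral>x. (a j x)\<^sup>2 \<partial>lborel) = (\<integral>x. (v (x + c *\<^sub>R z) - v x)\<^sup>2 \<partial>lborel)" for j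
      unfolding a_eq using lborel_translation[OF meas] int by (simp_all only:)
    have "(v (x + z) - v x)\<^sup>2 \<le> (\<Sum>j<N. (a j x)\<^sup>2) * real N" for x
    proof -
      have "(\<Sum>j<N. a j x) = v (x + (real N * c) *\<^sub>R z) - v (x + (real 0 * c) *\<^sub>R z)"
        unfolding a_def by (rule sum_lessThan_telescope)
      also have "real N * c = 1" by (simp add: c_def N_def field_simps)
      finally have "v (x + z) - v x = (\<Sum>j<N. a j x)" by simp
      then show ?thesis
        using sum_squared_le_sum_of_squares[of "\<lambda>j. a j x" "{..<N}"] by simp
    qed
    then have "(\<integral>x. (v (x + z) - v x)\<^sup>2 \<partial>lborel) \<le> (\<integral>x. (\<Sum>j<N. (a j x)\<^sup>2) * real N \<partial>lborel)"
      by (intro integral_mono int) (auto intro!: ia)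
    \<comment> \<open>One factor \<open>N\<close> counts the summands, equal by translation
      invariance; the other comes from Cauchy-Schwarz. Together they produce the square of a
      difference quotient.\<close>
    also have "\<dots> = real N * (real N * (\<integral>x. (v (x + c *\<^sub>R z) - v x)\<^sup>2 \<partial>lborel))"
      using ia by (simp add: Bochner_Integration.integral_sum)
    also have "\<dots> = (\<integral>x. s n x \<partial>lborel)"
      by (simp add: s_def c_def N_def power_mult_distrib power2_eq_square[of "1 + real n"] mult_ac del: of_nat_Suc)
        (simp add: power2_eq_square)
    finally show ?thesis .
  qed
  have lim: "(\<lambda>n. \<integral>x. s n x \<partial>lborel) \<longlonglongrightarrow> (\<integral>x. (grad v x \<bullet> z)\<^sup>2 \<partial>lborel)"
  proof (rule integral_dominated_convergence)
    show "integrable lborel (\<lambda>x. (B * norm z)\<^sup>2 * indicator (cball 0 (R + norm z)) (x :: real^2) :: real)"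
      using emeasure_bounded_finite[OF bounded_cball, of "0 :: real^2" "R + norm z"]
      by (intro integrable_mult_right integrable_real_indicator) auto
    show "s n \<in> borel_measurable lborel" for n
      unfolding s_def using borel_measurable_continuous_onI[OF c] by measurable
    show "(\<lambda>x. (grad v x \<bullet> z)\<^sup>2) \<in> borel_measurable lborel"
      using borel_measurable_continuous_onI[OF smooth_grad_continuous[OF v(1)]] by measurable
    show "AE x in lborel. (\<lambda>n. s n x) \<longlonglongrightarrow> (grad v x \<bullet> z)\<^sup>2"
      unfolding s_def by (intro AE_I2 tendsto_power difference_quotient_LIMSEQ smooth_has_grad v)
    show "AE x in lborel. norm (s n x) \<le> (B * norm z)\<^sup>2 * indicator (cball 0 (R + norm z)) x" for n
    proof (rule AE_I2)
      fix x
      let ?c = "inverse (real (Suc n))"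
      show "norm (s n x) \<le> (B * norm z)\<^sup>2 * indicator (cball 0 (R + norm z)) x"
      proof (cases "x \<in> cball 0 (R + norm z)")
        case True
        have "\<bar>v (x + ?c *\<^sub>R z) - v x\<bar> \<le> B * (?c * norm z)"
          using lipschitz_onD[OF B, of "x + ?c *\<^sub>R z" x] by (simp add: dist_norm)
        then have "\<bar>v (x + ?c *\<^sub>R z) - v x\<bar> * real (Suc n) \<le> B * (?c * norm z) * real (Suc n)"
          by (rule mult_right_mono) simp
        also have "\<dots> = B * norm z" by (simp add: field_simps del: of_nat_Suc)
        finally have "\<bar>(v (x + ?c *\<^sub>R z) - v x) * real (Suc n)\<bar> \<le> B * norm z"
          by (simp add: abs_mult)
        then show ?thesis
          using True power_mono[of "\<bar>(v (x + ?c *\<^sub>R z) - v x) * real (Suc n)\<bar>" "B * norm z" 2]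
          by (simp add: s_def del: of_nat_Suc)
      next
        case False
        have "norm (?c *\<^sub>R z) \<le> norm z" by (simp add: field_simps mult_left_le)
        then have "v (x + ?c *\<^sub>R z) - v x = 0" using False by (intro sup) simp
        then show ?thesis using False by (simp add: s_def)
      qed
    qed
  qed
  have "(\<integral>x. (v (x + z) - v x)\<^sup>2 \<partial>lborel) \<le> (\<integral>x. (grad v x \<bullet> z)\<^sup>2 \<partial>lborel)"
    by (rule LIMSEQ_le_const[OF lim]) (use le in auto)
  also have "\<dots> \<le> (\<integral>x. (norm z)\<^sup>2 * (norm (grad v x))\<^sup>2 \<partial>lborel)"
  proof (rule integral_mono)
    show "integrable lborel (\<lambda>x. (grad v x \<bullet> z)\<^sup>2)" "integrable lborel (\<lambda>x. (norm z)\<^sup>2 * (norm (grad v x))\<^sup>2)"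
      by (rule integrable_lborel_continuous_compact[OF _ v(2)];
          auto intro!: continuous_intros smooth_grad_continuous v(1) simp: grad_eq_0_outside_supp[OF v(1)])+
    show "(grad v x \<bullet> z)\<^sup>2 \<le> (norm z)\<^sup>2 * (norm (grad v x))\<^sup>2" for x
      using power_mono[OF Cauchy_Schwarz_ineq2[of "grad v x" z], of 2] by (simp add: power_mult_distrib mult.commute)
  qed
  finally show "(\<integral>x. (v (x + z) - v x)\<^sup>2 \<partial>lborel) \<le> (norm z)\<^sup>2 * (\<integral>x. (norm (grad v x))\<^sup>2 \<partial>lborel)"
    by simp
qed

lemma nn_integral_lborel_translation:
  fixes f :: "'a::euclidean_space \<Rightarrow> ennreal"
  assumes [measurable]: "f \<in> borel_measurable borel"
  shows "(\<integral>\<^sup>+x. f x \<partial>lborel) = (\<integral>\<^sup>+z. f (x + z) \<partial>lborel)"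
proof -
  have d: "lborel = distr lborel borel ((+) x)" by (simp add: lborel_distr_plus)
  show ?thesis by (subst d, subst nn_integral_distr) auto
qed

text \<open>Subtracting from \<open>v\<close> its mean over the ball leaves the pairing unchanged.
  Writing \<open>v x\<close> minus this mean as an average of \<open>v x - v y\<close> and
  substituting \<open>y = x + z\<close> with \<open>norm z \<le> 2 * R\<close> reduces the claim to
  the translation estimate. The constant collects \<open>sqrt m\<close> from Cauchy-Schwarz,
  \<open>2 * R\<close> from the length of \<open>z\<close> and the area \<open>4 * m\<close> of the
  ball of all \<open>z\<close>, divided by \<open>m\<close>.\<close>

lemma mean_zero_functional_bound:
  fixes g v :: "real^2 \<Rightarrow> real"
  assumes v': "v \<in> test_functions S" and R: "R > 0"
    and g: "continuous_on UNIV g" "\<And>x. \<bar>g x\<bar> \<le> 1" "\<And>x. x \<notin> cball x0 R \<Longrightarrow> g x = 0"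
    and mean: "(\<integral>x. g x \<partial>lborel) = 0"
  shows "\<bar>\<integral>x. g x * v x \<partial>lborel\<bar> \<le> 16 * R\<^sup>2 * sqrt (\<integral>x. (norm (grad v x))\<^sup>2 \<partial>lborel)"
proof -
  note v = test_functionsD[OF v']
  note c = smooth_continuous[OF v(1)]
  define B where "B = cball x0 R"
  define m where "m = measure lborel B"
  define G where "G = sqrt (\<integral>x. (norm (grad v x))\<^sup>2 \<partial>lborel)"
  have [measurable]: "v \<in> borel_measurable borel" "g \<in> borel_measurable borel"
    using borel_measurable_continuous_onI c g(1) by blast+
  define C :: "(real^2) set" where "C = cball 0 (2 * R)"
  have [measurable]: "B \<in> sets borel" "C \<in> sets borel" by (simp_all add: B_def C_def)
  have m: "m = pi * R\<^sup>2"
    using R by (simp add: m_def B_def content_cball unit_ball_vol_2)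
  have emB: "emeasure lborel B = ennreal m"
    unfolding m_def B_def using emeasure_bounded_finite[OF bounded_cball, of x0 R]
    by (intro emeasure_eq_ennreal_measure) auto
  have "m > 0" using R by (simp add: m)
  have G: "G \<ge> 0" by (simp add: G_def)
  have iv: "integrable lborel (\<lambda>y. indicator B y * v y)"
    using borel_integrable_compact[of B v] continuous_on_subset[OF c] by (simp add: B_def)
  have sqB: "(indicator B x)\<^sup>2 = (indicator B x :: real)" for x
    by (simp split: split_indicator)
  have i1: "integrable lborel (indicator B :: real^2 \<Rightarrow> real)"
    using emB by (intro integrable_real_indicator) auto
  have ig: "integrable lborel g" "integrable lborel (\<lambda>x. g x * v x)"
    by (rule integrable_lborel_continuous_compact[of _ "cball x0 R"]; auto intro!: continuous_intros c g)+
  define b where "b = (\<integral>y. indicator B y * v y \<partial>lborel)"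
  \<comment> \<open>The mean of \<open>v\<close> over the ball is \<open>b / m\<close>; everything
    is multiplied by \<open>m\<close> to avoid the division.\<close>
  have "m * (\<integral>x. g x * v x \<partial>lborel) = (\<integral>x. g x * (m * v x - b) \<partial>lborel)"
    using ig mean by (simp add: right_diff_distrib mult.left_commute)
  also have "norm \<dots> \<le> (\<integral>x. norm (g x * (m * v x - b)) \<partial>lborel)"
    by (rule integral_norm_bound)
  finally have 1: "m * \<bar>\<integral>x. g x * v x \<partial>lborel\<bar> \<le> (\<integral>x. norm (g x * (m * v x - b)) \<partial>lborel)"
    using \<open>m > 0\<close> by (simp add: abs_mult)
  have pw: "ennreal (norm (g x * (m * v x - b))) \<le> (\<integral>\<^sup>+y. indicator B x * (indicator B y * ennreal \<bar>v y - v x\<bar>) \<partial>lborel)" for x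
  proof (cases "x \<in> B")
    case True
    have "m * v x - b = (\<integral>y. indicator B y * v x - indicator B y * v y \<partial>lborel)"
      using iv i1 by (simp add: b_def m_def)
    also have "\<dots> = (\<integral>y. indicator B y * (v x - v y) \<partial>lborel)"
      by (simp add: right_diff_distrib)
    finally have "norm (g x * (m * v x - b)) \<le> norm (\<integral>y. indicator B y * (v x - v y) \<partial>lborel)"
      using g(2)[of x] by (simp add: abs_mult mult_left_le_one_le)
    also have "\<dots> \<le> (\<integral>y. norm (indicator B y * (v x - v y)) \<partial>lborel)"
      by (rule integral_norm_bound)
    finally have "ennreal (norm (g x * (m * v x - b))) \<le> ennreal (\<integral>y. norm (indicator B y * (v x - v y)) \<partial>lborel)"
      by (rule ennreal_leI)
    also have "\<dots> = (\<integral>\<^sup>+y. ennreal (norm (indicator B y * (v x - v y))) \<partial>lborel)"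
    proof (rule nn_integral_eq_integral[symmetric])
      have "integrable lborel (\<lambda>y. indicator B y * (v x - v y))"
        using iv i1 by (simp add: right_diff_distrib)
      then show "integrable lborel (\<lambda>y. norm (indicator B y * (v x - v y)))" by (rule integrable_norm)
    qed simp
    also have "\<dots> = (\<integral>\<^sup>+y. indicator B x * (indicator B y * ennreal \<bar>v y - v x\<bar>) \<partial>lborel)"
      using True by (intro nn_integral_cong) (auto simp: abs_minus_commute split: split_indicator)
    finally show ?thesis .
  next
    case False
    then show ?thesis using g(3) by (simp add: B_def)
  qed
  have inner: "(\<integral>\<^sup>+x. indicator B x * ennreal \<bar>v (x + z) - v x\<bar> \<partial>lborel) \<le> ennreal (sqrt m * (2 * R * G))"
    if z: "norm z \<le> 2 * R" for z
  proof -
    note t = integral_translation_difference_le[OF v', of z]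
    have i: "integrable lborel (\<lambda>x. indicator B x * \<bar>v (x + z) - v x\<bar>)"
      by (rule integrable_mult_of_squares) (use t(1) i1 in \<open>auto simp: sqB\<close>)
    have "(\<integral>\<^sup>+x. indicator B x * ennreal \<bar>v (x + z) - v x\<bar> \<partial>lborel)
        = (\<integral>\<^sup>+x. ennreal (indicator B x * \<bar>v (x + z) - v x\<bar>) \<partial>lborel)"
      by (intro nn_integral_cong) (auto split: split_indicator)
    also have "\<dots> = ennreal (\<integral>x. indicator B x * \<bar>v (x + z) - v x\<bar> \<partial>lborel)"
      by (rule nn_integral_eq_integral[OF i]) simp
    also have "\<dots> \<le> ennreal (sqrt m * (2 * R * G))"
    proof (rule ennreal_leI)
      have "\<bar>\<integral>x. indicator B x * \<bar>v (x + z) - v x\<bar> \<partial>lborel\<bar>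
          \<le> sqrt (\<integral>x. (indicator B x)\<^sup>2 \<partial>lborel) * sqrt (\<integral>x. \<bar>v (x + z) - v x\<bar>\<^sup>2 \<partial>lborel)"
        by (rule Cauchy_Schwarz_integral) (use t(1) i1 in \<open>auto simp: sqB\<close>)
      also have "(\<integral>x. (indicator B x)\<^sup>2 \<partial>lborel) = m"
        using i1 by (simp add: sqB m_def)
      also have "sqrt (\<integral>x. \<bar>v (x + z) - v x\<bar>\<^sup>2 \<partial>lborel) \<le> norm z * G"
        using real_sqrt_le_mono[OF t(2)] by (simp add: real_sqrt_mult G_def)
      also have "norm z * G \<le> 2 * R * G" using z G by (intro mult_right_mono)
      finally show "(\<integral>x. indicator B x * \<bar>v (x + z) - v x\<bar> \<partial>lborel) \<le> sqrt m * (2 * R * G)"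
        using \<open>m > 0\<close> by (simp add: mult_left_mono)
    qed
    finally show ?thesis .
  qed
  have "ennreal (\<integral>x. norm (g x * (m * v x - b)) \<partial>lborel) = (\<integral>\<^sup>+x. ennreal (norm (g x * (m * v x - b))) \<partial>lborel)"
    using ig by (intro nn_integral_eq_integral[symmetric] integrable_norm) (simp_all add: right_diff_distrib mult.left_commute)
  also have "\<dots> \<le> (\<integral>\<^sup>+x. \<integral>\<^sup>+y. indicator B x * (indicator B y * ennreal \<bar>v y - v x\<bar>) \<partial>lborel \<partial>lborel)"
    by (intro nn_integral_mono pw)
  also have "\<dots> = (\<integral>\<^sup>+x. \<integral>\<^sup>+z. indicator B x * (indicator B (x + z) * ennreal \<bar>v (x + z) - v x\<bar>) \<partial>lborel \<partial>lborel)"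
    by (intro nn_integral_cong nn_integral_lborel_translation) measurable
  also have "\<dots> \<le> (\<integral>\<^sup>+x. \<integral>\<^sup>+z. indicator C z * (indicator B x * ennreal \<bar>v (x + z) - v x\<bar>) \<partial>lborel \<partial>lborel)"
  proof (intro nn_integral_mono)
    fix x z :: "real^2"
    have "norm z \<le> 2 * R" if "x \<in> B" "x + z \<in> B"
    proof -
      have "norm z = dist (x + z) x" by (simp add: dist_norm)
      also have "\<dots> \<le> dist (x + z) x0 + dist x x0" by (rule dist_triangle2)
      also have "\<dots> \<le> 2 * R" using that by (simp add: B_def dist_commute)
      finally show ?thesis .
    qed
    then show "indicator B x * (indicator B (x + z) * ennreal \<bar>v (x + z) - v x\<bar>)
        \<le> indicator C z * (indicator B x * ennreal \<bar>v (x + z) - v x\<bar>)"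
      by (auto simp: C_def split: split_indicator)
  qed
  \<comment> \<open>Tonelli: with \<open>z\<close> outside, the inner integral is a translation
    difference over the ball.\<close>
  also have "\<dots> = (\<integral>\<^sup>+z. \<integral>\<^sup>+x. indicator C z * (indicator B x * ennreal \<bar>v (x + z) - v x\<bar>) \<partial>lborel \<partial>lborel)"
    by (rule lborel_pair.Fubini') measurable
  also have "\<dots> = (\<integral>\<^sup>+z. indicator C z * (\<integral>\<^sup>+x. indicator B x * ennreal \<bar>v (x + z) - v x\<bar> \<partial>lborel) \<partial>lborel)"
    by (intro nn_integral_cong nn_integral_cmult) measurable
  also have "\<dots> \<le> (\<integral>\<^sup>+z. ennreal (sqrt m * (2 * R * G)) * indicator C z \<partial>lborel)"
    using inner by (intro nn_integral_mono) (auto simp: C_def split: split_indicator)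
  also have "\<dots> = ennreal (sqrt m * (2 * R * G)) * emeasure lborel C"
    by (rule nn_integral_cmult_indicator) simp
  also have "emeasure lborel C = ennreal (4 * m)"
    using R by (simp add: C_def emeasure_cball unit_ball_vol_2 m power_mult_distrib)
  also have "ennreal (sqrt m * (2 * R * G)) * ennreal (4 * m) = ennreal (sqrt m * (2 * R * G) * (4 * m))"
    by (rule ennreal_mult[symmetric]) (use R G \<open>m > 0\<close> in auto)
  finally have "(\<integral>x. norm (g x * (m * v x - b)) \<partial>lborel) \<le> sqrt m * (2 * R * G) * (4 * m)"
    using R G \<open>m > 0\<close> by (subst (asm) ennreal_le_iff) auto
  with 1 have "m * \<bar>\<integral>x. g x * v x \<partial>lborel\<bar> \<le> m * (8 * R * sqrt m * G)"
    by (simp add: algebra_simps)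
  then have "\<bar>\<integral>x. g x * v x \<partial>lborel\<bar> \<le> 8 * R * sqrt m * G"
    using \<open>m > 0\<close> by simp
  also have "\<dots> \<le> 8 * R * (2 * R) * G"
  proof (intro mult_right_mono mult_left_mono)
    \<comment> \<open>The crude bound \<open>pi < 4\<close> turns \<open>8 * R * sqrt m\<close> into
      \<open>16 * R\<^sup>2\<close>.\<close>
    have "pi * R\<^sup>2 \<le> (2 * R)\<^sup>2"
      using pi_less_4 by (simp add: power_mult_distrib mult_right_mono)
    then show "sqrt m \<le> 2 * R"
      using R by (simp add: m real_le_lsqrt)
  qed (use R G in auto)
  finally show ?thesis by (simp add: G_def power2_eq_square)
qed

context bounded_open
begin

lemma integral_\<Omega>_lborel:
  assumes "f \<in> borel_measurable borel" "\<And>x. x \<notin> \<Omega> \<Longrightarrow> f x = (0::real)"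
  shows "(\<integral>x. f x \<partial>lebesgue_on \<Omega>) = (\<integral>x. f x \<partial>lborel)"
proof -
  have "(\<integral>x. f x \<partial>lebesgue_on \<Omega>) = (\<integral>x. f x \<partial>lebesgue)"
    by (rule integral_\<Omega>_eq) (rule assms)
  also have "\<dots> = (\<integral>x. f x \<partial>lborel)"
    by (rule integral_completion) (use assms in simp)
  finally show ?thesis .
qed

lemma test_function_outside: 
  assumes "v \<in> test_functions \<Omega>" "x \<notin> \<Omega>" shows "v x = 0" "grad v x = 0"
  using assms test_functionsD[OF assms(1)] eq_0_outside_supp grad_eq_0_outside_supp by blast+

lemma V_norm_test:
  assumes "v \<in> test_functions \<Omega>"
  shows "V_norm \<Omega> v = sqrt (\<integral>x. (norm (grad v x))\<^sup>2 \<partial>lborel)"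
proof -
  have "continuous_on UNIV (\<lambda>x. (norm (grad v x))\<^sup>2)"
    by (intro continuous_intros smooth_grad_continuous test_functionsD(1)[OF assms])
  then show ?thesis
    unfolding V_norm_eq[OF test_function_is_weak_gradient[OF assms]] L2_norm_def
    by (subst integral_\<Omega>_lborel) (auto simp: borel_measurable_continuous_onI test_function_outside[OF assms])
qed

lemma L2_norm_test:
  assumes "v \<in> test_functions \<Omega>"
  shows "L2_norm \<Omega> v = sqrt (\<integral>x. (v x)\<^sup>2 \<partial>lborel)"
proof -
  have "continuous_on UNIV (\<lambda>x. (v x)\<^sup>2)"
    by (intro continuous_intros smooth_continuous test_functionsD(1)[OF assms])
  then show ?thesis
    unfolding L2_norm_def
    by (subst integral_\<Omega>_lborel) (auto simp: borel_measurable_continuous_onI test_function_outside[OF assms])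
qed

text \<open>A translation by \<open>2 * D + 1\<close>, more than the diameter of
  \<open>\<Omega>\<close>, separates \<open>v\<close> from its translate. The squared norm of their
  difference is then twice that of \<open>v\<close>, and the translation estimate bounds it by the
  energy.\<close>

lemma Friedrichs_inequality:
  obtains K where "K \<ge> 0" "\<And>v. v \<in> test_functions \<Omega> \<Longrightarrow> L2_norm \<Omega> v \<le> K * V_norm \<Omega> v"
proof -
  obtain D where D: "D > 0" "\<And>x. x \<in> \<Omega> \<Longrightarrow> norm x \<le> D"
    using bounded_\<Omega> unfolding bounded_pos by blast
  define z :: "real^2" where "z = (2 * D + 1) *\<^sub>R axis 1 1"
  have z: "norm z = 2 * D + 1" using D by (simp add: z_def norm_axis_1)
  have "L2_norm \<Omega> v \<le> (2 * D + 1) * V_norm \<Omega> v" if v: "v \<in> test_functions \<Omega>" for v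
  proof -
    note v' = test_functionsD[OF v]
    have i: "integrable lborel (\<lambda>x. (v x)\<^sup>2)"
      by (rule integrable_lborel_continuous_compact[OF _ v'(2)])
        (auto intro!: continuous_on_power smooth_continuous[OF v'(1)] simp: eq_0_outside_supp)
    have m: "(\<lambda>x. (v x)\<^sup>2) \<in> borel_measurable borel"
      using i by auto
    have "v (x + z) = 0 \<or> v x = 0" for x
    proof (rule ccontr)
      assume "\<not> ?thesis"
      then have "x + z \<in> \<Omega>" "x \<in> \<Omega>" using test_function_outside[OF v] by blast+
      then have "norm (x + z) \<le> D" "norm x \<le> D" using D by auto
      moreover have "norm z \<le> norm (x + z) + norm x"
        by (metis add_diff_cancel_left' norm_triangle_ineq4)
      ultimately show False using z by simp
    qed
    then have "(v (x + z) - v x)\<^sup>2 = (v (x + z))\<^sup>2 + (v x)\<^sup>2" for x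
      using mult_eq_0_iff[of "v (x + z)" "v x"] by (simp add: power2_diff)
    then have "(\<integral>x. (v (x + z) - v x)\<^sup>2 \<partial>lborel) = 2 * (\<integral>x. (v x)\<^sup>2 \<partial>lborel)"
      using i lborel_translation[OF m, of z] by simp
    then have "(\<integral>x. (v x)\<^sup>2 \<partial>lborel) \<le> (norm z)\<^sup>2 * (\<integral>x. (norm (grad v x))\<^sup>2 \<partial>lborel)"
      using integral_translation_difference_le(2)[OF v, of z]
        Bochner_Integration.integral_nonneg[of lborel "\<lambda>x. (v x)\<^sup>2", OF zero_le_power2] by linarith
    then have "sqrt (\<integral>x. (v x)\<^sup>2 \<partial>lborel) \<le> norm z * sqrt (\<integral>x. (norm (grad v x))\<^sup>2 \<partial>lborel)"
      using real_sqrt_le_mono by (fastforce simp: real_sqrt_mult)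
    then show ?thesis by (simp add: L2_norm_test[OF v] V_norm_test[OF v] z)
  qed
  then show thesis using D(1) by (intro that[of "2 * D + 1"]) auto
qed

text \<open>Makes L2 functions elements of \<open>Hm1\<close>. The quantitative estimates rest
  instead on \<open>mean_zero_H10_bound\<close> and on explicit test functions.\<close>

lemma L2_functional_bounded:
  assumes g: "g \<in> L2 \<Omega>"
  obtains K where "K \<ge> 0" "\<And>v. v \<in> H10 \<Omega> \<Longrightarrow> \<bar>\<integral>x. g x * v x \<partial>lebesgue_on \<Omega>\<bar> \<le> K * V_norm \<Omega> v"
proof -
  obtain K where K: "K \<ge> 0" "\<And>v. v \<in> test_functions \<Omega> \<Longrightarrow> L2_norm \<Omega> v \<le> K * V_norm \<Omega> v"
    using Friedrichs_inequality by blast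
  have "\<bar>\<integral>x. g x * v x \<partial>lebesgue_on \<Omega>\<bar> \<le> L2_norm \<Omega> g * K * V_norm \<Omega> v" if "v \<in> H10 \<Omega>" for v
  proof (rule H10_functional_bound[OF g that])
    fix \<phi> :: "real^2 \<Rightarrow> real" assume \<phi>: "\<phi> \<in> test_functions \<Omega>"
    have "\<bar>\<integral>x. g x * \<phi> x \<partial>lebesgue_on \<Omega>\<bar> \<le> L2_norm \<Omega> g * L2_norm \<Omega> \<phi>"
      by (rule L2_Cauchy_Schwarz[OF g test_function_L2[OF \<phi>]])
    also have "\<dots> \<le> L2_norm \<Omega> g * (K * V_norm \<Omega> \<phi>)"
      by (intro mult_left_mono K \<phi>) simp
    finally show "\<bar>\<integral>x. g x * \<phi> x \<partial>lebesgue_on \<Omega>\<bar> \<le> L2_norm \<Omega> g * K * V_norm \<Omega> \<phi>" by simp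
  qed
  then show thesis using K(1) by (intro that[of "L2_norm \<Omega> g * K"]) auto
qed

lemma mean_zero_H10_bound:
  assumes R: "R > 0" "cball x0 R \<subseteq> \<Omega>"
    and g: "continuous_on UNIV g" "\<And>x. \<bar>g x\<bar> \<le> 1" "\<And>x. x \<notin> cball x0 R \<Longrightarrow> g x = 0"
    and mean: "(\<integral>x. g x \<partial>lebesgue_on \<Omega>) = 0" and v: "v \<in> H10 \<Omega>"
  shows "\<bar>\<integral>x. g x * v x \<partial>lebesgue_on \<Omega>\<bar> \<le> 16 * R\<^sup>2 * V_norm \<Omega> v"
proof (rule H10_functional_bound[OF continuous_L2[OF g(1)] v])
  fix \<phi> :: "real^2 \<Rightarrow> real" assume \<phi>: "\<phi> \<in> test_functions \<Omega>"
  have g0: "g x = 0" if "x \<notin> \<Omega>" for x using g(3) R(2) that by blast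
  have "(\<integral>x. g x \<partial>lborel) = 0"
    using mean integral_\<Omega>_lborel[of g] g0 borel_measurable_continuous_onI[OF g(1)] by simp
  moreover have "(\<integral>x. g x * \<phi> x \<partial>lebesgue_on \<Omega>) = (\<integral>x. g x * \<phi> x \<partial>lborel)"
    by (rule integral_\<Omega>_lborel)
      (auto simp: g0 intro!: borel_measurable_times borel_measurable_continuous_onI[OF g(1)]
        borel_measurable_continuous_onI[OF smooth_continuous[OF test_functionsD(1)[OF \<phi>]]])
  ultimately show "\<bar>\<integral>x. g x * \<phi> x \<partial>lebesgue_on \<Omega>\<bar> \<le> 16 * R\<^sup>2 * V_norm \<Omega> \<phi>"
    using mean_zero_functional_bound[OF \<phi> R(1) g] by (simp add: V_norm_test[OF \<phi>])
qed

end

section \<open>Convolution with smooth kernels, and membership of compactly supported piecewise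
  affine functions in H10\<close>

section \<open>Mollification\<close>

lemma mollifier_exists:
  assumes "\<epsilon> > 0"
  obtains \<kappa> :: "real^2 \<Rightarrow> real" where "smooth \<kappa>" "\<And>z. \<kappa> z \<ge> 0" "\<And>z. norm z \<ge> \<epsilon> \<Longrightarrow> \<kappa> z = 0"
    "integrable lborel \<kappa>" "(\<integral>z. \<kappa> z \<partial>lborel) = 1"
proof -
  define \<rho> :: "real^2 \<Rightarrow> real" where "\<rho> z = flat 0 (\<epsilon>\<^sup>2 - z \<bullet> z)" for z
  have smooth: "smooth \<rho>"
    unfolding \<rho>_def by (intro smooth_compose[OF smooth_flat] smooth_diff smooth_const smooth_inner_self)
  have nonneg: "\<rho> z \<ge> 0" for z by (simp add: \<rho>_def flat0_nonneg)
  have zero: "\<rho> z = 0" if "norm z \<ge> \<epsilon>" for z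
  proof -
    have "\<epsilon>\<^sup>2 \<le> z \<bullet> z"
      using that assms power_mono[of \<epsilon> "norm z" 2] unfolding dot_square_norm by simp
    then show ?thesis by (simp add: \<rho>_def flat_def)
  qed
  have pos: "\<rho> z > 0" if "norm z < \<epsilon>" for z
    using that power_strict_mono[of "norm z" \<epsilon> 2] by (simp add: \<rho>_def flat0_pos_iff dot_square_norm)
  have int: "integrable lborel \<rho>"
    by (rule integrable_lborel_continuous_compact[OF smooth_continuous[OF smooth] compact_cball[of 0 \<epsilon>]])
      (use zero in auto)
  define I where "I = (\<integral>z. \<rho> z \<partial>lborel)"
  have "I \<noteq> 0"
  proof
    assume "I = 0"
    then have "AE z in lborel. \<rho> z = 0"
      unfolding I_def using integral_nonneg_eq_0_iff_AE[OF int] nonneg by simp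
    then have "AE z in lborel. z \<notin> ball (0::real^2) \<epsilon>"
      by eventually_elim (use pos in force)
    then have "ball (0::real^2) \<epsilon> \<in> null_sets lborel"
      by (simp add: AE_iff_null_sets)
    then have "negligible (ball (0::real^2) \<epsilon>)"
      by (auto simp: negligible_iff_null_sets intro: null_sets_completionI)
    then show False using assms open_not_negligible[of "ball (0::real^2) \<epsilon>"] by simp
  qed
  then have "I > 0" using nonneg by (simp add: I_def less_le)
  show thesis
  proof
    show "smooth (\<lambda>z. inverse I * \<rho> z)" by (intro smooth_mult smooth_const smooth)
    show "inverse I * \<rho> z \<ge> 0" for z using \<open>I > 0\<close> nonneg by simp
    show "inverse I * \<rho> z = 0" if "norm z \<ge> \<epsilon>" for z using zero[OF that] by simp
    show "integrable lborel (\<lambda>z. inverse I * \<rho> z)" using int by simp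
    show "(\<integral>z. inverse I * \<rho> z \<partial>lborel) = 1" using \<open>I \<noteq> 0\<close> by (simp add: I_def)
  qed
qed

text \<open>All derivatives fall on the kernel; integrating over a fixed compact box gives access to
  the Leibniz rule for differentiation under the integral.\<close>

lemma smooth_convolution:
  fixes u \<kappa> :: "real^2 \<Rightarrow> real"
  assumes u: "continuous_on UNIV u" and "smooth \<kappa>"
  shows "smooth (\<lambda>x. integral (cbox a b) (\<lambda>y. u y * \<kappa> (x - y)))"
proof -
  have deriv: "((\<lambda>x. integral (cbox a b) (\<lambda>y. u y * \<kappa> (x - y))) has_derivative
      (\<lambda>h. integral (cbox a b) (\<lambda>y. u y * frechet_derivative \<kappa> (at (x - y)) h))) (at x)"
    if \<kappa>: "smooth \<kappa>" for \<kappa> :: "real^2 \<Rightarrow> real" and x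
  proof -
    \<comment> \<open>The Leibniz rule asks for the derivative as a continuous family of bounded
      linear maps.\<close>
    define F where "F x y = blinfun_inner_right (u y *\<^sub>R grad \<kappa> (x - y))" for x y :: "real^2"
    have Fa: "blinfun_apply (F x y) h = u y * frechet_derivative \<kappa> (at (x - y)) h" for x y h
    proof -
      have "frechet_derivative \<kappa> (at (x - y)) = (\<lambda>h. grad \<kappa> (x - y) \<bullet> h)"
        by (rule frechet_derivative_at[OF smooth_has_grad[OF \<kappa>], symmetric])
      then show ?thesis by (simp add: F_def)
    qed
    have c\<kappa>: "continuous_on UNIV (\<lambda>y. \<kappa> (x - y))" for x
      by (rule continuous_on_compose2[OF smooth_continuous[OF \<kappa>]]) (auto intro!: continuous_intros)
    have c: "continuous_on (UNIV \<times> cbox a b) (\<lambda>(x, y). F x y)"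
    proof -
      have 1: "continuous_on (UNIV \<times> cbox a b) (\<lambda>z. u (snd z))"
        by (rule continuous_on_compose2[OF u]) (auto intro!: continuous_intros)
      have 2: "continuous_on (UNIV \<times> cbox a b) (\<lambda>z. grad \<kappa> (fst z - snd z))"
        by (rule continuous_on_compose2[OF smooth_grad_continuous[OF \<kappa>]]) (auto intro!: continuous_intros)
      show ?thesis
        unfolding F_def case_prod_unfold
        by (intro bounded_linear.continuous_on[OF bounded_linear_blinfun_inner_right] continuous_on_scaleR 1 2)
    qed
    have "((\<lambda>x. integral (cbox a b) (\<lambda>y. u y * \<kappa> (x - y))) has_derivative
        blinfun_apply (integral (cbox a b) (F x))) (at x within UNIV)"
    proof (rule leibniz_rule)
      show "((\<lambda>x. u y * \<kappa> (x - y)) has_derivative blinfun_apply (F x y)) (at x within UNIV)" for x y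
      proof -
        have "((\<lambda>x. \<kappa> (x - y)) has_derivative (\<lambda>h. grad \<kappa> (x - y) \<bullet> h)) (at x)"
          by (rule has_derivative_compose[OF _ smooth_has_grad[OF \<kappa>]]) (auto intro!: derivative_eq_intros)
        then have "((\<lambda>x. u y * \<kappa> (x - y)) has_derivative (\<lambda>h. u y * (grad \<kappa> (x - y) \<bullet> h))) (at x)"
          by (rule has_derivative_mult_right)
        moreover have "blinfun_apply (F x y) = (\<lambda>h. u y * (grad \<kappa> (x - y) \<bullet> h))"
          by (auto simp: F_def)
        ultimately show ?thesis by simp
      qed
      show "(\<lambda>y. u y * \<kappa> (x - y)) integrable_on cbox a b" for x
        by (intro integrable_continuous continuous_on_mult continuous_on_subset[OF u] continuous_on_subset[OF c\<kappa>]) auto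
    qed (use c in auto)
    moreover have "F x integrable_on cbox a b"
    proof (rule integrable_continuous)
      have "continuous_on (cbox a b) (\<lambda>y. (\<lambda>(x, y). F x y) (x, y))"
        by (rule continuous_on_compose2[OF c]) (auto intro!: continuous_intros)
      then show "continuous_on (cbox a b) (F x)" by simp
    qed
    then have "blinfun_apply (integral (cbox a b) (F x)) h = integral (cbox a b) (\<lambda>y. blinfun_apply (F x y) h)" for h
      by (rule blinfun_apply_integral)
    then have "blinfun_apply (integral (cbox a b) (F x))
        = (\<lambda>h. integral (cbox a b) (\<lambda>y. u y * frechet_derivative \<kappa> (at (x - y)) h))"
      by (auto simp: Fa)
    ultimately show ?thesis by simp
  qed
  \<comment> \<open>The kernel is generalised because its derivatives serve as kernels in the
    induction step; starting at order 1 makes continuity of the first derivative the base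
    case.\<close>
  have "smooth \<kappa> \<Longrightarrow> C_k (Suc k) (\<lambda>x. integral (cbox a b) (\<lambda>y. u y * \<kappa> (x - y)))" for k \<kappa>
  proof (induction k arbitrary: \<kappa>)
    case 0
    have "continuous_on UNIV (\<lambda>x. integral (cbox a b) (\<lambda>y. u y * frechet_derivative \<kappa> (at (x - y)) c))"
      if "c \<in> Basis" for c
      using deriv[OF smooth_frechet_derivative[OF 0 that]]
      by (auto intro!: continuous_at_imp_continuous_on has_derivative_continuous)
    then show ?case
      by (intro C_k_SucI[OF deriv[OF 0]]) simp
  next
    case (Suc k)
    show ?case
      by (rule C_k_SucI[OF deriv[OF Suc.prems]]) (rule Suc.IH[OF smooth_frechet_derivative[OF Suc.prems]])
  qed
  then show ?thesis using assms(2) C_k_mono_Suc unfolding smooth_def by blast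
qed

lemma lborel_integral_reflection:
  fixes f :: "'a::euclidean_space \<Rightarrow> real"
  assumes [measurable]: "f \<in> borel_measurable borel"
  shows "(\<integral>y. f y \<partial>lborel) = (\<integral>z. f (x - z) \<partial>lborel)"
proof -
  have d: "lborel = distr lborel borel (\<lambda>z. x - z)"
    using lborel_affine[of "-1" x] by (simp add: density_1)
  show ?thesis by (subst d, subst integral_distr) auto
qed

text \<open>One convolution in two forms: over a fixed box in \<open>y\<close>, where it is smooth,
  and over \<open>z = x - y\<close>, where it is an average of translates of \<open>u\<close> and
  inherits the Lipschitz constant and the affine pieces. The radius \<open>2 * \<epsilon>\<close> in
  the last claim arises because the gradient at \<open>x\<close> is read off \<open>w\<close> on the
  ball of radius \<open>\<epsilon>\<close>, where \<open>w\<close> averages \<open>u\<close> over a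
  further \<open>\<epsilon>\<close>.\<close>

lemma regularization:
  fixes u :: "real^2 \<Rightarrow> real"
  assumes L: "L-lipschitz_on UNIV u" and comp: "compact (supp u)" and \<epsilon>: "\<epsilon> > 0"
  obtains w where "smooth w" "L-lipschitz_on UNIV w" "\<And>x. \<bar>w x - u x\<bar> \<le> L * \<epsilon>"
    "supp w \<subseteq> (\<Union>x\<in>supp u. cball x \<epsilon>)" "compact (supp w)"
    "\<And>x g. (\<forall>y\<in>ball x (2 * \<epsilon>). u y = u x + g \<bullet> (y - x)) \<Longrightarrow> grad w x = g"
proof -
  obtain \<kappa> :: "real^2 \<Rightarrow> real" where \<kappa>: "smooth \<kappa>" "\<And>z. \<kappa> z \<ge> 0" "\<And>z. norm z \<ge> \<epsilon> \<Longrightarrow> \<kappa> z = 0"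
    "integrable lborel \<kappa>" "(\<integral>z. \<kappa> z \<partial>lborel) = 1"
    using mollifier_exists[OF \<epsilon>] by blast
  have u: "continuous_on UNIV u" using L by (rule lipschitz_on_continuous_on)
  obtain a b where ab: "supp u \<subseteq> cbox a b"
    using bounded_subset_cbox_symmetric[OF compact_imp_bounded[OF comp]] by metis
  define w where "w x = integral (cbox a b) (\<lambda>y. u y * \<kappa> (x - y))" for x
  have cu: "continuous_on UNIV (\<lambda>z. u (x - z))" for x
    by (rule continuous_on_compose2[OF u]) (auto intro!: continuous_intros)
  have int: "integrable lborel (\<lambda>z. u (x - z) * \<kappa> z)" for x
    by (rule integrable_lborel_continuous_compact[OF _ compact_cball[of 0 \<epsilon>]])
      (auto intro!: continuous_on_mult cu smooth_continuous[OF \<kappa>(1)] \<kappa>(3))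
  have w: "w x = (\<integral>z. u (x - z) * \<kappa> z \<partial>lborel)" for x
  proof -
    have c: "continuous_on UNIV (\<lambda>y. u y * \<kappa> (x - y))"
      by (intro continuous_on_mult u continuous_on_compose2[OF smooth_continuous[OF \<kappa>(1)]])
        (auto intro!: continuous_intros)
    have i: "integrable lborel (\<lambda>y. u y * \<kappa> (x - y))"
      by (rule integrable_lborel_continuous_compact[OF c comp]) (simp add: eq_0_outside_supp)
    have "w x = integral UNIV (\<lambda>y. if y \<in> cbox a b then u y * \<kappa> (x - y) else 0)"
      unfolding w_def by (rule Henstock_Kurzweil_Integration.integral_restrict_UNIV[symmetric])
    also have "(\<lambda>y. if y \<in> cbox a b then u y * \<kappa> (x - y) else 0) = (\<lambda>y. u y * \<kappa> (x - y))"
      using ab eq_0_outside_supp[of _ u] by (auto simp: fun_eq_iff)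
    also have "integral UNIV (\<lambda>y. u y * \<kappa> (x - y)) = (\<integral>y. u y * \<kappa> (x - y) \<partial>lborel)"
      using has_integral_integral_lborel[OF i] by (rule integral_unique)
    also have "\<dots> = (\<integral>z. u (x - z) * \<kappa> (x - (x - z)) \<partial>lborel)"
      by (rule lborel_integral_reflection) (rule borel_measurable_continuous_onI[OF c])
    finally show ?thesis by simp
  qed
  have diff: "w x - w x' = (\<integral>z. (u (x - z) - u (x' - z)) * \<kappa> z \<partial>lborel)" for x x'
    using int by (simp add: w left_diff_distrib)
  have bound: "\<bar>\<integral>z. f z * \<kappa> z \<partial>lborel\<bar> \<le> B" if f: "integrable lborel (\<lambda>z. f z * \<kappa> z)"
    "\<And>z. norm z < \<epsilon> \<Longrightarrow> \<bar>f z\<bar> \<le> B" for f B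
  proof -
    have "\<bar>\<integral>z. f z * \<kappa> z \<partial>lborel\<bar> \<le> (\<integral>z. norm (f z * \<kappa> z) \<partial>lborel)"
      using integral_norm_bound[of lborel "\<lambda>z. f z * \<kappa> z"] by simp
    also have "\<dots> \<le> (\<integral>z. B * \<kappa> z \<partial>lborel)"
    proof (rule integral_mono)
      show "norm (f z * \<kappa> z) \<le> B * \<kappa> z" for z
        using f(2)[of z] \<kappa>(2)[of z] \<kappa>(3)[of z] by (cases "norm z < \<epsilon>") (auto simp: abs_mult intro: mult_right_mono)
    qed (use f \<kappa> in auto)
    finally show ?thesis using \<kappa>(5) by simp
  qed
  have smooth: "smooth w"
    unfolding w_def by (rule smooth_convolution[OF u \<kappa>(1)])
  have Lip: "L-lipschitz_on UNIV w"
  proof (rule lipschitz_onI)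
    fix x y :: "real^2"
    have "\<bar>w x - w y\<bar> \<le> L * dist x y"
      unfolding diff
    proof (rule bound)
      show "integrable lborel (\<lambda>z. (u (x - z) - u (y - z)) * \<kappa> z)"
        using int by (simp add: left_diff_distrib)
      show "\<bar>u (x - z) - u (y - z)\<bar> \<le> L * dist x y" for z
        using lipschitz_onD[OF L, of "x - z" "y - z"] by (simp add: dist_norm)
    qed
    then show "dist (w x) (w y) \<le> L * dist x y" by (simp add: dist_norm)
  qed (rule lipschitz_on_nonneg[OF L])
  have close: "\<bar>w x - u x\<bar> \<le> L * \<epsilon>" for x
  proof -
    have "w x - u x = (\<integral>z. (u (x - z) - u x) * \<kappa> z \<partial>lborel)"
      using int \<kappa>(4,5) by (simp add: w left_diff_distrib)
    also have "\<bar>\<dots>\<bar> \<le> L * \<epsilon>"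
    proof (rule bound)
      show "integrable lborel (\<lambda>z. (u (x - z) - u x) * \<kappa> z)"
        using int \<kappa>(4) by (simp add: left_diff_distrib)
      show "\<bar>u (x - z) - u x\<bar> \<le> L * \<epsilon>" if "norm z < \<epsilon>" for z
      proof -
        have "\<bar>u (x - z) - u x\<bar> \<le> L * norm z"
          using lipschitz_onD[OF L, of "x - z" x] by (simp add: dist_norm)
        also have "\<dots> \<le> L * \<epsilon>" using that lipschitz_on_nonneg[OF L] by (intro mult_left_mono) auto
        finally show ?thesis .
      qed
    qed
    finally show ?thesis .
  qed
  define S where "S = (\<Union>x\<in>supp u. cball x \<epsilon>)"
  have S: "compact S"
  proof -
    have "S = {x + y | x y. x \<in> supp u \<and> y \<in> cball 0 \<epsilon>}"
    proof (intro equalityI subsetI)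
      fix y assume "y \<in> S"
      then obtain x where "x \<in> supp u" "dist x y \<le> \<epsilon>" by (auto simp: S_def)
      then show "y \<in> {x + y | x y. x \<in> supp u \<and> y \<in> cball 0 \<epsilon>}"
        by (intro CollectI exI[of _ x] exI[of _ "y - x"]) (auto simp: dist_norm norm_minus_commute)
    next
      fix y assume "y \<in> {x + y | x y. x \<in> supp u \<and> y \<in> cball 0 \<epsilon>}"
      then obtain x z where "x \<in> supp u" "norm z \<le> \<epsilon>" "y = x + z" by auto
      then show "y \<in> S" unfolding S_def by (intro UN_I[of x]) (auto simp: dist_norm)
    qed
    then show ?thesis using compact_sums[OF comp compact_cball[of 0 \<epsilon>]] by simp
  qed
  have sup: "supp w \<subseteq> S"
  proof -
    have "w x = 0" if "x \<notin> S" for x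
    proof -
      have z: "u (x - z) * \<kappa> z = 0" for z
      proof (cases "norm z < \<epsilon>")
        case True
        then have "x - z \<notin> supp u" using that by (force simp: S_def dist_norm)
        then show ?thesis by (simp add: eq_0_outside_supp)
      next
        case False
        then show ?thesis using \<kappa>(3) by simp
      qed
      show ?thesis unfolding w z by simp
    qed
    then have "{x. w x \<noteq> 0} \<subseteq> S" by blast
    then show ?thesis unfolding supp_def by (rule closure_minimal) (rule compact_imp_closed[OF S])
  qed
  have "compact (S \<inter> supp w)" by (rule compact_Int_closed[OF S]) (simp add: supp_def)
  then have compw: "compact (supp w)" using sup by (simp add: inf_absorb2)
  have gr: "grad w x = g" if aff: "\<forall>y\<in>ball x (2 * \<epsilon>). u y = u x + g \<bullet> (y - x)" for x g
  proof -
    have eq: "w y = w x + g \<bullet> (y - x)" if y: "y \<in> ball x \<epsilon>" for y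
    proof -
      have z: "(u (y - z) - u (x - z)) * \<kappa> z = g \<bullet> (y - x) * \<kappa> z" for z
      proof (cases "norm z < \<epsilon>")
        case True
        have "norm (y - z - x) \<le> norm (y - x) + norm z"
          using norm_triangle_ineq4[of "y - x" z] by (simp add: algebra_simps)
        then have "y - z \<in> ball x (2 * \<epsilon>)" "x - z \<in> ball x (2 * \<epsilon>)"
          using y True \<epsilon> by (auto simp: dist_norm norm_minus_commute)
        then have "u (y - z) - u (x - z) = g \<bullet> (y - x)"
          using aff by (auto simp: inner_diff_right)
        then show ?thesis by simp
      next
        case False
        then show ?thesis using \<kappa>(3) by simp
      qed
      have "w y - w x = g \<bullet> (y - x)" unfolding diff z using \<kappa>(5) by simp
      then show ?thesis by simp
    qed
    have "((\<lambda>y. w x + g \<bullet> (y - x)) has_derivative (\<lambda>h. g \<bullet> h)) (at x)"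
      by (auto intro!: derivative_eq_intros)
    then have "(w has_derivative (\<lambda>h. g \<bullet> h)) (at x)"
    proof (rule has_derivative_transform_within_open)
      show "open (ball x \<epsilon>)" "x \<in> ball x \<epsilon>" using \<epsilon> by auto
      show "w x + g \<bullet> (y - x) = w y" if "y \<in> ball x \<epsilon>" for y
        by (rule eq[OF that, symmetric])
    qed
    then have "(\<lambda>h. grad w x \<bullet> h) = (\<lambda>h. g \<bullet> h)"
      by (rule has_derivative_unique[OF smooth_has_grad[OF smooth]])
    then have "grad w x \<bullet> h = g \<bullet> h" for h by meson
    then show ?thesis using vector_eq_rdot by blast
  qed
  show thesis
    by (rule that[OF smooth Lip close sup[unfolded S_def] compw gr])
qed

text \<open>The gradients of the regularizations are eventually constant almost everywhere, which is why
  dominated convergence suffices.\<close>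

lemma (in bounded_open) piecewise_affine_H10:
  assumes L: "L-lipschitz_on UNIV u" and comp: "compact (supp u)" "supp u \<subseteq> \<Omega>"
    and aff: "AE x in lebesgue. \<exists>\<epsilon>>0. \<forall>y\<in>ball x \<epsilon>. u y = u x + g x \<bullet> (y - x)"
  shows "is_weak_gradient \<Omega> u g" and "u \<in> H10 \<Omega>"
proof -
  have d: "AE x in lebesgue. (u has_derivative (\<lambda>h. g x \<bullet> h)) (at x)"
    using aff
  proof eventually_elim
    case (elim x)
    then obtain \<epsilon> where \<epsilon>: "\<epsilon> > 0" "\<And>y. y \<in> ball x \<epsilon> \<Longrightarrow> u y = u x + g x \<bullet> (y - x)" by blast
    have "((\<lambda>y. u x + g x \<bullet> (y - x)) has_derivative (\<lambda>h. g x \<bullet> h)) (at x)"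
      by (auto intro!: derivative_eq_intros)
    then show ?case
    proof (rule has_derivative_transform_within_open)
      show "open (ball x \<epsilon>)" "x \<in> ball x \<epsilon>" using \<epsilon>(1) by auto
      show "u x + g x \<bullet> (y - x) = u y" if "y \<in> ball x \<epsilon>" for y
        by (rule \<epsilon>(2)[OF that, symmetric])
    qed
  qed
  show wg: "is_weak_gradient \<Omega> u g"
    by (rule Lipschitz_is_weak_gradient[OF L d])
  obtain e where e: "e > 0" "(\<Union>x\<in>supp u. cball x e) \<subseteq> \<Omega>"
    using compact_subset_open_imp_cball_epsilon_subset[OF comp(1) open_\<Omega> comp(2)] by blast
  \<comment> \<open>\<open>e\<close> is the margin around the support of \<open>u\<close> inside
    \<open>\<Omega>\<close>; radii not exceeding it keep all regularizations supported
    there.\<close>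
  define \<epsilon> where "\<epsilon> n = e * inverse (real (Suc n))" for n
  have \<epsilon>: "\<epsilon> n > 0" "\<epsilon> n \<le> e" for n
    using e(1) by (auto simp: \<epsilon>_def field_simps)
  have \<epsilon>0: "\<epsilon> \<longlonglongrightarrow> 0"
    unfolding \<epsilon>_def using tendsto_mult_left[OF LIMSEQ_inverse_real_of_nat, of e] by simp
  define P where "P n w \<longleftrightarrow> smooth w \<and> L-lipschitz_on UNIV w \<and> (\<forall>x. \<bar>w x - u x\<bar> \<le> L * \<epsilon> n) \<and>
    supp w \<subseteq> (\<Union>x\<in>supp u. cball x (\<epsilon> n)) \<and> compact (supp w) \<and>
    (\<forall>x g. (\<forall>y\<in>ball x (2 * \<epsilon> n). u y = u x + g \<bullet> (y - x)) \<longrightarrow> grad w x = g)" for n w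
  have "\<exists>w. P n w" for n
  proof (rule regularization[OF L comp(1) \<epsilon>(1)[of n]])
    fix w
    assume w: "smooth w" "L-lipschitz_on UNIV w" "\<And>x. \<bar>w x - u x\<bar> \<le> L * \<epsilon> n"
      "supp w \<subseteq> (\<Union>x\<in>supp u. cball x (\<epsilon> n))" "compact (supp w)"
      "\<And>x g. \<forall>y\<in>ball x (2 * \<epsilon> n). u y = u x + g \<bullet> (y - x) \<Longrightarrow> grad w x = g"
    show ?thesis
      unfolding P_def by (intro exI[of _ w] conjI allI impI w)
  qed
  then have "\<forall>n. \<exists>w. P n w" by simp
  from choice[OF this] obtain w where "\<And>n. P n (w n)" by auto
  then have w: "\<And>n. smooth (w n)" "\<And>n. L-lipschitz_on UNIV (w n)"
    "\<And>n x. \<bar>w n x - u x\<bar> \<le> L * \<epsilon> n" "\<And>n. supp (w n) \<subseteq> (\<Union>x\<in>supp u. cball x (\<epsilon> n))"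
    "\<And>n. compact (supp (w n))"
    "\<And>n x g. (\<forall>y\<in>ball x (2 * \<epsilon> n). u y = u x + g \<bullet> (y - x)) \<Longrightarrow> grad (w n) x = g"
    unfolding P_def by simp_all
  have wt: "w n \<in> test_functions \<Omega>" for n
  proof (rule test_functionsI[OF w(1,5)])
    have "(\<Union>x\<in>supp u. cball x (\<epsilon> n)) \<subseteq> (\<Union>x\<in>supp u. cball x e)"
      by (intro UN_mono order_refl subset_cball \<epsilon>(2))
    then show "supp (w n) \<subseteq> \<Omega>" by (rule order_trans[OF w(4) order_trans[OF _ e(2)]])
  qed
  show "u \<in> H10 \<Omega>"
  proof (rule H10I[OF H1I[OF wg] wt])
    have L0: "L \<ge> 0" by (rule lipschitz_on_nonneg[OF L])
    have "L2_norm \<Omega> (w n - u) \<le> L * \<epsilon> n * sqrt (measure lebesgue \<Omega>)" for n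
    proof -
      have "(L2_norm \<Omega> (w n - u))\<^sup>2 \<le> (L * \<epsilon> n)\<^sup>2 * measure lebesgue \<Omega>"
        by (rule L2_norm_le_bound) (use w(3) L0 \<epsilon>(1)[of n] in \<open>auto simp: fun_diff_def\<close>)
      then show ?thesis
        using L0 \<epsilon>(1)[of n] real_sqrt_le_mono by (fastforce simp: real_sqrt_mult)
    qed
    moreover have "(\<lambda>n. L * \<epsilon> n * sqrt (measure lebesgue \<Omega>)) \<longlonglongrightarrow> L * 0 * sqrt (measure lebesgue \<Omega>)"
      by (intro tendsto_intros \<epsilon>0)
    ultimately show "(\<lambda>n. L2_norm \<Omega> (w n - u)) \<longlonglongrightarrow> 0"
      by (intro Lim_null_comparison[of "\<lambda>n. L2_norm \<Omega> (w n - u)"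
            "\<lambda>n. L * \<epsilon> n * sqrt (measure lebesgue \<Omega>)"]) auto
    have eq: "V_norm \<Omega> (w n - u) = sqrt (\<integral>x. (norm (grad (w n) x - g x))\<^sup>2 \<partial>lebesgue_on \<Omega>)" for n
    proof -
      have "is_weak_gradient \<Omega> (w n - u) (\<lambda>x. grad (w n) x - g x)"
        using is_weak_gradient_lincomb[OF test_function_is_weak_gradient[OF wt[of n]] wg, of 1 "-1"]
        by (simp add: fun_diff_def)
      then show ?thesis by (simp add: V_norm_eq L2_norm_def)
    qed
    have gm: "g \<in> borel_measurable (lebesgue_on \<Omega>)"
      using is_weak_gradientD(2)[OF wg] by (simp add: L2_def)
    have wm: "grad (w n) \<in> borel_measurable (lebesgue_on \<Omega>)" for n
      by (rule continuous_borel_measurable_lebesgue_on[OF smooth_grad_continuous[OF w(1)]])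
    have "(\<lambda>n. \<integral>x. (norm (grad (w n) x - g x))\<^sup>2 \<partial>lebesgue_on \<Omega>) \<longlonglongrightarrow> (\<integral>x. 0 \<partial>lebesgue_on \<Omega>)"
    proof (rule integral_dominated_convergence)
      interpret finite_measure "lebesgue_on \<Omega>" by (rule finite_measure_lebesgue_on) simp
      show "integrable (lebesgue_on \<Omega>) (\<lambda>x. (2 * L)\<^sup>2)" by simp
      show "(\<lambda>x. (norm (grad (w n) x - g x))\<^sup>2) \<in> borel_measurable (lebesgue_on \<Omega>)" for n
        using gm wm by simp
      show "AE x in lebesgue_on \<Omega>. norm ((norm (grad (w n) x - g x))\<^sup>2) \<le> (2 * L)\<^sup>2" for n
        using AE_\<Omega>I[OF d]
      proof eventually_elim
        case (elim x)
        have "norm (grad (w n) x - g x) \<le> norm (grad (w n) x) + norm (g x)"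
          by (rule norm_triangle_ineq4)
        also have "\<dots> \<le> 2 * L"
          using AE_gradient_bound[OF w(2) smooth_has_grad[OF w(1)], of n x] AE_gradient_bound[OF L elim] by simp
        finally have "norm (grad (w n) x - g x) \<le> 2 * L" .
        from power_mono[OF this norm_ge_zero, of 2] show ?case by simp
      qed
      show "AE x in lebesgue_on \<Omega>. (\<lambda>n. (norm (grad (w n) x - g x))\<^sup>2) \<longlonglongrightarrow> 0"
        using AE_\<Omega>I[OF aff]
      proof eventually_elim
        case (elim x)
        then obtain r where r: "r > 0" "\<And>y. y \<in> ball x r \<Longrightarrow> u y = u x + g x \<bullet> (y - x)" by blast
        have "\<forall>\<^sub>F n in sequentially. \<epsilon> n < r / 2"
          using order_tendstoD(2)[OF \<epsilon>0, of "r / 2"] r by simp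
        then have "\<forall>\<^sub>F n in sequentially. (norm (grad (w n) x - g x))\<^sup>2 = 0"
        proof eventually_elim
          case (elim n)
          have "grad (w n) x = g x"
          proof (rule w(6), rule ballI)
            fix y assume "y \<in> ball x (2 * \<epsilon> n)"
            then have "y \<in> ball x r" using elim by simp
            then show "u y = u x + g x \<bullet> (y - x)" by (rule r(2))
          qed
          then show ?case by simp
        qed
        then show ?case by (rule tendsto_eventually)
      qed
    qed simp
    from tendsto_real_sqrt[OF this] show "(\<lambda>n. V_norm \<Omega> (w n - u)) \<longlonglongrightarrow> 0"
      by (simp add: eq)
  qed
qed

section \<open>Range, Lipschitz continuity, support and gradient of a hat function\<close>

section \<open>Hat functions\<close>

lemma triangle_geometry:
  fixes T :: "(real^2) set"
  assumes "2 simplex T"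
  shows "convex T" "compact T" "closed T" "interior T \<noteq> {}" "closure (interior T) = T"
proof -
  show c: "convex T" and "compact T" and cl: "closed T"
    using assms convex_simplex compact_simplex closed_simplex by blast+
  have "aff_dim T = int DIM(real^2)"
    using aff_dim_simplex[OF assms] by simp
  then have "interior T = rel_interior T"
    by (simp add: interior_rel_interior_gen)
  moreover have "T \<noteq> {}" using assms by auto
  ultimately show i: "interior T \<noteq> {}"
    using rel_interior_eq_empty[OF c] by simp
  show "closure (interior T) = T"
    using convex_closure_interior[OF c i] cl by simp
qed

text \<open>Two triangles meet in a common face, and a proper face avoids the interior. Applied to
  \<open>T\<close> this gives \<open>T \<subseteq> T'\<close>, applied to \<open>T'\<close> it
  excludes strict inclusion.\<close>

lemma triangulation_interior_inject:
  fixes \<T> :: "(real^2) set set"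
  assumes \<T>: "triangulation \<T>" "\<And>T. T \<in> \<T> \<Longrightarrow> 2 simplex T"
    and T: "T \<in> \<T>" "T' \<in> \<T>" "interior T \<inter> T' \<noteq> {}"
  shows "T = T'"
proof -
  have f: "(T \<inter> T') face_of T" "(T' \<inter> T) face_of T'"
    using \<T>(1) T by (auto simp: triangulation_def)
  have "T \<inter> T' = T"
  proof (rule ccontr)
    assume "T \<inter> T' \<noteq> T"
    then have "T \<inter> T' \<inter> interior T = {}" by (rule face_of_disjoint_interior[OF f(1)])
    then show False using T(3) interior_subset by blast
  qed
  then have "T \<subseteq> T'" by blast
  show "T = T'"
  proof (rule ccontr)
    assume "T \<noteq> T'"
    then have "T' \<inter> T \<inter> interior T' = {}"
      using \<open>T \<subseteq> T'\<close> by (intro face_of_disjoint_interior[OF f(2)]) blast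
    moreover have "interior T \<subseteq> interior T'" by (rule interior_mono[OF \<open>T \<subseteq> T'\<close>])
    ultimately have "interior T = {}" using interior_subset \<open>T \<subseteq> T'\<close> by blast
    then show False using triangle_geometry(4)[OF \<T>(2)[OF T(1)]] by simp
  qed
qed

locale hat = bounded_open +
  fixes \<T> :: "(real^2) set set" and \<phi> :: "real^2 \<Rightarrow> real"
  assumes hat: "hat_function \<Omega> \<T> \<phi>"
begin

lemma triangulation: "triangulation \<T>" and simplex2: "T \<in> \<T> \<Longrightarrow> 2 simplex T"
  and finite_\<T>: "finite \<T>" and cont: "continuous_on UNIV \<phi>"
  and zero_outside: "x \<notin> \<Union>\<T> \<Longrightarrow> \<phi> x = 0" and subset_closure: "\<Union>\<T> \<subseteq> closure \<Omega>"
  using hat by (auto simp: hat_function_def triangulation_def)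

lemmas geometry = triangle_geometry[OF simplex2]

lemma interior_inject: "T \<in> \<T> \<Longrightarrow> T' \<in> \<T> \<Longrightarrow> interior T \<inter> T' \<noteq> {} \<Longrightarrow> T = T'"
  using triangulation_interior_inject[OF triangulation simplex2] .

lemma closed_patch: "closed (\<Union>\<T>)"
  by (intro closed_Union finite_\<T> ballI geometry(3))

definition "gr T = (SOME a. \<exists>b. \<forall>x\<in>T. \<phi> x = a \<bullet> x + b)"

lemma affine_on: "T \<in> \<T> \<Longrightarrow> \<exists>b. \<forall>x\<in>T. \<phi> x = gr T \<bullet> x + b"
  unfolding gr_def by (rule someI_ex) (use hat in \<open>auto simp: hat_function_def\<close>)

lemma affine_diff: "T \<in> \<T> \<Longrightarrow> x \<in> T \<Longrightarrow> y \<in> T \<Longrightarrow> \<phi> y = \<phi> x + gr T \<bullet> (y - x)"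
  using affine_on[of T] by (auto simp: inner_diff_right)

lemma vertex:
  "\<exists>z. z \<in> interior (\<Union>\<T>) \<and> \<phi> z = 1 \<and> (\<forall>T\<in>\<T>. z extreme_point_of T) \<and>
    (\<forall>T\<in>\<T>. \<forall>y. y extreme_point_of T \<longrightarrow> y \<noteq> z \<longrightarrow> \<phi> y = 0)"
proof -
  have "\<exists>z \<in> interior (\<Union>\<T>). \<phi> z = 1 \<and>
        (\<forall>T\<in>\<T>. z extreme_point_of T \<and> (\<forall>y. y extreme_point_of T \<and> y \<noteq> z \<longrightarrow> \<phi> y = 0))"
    using hat by (simp only: hat_function_def)
  then show ?thesis by (elim bexE conjE, intro exI conjI ballI allI impI) auto
qed

text \<open>A triangle is the convex hull of its extreme points, at which \<open>\<phi>\<close> is 0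
  or 1, and the strip on which the affine function stays between 0 and 1 is convex.\<close>

lemma bounds: "0 \<le> \<phi> x" "\<phi> x \<le> 1"
proof -
  obtain z where z: "\<phi> z = 1" "\<And>T y. T \<in> \<T> \<Longrightarrow> y extreme_point_of T \<Longrightarrow> y \<noteq> z \<Longrightarrow> \<phi> y = 0"
    using vertex by auto
  have "0 \<le> \<phi> x \<and> \<phi> x \<le> 1"
  proof (cases "x \<in> \<Union>\<T>")
    case True
    then obtain T where T: "T \<in> \<T>" "x \<in> T" by blast
    obtain b where b: "\<And>y. y \<in> T \<Longrightarrow> \<phi> y = gr T \<bullet> y + b"
      using affine_on[OF T(1)] by blast
    have ext: "y \<in> T" if "y extreme_point_of T" for y
      using that by (simp add: extreme_point_of_def)
    let ?S = "{y. gr T \<bullet> y \<ge> - b} \<inter> {y. gr T \<bullet> y \<le> 1 - b}"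
    have "T = convex hull {y. y extreme_point_of T}"
      by (rule Krein_Milman_Minkowski[OF geometry(2)[OF T(1)] geometry(1)[OF T(1)]])
    also have "\<dots> \<subseteq> ?S"
    proof (rule hull_minimal)
      show "convex ?S" by (intro convex_Int convex_halfspace_ge convex_halfspace_le)
      show "{y. y extreme_point_of T} \<subseteq> ?S"
      proof
        fix y assume "y \<in> {y. y extreme_point_of T}"
        then have y: "y extreme_point_of T" by simp
        then have "\<phi> y \<in> {0, 1}" using z(1) z(2)[OF T(1) y] by auto
        then show "y \<in> ?S" using b[OF ext[OF y]] by auto
      qed
    qed
    finally show ?thesis using T(2) b[OF T(2)] by auto
  qed (simp add: zero_outside)
  then show "0 \<le> \<phi> x" "\<phi> x \<le> 1" by auto
qed

text \<open>On the segment from \<open>x\<close> to \<open>y\<close> the function is Lipschitz on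
  finitely many closed pieces, namely the preimages of the triangles and of the closure of the
  complement; closed pieces covering an interval can be glued without loss in the constant.\<close>

lemma Lipschitz: obtains L where "L-lipschitz_on UNIV \<phi>"
proof -
  define L where "L = (\<Sum>T\<in>\<T>. norm (gr T))"
  have L: "norm (gr T) \<le> L" if "T \<in> \<T>" for T
    unfolding L_def using that finite_\<T> by (intro member_le_sum) auto
  have L0: "L \<ge> 0" by (simp add: L_def sum_nonneg)
  define Z where "Z = closure (- \<Union>\<T>)"
  have Z: "\<phi> y = 0" if "y \<in> Z" for y
    using that unfolding Z_def
    by (rule continuous_constant_on_closure[rotated 2])
      (auto intro: continuous_on_subset[OF cont] zero_outside)
  have "L-lipschitz_on UNIV \<phi>"
  proof (rule lipschitz_onI[OF _ L0])
    fix x y :: "real^2"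
    define p where "p s = x + s *\<^sub>R (y - x)" for s :: real
    have p: "continuous_on UNIV p" unfolding p_def by (intro continuous_intros)
    have "(L * norm (y - x))-lipschitz_on {0..1} (\<phi> \<circ> p)"
    proof (rule lipschitz_on_closed_Union[where I = "insert Z \<T>" and U = "\<lambda>S. p -` S"])
      show "{0..1} \<subseteq> (\<Union>i\<in>insert Z \<T>. p -` i)"
        using closure_subset[of "- \<Union>\<T>"] by (auto simp: Z_def)
      show "closed (p -` S)" if "S \<in> insert Z \<T>" for S
        using that geometry(3) p by (intro closed_vimage) (auto simp: Z_def)
      show "(L * norm (y - x))-lipschitz_on (p -` S) (\<phi> \<circ> p)" if S: "S \<in> insert Z \<T>" for S
      proof (cases "S = Z")
        case True
        then show ?thesis using Z L0 by (auto simp: lipschitz_on_def)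
      next
        case False
        then have S: "S \<in> \<T>" using S by simp
        show ?thesis
        proof (rule lipschitz_onI)
          fix s t assume "s \<in> p -` S" "t \<in> p -` S"
          then have "\<phi> (p s) - \<phi> (p t) = gr S \<bullet> (p s - p t)"
            using affine_diff[OF S, of "p t" "p s"] by simp
          also have "p s - p t = (s - t) *\<^sub>R (y - x)" by (simp add: p_def algebra_simps)
          finally have "\<bar>\<phi> (p s) - \<phi> (p t)\<bar> \<le> norm (gr S) * norm ((s - t) *\<^sub>R (y - x))"
            using Cauchy_Schwarz_ineq2[of "gr S" "(s - t) *\<^sub>R (y - x)"] by simp
          also have "\<dots> \<le> L * norm ((s - t) *\<^sub>R (y - x))"
            by (intro mult_right_mono L S) simp
          finally show "dist ((\<phi> \<circ> p) s) ((\<phi> \<circ> p) t) \<le> L * norm (y - x) * dist s t"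
            by (simp add: dist_norm mult_ac)
        qed (use L0 in simp)
      qed
    qed (use finite_\<T> L0 in auto)
    from lipschitz_onD[OF this, of 0 1] show "dist (\<phi> x) (\<phi> y) \<le> L * dist x y"
      by (simp add: p_def dist_norm norm_minus_commute)
  qed
  then show thesis by (rule that)
qed

lemma supp_subset: "supp \<phi> \<subseteq> \<Union>\<T>"
  unfolding supp_def by (rule closure_minimal[OF _ closed_patch]) (use zero_outside in blast)

lemma compact_supp: "compact (supp \<phi>)"
proof -
  have "compact (\<Union>\<T>)" using finite_\<T> geometry(2) by (rule compact_Union)
  then have "compact (\<Union>\<T> \<inter> supp \<phi>)" by (rule compact_Int_closed) (simp add: supp_def)
  then show ?thesis using supp_subset by (simp add: inf_absorb2)
qed

text \<open>A zero in the interior is a minimum, and moving against the slope would give negative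
  values unless the slope is 0. Then \<open>\<phi>\<close> is constant on the triangle,
  contradicting its value 1 at the vertex \<open>z\<close>.\<close>

lemma interior_pos:
  assumes "T \<in> \<T>" "x \<in> interior T" shows "\<phi> x > 0"
proof (rule ccontr)
  assume "\<not> \<phi> x > 0"
  then have x0: "\<phi> x = 0" using bounds(1)[of x] by simp
  have xT: "x \<in> T" using assms(2) interior_subset by blast
  obtain e where e: "e > 0" "cball x e \<subseteq> T"
    using assms(2) by (auto simp: mem_interior_cball)
  have "gr T = 0"
  proof (rule ccontr)
    assume g: "gr T \<noteq> 0"
    define y where "y = x - (e / norm (gr T)) *\<^sub>R gr T"
    have "norm ((e / norm (gr T)) *\<^sub>R gr T) = e" using e(1) g by simp
    then have "y \<in> cball x e" by (simp add: y_def dist_norm)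
    then have "y \<in> T" using e(2) by blast
    then have "\<phi> y = - e * norm (gr T)"
      using affine_diff[OF assms(1) xT, of y] x0 g by (simp add: y_def dot_square_norm power2_eq_square)
    moreover have "e * norm (gr T) > 0" using e(1) g by simp
    ultimately show False using bounds(1)[of y] by simp
  qed
  obtain z where z: "\<phi> z = 1" "\<And>T. T \<in> \<T> \<Longrightarrow> z extreme_point_of T"
    using vertex by auto
  then have "z \<in> T" using assms(1) by (auto simp: extreme_point_of_def)
  then show False
    using affine_diff[OF assms(1) xT, of z] z(1) x0 \<open>gr T = 0\<close> by simp
qed

lemma interior_subset_supp: "T \<in> \<T> \<Longrightarrow> interior T \<subseteq> supp \<phi>"
  using interior_pos closure_subset[of "{x. \<phi> x \<noteq> 0}"] unfolding supp_def by force

text \<open>Takes the value 0 on the edges, a null set. The form as a sum of indicators allows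
  energies to be integrated triangle by triangle.\<close>

definition "gradient x = (\<Sum>T\<in>\<T>. indicator (interior T) x *\<^sub>R gr T)"

lemma sum_indicator_interior:
  fixes f :: "(real^2) set \<Rightarrow> 'b::real_vector"
  assumes "T \<in> \<T>" "x \<in> interior T"
  shows "(\<Sum>T'\<in>\<T>. indicator (interior T') x *\<^sub>R f T') = f T"
proof -
  have "(\<Sum>T'\<in>\<T>. indicator (interior T') x *\<^sub>R f T') = (\<Sum>T'\<in>\<T>. if T' = T then f T else 0)"
  proof (rule sum.cong[OF refl])
    fix T' assume "T' \<in> \<T>"
    then have imp: "x \<in> interior T' \<longrightarrow> T' = T"
      using interior_inject[of T' T] assms interior_subset[of T] by blast
    show "indicator (interior T') x *\<^sub>R f T' = (if T' = T then f T else 0)"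
    proof (cases "T' = T")
      case True
      then show ?thesis using assms(2) by simp
    next
      case False
      with imp have "x \<notin> interior T'" by blast
      then show ?thesis using False by simp
    qed
  qed
  then show ?thesis using assms(1) finite_\<T> by simp
qed

lemma AE_interior_or_outside:
  "AE x in lebesgue. (\<exists>T\<in>\<T>. x \<in> interior T) \<or> x \<notin> \<Union>\<T>"
proof -
  have "AE x in lebesgue. \<forall>T\<in>\<T>. x \<notin> frontier T"
  proof (rule AE_finite_allI[OF finite_\<T>])
    fix T assume "T \<in> \<T>"
    then have "negligible (frontier T)" by (intro negligible_convex_frontier geometry(1))
    then show "AE x in lebesgue. x \<notin> frontier T" unfolding negligible_iff_null_sets by (rule AE_not_in)
  qed
  then show ?thesis
  proof eventually_elim
    case (elim x)
    show ?case
    proof (cases "x \<in> \<Union>\<T>")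
      case True
      then obtain T where T: "T \<in> \<T>" "x \<in> T" by blast
      then have "x \<in> interior T"
        using elim geometry(3)[OF T(1)] by (auto simp: frontier_def)
      then show ?thesis using T(1) by blast
    qed simp
  qed
qed

lemma AE_affine: "AE x in lebesgue. \<exists>\<epsilon>>0. \<forall>y\<in>ball x \<epsilon>. \<phi> y = \<phi> x + gradient x \<bullet> (y - x)"
  using AE_interior_or_outside
proof eventually_elim
  case (elim x)
  show ?case
  proof (cases "x \<in> \<Union>\<T>")
    case True
    then obtain T where T: "T \<in> \<T>" "x \<in> interior T" using elim by blast
    then obtain e where "e > 0" "ball x e \<subseteq> T" by (auto simp: mem_interior)
    moreover have "gradient x = gr T"
      unfolding gradient_def using T by (rule sum_indicator_interior)
    ultimately show ?thesis
      using affine_diff[OF T(1), of x] T(2) interior_subset[of T] by (intro exI[of _ e]) auto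
  next
    case False
    then obtain e where e: "e > 0" "ball x e \<subseteq> - \<Union>\<T>"
      using open_Compl[OF closed_patch] False unfolding open_contains_ball by blast
    have "gradient x = 0"
      unfolding gradient_def using False interior_subset by (intro sum.neutral) (force simp: indicator_def)
    moreover have "\<phi> y = 0" if "y \<in> ball x e" for y
      using that e(2) by (intro zero_outside) blast
    ultimately show ?thesis using e(1) by (intro exI[of _ e]) auto
  qed
qed

lemma H10:
  assumes "supp \<phi> \<subseteq> \<Omega>"
  shows "\<phi> \<in> H10 \<Omega>" "is_weak_gradient \<Omega> \<phi> gradient"
proof -
  obtain L where L: "L-lipschitz_on UNIV \<phi>" by (rule Lipschitz)
  show "is_weak_gradient \<Omega> \<phi> gradient" "\<phi> \<in> H10 \<Omega>"
    using piecewise_affine_H10[OF L compact_supp assms AE_affine] by auto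
qed

lemma V_norm_le:
  assumes "supp \<phi> \<subseteq> \<Omega>" and E: "\<And>T. T \<in> \<T> \<Longrightarrow> (norm (gr T))\<^sup>2 * measure lebesgue T \<le> E"
  shows "(V_norm \<Omega> \<phi>)\<^sup>2 \<le> real (card \<T>) * E"
proof -
  have im: "interior T \<in> lmeasurable" if "T \<in> \<T>" for T
    using geometry(2)[OF that] by (intro lmeasurable_open) (auto intro: bounded_subset[OF compact_imp_bounded interior_subset])
  have sq: "(norm (gradient x))\<^sup>2 = (\<Sum>T\<in>\<T>. indicator (interior T) x * (norm (gr T))\<^sup>2)" for x
  proof (cases "\<exists>T\<in>\<T>. x \<in> interior T")
    case True
    then obtain T where T: "T \<in> \<T>" "x \<in> interior T" by blast
    show ?thesis
      using sum_indicator_interior[OF T, of gr] sum_indicator_interior[OF T, of "\<lambda>T. (norm (gr T))\<^sup>2"]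
      by (simp add: gradient_def)
  qed (simp add: gradient_def)
  have i: "integrable lebesgue (\<lambda>x. indicator (interior T) x * (norm (gr T))\<^sup>2)" if "T \<in> \<T>" for T
    using im[OF that] by (intro integrable_mult_left integrable_real_indicator) (auto simp: fmeasurable_def)
  have "(V_norm \<Omega> \<phi>)\<^sup>2 = (\<integral>x. (norm (gradient x))\<^sup>2 \<partial>lebesgue_on \<Omega>)"
    by (simp add: V_norm_eq[OF H10(2)[OF assms(1)]] L2_norm_power2)
  also have "\<dots> = (\<integral>x. (norm (gradient x))\<^sup>2 \<partial>lebesgue)"
  proof (rule integral_\<Omega>_eq)
    fix x assume "x \<notin> \<Omega>"
    then have "x \<notin> interior T" if "T \<in> \<T>" for T
      using interior_subset_supp[OF that] assms(1) by blast
    then show "(norm (gradient x))\<^sup>2 = 0" by (simp add: sq)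
  qed
  also have "\<dots> = (\<Sum>T\<in>\<T>. \<integral>x. indicator (interior T) x * (norm (gr T))\<^sup>2 \<partial>lebesgue)"
    unfolding sq by (rule Bochner_Integration.integral_sum[OF i])
  also have "\<dots> = (\<Sum>T\<in>\<T>. measure lebesgue (interior T) * (norm (gr T))\<^sup>2)"
    by (simp add: im fmeasurableD)
  also have "\<dots> \<le> (\<Sum>T\<in>\<T>. E)"
  proof (rule sum_mono)
    fix T assume T: "T \<in> \<T>"
    have "measure lebesgue (interior T) \<le> measure lebesgue T"
      by (rule measure_mono_fmeasurable[OF interior_subset])
        (use im[OF T] geometry(2)[OF T] in \<open>auto simp: fmeasurableD lmeasurable_compact\<close>)
    then have "measure lebesgue (interior T) * (norm (gr T))\<^sup>2 \<le> measure lebesgue T * (norm (gr T))\<^sup>2"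
      by (rule mult_right_mono) simp
    also have "\<dots> \<le> E" using E[OF T] by (simp add: mult.commute)
    finally show "measure lebesgue (interior T) * (norm (gr T))\<^sup>2 \<le> E" .
  qed
  finally show ?thesis by simp
qed

end

section \<open>Angle conditions inherited from small shape regular tiles at the corners, and the
  resulting scale-invariant energy bound\<close>

subsection \<open>The energy of a hat function on a shape regular refinement\<close>

text \<open>A ball of radius \<open>\<rho>\<close> inside the triangle at distance at most \<open>C \<rho>\<close> from the corner \<open>a\<close> bounds the
  cotangent of the angle at \<open>a\<close>: moving by \<open>\<rho>\<close> in the direction of \<open>g\<close> from the centre reaches height
  \<open>2 \<rho>\<close> above the edge \<open>a b\<close>, at tangential distance at most \<open>C \<rho>\<close> from \<open>a\<close>.\<close>

lemma corner_cotangent_le: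
  fixes a b z g y :: "real^2"
  assumes g: "g \<bullet> (b - a) = 0" "g \<bullet> (z - a) = 1"
    and ball: "cball y \<rho> \<subseteq> convex hull {a, b, z}" "cball y \<rho> \<subseteq> cball a D" "D \<le> C * \<rho>" "\<rho> > 0"
    and C: "C \<ge> 0"
  shows "2 * norm g * ((z - a) \<bullet> (b - a)) \<le> C * norm (b - a)"
proof (cases "(z - a) \<bullet> (b - a) > 0")
  case True
  have g0: "g \<noteq> 0" using g(2) by auto
  define d where "d = (\<rho> / norm g) *\<^sub>R g"
  have nd: "norm d = \<rho>" using g0 ball(4) by (simp add: d_def)
  have gd: "g \<bullet> d = \<rho> * norm g"
    using g0 by (simp add: d_def dot_square_norm power2_eq_square)
  have y: "y + d \<in> cball y \<rho>" "y - d \<in> cball y \<rho>" using nd by (auto simp: dist_norm)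
  have coord: "\<exists>\<beta> \<gamma>. \<beta> \<ge> 0 \<and> \<gamma> \<ge> 0 \<and> x = a + \<beta> *\<^sub>R (b - a) + \<gamma> *\<^sub>R (z - a)" if "x \<in> cball y \<rho>" for x
    using ball(1) that unfolding convex_hull_3_alt by blast
  have height: "\<gamma> = g \<bullet> (x - a)" if "x = a + \<beta> *\<^sub>R (b - a) + \<gamma> *\<^sub>R (z - a)" for x \<beta> \<gamma>
    using g by (simp add: that inner_add_right)
  obtain \<beta> \<gamma> where bg: "\<beta> \<ge> 0" "\<gamma> \<ge> 0" "y + d = a + \<beta> *\<^sub>R (b - a) + \<gamma> *\<^sub>R (z - a)"
    using coord[OF y(1)] by blast
  obtain \<beta>' \<gamma>' where bg': "\<beta>' \<ge> 0" "\<gamma>' \<ge> 0" "y - d = a + \<beta>' *\<^sub>R (b - a) + \<gamma>' *\<^sub>R (z - a)"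
    using coord[OF y(2)] by blast
  have "\<gamma> = \<gamma>' + 2 * (\<rho> * norm g)"
    unfolding height[OF bg(3)] height[OF bg'(3)] gd[symmetric] by (simp add: algebra_simps)
  then have \<gamma>: "\<gamma> \<ge> 2 * (\<rho> * norm g)" using bg'(2) by simp
  have "2 * (\<rho> * norm g) * ((z - a) \<bullet> (b - a)) \<le> \<gamma> * ((z - a) \<bullet> (b - a))"
    using \<gamma> True by (intro mult_right_mono) auto
  also have "\<dots> \<le> (\<beta> *\<^sub>R (b - a) + \<gamma> *\<^sub>R (z - a)) \<bullet> (b - a)"
    using bg(1) by (simp add: inner_add_left)
  also have "\<beta> *\<^sub>R (b - a) + \<gamma> *\<^sub>R (z - a) = y + d - a" using bg(3) by simp
  also have "(y + d - a) \<bullet> (b - a) \<le> norm (y + d - a) * norm (b - a)"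
    by (rule norm_cauchy_schwarz)
  also have "\<dots> \<le> (C * \<rho>) * norm (b - a)"
  proof (rule mult_right_mono)
    have "y + d \<in> cball a D" using y(1) ball(2) by blast
    then show "norm (y + d - a) \<le> C * \<rho>" using ball(3) by (simp add: dist_norm norm_minus_commute)
  qed simp
  finally have "\<rho> * (2 * norm g * ((z - a) \<bullet> (b - a))) \<le> \<rho> * (C * norm (b - a))"
    by (simp add: mult_ac)
  then show ?thesis using ball(4) by simp
next
  case False
  then have "2 * norm g * ((z - a) \<bullet> (b - a)) \<le> 0"
    by (simp add: mult_nonneg_nonpos)
  also have "0 \<le> C * norm (b - a)" using C by simp
  finally show ?thesis .
qed

text \<open>Pythagoras for \<open>v\<close> along and across \<open>e\<close>, multiplied by the
  squared norms of \<open>g\<close> and \<open>e\<close>: since \<open>g\<close> is normal to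
  \<open>e\<close> and \<open>g \<bullet> v = 1\<close>, the part of \<open>v\<close> across
  \<open>e\<close> has length \<open>1 / norm g\<close>.\<close>

lemma orthogonal_decomposition_2D:
  fixes e g v :: "real^2"
  assumes "g \<bullet> e = 0" "g \<bullet> v = 1" "e \<noteq> 0"
  shows "(norm v * norm g * norm e)\<^sup>2 = ((v \<bullet> e) * norm g)\<^sup>2 + (norm e)\<^sup>2"
proof -
  obtain g1 g2 e1 e2 v1 v2 where c: "g1 = g $ 1" "g2 = g $ 2" "e1 = e $ 1" "e2 = e $ 2" "v1 = v $ 1" "v2 = v $ 2"
    by simp
  have ge: "g1 * e1 + g2 * e2 = 0" and gv: "g1 * v1 + g2 * v2 = 1"
    using assms by (simp_all add: inner_vec_def UNIV_2 c)
  have n: "(norm g)\<^sup>2 = g1\<^sup>2 + g2\<^sup>2" "(norm e)\<^sup>2 = e1\<^sup>2 + e2\<^sup>2" "(norm v)\<^sup>2 = v1\<^sup>2 + v2\<^sup>2" "v \<bullet> e = v1 * e1 + v2 * e2"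
    unfolding dot_square_norm[symmetric] by (simp_all add: inner_vec_def UNIV_2 c power2_eq_square)
  \<comment> \<open>The last summand of this polynomial identity carries the factor
    \<open>g \<bullet> e\<close>, which is zero.\<close>
  have "(v1\<^sup>2 + v2\<^sup>2) * (g1\<^sup>2 + g2\<^sup>2) * (e1\<^sup>2 + e2\<^sup>2)
      = (v1 * e1 + v2 * e2)\<^sup>2 * (g1\<^sup>2 + g2\<^sup>2) + (g1 * v1 + g2 * v2)\<^sup>2 * (e1\<^sup>2 + e2\<^sup>2)
        + (g1 * e1 + g2 * e2) * ((v1 * e2 - v2 * e1) * (v1 * g2 - v2 * g1) - (v1 * e1 + v2 * e2) * (v1 * g1 + v2 * g2))"
    by (simp add: power2_eq_square algebra_simps)
  then show ?thesis
    unfolding power_mult_distrib n ge gv by simp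
qed

text \<open>The height of \<open>z\<close> above the opposite edge is \<open>1 / norm g\<close>.
  Bounded cotangents at both ends of that edge bound edge and sides by a multiple of this height, so
  \<open>T\<close> lies in a ball of radius \<open>(1 + C) / norm g\<close>, and the slope cancels
  from slope squared times area.\<close>

lemma (in hat) triangle_energy_le:
  assumes T: "T \<in> \<T>" and C: "C \<ge> 0"
    and corner: "\<And>c. c extreme_point_of T \<Longrightarrow>
      \<exists>y \<rho> D. cball y \<rho> \<subseteq> T \<and> cball y \<rho> \<subseteq> cball c D \<and> D \<le> C * \<rho> \<and> \<rho> > 0"
  shows "(norm (gr T))\<^sup>2 * measure lebesgue T \<le> pi * (1 + C)\<^sup>2"
proof -
  obtain z where z: "\<phi> z = 1" "z extreme_point_of T" "\<And>y. y extreme_point_of T \<Longrightarrow> y \<noteq> z \<Longrightarrow> \<phi> y = 0"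
    using vertex T by auto
  obtain S where S: "\<not> affine_dependent S" "int (card S) = 2 + 1" "T = convex hull S"
    using simplex2[OF T] unfolding simplex_def by blast
  have ext: "x extreme_point_of T \<longleftrightarrow> x \<in> S" for x
    unfolding S(3) by (rule extreme_point_of_convex_hull_affine_independent[OF S(1)])
  have "z \<in> S" using z(2) ext by simp
  have "card S = 3" using S(2) by simp
  then have fS: "finite S" using card.infinite by force
  have "card (S - {z}) = 2" using \<open>card S = 3\<close> \<open>z \<in> S\<close> fS by simp
  then obtain a b where ab: "S - {z} = {a, b}" "a \<noteq> b" by (auto simp: card_2_iff)
  then have S': "S = {a, b, z}" "S = {b, a, z}" "a \<noteq> z" "b \<noteq> z" using \<open>z \<in> S\<close> by auto
  have hull: "T = convex hull {a, b, z}" "T = convex hull {b, a, z}"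
    by (simp_all only: S(3) S'(1)[symmetric] S'(2)[symmetric])
  have exts: "a extreme_point_of T" "b extreme_point_of T" using ext S' by auto
  have inT: "a \<in> T" "b \<in> T" "z \<in> T" using exts z(2) by (auto simp: extreme_point_of_def)
  have \<phi>0: "\<phi> a = 0" "\<phi> b = 0" using z(3) exts S' by auto
  define g where "g = gr T"
  have ga: "g \<bullet> (b - a) = 0" "g \<bullet> (z - a) = 1" and gb: "g \<bullet> (a - b) = 0" "g \<bullet> (z - b) = 1"
    using affine_diff[OF T inT(1,2)] affine_diff[OF T inT(1,3)] affine_diff[OF T inT(2,1)]
      affine_diff[OF T inT(2,3)] unfolding g_def \<phi>0 z(1) by simp_all
  define e where "e = norm (b - a)"
  have e: "e > 0" using ab(2) by (simp add: e_def)
  have g0: "norm g > 0" using ga(2) by auto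
  obtain y \<rho> D where y: "cball y \<rho> \<subseteq> T" "cball y \<rho> \<subseteq> cball a D" "D \<le> C * \<rho>" "\<rho> > 0"
    using corner[OF exts(1)] by blast
  have A: "2 * norm g * ((z - a) \<bullet> (b - a)) \<le> C * e"
    unfolding e_def by (rule corner_cotangent_le[OF ga y(1)[unfolded hull(1)] y(2-4) C])
  obtain y \<rho> D where y: "cball y \<rho> \<subseteq> T" "cball y \<rho> \<subseteq> cball b D" "D \<le> C * \<rho>" "\<rho> > 0"
    using corner[OF exts(2)] by blast
  have B: "2 * norm g * ((z - b) \<bullet> (a - b)) \<le> C * e"
    unfolding e_def norm_minus_commute[of b a]
    by (rule corner_cotangent_le[OF gb y(1)[unfolded hull(2)] y(2-4) C])
  \<comment> \<open>The projections of the two sides at \<open>z\<close> onto the opposite edge add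
    up to that edge.\<close>
  have sum: "(z - a) \<bullet> (b - a) + (z - b) \<bullet> (a - b) = e\<^sup>2"
    unfolding e_def dot_square_norm[symmetric] by (simp add: algebra_simps inner_commute)
  have "norm g * e * e \<le> C * e"
  proof -
    have "2 * (norm g * e\<^sup>2) = 2 * norm g * ((z - a) \<bullet> (b - a)) + 2 * norm g * ((z - b) \<bullet> (a - b))"
      unfolding sum[symmetric] by (simp only: distrib_left mult.assoc)
    then show ?thesis using A B by (simp add: power2_eq_square)
  qed
  then have ge: "norm g * e \<le> C" using e by simp
  have "\<bar>(z - a) \<bullet> (b - a)\<bar> * norm g \<le> C * e"
  proof -
    have Ce: "C * e \<ge> 0" using C e by simp
    have A': "2 * ((z - a) \<bullet> (b - a) * norm g) \<le> C * e" using A by (simp only: mult_ac)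
    have B': "2 * ((z - b) \<bullet> (a - b) * norm g) \<le> C * e" using B by (simp only: mult_ac)
    have "(z - a) \<bullet> (b - a) * norm g \<le> C * e"
      using A' Ce by linarith
    \<comment> \<open>An obtuse angle at \<open>a\<close> makes the projection negative; it is then
      controlled by the cotangent at the other end \<open>b\<close>.\<close>
    moreover have "- ((z - a) \<bullet> (b - a)) * norm g \<le> C * e"
    proof -
      have "- ((z - a) \<bullet> (b - a)) \<le> (z - b) \<bullet> (a - b)" using sum zero_le_power2[of e] by linarith
      then have "- ((z - a) \<bullet> (b - a)) * norm g \<le> ((z - b) \<bullet> (a - b)) * norm g"
        using g0 by (intro mult_right_mono) auto
      also have "\<dots> \<le> C * e"
        using B' Ce by linarith
      finally show ?thesis .
    qed
    ultimately show ?thesis by (simp add: abs_if)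
  qed
  then have "(((z - a) \<bullet> (b - a)) * norm g)\<^sup>2 \<le> (C * e)\<^sup>2"
    using power_mono[of "\<bar>(z - a) \<bullet> (b - a)\<bar> * norm g" "C * e" 2] g0 by (simp add: power_mult_distrib)
  then have "(norm (z - a) * norm g * e)\<^sup>2 \<le> (C * e)\<^sup>2 + e\<^sup>2"
    using orthogonal_decomposition_2D[OF ga] ab(2) by (simp add: e_def)
  also have "\<dots> \<le> ((1 + C) * e)\<^sup>2"
  proof -
    have "((1 + C) * e)\<^sup>2 = (C * e)\<^sup>2 + e\<^sup>2 + 2 * C * e\<^sup>2"
      by (simp add: power2_eq_square algebra_simps)
    moreover have "2 * C * e\<^sup>2 \<ge> 0" using C by simp
    ultimately show ?thesis by linarith
  qed
  finally have "norm (z - a) * norm g * e \<le> (1 + C) * e"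
    by (rule power2_le_imp_le) (use e C in simp)
  then have gz: "norm g * norm (z - a) \<le> 1 + C" using e by (simp add: mult.commute[of "norm g"])
  define r where "r = (1 + C) / norm g"
  have "T \<subseteq> cball a r"
    unfolding hull(1)
  proof (rule hull_minimal)
    show "{a, b, z} \<subseteq> cball a r"
      using ge gz g0 C by (auto simp: r_def e_def dist_norm norm_minus_commute field_simps)
  qed simp
  then have "measure lebesgue T \<le> measure lebesgue (cball a r)"
    by (rule measure_mono_fmeasurable)
      (use geometry(2)[OF T] in \<open>auto simp: fmeasurableD lmeasurable_compact\<close>)
  also have "\<dots> = pi * r\<^sup>2"
    using C g0 by (simp add: content_cball r_def unit_ball_vol_2)
  finally have "(norm g)\<^sup>2 * measure lebesgue T \<le> (norm g)\<^sup>2 * (pi * r\<^sup>2)"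
    by (rule mult_left_mono) simp
  also have "\<dots> = pi * (1 + C)\<^sup>2" using g0 by (simp add: r_def power_divide)
  finally show ?thesis by (simp add: g_def)
qed

text \<open>Area count: the triangles have disjoint interiors, so their inscribed balls are disjoint
  and share the area of the large ball.\<close>

lemma (in hat) card_le:
  assumes \<rho>: "\<rho> > 0" and R: "R \<ge> 0" and ball: "\<And>T. T \<in> \<T> \<Longrightarrow> \<exists>y. ball y \<rho> \<subseteq> T \<and> ball y \<rho> \<subseteq> cball z R"
  shows "real (card \<T>) * \<rho>\<^sup>2 \<le> R\<^sup>2"
proof -
  obtain y where y: "\<And>T. T \<in> \<T> \<Longrightarrow> ball (y T) \<rho> \<subseteq> T" "\<And>T. T \<in> \<T> \<Longrightarrow> ball (y T) \<rho> \<subseteq> cball z R"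
    using ball by metis
  have dis: "disjoint_family_on (\<lambda>T. ball (y T) \<rho>) \<T>"
    unfolding disjoint_family_on_def
  proof (intro ballI impI)
    fix T T' assume T: "T \<in> \<T>" "T' \<in> \<T>" "T \<noteq> T'"
    have "ball (y T) \<rho> \<subseteq> interior T" by (rule interior_maximal[OF y(1)[OF T(1)]]) simp
    then show "ball (y T) \<rho> \<inter> ball (y T') \<rho> = {}"
      using interior_inject[of T T'] T y(1)[OF T(2)] by blast
  qed
  have "real (card \<T>) * (pi * \<rho>\<^sup>2) = (\<Sum>T\<in>\<T>. measure lebesgue (ball (y T) \<rho>))"
    using \<rho> by (simp add: content_ball unit_ball_vol_2)
  also have "\<dots> = measure lebesgue (\<Union>T\<in>\<T>. ball (y T) \<rho>)"
    by (rule measure_finite_Union[symmetric, OF finite_\<T> _ dis])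
      (use fmeasurableD2[OF lmeasurable_ball] in \<open>simp_all add: image_subset_iff\<close>)
  also have "\<dots> \<le> measure lebesgue (cball z R)"
    by (rule measure_mono_fmeasurable) (use y(2) finite_\<T> in \<open>auto intro!: sets.finite_UN\<close>)
  also have "\<dots> = pi * R\<^sup>2"
    using R by (simp add: content_cball unit_ball_vol_2)
  finally have "pi * (real (card \<T>) * \<rho>\<^sup>2) \<le> pi * R\<^sup>2" by (simp add: mult_ac)
  then show ?thesis by simp
qed

section \<open>Finite differences in time: supports, moments and norms of the spline and its
  derivative\<close>

section \<open>An oscillating spline in time\<close>

text \<open>Pascal's rule: a difference of order \<open>Suc m\<close> is the difference of order
  \<open>m\<close> of first differences.\<close>

lemma alternating_binomial_step:
  fixes f :: "nat \<Rightarrow> real"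
  shows "(\<Sum>i\<le>Suc m. (-1) ^ i * real (Suc m choose i) * f i)
    = (\<Sum>i\<le>m. (-1) ^ i * real (m choose i) * (f i - f (Suc i)))"
proof -
  have "(\<Sum>i\<le>Suc m. (-1) ^ i * real (Suc m choose i) * f i)
      = f 0 - (\<Sum>i\<le>m. (-1) ^ i * real (Suc m choose Suc i) * f (Suc i))"
    by (subst sum.atMost_Suc_shift) (simp add: sum_negf)
  also have "(\<Sum>i\<le>m. (-1) ^ i * real (Suc m choose Suc i) * f (Suc i))
      = (\<Sum>i\<le>m. (-1) ^ i * real (m choose i) * f (Suc i)) + (\<Sum>i\<le>m. (-1) ^ i * real (m choose Suc i) * f (Suc i))"
    by (simp add: sum.distrib algebra_simps)
  also have "(\<Sum>i\<le>m. (-1) ^ i * real (m choose Suc i) * f (Suc i))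
      = f 0 - (\<Sum>i\<le>Suc m. (-1) ^ i * real (m choose i) * f i)"
    using sum.atMost_Suc_shift[of "\<lambda>i. (-1) ^ i * real (m choose i) * f i" m] by (simp add: sum_negf)
  also have "(\<Sum>i\<le>Suc m. (-1) ^ i * real (m choose i) * f i) = (\<Sum>i\<le>m. (-1) ^ i * real (m choose i) * f i)"
    by (simp add: binomial_eq_0)
  finally show ?thesis by (simp add: sum_subtractf right_diff_distrib)
qed

text \<open>A first difference lowers the degree of a power, and each difference uses up one
  order.\<close>

lemma alternating_binomial_power:
  "k < m \<Longrightarrow> (\<Sum>i\<le>m. (-1) ^ i * real (m choose i) * real i ^ k) = 0"
proof (induction m arbitrary: k)
  case (Suc m)
  have "real i ^ k - real (Suc i) ^ k = - (\<Sum>j<k. real (k choose j) * real i ^ j)" for i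
  proof -
    have "real (Suc i) ^ k = (\<Sum>j\<le>k. real (k choose j) * real i ^ j)"
      using binomial_ring[of "real i" 1 k] by (simp add: add.commute)
    also have "\<dots> = (\<Sum>j<k. real (k choose j) * real i ^ j) + real i ^ k"
      by (simp flip: lessThan_Suc_atMost)
    finally show ?thesis by simp
  qed
  then have "(\<Sum>i\<le>Suc m. (-1) ^ i * real (Suc m choose i) * real i ^ k)
      = (\<Sum>i\<le>m. (-1) ^ i * real (m choose i) * - (\<Sum>j<k. real (k choose j) * real i ^ j))"
    by (simp only: alternating_binomial_step)
  also have "\<dots> = - (\<Sum>i\<le>m. \<Sum>j<k. real (k choose j) * ((-1) ^ i * real (m choose i) * real i ^ j))"
    by (simp add: sum_distrib_left sum_negf mult_ac)
  also have "\<dots> = - (\<Sum>j<k. real (k choose j) * (\<Sum>i\<le>m. (-1) ^ i * real (m choose i) * real i ^ j))"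
    by (subst sum.swap) (simp add: sum_distrib_left)
  also have "\<dots> = 0"
    using Suc.IH Suc.prems by (auto intro!: sum.neutral)
  finally show ?case .
qed simp

text \<open>For \<open>m = 2\<close> this is the hat function on \<open>[0, 2 h]\<close> with peak
  \<open>h\<close>; for larger \<open>m\<close> it is the finite difference of order
  \<open>m - 2\<close> of that hat function.\<close>

definition osc :: "nat \<Rightarrow> real \<Rightarrow> real \<Rightarrow> real" where
  "osc m h t = (\<Sum>i\<le>m. (-1) ^ i * real (m choose i) * max 0 (t - real i * h))"

text \<open>The strict inequality fixes the values at the knots, where \<open>osc\<close> has
  kinks.\<close>

definition osc' :: "nat \<Rightarrow> real \<Rightarrow> real \<Rightarrow> real" where
  "osc' m h t = (\<Sum>i\<le>m. (-1) ^ i * real (m choose i) * (if real i * h < t then 1 else 0))"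

lemma Xi_lmeasurable [simp]: "\<Xi> \<in> lmeasurable" "\<Xi> \<in> sets lebesgue"
  using lmeasurable_box[of "0::real" 1] by (auto simp: box_real)

lemma finite_measure_Xi: "finite_measure (lebesgue_on \<Xi>)"
  by (rule finite_measure_lebesgue_on) simp

lemma integrable_Xi_bounded:
  fixes f :: "real \<Rightarrow> real"
  assumes "f \<in> borel_measurable (lebesgue_on \<Xi>)" "\<And>t. t \<in> \<Xi> \<Longrightarrow> \<bar>f t\<bar> \<le> B"
  shows "integrable (lebesgue_on \<Xi>) f"
  by (rule finite_measure.integrable_const_bound[OF finite_measure_Xi, of _ B])
    (use assms in \<open>auto intro: AE_I2\<close>)

lemma integral_Xi_FTC:
  fixes F f :: "real \<Rightarrow> real"
  assumes "finite S" "continuous_on UNIV F" "\<And>t. t \<notin> S \<Longrightarrow> (F has_real_derivative f t) (at t)"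
    and f: "integrable (lebesgue_on \<Xi>) f"
  shows "(\<integral>t. f t \<partial>lebesgue_on \<Xi>) = F 1 - F 0"
proof -
  have "(f has_integral (F 1 - F 0)) {0..1}"
    by (rule fundamental_theorem_of_calculus_interior_strong[OF assms(1)])
      (use assms in \<open>auto simp flip: has_real_derivative_iff_has_vector_derivative intro: continuous_on_subset\<close>)
  then have "(f has_integral (F 1 - F 0)) \<Xi>"
    using has_integral_open_interval[of f "F 1 - F 0" 0 "1::real"] by (simp add: box_real cbox_interval)
  moreover have "(f has_integral (\<integral>t. f t \<partial>lebesgue_on \<Xi>)) \<Xi>"
    by (rule has_integral_integral_lebesgue_on[OF f]) simp
  ultimately show ?thesis by (rule has_integral_unique[symmetric])
qed

lemma sum_abs_binomial: "(\<Sum>i\<le>m. \<bar>(-1) ^ i * real (m choose i)\<bar>) = 2 ^ m"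
proof -
  have "(\<Sum>i\<le>m. \<bar>(-1) ^ i * real (m choose i)\<bar>) = real (\<Sum>i\<le>m. m choose i)"
    by (simp add: abs_mult)
  then show ?thesis by (simp only: choose_row_sum) simp
qed

lemma osc_neg: "h > 0 \<Longrightarrow> t \<le> 0 \<Longrightarrow> osc m h t = 0" "h > 0 \<Longrightarrow> t \<le> 0 \<Longrightarrow> osc' m h t = 0"
proof -
  assume h: "h > 0" "t \<le> 0"
  have "t \<le> real i * h" for i
    using h mult_nonneg_nonneg[of "real i" h] by linarith
  then show "osc m h t = 0" "osc' m h t = 0"
    unfolding osc_def osc'_def by (auto intro!: sum.neutral simp: not_less)
qed

text \<open>Past the last knot every truncated power is linear, and the binomial sums of orders 0
  and 1 in \<open>i\<close> vanish once \<open>m \<ge> 2\<close>. For \<open>osc'\<close> the knot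
  \<open>m h\<close> itself must be excluded, since there the last step is not yet switched
  on.\<close>

lemma osc_beyond:
  assumes "m \<ge> 2" "h > 0"
  shows "t \<ge> real m * h \<Longrightarrow> osc m h t = 0" and "t > real m * h \<Longrightarrow> osc' m h t = 0"
proof -
  have s: "(\<Sum>i\<le>m. (-1) ^ i * real (m choose i)) = 0" "(\<Sum>i\<le>m. (-1) ^ i * real (m choose i) * real i) = 0"
    using alternating_binomial_power[of 0 m] alternating_binomial_power[of 1 m] assms by auto
  have le: "real i * h \<le> real m * h" if "i \<le> m" for i
    using that assms by (intro mult_right_mono) auto
  show "osc m h t = 0" if "t \<ge> real m * h"
  proof -
    have "osc m h t = (\<Sum>i\<le>m. t * ((-1) ^ i * real (m choose i)) - h * ((-1) ^ i * real (m choose i) * real i))"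
      unfolding osc_def using le that by (intro sum.cong) (force simp: algebra_simps max_def)+
    also have "\<dots> = t * (\<Sum>i\<le>m. (-1) ^ i * real (m choose i)) - h * (\<Sum>i\<le>m. (-1) ^ i * real (m choose i) * real i)"
      by (simp add: sum_subtractf sum_distrib_left)
    finally show ?thesis unfolding s by simp
  qed
  show "osc' m h t = 0" if "t > real m * h"
  proof -
    have "osc' m h t = (\<Sum>i\<le>m. (-1) ^ i * real (m choose i))"
      unfolding osc'_def using le that by (intro sum.cong) force+
    then show ?thesis by (simp only: s)
  qed
qed

lemma continuous_osc: "continuous_on UNIV (osc m h)"
  unfolding osc_def by (intro continuous_intros)

lemma osc_has_derivative:
  assumes "t \<notin> (\<lambda>i. real i * h) ` {..m}"
  shows "(osc m h has_real_derivative osc' m h t) (at t)"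
proof -
  have "((\<lambda>t. max 0 (t - c)) has_real_derivative (if c < t then 1 else 0)) (at t)" if "t \<noteq> c" for c
  proof (cases "c < t")
    case True
    have "((\<lambda>t. t - c) has_real_derivative 1) (at t)" by (auto intro!: derivative_eq_intros)
    then have "((\<lambda>t. max 0 (t - c)) has_real_derivative 1) (at t)"
      by (rule has_field_derivative_transform_within_open[of _ _ _ "{c<..}"]) (use True in auto)
    then show ?thesis using True by simp
  next
    case False
    have "((\<lambda>t. 0) has_real_derivative 0) (at t)" by simp
    then have "((\<lambda>t. max 0 (t - c)) has_real_derivative 0) (at t)"
      by (rule has_field_derivative_transform_within_open[of _ _ _ "{..<c}"]) (use that False in auto)
    then show ?thesis using False by simp
  qed
  then show ?thesis
    unfolding osc_def osc'_def using assms by (intro DERIV_sum DERIV_cmult) blast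
qed

lemma osc_affine_on_cell:
  assumes "h > 0"
  shows "\<exists>c0 c1. \<forall>t\<in>{real j * h..real (Suc j) * h}. osc m h t = c0 + c1 * t"
proof -
  have "max 0 (t - real i * h) = (if i \<le> j then - real i * h else 0) + (if i \<le> j then 1 else 0) * t"
    if "t \<in> {real j * h..real (Suc j) * h}" for i t
  proof (cases "i \<le> j")
    case True
    then have "real i * h \<le> real j * h" using assms by (intro mult_right_mono) auto
    then show ?thesis using that True by auto
  next
    case False
    then have "real (Suc j) * h \<le> real i * h" using assms by (intro mult_right_mono) auto
    then have "t \<le> real i * h" using that by simp
    then show ?thesis using False by simp
  qed
  then have "osc m h t = (\<Sum>i\<le>m. (-1) ^ i * real (m choose i) * (if i \<le> j then - real i * h else 0))
      + (\<Sum>i\<le>m. (-1) ^ i * real (m choose i) * (if i \<le> j then 1 else 0)) * t"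
    if "t \<in> {real j * h..real (Suc j) * h}" for t
    unfolding osc_def sum_distrib_right sum.distrib[symmetric] using that
    by (intro sum.cong refl) (simp only: distrib_left mult.assoc)
  then show ?thesis by blast
qed

lemma osc'_measurable: "osc' m h \<in> borel_measurable borel"
  unfolding osc'_def by measurable

lemma measurable_Xi: "f \<in> borel_measurable borel \<Longrightarrow> f \<in> borel_measurable (lebesgue_on \<Xi>)"
  by (intro measurable_restrict_space1 measurable_completion) simp

lemma osc'_bound: "\<bar>osc' m h t\<bar> \<le> 2 ^ m"
proof -
  have "\<bar>osc' m h t\<bar> \<le> (\<Sum>i\<le>m. \<bar>(-1) ^ i * real (m choose i) * (if real i * h < t then 1 else 0)\<bar>)"
    unfolding osc'_def by (rule sum_abs)
  also have "\<dots> \<le> (\<Sum>i\<le>m. \<bar>(-1) ^ i * real (m choose i)\<bar>)"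
    by (intro sum_mono) auto
  finally show ?thesis by (simp only: sum_abs_binomial)
qed

lemma osc_bound:
  assumes "m \<ge> 2" "h > 0"
  shows "\<bar>osc m h t\<bar> \<le> 2 ^ m * (real m * h)"
proof (cases "t \<le> real m * h")
  case True
  have "\<bar>osc m h t\<bar> \<le> (\<Sum>i\<le>m. \<bar>(-1) ^ i * real (m choose i) * max 0 (t - real i * h)\<bar>)"
    unfolding osc_def by (rule sum_abs)
  also have "\<dots> \<le> (\<Sum>i\<le>m. \<bar>(-1) ^ i * real (m choose i)\<bar> * (real m * h))"
  proof (rule sum_mono)
    fix i
    have "0 \<le> real i * h" "0 \<le> real m * h" using assms by simp_all
    then have "\<bar>max 0 (t - real i * h)\<bar> \<le> real m * h" using True by linarith
    then show "\<bar>(-1) ^ i * real (m choose i) * max 0 (t - real i * h)\<bar> \<le> \<bar>(-1) ^ i * real (m choose i)\<bar> * (real m * h)"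
      unfolding abs_mult[of "(-1) ^ i * real (m choose i)"] by (rule mult_left_mono) simp
  qed
  finally show ?thesis by (simp only: sum_abs_binomial flip: sum_distrib_right)
next
  case False
  then show ?thesis using osc_beyond(1)[OF assms, of t] assms by simp
qed

lemma osc'_power_integrable: "integrable (lebesgue_on \<Xi>) (\<lambda>t. osc' m h t * t ^ k)"
proof (rule integrable_Xi_bounded)
  show "(\<lambda>t. osc' m h t * t ^ k) \<in> borel_measurable (lebesgue_on \<Xi>)"
    by (rule measurable_Xi) (use osc'_measurable in measurable)
  show "\<bar>osc' m h t * t ^ k\<bar> \<le> 2 ^ m * 1" if "t \<in> \<Xi>" for t
    unfolding abs_mult by (intro mult_mono osc'_bound) (use that in \<open>auto simp: power_le_one power_abs\<close>)
qed

text \<open>\<open>G c\<close> is an antiderivative of \<open>t ^ k\<close> switched on at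
  \<open>c\<close>. At 1, with all knots inside the unit interval, only the binomial sums of
  \<open>1\<close> and of \<open>i ^ (k + 1)\<close> remain, and both vanish because
  \<open>k + 1 < m\<close>.\<close>

lemma osc'_power_orthogonal:
  assumes "Suc k < m" "h > 0" "real m * h \<le> 1"
  shows "(\<integral>t. osc' m h t * t ^ k \<partial>lebesgue_on \<Xi>) = 0"
proof -
  define G where "G c t = ((max t c) ^ Suc k - c ^ Suc k) / real (Suc k)" for c t :: real
  define F where "F t = (\<Sum>i\<le>m. (-1) ^ i * real (m choose i) * G (real i * h) t)" for t
  have G: "(G c has_real_derivative (if c < t then 1 else 0) * t ^ k) (at t)" if "t \<noteq> c" for c t
  proof (cases "c < t")
    case True
    have "((\<lambda>t. (t ^ Suc k - c ^ Suc k) / real (Suc k)) has_real_derivative t ^ k) (at t)"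
      using DERIV_cdivide[OF DERIV_diff[OF DERIV_pow[of "Suc k" t] DERIV_const], of "c ^ Suc k" "real (Suc k)"]
      by (simp del: of_nat_Suc power_Suc)
    then have "(G c has_real_derivative t ^ k) (at t)"
      by (rule has_field_derivative_transform_within_open[of _ _ _ "{c<..}"]) (use True in \<open>auto simp: G_def max_def\<close>)
    then show ?thesis using True by simp
  next
    case False
    have "((\<lambda>t. 0) has_real_derivative 0) (at t)" by simp
    then have "(G c has_real_derivative 0) (at t)"
      by (rule has_field_derivative_transform_within_open[of _ _ _ "{..<c}"]) (use that False in \<open>auto simp: G_def max_def\<close>)
    then show ?thesis using False by simp
  qed
  have "(\<integral>t. osc' m h t * t ^ k \<partial>lebesgue_on \<Xi>) = F 1 - F 0"
  proof (rule integral_Xi_FTC[of "(\<lambda>i. real i * h) ` {..m}"])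
    show "continuous_on UNIV F" unfolding F_def G_def by (intro continuous_intros) auto
    show "(F has_real_derivative osc' m h t * t ^ k) (at t)" if "t \<notin> (\<lambda>i. real i * h) ` {..m}" for t
      unfolding F_def osc'_def sum_distrib_right mult.assoc using that by (intro DERIV_sum DERIV_cmult G) auto
  qed (use osc'_power_integrable in auto)
  also have "F 0 = 0"
    unfolding F_def G_def using assms by (intro sum.neutral) (auto simp: max_def)
  also have "F 1 = (\<Sum>i\<le>m. (-1) ^ i * real (m choose i) - h ^ Suc k * ((-1) ^ i * real (m choose i) * real i ^ Suc k)) / real (Suc k)"
    unfolding F_def sum_divide_distrib
  proof (rule sum.cong[OF refl])
    fix i assume "i \<in> {..m}"
    then have "real i * h \<le> real m * h" using assms by (intro mult_right_mono) auto
    then have "real i * h \<le> 1" using assms(3) by linarith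
    then have "max 1 (real i * h) = 1" by simp
    then show "(-1) ^ i * real (m choose i) * G (real i * h) 1
        = ((-1) ^ i * real (m choose i) - h ^ Suc k * ((-1) ^ i * real (m choose i) * real i ^ Suc k)) / real (Suc k)"
      unfolding G_def power_mult_distrib by (simp add: right_diff_distrib mult_ac del: of_nat_Suc power_Suc)
  qed
  also have "\<dots> = ((\<Sum>i\<le>m. (-1) ^ i * real (m choose i)) - h ^ Suc k * (\<Sum>i\<le>m. (-1) ^ i * real (m choose i) * real i ^ Suc k)) / real (Suc k)"
    by (simp add: sum_subtractf sum_distrib_left del: power_Suc of_nat_Suc)
  also have "\<dots> = 0"
    using alternating_binomial_power[of 0 m] alternating_binomial_power[of "Suc k" m] assms
    by (simp del: power_Suc of_nat_Suc)
  finally show ?thesis by simp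
qed

text \<open>On the first cell \<open>(0, h)\<close> only the step at 0 is active and
  \<open>osc'\<close> equals 1.\<close>

lemma osc'_square_integral_ge:
  assumes "h > 0" "h \<le> 1"
  shows "integrable (lebesgue_on \<Xi>) (\<lambda>t. (osc' m h t)\<^sup>2)" "h \<le> (\<integral>t. (osc' m h t)\<^sup>2 \<partial>lebesgue_on \<Xi>)"
proof -
  show i: "integrable (lebesgue_on \<Xi>) (\<lambda>t. (osc' m h t)\<^sup>2)"
  proof (rule integrable_Xi_bounded)
    show "(\<lambda>t. (osc' m h t)\<^sup>2) \<in> borel_measurable (lebesgue_on \<Xi>)"
      by (rule measurable_Xi) (use osc'_measurable in measurable)
    show "\<bar>(osc' m h t)\<^sup>2\<bar> \<le> (2 ^ m)\<^sup>2" for t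
      using power_mono[OF osc'_bound[of m h t] abs_ge_zero, of 2] by simp
  qed
  have one: "osc' m h t = 1" if "0 < t" "t < h" for t
  proof -
    have "real i * h < t \<longleftrightarrow> i = 0" for i
    proof (cases i)
      case (Suc j)
      have "h \<le> real i * h" using Suc assms by (simp add: mult_le_cancel_right1)
      then have "\<not> real i * h < t" using that by linarith
      then show ?thesis using Suc by simp
    qed (use that in simp)
    then have "osc' m h t = (\<Sum>i\<le>m. if i = 0 then 1 else 0)"
      unfolding osc'_def by (intro sum.cong) auto
    then show ?thesis by simp
  qed
  have m: "{0<..<h} \<in> sets (lebesgue_on \<Xi>)"
    using assms lmeasurable_box[of 0 h] by (auto simp: sets_restrict_space_iff box_real fmeasurableD)
  have e: "emeasure (lebesgue_on \<Xi>) {0<..<h} = ennreal h"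
    using assms by (subst emeasure_restrict_space) auto
  have "h = (\<integral>t. indicator {0<..<h} t \<partial>lebesgue_on \<Xi>)"
    using m e assms by (simp add: measure_def)
  also have "\<dots> \<le> (\<integral>t. (osc' m h t)\<^sup>2 \<partial>lebesgue_on \<Xi>)"
  proof (rule integral_mono[OF _ i])
    show "integrable (lebesgue_on \<Xi>) (indicator {0<..<h} :: real \<Rightarrow> real)"
      using m e by (intro integrable_real_indicator) auto
    show "indicator {0<..<h} t \<le> (osc' m h t)\<^sup>2" for t
      using one by (auto simp: indicator_def)
  qed
  finally show "h \<le> (\<integral>t. (osc' m h t)\<^sup>2 \<partial>lebesgue_on \<Xi>)" .
qed

text \<open>A Poincare inequality in time with crude constants: \<open>osc\<close> is at most
  \<open>2 ^ m * m * h\<close> on a support of length \<open>m * h\<close>, whereas the squared norm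
  of \<open>osc'\<close> is at least \<open>h\<close>. The gain of a factor \<open>h\<close> is what
  makes the contribution of \<open>A\<close> small.\<close>

lemma osc_square_integral_le:
  assumes "m \<ge> 2" "h > 0" "real m * h \<le> 1"
  shows "integrable (lebesgue_on \<Xi>) (\<lambda>t. (osc m h t)\<^sup>2)"
    and "sqrt (\<integral>t. (osc m h t)\<^sup>2 \<partial>lebesgue_on \<Xi>) \<le> 2 ^ m * real m ^ 2 * h * sqrt (\<integral>t. (osc' m h t)\<^sup>2 \<partial>lebesgue_on \<Xi>)"
proof -
  have om: "osc m h \<in> borel_measurable (lebesgue_on \<Xi>)"
    by (rule continuous_borel_measurable_lebesgue_on[OF continuous_osc])
  have mh: "real m * h > 0" using assms by simp
  have sq: "(osc m h t)\<^sup>2 \<le> (2 ^ m * (real m * h))\<^sup>2" for t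
    using power_mono[OF osc_bound[OF assms(1,2), of t] abs_ge_zero, of 2] by simp
  show i: "integrable (lebesgue_on \<Xi>) (\<lambda>t. (osc m h t)\<^sup>2)"
    by (rule integrable_Xi_bounded[of _ "(2 ^ m * (real m * h))\<^sup>2"]) (use om sq in auto)
  let ?J = "{0<..<real m * h}"
  have mJ: "?J \<in> sets (lebesgue_on \<Xi>)"
    using assms lmeasurable_box[of 0 "real m * h"] by (auto simp: sets_restrict_space_iff box_real fmeasurableD)
  have e: "emeasure (lebesgue_on \<Xi>) ?J = ennreal (real m * h)"
    using assms by (subst emeasure_restrict_space) auto
  have "(\<integral>t. (osc m h t)\<^sup>2 \<partial>lebesgue_on \<Xi>) \<le> (\<integral>t. (2 ^ m * (real m * h))\<^sup>2 * indicator ?J t \<partial>lebesgue_on \<Xi>)"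
  proof (rule integral_mono[OF i])
    show "integrable (lebesgue_on \<Xi>) (\<lambda>t. (2 ^ m * (real m * h))\<^sup>2 * indicator ?J t :: real)"
      using mJ e by (intro integrable_mult_right integrable_real_indicator) auto
    show "(osc m h t)\<^sup>2 \<le> (2 ^ m * (real m * h))\<^sup>2 * indicator ?J t" for t
      using sq[of t] osc_neg(1)[of h t m] osc_beyond(1)[OF assms(1,2), of t] assms(2) by (auto simp: indicator_def not_less)
  qed
  also have "\<dots> = (2 ^ m * (real m * h))\<^sup>2 * (real m * h)"
    using mJ e mh by (simp add: measure_def min.absorb1[OF assms(3)])
  also have "\<dots> \<le> (2 ^ m * (real m * h))\<^sup>2 * (real m * (\<integral>t. (osc' m h t)\<^sup>2 \<partial>lebesgue_on \<Xi>))"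
  proof (intro mult_left_mono osc'_square_integral_ge(2))
    have "h \<le> real m * h" using assms by (simp add: mult_le_cancel_right1)
    then show "h \<le> 1" using assms by linarith
  qed (use assms in auto)
  \<comment> \<open>Replacing \<open>m\<close> by its square is wasteful, but makes the prefactor a
    perfect square.\<close>
  also have "\<dots> \<le> (2 ^ m * (real m * h))\<^sup>2 * ((real m)\<^sup>2 * (\<integral>t. (osc' m h t)\<^sup>2 \<partial>lebesgue_on \<Xi>))"
  proof (intro mult_left_mono mult_right_mono)
    show "real m \<le> (real m)\<^sup>2" using assms by (simp add: power2_eq_square)
  qed auto
  also have "\<dots> = (2 ^ m * real m ^ 2 * h)\<^sup>2 * (\<integral>t. (osc' m h t)\<^sup>2 \<partial>lebesgue_on \<Xi>)"
    by (simp add: power_mult_distrib power2_eq_square mult_ac)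
  finally have "sqrt (\<integral>t. (osc m h t)\<^sup>2 \<partial>lebesgue_on \<Xi>) \<le> sqrt ((2 ^ m * real m ^ 2 * h)\<^sup>2 * (\<integral>t. (osc' m h t)\<^sup>2 \<partial>lebesgue_on \<Xi>))"
    by (rule real_sqrt_le_mono)
  also have "\<dots> = 2 ^ m * real m ^ 2 * h * sqrt (\<integral>t. (osc' m h t)\<^sup>2 \<partial>lebesgue_on \<Xi>)"
    using assms(2) by (simp add: real_sqrt_mult)
  finally show "sqrt (\<integral>t. (osc m h t)\<^sup>2 \<partial>lebesgue_on \<Xi>)
      \<le> 2 ^ m * real m ^ 2 * h * sqrt (\<integral>t. (osc' m h t)\<^sup>2 \<partial>lebesgue_on \<Xi>)" .
qed

lemma test_function_deriv:
  fixes \<theta> :: "real \<Rightarrow> real"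
  assumes "\<theta> \<in> test_functions S"
  shows "(\<theta> has_real_derivative deriv \<theta> t) (at t)" "continuous_on UNIV (deriv \<theta>)"
proof -
  have s: "smooth \<theta>" by (rule test_functionsD(1)[OF assms])
  have "\<theta> field_differentiable (at t)" for t
    using smooth_has_derivative[OF s, of t]
    by (metis differentiable_def field_differentiable_def real_differentiable_def)
  then show d: "(\<theta> has_real_derivative deriv \<theta> t) (at t)" for t
    using DERIV_deriv_iff_field_differentiable by blast
  have "deriv \<theta> t = frechet_derivative \<theta> (at t) 1" for t
    using frechet_derivative_at[OF d[of t, unfolded has_field_derivative_def]] by (metis mult.right_neutral)
  then show "continuous_on UNIV (deriv \<theta>)"
    using smooth_continuous[OF smooth_frechet_derivative[OF s, of 1]] by simp
qed

text \<open>The boundary terms vanish because \<open>osc\<close> is 0 at both ends of the unit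
  interval; the knots form the finite exceptional set in the fundamental theorem.\<close>

lemma osc_integration_by_parts:
  assumes m: "m \<ge> 2" "h > 0" "real m * h \<le> 1" and \<theta>: "\<theta> \<in> test_functions \<Xi>"
  shows "(\<integral>t. deriv \<theta> t * osc m h t \<partial>lebesgue_on \<Xi>) = - (\<integral>t. \<theta> t * osc' m h t \<partial>lebesgue_on \<Xi>)"
proof -
  note d = test_function_deriv[OF \<theta>]
  have c: "continuous_on UNIV \<theta>" by (rule smooth_continuous[OF test_functionsD(1)[OF \<theta>]])
  have bounded: "\<exists>B. \<forall>t\<in>\<Xi>. \<bar>f t\<bar> \<le> B" if "continuous_on UNIV f" for f :: "real \<Rightarrow> real"
  proof -
    have "bounded (f ` {0..1})"
      by (intro compact_imp_bounded compact_continuous_image continuous_on_subset[OF that]) auto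
    then obtain B where "\<forall>t\<in>{0..1}. \<bar>f t\<bar> \<le> B" by (auto simp: bounded_iff)
    then have "\<forall>t\<in>\<Xi>. \<bar>f t\<bar> \<le> B" by auto
    then show ?thesis ..
  qed
  have c1: "continuous_on UNIV (\<lambda>t. deriv \<theta> t * osc m h t)"
    by (intro continuous_on_mult d continuous_osc)
  obtain B1 where "\<forall>t\<in>\<Xi>. \<bar>deriv \<theta> t * osc m h t\<bar> \<le> B1" using bounded[OF c1] by blast
  then have i1: "integrable (lebesgue_on \<Xi>) (\<lambda>t. deriv \<theta> t * osc m h t)"
    by (intro integrable_Xi_bounded[of _ B1] continuous_borel_measurable_lebesgue_on c1) auto
  obtain B2 where B2: "\<forall>t\<in>\<Xi>. \<bar>\<theta> t\<bar> \<le> B2" using bounded[OF c] by blast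
  have i2: "integrable (lebesgue_on \<Xi>) (\<lambda>t. \<theta> t * osc' m h t)"
  proof (rule integrable_Xi_bounded)
    show "(\<lambda>t. \<theta> t * osc' m h t) \<in> borel_measurable (lebesgue_on \<Xi>)"
      by (intro borel_measurable_times continuous_borel_measurable_lebesgue_on c measurable_Xi osc'_measurable)
    show "\<bar>\<theta> t * osc' m h t\<bar> \<le> B2 * 2 ^ m" if "t \<in> \<Xi>" for t
      unfolding abs_mult using B2 that by (intro mult_mono osc'_bound) (auto intro: order_trans[OF abs_ge_zero])
  qed
  have "(\<integral>t. deriv \<theta> t * osc m h t + \<theta> t * osc' m h t \<partial>lebesgue_on \<Xi>) = \<theta> 1 * osc m h 1 - \<theta> 0 * osc m h 0"
  proof (rule integral_Xi_FTC[of "(\<lambda>i. real i * h) ` {..m}"])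
    show "((\<lambda>t. \<theta> t * osc m h t) has_real_derivative deriv \<theta> t * osc m h t + \<theta> t * osc' m h t) (at t)"
      if "t \<notin> (\<lambda>i. real i * h) ` {..m}" for t
      using DERIV_mult[OF d(1)[of t] osc_has_derivative[OF that]] by (simp add: mult.commute)
  qed (use i1 i2 c continuous_osc in \<open>auto intro!: continuous_on_mult\<close>)
  also have "\<dots> = 0"
    using osc_neg(1)[OF m(2), of 0 m] osc_beyond(1)[OF m(1,2), of 1] m(3) by simp
  finally show ?thesis using i1 i2 by simp
qed

section \<open>Dual norms, pairings with functions in Y, and the time derivative of a tensor
  product\<close>

section \<open>Dual norms and Bochner spaces\<close>

lemma dual_norm_nonneg [simp]: "dual_norm S N g \<ge> 0"
  by (simp add: dual_norm_def)

lemma dual_norm_le: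
  assumes "\<And>v. v \<in> S \<Longrightarrow> N v > 0 \<Longrightarrow> g v \<le> K * N v" "\<And>v. v \<in> S \<Longrightarrow> N v \<ge> 0" "K \<ge> 0"
  shows "dual_norm S N g \<le> K"
  unfolding dual_norm_def
proof (rule enn2real_leI[OF assms(3)], rule SUP_least)
  fix v assume "v \<in> {v \<in> S. N v \<noteq> 0}"
  then have "v \<in> S" "N v > 0" using assms(2)[of v] by auto
  then have "g v / N v \<le> K" using assms(1) by (simp add: field_simps)
  then show "ennreal (g v / N v) \<le> ennreal K" by (rule ennreal_leI)
qed

text \<open>The a priori bound \<open>K\<close> is essential: an infinite supremum would be
  converted to 0 and the lower bound would fail.\<close>

lemma dual_norm_ge:
  assumes "\<And>v. v \<in> S \<Longrightarrow> N v > 0 \<Longrightarrow> g v \<le> K * N v" "\<And>v. v \<in> S \<Longrightarrow> N v \<ge> 0" "K \<ge> 0"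
    and v: "v \<in> S" "N v > 0"
  shows "g v / N v \<le> dual_norm S N g"
proof -
  have "(SUP v\<in>{v \<in> S. N v \<noteq> 0}. ennreal (g v / N v)) \<le> ennreal K"
  proof (rule SUP_least)
    fix v assume "v \<in> {v \<in> S. N v \<noteq> 0}"
    then have "v \<in> S" "N v > 0" using assms(2)[of v] by auto
    then have "g v / N v \<le> K" using assms(1) by (simp add: field_simps)
    then show "ennreal (g v / N v) \<le> ennreal K" by (rule ennreal_leI)
  qed
  then have fin: "(SUP v\<in>{v \<in> S. N v \<noteq> 0}. ennreal (g v / N v)) < top"
    by (rule le_less_trans) simp
  have "ennreal (g v / N v) \<le> (SUP v\<in>{v \<in> S. N v \<noteq> 0}. ennreal (g v / N v))"
    by (rule SUP_upper) (use v in auto)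
  then have "enn2real (ennreal (g v / N v)) \<le> dual_norm S N g"
    unfolding dual_norm_def by (rule enn2real_mono[OF _ fin])
  then show ?thesis
    by (cases "g v / N v \<ge> 0") (auto intro: order_trans[of _ 0])
qed

text \<open>Covers integrands such as \<open>A t (w t) (v t)\<close> whose measurability has not
  been established: a nonintegrable \<open>f\<close> has integral 0, and the bound is
  nonnegative.\<close>

lemma abs_integral_le_AE:
  fixes f g :: "'a \<Rightarrow> real"
  assumes le: "AE x in M. \<bar>f x\<bar> \<le> g x" and g: "integrable M g"
  shows "\<bar>\<integral>x. f x \<partial>M\<bar> \<le> (\<integral>x. g x \<partial>M)"
proof (cases "integrable M f")
  case True
  have "\<bar>\<integral>x. f x \<partial>M\<bar> \<le> (\<integral>x. \<bar>f x\<bar> \<partial>M)" by (rule integral_abs_bound)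
  also have "\<dots> \<le> (\<integral>x. g x \<partial>M)" by (rule integral_mono_AE) (use True g le in auto)
  finally show ?thesis .
next
  case False
  have "0 \<le> (\<integral>x. g x \<partial>M)"
    by (rule integral_nonneg_AE) (use le in \<open>auto elim!: eventually_mono\<close>)
  then show ?thesis using False by (simp add: not_integrable_integral_eq)
qed

context bounded_open
begin

lemma Hm1I:
  assumes "\<And>u v. u \<in> H10 \<Omega> \<Longrightarrow> v \<in> H10 \<Omega> \<Longrightarrow> g (\<lambda>x. u x + v x) = g u + g v"
    "\<And>c u. u \<in> H10 \<Omega> \<Longrightarrow> g (\<lambda>x. c * u x) = c * g u"
    "\<And>v. v \<in> H10 \<Omega> \<Longrightarrow> \<bar>g v\<bar> \<le> K * V_norm \<Omega> v"
  shows "g \<in> Hm1 \<Omega>"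
  unfolding Hm1_def linear_on_functions_def using assms by (intro CollectI conjI ballI allI exI[of _ K]) auto

lemma Hm1D:
  assumes "g \<in> Hm1 \<Omega>"
  shows "u \<in> H10 \<Omega> \<Longrightarrow> v \<in> H10 \<Omega> \<Longrightarrow> g (\<lambda>x. u x + v x) = g u + g v"
    "u \<in> H10 \<Omega> \<Longrightarrow> g (\<lambda>x. c * u x) = c * g u"
  using assms by (auto simp: Hm1_def linear_on_functions_def)

lemma Hm1_bounded:
  assumes "g \<in> Hm1 \<Omega>"
  obtains K where "K \<ge> 0" "\<And>v. v \<in> H10 \<Omega> \<Longrightarrow> \<bar>g v\<bar> \<le> K * V_norm \<Omega> v"
proof -
  obtain K where K: "\<And>v. v \<in> H10 \<Omega> \<Longrightarrow> \<bar>g v\<bar> \<le> K * V_norm \<Omega> v"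
    using assms by (auto simp: Hm1_def)
  have "\<bar>g v\<bar> \<le> max K 0 * V_norm \<Omega> v" if "v \<in> H10 \<Omega>" for v
    using K[OF that] mult_right_mono[of K "max K 0" "V_norm \<Omega> v"] by simp
  then show thesis by (intro that[of "max K 0"]) auto
qed

lemma Hm1_apply_diff:
  assumes g: "g \<in> Hm1 \<Omega>" and "u \<in> H10 \<Omega>" "v \<in> H10 \<Omega>"
  shows "g (u - v) = g u - g v"
proof -
  have eq: "(\<lambda>x. u x + (-1) * v x) = u - v" by (simp add: fun_eq_iff)
  have "g (u - v) = g u + g (\<lambda>x. (-1) * v x)"
    unfolding eq[symmetric] by (rule Hm1D(1)[OF g assms(2) H10_scale[OF assms(3)]])
  also have "g (\<lambda>x. (-1) * v x) = (-1) * g v" by (rule Hm1D(2)[OF g assms(3)])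
  finally show ?thesis by (simp only: mult_minus1 diff_conv_add_uminus)
qed

lemma Hm1_norm_bound:
  assumes g: "g \<in> Hm1 \<Omega>" and v: "v \<in> H10 \<Omega>"
  shows "\<bar>g v\<bar> \<le> Hm1_norm \<Omega> g * V_norm \<Omega> v"
proof -
  obtain K where K: "K \<ge> 0" "\<And>v. v \<in> H10 \<Omega> \<Longrightarrow> \<bar>g v\<bar> \<le> K * V_norm \<Omega> v"
    using Hm1_bounded[OF g] by metis
  have le: "g u \<le> Hm1_norm \<Omega> g * V_norm \<Omega> u" if u: "u \<in> H10 \<Omega>" for u
  proof (cases "V_norm \<Omega> u > 0")
    case True
    have "g u / V_norm \<Omega> u \<le> Hm1_norm \<Omega> g"
      unfolding Hm1_norm_def
      by (rule dual_norm_ge[where K = K]) (use K True u in \<open>auto intro: order_trans[OF abs_ge_self]\<close>)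
    then show ?thesis using True by (simp add: field_simps)
  next
    case False
    \<comment> \<open>Elements of seminorm 0 are left out of the supremum; the a priori bound forces
      \<open>g\<close> to vanish on them.\<close>
    then have "V_norm \<Omega> u = 0" using V_norm_nonneg[of u] by linarith
    then show ?thesis using K(2)[OF u] by simp
  qed
  have "- g v \<le> Hm1_norm \<Omega> g * V_norm \<Omega> v"
    using le[OF H10_scale[OF v, of "-1"]] Hm1D(2)[OF g v, of "-1"] H1_scale(2)[OF H10_H1[OF v], of "-1"] by simp
  then show ?thesis using le[OF v] by simp
qed

lemma Hm1_scale: "g \<in> Hm1 \<Omega> \<Longrightarrow> (\<lambda>v. c * g v) \<in> Hm1 \<Omega>"
proof -
  assume g: "g \<in> Hm1 \<Omega>"
  then obtain K where K: "K \<ge> 0" "\<And>v. v \<in> H10 \<Omega> \<Longrightarrow> \<bar>g v\<bar> \<le> K * V_norm \<Omega> v"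
    using Hm1_bounded by metis
  show ?thesis
  proof (rule Hm1I[where K = "\<bar>c\<bar> * K"])
    show "\<bar>c * g v\<bar> \<le> \<bar>c\<bar> * K * V_norm \<Omega> v" if "v \<in> H10 \<Omega>" for v
      using mult_left_mono[OF K(2)[OF that], of "\<bar>c\<bar>"] by (simp add: abs_mult)
  qed (simp_all add: Hm1D[OF g] algebra_simps)
qed

lemma Hm1_diff:
  assumes g: "g \<in> Hm1 \<Omega>" and k: "k \<in> Hm1 \<Omega>"
  shows "g - k \<in> Hm1 \<Omega>"
proof -
  obtain K where K: "\<And>v. v \<in> H10 \<Omega> \<Longrightarrow> \<bar>g v\<bar> \<le> K * V_norm \<Omega> v" using Hm1_bounded[OF g] by metis
  obtain L where L: "\<And>v. v \<in> H10 \<Omega> \<Longrightarrow> \<bar>k v\<bar> \<le> L * V_norm \<Omega> v" using Hm1_bounded[OF k] by metis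
  show ?thesis
  proof (rule Hm1I[where K = "K + L"])
    show "\<bar>(g - k) v\<bar> \<le> (K + L) * V_norm \<Omega> v" if "v \<in> H10 \<Omega>" for v
      using K[OF that] L[OF that] by (simp add: distrib_right)
  qed (simp_all add: Hm1D[OF g] Hm1D[OF k] algebra_simps)
qed

lemma integral_functional_Hm1:
  assumes f: "f \<in> L2 \<Omega>"
  shows "(\<lambda>v. \<integral>x. f x * v x \<partial>lebesgue_on \<Omega>) \<in> Hm1 \<Omega>"
proof -
  obtain K where K: "\<And>v. v \<in> H10 \<Omega> \<Longrightarrow> \<bar>\<integral>x. f x * v x \<partial>lebesgue_on \<Omega>\<bar> \<le> K * V_norm \<Omega> v"
    using L2_functional_bounded[OF f] by metis
  show ?thesis
  proof (rule Hm1I[OF _ _ K])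
    fix u v assume "u \<in> H10 \<Omega>" "v \<in> H10 \<Omega>"
    then show "(\<integral>x. f x * (u x + v x) \<partial>lebesgue_on \<Omega>)
        = (\<integral>x. f x * u x \<partial>lebesgue_on \<Omega>) + (\<integral>x. f x * v x \<partial>lebesgue_on \<Omega>)"
      using L2_integrable_mult[OF f H1_L2[OF H10_H1]] by (simp add: distrib_left)
  next
    fix c u
    have "(\<integral>x. f x * (c * u x) \<partial>lebesgue_on \<Omega>) = (\<integral>x. c * (f x * u x) \<partial>lebesgue_on \<Omega>)"
      by (simp add: mult.left_commute)
    then show "(\<integral>x. f x * (c * u x) \<partial>lebesgue_on \<Omega>) = c * (\<integral>x. f x * u x \<partial>lebesgue_on \<Omega>)"
      by simp
  qed
qed

lemma Y_space_simple_approx: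
  assumes "v \<in> Y_space \<Omega>"
  shows "AE t in lebesgue_on \<Xi>. v t \<in> H10 \<Omega>"
    "\<exists>s. (\<forall>n. simple_function (lebesgue_on \<Xi>) (s n) \<and> s n ` \<Xi> \<subseteq> H10 \<Omega>) \<and>
      (AE t in lebesgue_on \<Xi>. (\<lambda>n. V_norm \<Omega> (s n t - v t)) \<longlonglongrightarrow> 0)"
  using assms unfolding Y_space_def bochner_L2_def by blast+

lemma Y_space_integrable:
  assumes "v \<in> Y_space \<Omega>"
  shows "integrable (lebesgue_on \<Xi>) (\<lambda>t. (V_norm \<Omega> (v t))\<^sup>2)"
    and "(\<lambda>t. V_norm \<Omega> (v t)) \<in> borel_measurable (lebesgue_on \<Xi>)"
proof -
  show i: "integrable (lebesgue_on \<Xi>) (\<lambda>t. (V_norm \<Omega> (v t))\<^sup>2)"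
    using assms by (simp add: Y_space_def bochner_L2_def)
  have "(\<lambda>t. sqrt ((V_norm \<Omega> (v t))\<^sup>2)) \<in> borel_measurable (lebesgue_on \<Xi>)"
    by (rule measurable_compose[OF borel_measurable_integrable[OF i] borel_measurable_sqrt])
  then show "(\<lambda>t. V_norm \<Omega> (v t)) \<in> borel_measurable (lebesgue_on \<Xi>)" by simp
qed

lemma Y_norm_eq: "Y_norm \<Omega> v = sqrt (\<integral>t. (V_norm \<Omega> (v t))\<^sup>2 \<partial>lebesgue_on \<Xi>)"
  by (simp add: Y_norm_def V_norm_def)

lemma Y_norm_nonneg [simp]: "Y_norm \<Omega> v \<ge> 0"
  by (simp add: Y_norm_def)

lemma functional_LIMSEQ:
  assumes g: "g \<in> Hm1 \<Omega>" and u: "u \<in> H10 \<Omega>" "\<And>n. s n \<in> H10 \<Omega>" "(\<lambda>n. V_norm \<Omega> (s n - u)) \<longlonglongrightarrow> 0"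
  shows "(\<lambda>n. g (s n)) \<longlonglongrightarrow> g u"
proof (rule LIM_zero_cancel, rule Lim_null_comparison)
  show "(\<lambda>n. Hm1_norm \<Omega> g * V_norm \<Omega> (s n - u)) \<longlonglongrightarrow> 0"
    using tendsto_mult_left[OF u(3), of "Hm1_norm \<Omega> g"] by simp
  have "norm (g (s n) - g u) \<le> Hm1_norm \<Omega> g * V_norm \<Omega> (s n - u)" for n
    using Hm1_norm_bound[OF g H10_diff[OF u(2) u(1)], of n] Hm1_apply_diff[OF g u(2) u(1), of n] by simp
  then show "\<forall>\<^sub>F n in sequentially. norm (g (s n) - g u) \<le> Hm1_norm \<Omega> g * V_norm \<Omega> (s n - u)" by simp
qed

lemma Y_functional_measurable:
  assumes g: "g \<in> Hm1 \<Omega>" and v: "v \<in> Y_space \<Omega>"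
  shows "(\<lambda>t. g (v t)) \<in> borel_measurable (lebesgue_on \<Xi>)"
proof -
  obtain s where s': "\<forall>n. simple_function (lebesgue_on \<Xi>) (s n) \<and> s n ` \<Xi> \<subseteq> H10 \<Omega>"
    "AE t in lebesgue_on \<Xi>. (\<lambda>n. V_norm \<Omega> (s n t - v t)) \<longlonglongrightarrow> 0"
    using Y_space_simple_approx(2)[OF v] by blast
  have s: "AE t in lebesgue_on \<Xi>. v t \<in> H10 \<Omega>"
    "\<And>n. simple_function (lebesgue_on \<Xi>) (s n)" "\<And>n t. t \<in> \<Xi> \<Longrightarrow> s n t \<in> H10 \<Omega>"
    "AE t in lebesgue_on \<Xi>. (\<lambda>n. V_norm \<Omega> (s n t - v t)) \<longlonglongrightarrow> 0"
    using Y_space_simple_approx(1)[OF v] s' by blast+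
  show ?thesis
  proof (rule borel_measurable_LIMSEQ_AE_lebesgue_on[of _ "\<lambda>n t. g (s n t)"])
    show "(\<lambda>t. g (s n t)) \<in> borel_measurable (lebesgue_on \<Xi>)" for n
      using simple_function_compose[OF s(2)[of n], of g] by (intro borel_measurable_simple_function) (simp add: comp_def)
    show "AE t in lebesgue_on \<Xi>. (\<lambda>n. g (s n t)) \<longlonglongrightarrow> g (v t)"
      using s(1,4) AE_space
    proof eventually_elim
      case (elim t)
      show ?case by (rule functional_LIMSEQ[OF g elim(1) s(3) elim(2)]) (use elim(3) in simp)
    qed
  qed simp
qed

text \<open>Cauchy-Schwarz in time. The bound \<open>K\<close> is a parameter rather than the dual
  norm of \<open>g\<close>, so that the small constant for the difference of the two hat functionals
  can be inserted.\<close>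

lemma Y_functional_integral_le:
  assumes v: "v \<in> Y_space \<Omega>" and K: "K \<ge> 0" "\<And>u. u \<in> H10 \<Omega> \<Longrightarrow> \<bar>g u\<bar> \<le> K * V_norm \<Omega> u"
    and \<psi>: "\<psi> \<in> borel_measurable (lebesgue_on \<Xi>)" "integrable (lebesgue_on \<Xi>) (\<lambda>t. (\<psi> t)\<^sup>2)"
  shows "\<bar>\<integral>t. \<psi> t * g (v t) \<partial>lebesgue_on \<Xi>\<bar> \<le> K * sqrt (\<integral>t. (\<psi> t)\<^sup>2 \<partial>lebesgue_on \<Xi>) * Y_norm \<Omega> v"
proof -
  have vH: "AE t in lebesgue_on \<Xi>. v t \<in> H10 \<Omega>"
    using v by (simp add: Y_space_def bochner_L2_def)
  note vi = Y_space_integrable[OF v]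
  have a\<psi>: "(\<lambda>t. \<bar>\<psi> t\<bar>) \<in> borel_measurable (lebesgue_on \<Xi>)" "integrable (lebesgue_on \<Xi>) (\<lambda>t. \<bar>\<psi> t\<bar>\<^sup>2)"
    using \<psi> by auto
  have "\<bar>\<integral>t. \<psi> t * g (v t) \<partial>lebesgue_on \<Xi>\<bar> \<le> (\<integral>t. K * (\<bar>\<psi> t\<bar> * V_norm \<Omega> (v t)) \<partial>lebesgue_on \<Xi>)"
  proof (rule abs_integral_le_AE)
    show "AE t in lebesgue_on \<Xi>. \<bar>\<psi> t * g (v t)\<bar> \<le> K * (\<bar>\<psi> t\<bar> * V_norm \<Omega> (v t))"
      using vH
    proof eventually_elim
      case (elim t)
      show ?case using mult_left_mono[OF K(2)[OF elim], of "\<bar>\<psi> t\<bar>"] by (simp add: abs_mult mult_ac)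
    qed
    show "integrable (lebesgue_on \<Xi>) (\<lambda>t. K * (\<bar>\<psi> t\<bar> * V_norm \<Omega> (v t)))"
      by (intro integrable_mult_right integrable_mult_of_squares a\<psi> vi)
  qed
  also have "\<dots> = K * (\<integral>t. \<bar>\<psi> t\<bar> * V_norm \<Omega> (v t) \<partial>lebesgue_on \<Xi>)" by simp
  also have "\<dots> \<le> K * (sqrt (\<integral>t. \<bar>\<psi> t\<bar>\<^sup>2 \<partial>lebesgue_on \<Xi>) * sqrt (\<integral>t. (V_norm \<Omega> (v t))\<^sup>2 \<partial>lebesgue_on \<Xi>))"
    by (intro mult_left_mono order_trans[OF abs_ge_self Cauchy_Schwarz_integral] a\<psi> vi K)
  finally show ?thesis by (simp add: Y_norm_eq)
qed

lemma A_op_le: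
  assumes A: "M \<ge> 0" "AE t in lebesgue_on \<Xi>. \<forall>u\<in>H10 \<Omega>. \<forall>v\<in>H10 \<Omega>. \<bar>A t u v\<bar> \<le> M * V_norm \<Omega> u * V_norm \<Omega> v"
    and w: "w \<in> Y_space \<Omega>" and v: "v \<in> Y_space \<Omega>"
  shows "\<bar>A_op A w v\<bar> \<le> M * Y_norm \<Omega> w * Y_norm \<Omega> v"
proof -
  have H: "AE t in lebesgue_on \<Xi>. v t \<in> H10 \<Omega>" "AE t in lebesgue_on \<Xi>. w t \<in> H10 \<Omega>"
    using v w by (simp_all add: Y_space_def bochner_L2_def)
  note i = Y_space_integrable[OF w] Y_space_integrable[OF v]
  have "\<bar>A_op A w v\<bar> \<le> (\<integral>t. M * (V_norm \<Omega> (w t) * V_norm \<Omega> (v t)) \<partial>lebesgue_on \<Xi>)"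
    unfolding A_op_def
  proof (rule abs_integral_le_AE)
    show "AE t in lebesgue_on \<Xi>. \<bar>A t (w t) (v t)\<bar> \<le> M * (V_norm \<Omega> (w t) * V_norm \<Omega> (v t))"
      using A(2) H by eventually_elim (simp add: mult.assoc)
    show "integrable (lebesgue_on \<Xi>) (\<lambda>t. M * (V_norm \<Omega> (w t) * V_norm \<Omega> (v t)))"
      by (intro integrable_mult_right integrable_mult_of_squares i)
  qed
  also have "\<dots> = M * (\<integral>t. V_norm \<Omega> (w t) * V_norm \<Omega> (v t) \<partial>lebesgue_on \<Xi>)" by simp
  also have "\<dots> \<le> M * (sqrt (\<integral>t. (V_norm \<Omega> (w t))\<^sup>2 \<partial>lebesgue_on \<Xi>) * sqrt (\<integral>t. (V_norm \<Omega> (v t))\<^sup>2 \<partial>lebesgue_on \<Xi>))"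
    by (intro mult_left_mono order_trans[OF abs_ge_self Cauchy_Schwarz_integral] i A(1))
  finally show ?thesis by (simp add: Y_norm_eq mult.assoc)
qed

lemma tensor_Y_space:
  assumes u: "u \<in> H10 \<Omega>" and \<psi>: "\<psi> \<in> borel_measurable (lebesgue_on \<Xi>)" "integrable (lebesgue_on \<Xi>) (\<lambda>t. (\<psi> t)\<^sup>2)"
  shows "(\<lambda>t x. \<psi> t * u x) \<in> Y_space \<Omega>"
    and "Y_norm \<Omega> (\<lambda>t x. \<psi> t * u x) = sqrt (\<integral>t. (\<psi> t)\<^sup>2 \<partial>lebesgue_on \<Xi>) * V_norm \<Omega> u"
proof -
  have V: "V_norm \<Omega> (\<lambda>x. c * u x) = \<bar>c\<bar> * V_norm \<Omega> u" for c
    by (rule H1_scale(2)[OF H10_H1[OF u]])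
  show "Y_norm \<Omega> (\<lambda>t x. \<psi> t * u x) = sqrt (\<integral>t. (\<psi> t)\<^sup>2 \<partial>lebesgue_on \<Xi>) * V_norm \<Omega> u"
    by (simp add: Y_norm_eq V power_mult_distrib real_sqrt_mult)
  obtain F where "\<forall>n. simple_function (lebesgue_on \<Xi>) (F n)"
    "\<forall>t\<in>space (lebesgue_on \<Xi>). (\<lambda>n. F n t) \<longlonglongrightarrow> \<psi> t"
    using borel_measurable_implies_sequence_metric[OF \<psi>(1), of 0] by blast
  then have F: "\<And>n. simple_function (lebesgue_on \<Xi>) (F n)"
    "\<And>t. t \<in> space (lebesgue_on \<Xi>) \<Longrightarrow> (\<lambda>n. F n t) \<longlonglongrightarrow> \<psi> t" by blast+
  have d: "(\<lambda>x. F n t * u x) - (\<lambda>x. \<psi> t * u x) = (\<lambda>x. (F n t - \<psi> t) * u x)" for n t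
    by (auto simp: fun_diff_def left_diff_distrib)
  show "(\<lambda>t x. \<psi> t * u x) \<in> Y_space \<Omega>"
    unfolding Y_space_def bochner_L2_def mem_Collect_eq
  proof (intro conjI exI[of _ "\<lambda>n t x. F n t * u x"] allI)
    show "simple_function (lebesgue_on \<Xi>) (\<lambda>t x. F n t * u x)" for n
      using simple_function_compose[OF F(1)[of n], of "\<lambda>c x. c * u x"] by (simp add: comp_def)
    show "AE t in lebesgue_on \<Xi>. (\<lambda>n. V_norm \<Omega> ((\<lambda>x. F n t * u x) - (\<lambda>x. \<psi> t * u x))) \<longlonglongrightarrow> 0"
      using AE_space
    proof eventually_elim
      case (elim t)
      then have "(\<lambda>n. \<bar>F n t - \<psi> t\<bar> * V_norm \<Omega> u) \<longlonglongrightarrow> \<bar>\<psi> t - \<psi> t\<bar> * V_norm \<Omega> u"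
        by (intro tendsto_intros F(2))
      then show ?case by (simp add: d V)
    qed
    show "integrable (lebesgue_on \<Xi>) (\<lambda>t. (V_norm \<Omega> (\<lambda>x. \<psi> t * u x))\<^sup>2)"
      using \<psi>(2) by (simp add: V power_mult_distrib)
  qed (use H10_scale[OF u] in auto)
qed

subsection \<open>Uniqueness of the weak time derivative\<close>

text \<open>Evaluation at a fixed \<open>\<eta>\<close> is continuous on the dual space, so
  measurability passes from the simple approximants to the limit; square integrability suffices
  because the time interval has finite measure.\<close>

lemma bochner_Hm1_integrable:
  assumes g: "g \<in> bochner_L2 \<Xi> (Hm1 \<Omega>) (Hm1_norm \<Omega>)" and \<eta>: "\<eta> \<in> H10 \<Omega>"
  shows "integrable (lebesgue_on \<Xi>) (\<lambda>t. g t \<eta>)"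
proof -
  have gH: "AE t in lebesgue_on \<Xi>. g t \<in> Hm1 \<Omega>"
    and i: "integrable (lebesgue_on \<Xi>) (\<lambda>t. (Hm1_norm \<Omega> (g t))\<^sup>2)"
    using g unfolding bochner_L2_def by blast+
  obtain s where s': "\<forall>n. simple_function (lebesgue_on \<Xi>) (s n) \<and> s n ` \<Xi> \<subseteq> Hm1 \<Omega>"
    "AE t in lebesgue_on \<Xi>. (\<lambda>n. Hm1_norm \<Omega> (s n t - g t)) \<longlonglongrightarrow> 0"
    using g unfolding bochner_L2_def by blast
  then have s: "\<And>n. simple_function (lebesgue_on \<Xi>) (s n)" "\<And>n t. t \<in> \<Xi> \<Longrightarrow> s n t \<in> Hm1 \<Omega>"
    "AE t in lebesgue_on \<Xi>. (\<lambda>n. Hm1_norm \<Omega> (s n t - g t)) \<longlonglongrightarrow> 0"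
    by blast+
  have m: "(\<lambda>t. g t \<eta>) \<in> borel_measurable (lebesgue_on \<Xi>)"
  proof (rule borel_measurable_LIMSEQ_AE_lebesgue_on[of _ "\<lambda>n t. s n t \<eta>"])
    show "(\<lambda>t. s n t \<eta>) \<in> borel_measurable (lebesgue_on \<Xi>)" for n
      using simple_function_compose[OF s(1)[of n], of "\<lambda>g. g \<eta>"]
      by (intro borel_measurable_simple_function) (simp add: comp_def)
    show "AE t in lebesgue_on \<Xi>. (\<lambda>n. s n t \<eta>) \<longlonglongrightarrow> g t \<eta>"
      using gH s(3) AE_space
    proof eventually_elim
      case (elim t)
      show ?case
      proof (rule LIM_zero_cancel, rule Lim_null_comparison)
        show "(\<lambda>n. Hm1_norm \<Omega> (s n t - g t) * V_norm \<Omega> \<eta>) \<longlonglongrightarrow> 0"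
          using tendsto_mult_right[OF elim(2), of "V_norm \<Omega> \<eta>"] by simp
        have "norm (s n t \<eta> - g t \<eta>) \<le> Hm1_norm \<Omega> (s n t - g t) * V_norm \<Omega> \<eta>" for n
          using Hm1_norm_bound[OF Hm1_diff[OF s(2) elim(1)] \<eta>, of t n] elim(3) by simp
        then show "\<forall>\<^sub>F n in sequentially. norm (s n t \<eta> - g t \<eta>) \<le> Hm1_norm \<Omega> (s n t - g t) * V_norm \<Omega> \<eta>" by simp
      qed
    qed
  qed simp
  interpret finite_measure "lebesgue_on \<Xi>" by (rule finite_measure_Xi)
  have "integrable (lebesgue_on \<Xi>) (\<lambda>t. (1 + (Hm1_norm \<Omega> (g t))\<^sup>2) * V_norm \<Omega> \<eta>)"
    using i by simp
  then show ?thesis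
  proof (rule Bochner_Integration.integrable_bound[OF _ m])
    show "AE t in lebesgue_on \<Xi>. norm (g t \<eta>) \<le> norm ((1 + (Hm1_norm \<Omega> (g t))\<^sup>2) * V_norm \<Omega> \<eta>)"
      using gH
    proof eventually_elim
      case (elim t)
      have "2 * Hm1_norm \<Omega> (g t) \<le> 1 + (Hm1_norm \<Omega> (g t))\<^sup>2"
        using zero_le_power2[of "Hm1_norm \<Omega> (g t) - 1"] by (simp add: power2_diff)
      moreover have "Hm1_norm \<Omega> (g t) \<ge> 0" by (simp add: Hm1_norm_def)
      ultimately have "Hm1_norm \<Omega> (g t) \<le> 1 + (Hm1_norm \<Omega> (g t))\<^sup>2" by linarith
      then have "\<bar>g t \<eta>\<bar> \<le> (1 + (Hm1_norm \<Omega> (g t))\<^sup>2) * V_norm \<Omega> \<eta>"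
        by (intro order_trans[OF Hm1_norm_bound[OF elim \<eta>]] mult_right_mono) auto
      then show ?case by (simp add: abs_mult)
    qed
  qed
qed

text \<open>The exceptional null set of times depends on the test function; it is made uniform over the
  countably many values of the simple functions approximating \<open>v\<close>.\<close>

lemma weak_time_derivative_unique:
  assumes g: "is_weak_time_derivative \<Omega> w g" and k: "is_weak_time_derivative \<Omega> w k" and v: "v \<in> Y_space \<Omega>"
  shows "AE t in lebesgue_on \<Xi>. g t (v t) = k t (v t)"
proof -
  have gB: "g \<in> bochner_L2 \<Xi> (Hm1 \<Omega>) (Hm1_norm \<Omega>)" and kB: "k \<in> bochner_L2 \<Xi> (Hm1 \<Omega>) (Hm1_norm \<Omega>)"
    using g k by (auto simp: is_weak_time_derivative_def)
  have gH: "AE t in lebesgue_on \<Xi>. g t \<in> Hm1 \<Omega>" "AE t in lebesgue_on \<Xi>. k t \<in> Hm1 \<Omega>"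
    using gB kB by (auto simp: bochner_L2_def)
  have fixed: "AE t in lebesgue_on \<Xi>. g t \<eta> = k t \<eta>" if \<eta>: "\<eta> \<in> H10 \<Omega>" for \<eta>
  proof -
    note ig = bochner_Hm1_integrable[OF gB \<eta>] and ik = bochner_Hm1_integrable[OF kB \<eta>]
    have "AE t in lebesgue_on \<Xi>. g t \<eta> - k t \<eta> = 0"
    proof (rule fundamental_lemma_calculus_of_variations)
      show "integrable (lebesgue_on \<Xi>) (\<lambda>t. g t \<eta> - k t \<eta>)" using ig ik by simp
      fix \<theta> :: "real \<Rightarrow> real" assume \<theta>: "\<theta> \<in> test_functions \<Xi>"
      note \<theta>' = test_functionsD[OF \<theta>]
      obtain B where B: "\<And>t. norm (\<theta> t) \<le> B"
        using bounded_range_compact_support[where F = \<theta> and S = "supp \<theta>", OF smooth_continuous[OF \<theta>'(1)] \<theta>'(2)]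
          eq_0_outside_supp[of _ \<theta>] by metis
      have m: "\<theta> \<in> borel_measurable (lebesgue_on \<Xi>)"
        by (rule continuous_borel_measurable_lebesgue_on[OF smooth_continuous[OF \<theta>'(1)]])
      have i: "integrable (lebesgue_on \<Xi>) (\<lambda>t. f t * \<theta> t)" if f: "integrable (lebesgue_on \<Xi>) f" for f :: "real \<Rightarrow> real"
      proof (rule Bochner_Integration.integrable_bound)
        show "integrable (lebesgue_on \<Xi>) (\<lambda>t. \<bar>f t\<bar> * B)" using f by simp
        show "(\<lambda>t. f t * \<theta> t) \<in> borel_measurable (lebesgue_on \<Xi>)" using f m by simp
        have "norm (f t * \<theta> t) \<le> norm (\<bar>f t\<bar> * B)" for t
        proof -
          have "norm (f t * \<theta> t) = \<bar>f t\<bar> * norm (\<theta> t)" by (simp add: abs_mult)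
          also have "\<dots> \<le> \<bar>f t\<bar> * B" by (intro mult_left_mono B) simp
          also have "\<dots> \<le> norm (\<bar>f t\<bar> * B)" by simp
          finally show ?thesis .
        qed
        then show "AE t in lebesgue_on \<Xi>. norm (f t * \<theta> t) \<le> norm (\<bar>f t\<bar> * B)" by simp
      qed
      have "(\<integral>t. (g t \<eta> - k t \<eta>) * \<theta> t \<partial>lebesgue_on \<Xi>)
          = (\<integral>t. g t \<eta> * \<theta> t \<partial>lebesgue_on \<Xi>) - (\<integral>t. k t \<eta> * \<theta> t \<partial>lebesgue_on \<Xi>)"
        using i[OF ig] i[OF ik] by (simp add: left_diff_distrib)
      also have "\<dots> = 0"
        using g k \<theta> \<eta> by (simp add: is_weak_time_derivative_def mult.commute[of _ "\<theta> _"])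
      finally show "(\<integral>t. (g t \<eta> - k t \<eta>) * \<theta> t \<partial>lebesgue_on \<Xi>) = 0" .
    qed simp
    then show ?thesis by eventually_elim simp
  qed
  obtain s where s': "\<forall>n. simple_function (lebesgue_on \<Xi>) (s n) \<and> s n ` \<Xi> \<subseteq> H10 \<Omega>"
    "AE t in lebesgue_on \<Xi>. (\<lambda>n. V_norm \<Omega> (s n t - v t)) \<longlonglongrightarrow> 0"
    using Y_space_simple_approx(2)[OF v] by blast
  have s: "AE t in lebesgue_on \<Xi>. v t \<in> H10 \<Omega>"
    "\<And>n. simple_function (lebesgue_on \<Xi>) (s n)" "\<And>n t. t \<in> \<Xi> \<Longrightarrow> s n t \<in> H10 \<Omega>"
    "AE t in lebesgue_on \<Xi>. (\<lambda>n. V_norm \<Omega> (s n t - v t)) \<longlonglongrightarrow> 0"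
    using Y_space_simple_approx(1)[OF v] s' by blast+
  define D where "D = (\<Union>n. s n ` \<Xi>)"
  have fin: "finite (s n ` \<Xi>)" for n using s(2)[of n] by (simp add: simple_function_def)
  have D: "countable D" unfolding D_def by (rule countable_UN) (simp_all add: countable_finite[OF fin])
  have "AE t in lebesgue_on \<Xi>. \<forall>\<eta>\<in>D. g t \<eta> = k t \<eta>"
    unfolding AE_ball_countable[OF D]
  proof
    fix \<eta> assume "\<eta> \<in> D"
    then have "\<eta> \<in> H10 \<Omega>" using s(3) by (auto simp: D_def)
    then show "AE t in lebesgue_on \<Xi>. g t \<eta> = k t \<eta>" by (rule fixed)
  qed
  then show ?thesis
    using s(1,4) gH AE_space
  proof eventually_elim
    case (elim t)
    then have t: "t \<in> \<Xi>" by simp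
    have "(\<lambda>n. g t (s n t)) \<longlonglongrightarrow> g t (v t)"
      by (rule functional_LIMSEQ[OF elim(4) elim(2) s(3)[OF t] elim(3)])
    moreover have "(\<lambda>n. k t (s n t)) \<longlonglongrightarrow> k t (v t)"
      by (rule functional_LIMSEQ[OF elim(5) elim(2) s(3)[OF t] elim(3)])
    moreover have "g t (s n t) = k t (s n t)" for n
      using elim(1) t by (auto simp: D_def)
    ultimately show ?case using LIMSEQ_unique by simp
  qed
qed

text \<open>At time \<open>t\<close> only the set of knots below \<open>t\<close> matters, and there
  are finitely many such sets.\<close>

lemma finite_range_osc': "finite (range (osc' m h))"
proof -
  have "osc' m h t = (\<Sum>i\<in>{i. i \<le> m \<and> real i * h < t}. (-1) ^ i * real (m choose i))" for t
    unfolding osc'_def by (rule sum.mono_neutral_cong_right) auto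
  then have "range (osc' m h) \<subseteq> (\<lambda>I. \<Sum>i\<in>I. (-1) ^ i * real (m choose i)) ` Pow {..m}"
    by auto
  then show ?thesis by (rule finite_subset) simp
qed

lemma osc_weak_time_derivative:
  assumes m: "m \<ge> 2" "h > 0" "real m * h \<le> 1" and u: "u \<in> H10 \<Omega>"
  shows "is_weak_time_derivative \<Omega> (\<lambda>t x. osc m h t * u x)
    (\<lambda>t \<eta>. osc' m h t * (\<integral>x. u x * \<eta> x \<partial>lebesgue_on \<Omega>))"
  unfolding is_weak_time_derivative_def
proof (intro conjI ballI)
  define F where "F \<eta> = (\<integral>x. u x * \<eta> x \<partial>lebesgue_on \<Omega>)" for \<eta>
  have F: "F \<in> Hm1 \<Omega>"
    unfolding F_def by (rule integral_functional_Hm1[OF H1_L2[OF H10_H1[OF u]]])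
  have simp_osc: "simple_function (lebesgue_on \<Xi>) (osc' m h)"
    by (rule simple_function_borel_measurable[OF measurable_Xi[OF osc'_measurable]])
      (rule finite_subset[OF _ finite_range_osc'], auto)
  show "(\<lambda>t \<eta>. osc' m h t * (\<integral>x. u x * \<eta> x \<partial>lebesgue_on \<Omega>)) \<in> bochner_L2 \<Xi> (Hm1 \<Omega>) (Hm1_norm \<Omega>)"
    unfolding F_def[symmetric] bochner_L2_def mem_Collect_eq
  \<comment> \<open>As \<open>osc'\<close> takes finitely many values, the map is itself simple, and
    a constant sequence approximates it.\<close>
  proof (intro conjI exI[of _ "\<lambda>n t \<eta>. osc' m h t * F \<eta>"] allI)
    show "simple_function (lebesgue_on \<Xi>) (\<lambda>t \<eta>. osc' m h t * F \<eta>)"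
      using simple_function_compose[OF simp_osc, of "\<lambda>c \<eta>. c * F \<eta>"] by (simp add: comp_def)
    have "Hm1_norm \<Omega> (\<lambda>\<eta>. osc' m h t * F \<eta> - osc' m h t * F \<eta>) = 0" for t
    proof (rule antisym)
      show "Hm1_norm \<Omega> (\<lambda>\<eta>. osc' m h t * F \<eta> - osc' m h t * F \<eta>) \<le> 0"
        unfolding Hm1_norm_def by (rule dual_norm_le) auto
    qed (simp add: Hm1_norm_def)
    then show "AE t in lebesgue_on \<Xi>. (\<lambda>n. Hm1_norm \<Omega> ((\<lambda>\<eta>. osc' m h t * F \<eta>) - (\<lambda>\<eta>. osc' m h t * F \<eta>))) \<longlonglongrightarrow> 0"
      by (simp add: fun_diff_def)
    have sN: "simple_function (lebesgue_on \<Xi>) (\<lambda>t. (Hm1_norm \<Omega> (\<lambda>\<eta>. osc' m h t * F \<eta>))\<^sup>2)"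
      using simple_function_compose[OF simp_osc, of "\<lambda>c. (Hm1_norm \<Omega> (\<lambda>\<eta>. c * F \<eta>))\<^sup>2"] by (simp add: comp_def)
    have "bounded ((\<lambda>c. (Hm1_norm \<Omega> (\<lambda>\<eta>. c * F \<eta>))\<^sup>2) ` range (osc' m h))"
      by (intro finite_imp_bounded finite_imageI finite_range_osc')
    then obtain B where "\<And>t. \<bar>(Hm1_norm \<Omega> (\<lambda>\<eta>. osc' m h t * F \<eta>))\<^sup>2\<bar> \<le> B"
      unfolding bounded_iff by auto
    then show "integrable (lebesgue_on \<Xi>) (\<lambda>t. (Hm1_norm \<Omega> (\<lambda>\<eta>. osc' m h t * F \<eta>))\<^sup>2)"
      by (intro integrable_Xi_bounded borel_measurable_simple_function sN)
  qed (use Hm1_scale[OF F] in auto)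
  fix \<theta> \<eta> assume \<theta>: "\<theta> \<in> test_functions \<Xi>" and "\<eta> \<in> H10 \<Omega>"
  have "(\<integral>t. deriv \<theta> t * (\<integral>x. osc m h t * u x * \<eta> x \<partial>lebesgue_on \<Omega>) \<partial>lebesgue_on \<Xi>)
      = (\<integral>t. deriv \<theta> t * osc m h t * F \<eta> \<partial>lebesgue_on \<Xi>)"
    by (simp add: F_def mult.assoc)
  also have "\<dots> = - ((\<integral>t. \<theta> t * osc' m h t \<partial>lebesgue_on \<Xi>) * F \<eta>)"
    using osc_integration_by_parts[OF m \<theta>] by simp
  also have "\<dots> = - (\<integral>t. \<theta> t * (osc' m h t * F \<eta>) \<partial>lebesgue_on \<Xi>)"
    by (simp flip: mult.assoc)
  finally show "(\<integral>t. deriv \<theta> t * (\<integral>x. osc m h t * u x * \<eta> x \<partial>lebesgue_on \<Omega>) \<partial>lebesgue_on \<Xi>)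
      = - (\<integral>t. \<theta> t * (osc' m h t * (\<integral>x. u x * \<eta> x \<partial>lebesgue_on \<Omega>)) \<partial>lebesgue_on \<Xi>)"
    by (simp add: F_def)
qed

text \<open>\<open>time_derivative\<close> is a choice; existence of the explicit derivative makes
  the chosen one a derivative, and uniqueness along \<open>v\<close> equates the two integrands.
  Measurability of the chosen integrand then follows by completeness.\<close>

lemma dt_op_osc:
  assumes m: "m \<ge> 2" "h > 0" "real m * h \<le> 1" and u: "u \<in> H10 \<Omega>" and v: "v \<in> Y_space \<Omega>"
  shows "dt_op \<Omega> (\<lambda>t x. osc m h t * u x) v
    = (\<integral>t. osc' m h t * (\<integral>x. u x * v t x \<partial>lebesgue_on \<Omega>) \<partial>lebesgue_on \<Xi>)"
proof -
  let ?w = "\<lambda>t x. osc m h t * u x"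
  note d = osc_weak_time_derivative[OF m u]
  have "is_weak_time_derivative \<Omega> ?w (time_derivative \<Omega> ?w)"
    unfolding time_derivative_def by (rule someI[of "is_weak_time_derivative \<Omega> ?w", OF d])
  then have eq: "AE t in lebesgue_on \<Xi>. osc' m h t * (\<integral>x. u x * v t x \<partial>lebesgue_on \<Omega>) = time_derivative \<Omega> ?w t (v t)"
    using weak_time_derivative_unique[OF d _ v] by blast
  have m1: "(\<lambda>t. osc' m h t * (\<integral>x. u x * v t x \<partial>lebesgue_on \<Omega>)) \<in> borel_measurable (lebesgue_on \<Xi>)"
    by (intro borel_measurable_times measurable_Xi osc'_measurable
        Y_functional_measurable[OF integral_functional_Hm1[OF H1_L2[OF H10_H1[OF u]]] v])
  have m2: "(\<lambda>t. time_derivative \<Omega> ?w t (v t)) \<in> borel_measurable (lebesgue_on \<Xi>)"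
    by (rule borel_measurable_AE_lebesgue_on[OF _ m1 eq]) simp
  show ?thesis
    unfolding dt_op_def by (rule integral_cong_AE[OF m1 m2 eq, symmetric])
qed

end

section \<open>The logarithmic failure of the embedding of H1 into continuous functions in two
  dimensions\<close>

section \<open>A test function with logarithmic growth\<close>

lemma grad_unique:
  assumes "(f has_derivative (\<lambda>h. g \<bullet> h)) (at x)" shows "grad f x = g"
  using frechet_derivative_at[OF assms, symmetric] by (simp add: grad_def inner_axis vec_eq_iff)

lemma plateau_exists:
  obtains \<eta> :: "real^2 \<Rightarrow> real" and B where "smooth \<eta>" "\<And>y. norm y \<le> 1 / 2 \<Longrightarrow> \<eta> y = 1"
    "\<And>y. norm y \<ge> 1 \<Longrightarrow> \<eta> y = 0" "B > 0" "\<And>y. norm (grad \<eta> y) \<le> B"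
    "\<And>y. norm y \<le> 1 / 2 \<or> norm y \<ge> 1 \<Longrightarrow> grad \<eta> y = 0"
proof -
  \<comment> \<open>On the unit circle the inner argument \<open>y \<bullet> y - 1 / 4\<close>
    equals 3/4, so dividing by \<open>c\<close> makes the step reach its plateau exactly
    there.\<close>
  define c where "c = flat 0 (3 / 4)"
  have c: "c > 0" by (simp add: c_def flat0_pos_iff)
  define \<eta> :: "real^2 \<Rightarrow> real" where "\<eta> y = 1 - smooth_step (inverse c * flat 0 (y \<bullet> y - 1 / 4))" for y
  have s: "smooth \<eta>"
    unfolding \<eta>_def
    by (intro smooth_diff smooth_const smooth_compose[OF smooth_smooth_step] smooth_mult
        smooth_compose[OF smooth_flat] smooth_inner_self)
  have b: "\<eta> y \<in> {0..1}" for y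
    using smooth_step_bounds[of "inverse c * flat 0 (y \<bullet> y - 1 / 4)"] c flat0_nonneg by (simp add: \<eta>_def)
  have one: "\<eta> y = 1" if "norm y \<le> 1 / 2" for y
  proof -
    have "y \<bullet> y \<le> 1 / 4"
      using power_mono[OF that, of 2] by (simp add: dot_square_norm power2_eq_square)
    then show ?thesis by (simp add: \<eta>_def flat_def)
  qed
  have zero: "\<eta> y = 0" if "norm y \<ge> 1" for y
  proof -
    have "y \<bullet> y \<ge> 1"
      using power_mono[OF that, of 2] by (simp add: dot_square_norm power2_eq_square)
    then have "c \<le> flat 0 (y \<bullet> y - 1 / 4)" unfolding c_def by (intro flat0_mono) simp
    then have "inverse c * flat 0 (y \<bullet> y - 1 / 4) \<ge> 1" using c by (simp add: field_simps)
    then show ?thesis by (simp add: \<eta>_def)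
  qed
  have g0: "grad \<eta> y = 0" if "norm y \<le> 1 / 2 \<or> norm y \<ge> 1" for y
  proof -
    \<comment> \<open>In both regions \<open>\<eta>\<close> attains its global maximum 1 or minimum
      0, so the gradient vanishes, also on the bounding circles.\<close>
    have ext: "(\<forall>z\<in>UNIV. \<eta> z \<le> \<eta> y) \<or> (\<forall>z\<in>UNIV. \<eta> y \<le> \<eta> z)"
      using that one[of y] zero[of y] b by auto
    have "(\<lambda>h. grad \<eta> y \<bullet> h) = (\<lambda>h. 0)"
      using differential_zero_maxmin[OF _ open_UNIV smooth_has_grad[OF s] ext] by simp
    then have "grad \<eta> y \<bullet> grad \<eta> y = 0" by meson
    then show ?thesis by simp
  qed
  obtain B where B: "B \<ge> 0" "\<And>y. norm (grad \<eta> y) \<le> B"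
    by (rule bounded_range_compact_support[where F = "grad \<eta>" and S = "cball 0 1"])
      (use smooth_grad_continuous[OF s] g0 in auto)
  \<comment> \<open>The increment by 1 makes the bound strictly positive.\<close>
  have B1: "norm (grad \<eta> y) \<le> B + 1" for y using B(2)[of y] by simp
  show thesis
    by (rule that[OF s one zero _ B1 g0]) (use B(1) in auto)
qed

lemma norm_sum_power2_single:
  fixes a :: "nat \<Rightarrow> 'a::real_inner"
  assumes "\<And>j k. j \<in> I \<Longrightarrow> k \<in> I \<Longrightarrow> a j \<noteq> 0 \<Longrightarrow> a k \<noteq> 0 \<Longrightarrow> j = k" "finite I"
  shows "(norm (\<Sum>k\<in>I. a k))\<^sup>2 = (\<Sum>k\<in>I. (norm (a k))\<^sup>2)"
proof (cases "\<exists>k\<in>I. a k \<noteq> 0")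
  case True
  then obtain k where k: "k \<in> I" "a k \<noteq> 0" by blast
  then have "a j = 0" if "j \<in> I - {k}" for j using assms(1) that by blast
  then have "(\<Sum>j\<in>I - {k}. a j) = 0" "(\<Sum>j\<in>I - {k}. (norm (a j))\<^sup>2) = 0" by simp_all
  then show ?thesis
    using k(1) assms(2) by (simp add: sum.remove[of I k])
qed simp

text \<open>Since \<open>H\<^sup>1\<close> barely fails to embed into the continuous functions in two dimensions, there is a
  function of height \<open>K\<close> and energy of order \<open>K\<close>: a sum of \<open>K\<close> dilated plateau functions, whose
  gradients have disjoint supports and equal energies.\<close>

lemma log_test_function:
  obtains c where "c > 0"
    "\<And>\<Omega> x0 r K. bounded_open \<Omega> \<Longrightarrow> r > 0 \<Longrightarrow> cball x0 r \<subseteq> \<Omega> \<Longrightarrow>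
      \<exists>v\<in>test_functions \<Omega>. (\<forall>x\<in>cball x0 (r / 2 ^ K). v x = real K) \<and> (V_norm \<Omega> v)\<^sup>2 \<le> c * real K"
proof -
  obtain \<eta> :: "real^2 \<Rightarrow> real" and B where \<eta>: "smooth \<eta>" "\<And>y. norm y \<le> 1 / 2 \<Longrightarrow> \<eta> y = 1"
    "\<And>y. norm y \<ge> 1 \<Longrightarrow> \<eta> y = 0" "B > 0" "\<And>y. norm (grad \<eta> y) \<le> B"
    "\<And>y. norm y \<le> 1 / 2 \<or> norm y \<ge> 1 \<Longrightarrow> grad \<eta> y = 0"
    using plateau_exists by metis
  have main: "\<exists>v\<in>test_functions \<Omega>. (\<forall>x\<in>cball x0 (r / 2 ^ K). v x = real K) \<and> (V_norm \<Omega> v)\<^sup>2 \<le> pi * B\<^sup>2 * real K"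
    if \<Omega>: "bounded_open \<Omega>" and r: "r > 0" "cball x0 r \<subseteq> \<Omega>" for \<Omega> and x0 :: "real^2" and r :: real and K :: nat
  proof -
    interpret bounded_open \<Omega> by (rule \<Omega>)
    \<comment> \<open>Level \<open>k\<close> lives on the ball of radius \<open>r / 2 ^ k\<close>
      and equals 1 on half that radius, hence on the ball of radius \<open>r / 2 ^ K\<close> for all
      \<open>k < K\<close>.\<close>
    define c where "c k = 2 ^ k / r" for k :: nat
    have c: "c k > 0" for k using r by (simp add: c_def)
    define Y where "Y k x = c k *\<^sub>R x + - (c k *\<^sub>R x0)" for k x
    have nY: "norm (Y k x) = c k * dist x0 x" for k x
    proof -
      have "Y k x = c k *\<^sub>R (x - x0)" by (simp add: Y_def algebra_simps)
      then show ?thesis using c[of k] by (simp add: dist_norm norm_minus_commute)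
    qed
    define v where "v x = (\<Sum>k<K. \<eta> (Y k x))" for x
    define a where "a k x = c k *\<^sub>R grad \<eta> (Y k x)" for k x
    have sv: "smooth v"
      unfolding v_def Y_def by (intro smooth_sum smooth_affine \<eta>)
    have gv: "grad v x = (\<Sum>k<K. a k x)" for x
    proof (rule grad_unique)
      have "((\<lambda>x. \<eta> (Y k x)) has_derivative (\<lambda>h. a k x \<bullet> h)) (at x)" for k
      proof -
        have "(Y k has_derivative (\<lambda>h. c k *\<^sub>R h)) (at x)"
          unfolding Y_def by (auto intro!: derivative_eq_intros)
        from has_derivative_compose[OF this smooth_has_grad[OF \<eta>(1)]]
        show ?thesis by (simp add: a_def)
      qed
      then have "((\<lambda>x. \<Sum>k<K. \<eta> (Y k x)) has_derivative (\<lambda>h. \<Sum>k<K. a k x \<bullet> h)) (at x)"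
        by (intro has_derivative_sum)
      then show "(v has_derivative (\<lambda>h. (\<Sum>k<K. a k x) \<bullet> h)) (at x)"
        by (simp add: v_def[abs_def] inner_sum_left)
    qed
    have sup: "supp v \<subseteq> cball x0 r"
      unfolding supp_def
    proof (rule closure_minimal)
      have "v x = 0" if "dist x0 x > r" for x
        unfolding v_def
      proof (rule sum.neutral, rule ballI, rule \<eta>(3))
        fix k
        have "1 \<le> c k * r" using r by (simp add: c_def)
        also have "\<dots> \<le> c k * dist x0 x" using c[of k] that by (intro mult_left_mono) auto
        finally show "1 \<le> norm (Y k x)" by (simp add: nY)
      qed
      then show "{x. v x \<noteq> 0} \<subseteq> cball x0 r" by force
    qed simp
    have vt: "v \<in> test_functions \<Omega>"
    proof (rule test_functionsI[OF sv])
      have "compact (cball x0 r \<inter> supp v)" by (rule compact_Int_closed) (auto simp: supp_def)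
      then show "compact (supp v)" using sup by (simp add: inf_absorb2)
      show "supp v \<subseteq> \<Omega>" using sup r(2) by blast
    qed
    have plateau: "v x = real K" if "x \<in> cball x0 (r / 2 ^ K)" for x
    proof -
      have "\<eta> (Y k x) = 1" if k: "k < K" for k
      proof (rule \<eta>(2))
        have "norm (Y k x) \<le> c k * (r / 2 ^ K)"
          unfolding nY using c[of k] \<open>x \<in> cball x0 (r / 2 ^ K)\<close> by (intro mult_left_mono) auto
        also have "\<dots> = 2 ^ k / 2 ^ K" using r by (simp add: c_def)
        also have "\<dots> \<le> 1 / 2"
          using power_increasing[of "Suc k" K "2::real"] k by (simp add: field_simps)
        finally show "norm (Y k x) \<le> 1 / 2" .
      qed
      then show ?thesis by (simp add: v_def)
    qed
    have sq: "(norm (grad v x))\<^sup>2 = (\<Sum>k<K. (norm (a k x))\<^sup>2)" for x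
      unfolding gv
    proof (rule norm_sum_power2_single)
      \<comment> \<open>A nonzero term confines \<open>c k * dist x0 x\<close> to the open interval
        from 1/2 to 1, and \<open>c\<close> at least doubles from one level to a later one.\<close>
      have lt: False if "j < k" "a j x \<noteq> 0" "a k x \<noteq> 0" for j k
      proof -
        have "\<not> norm (Y j x) \<le> 1 / 2" "\<not> norm (Y k x) \<ge> 1"
          using that \<eta>(6) by (auto simp: a_def)
        then have l: "c j * dist x0 x > 1 / 2" "c k * dist x0 x < 1" by (auto simp: nY)
        have "2 * c j \<le> c k"
          using power_increasing[of "Suc j" k "2::real"] that(1) r by (simp add: c_def divide_right_mono)
        then have "2 * c j * dist x0 x \<le> c k * dist x0 x" by (rule mult_right_mono) simp
        then show False using l by simp
      qed
      fix j k assume "a j x \<noteq> 0" "a k x \<noteq> 0"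
      then show "j = k" using lt[of j k] lt[of k j] by (cases j k rule: linorder_cases) auto
    qed simp
    have ab: "(norm (a k x))\<^sup>2 \<le> (c k)\<^sup>2 * B\<^sup>2 * indicator (cball x0 (1 / c k)) x" for k x
    proof (cases "x \<in> cball x0 (1 / c k)")
      case True
      have "norm (a k x) \<le> c k * B" using c[of k] \<eta>(5) by (simp add: a_def)
      from power_mono[OF this norm_ge_zero, of 2] show ?thesis using True by (simp add: power_mult_distrib)
    next
      case False
      then have "norm (Y k x) \<ge> 1" using c[of k] by (simp add: nY field_simps)
      then have "a k x = 0" using \<eta>(6) by (simp add: a_def)
      then show ?thesis by simp
    qed
    have ca: "continuous_on UNIV (a k)" for k
      unfolding a_def Y_def
      by (intro continuous_on_scaleR continuous_on_const continuous_on_compose2[OF smooth_grad_continuous[OF \<eta>(1)]])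
        (auto intro!: continuous_intros)
    have fin: "emeasure lborel (cball x0 R) < \<infinity>" for R
      by (rule emeasure_bounded_finite) simp
    have ii: "integrable lborel (\<lambda>x. (c k)\<^sup>2 * B\<^sup>2 * indicator (cball x0 (1 / c k)) x :: real)" for k
      using fin by (intro integrable_mult_right integrable_real_indicator) auto
    have ia: "integrable lborel (\<lambda>x. (norm (a k x))\<^sup>2)" for k
    proof (rule Bochner_Integration.integrable_bound[OF ii])
      show "(\<lambda>x. (norm (a k x))\<^sup>2) \<in> borel_measurable lborel"
        using borel_measurable_continuous_onI[OF ca[of k]] by measurable
      show "AE x in lborel. norm ((norm (a k x))\<^sup>2) \<le> norm ((c k)\<^sup>2 * B\<^sup>2 * indicator (cball x0 (1 / c k)) x)"
        using ab by (intro AE_I2) (simp add: abs_mult)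
    qed
    \<comment> \<open>Dilation invariance of the Dirichlet energy in two dimensions: the factor
      \<open>(c k)\<^sup>2\<close> cancels against the area of the ball.\<close>
    have "(\<integral>x. (norm (a k x))\<^sup>2 \<partial>lborel) \<le> pi * B\<^sup>2" for k
    proof -
      have "(\<integral>x. (norm (a k x))\<^sup>2 \<partial>lborel) \<le> (\<integral>x. (c k)\<^sup>2 * B\<^sup>2 * indicator (cball x0 (1 / c k)) x \<partial>lborel)"
        by (rule integral_mono[OF ia ii ab])
      also have "\<dots> = (c k)\<^sup>2 * B\<^sup>2 * (pi * (1 / c k)\<^sup>2)"
        using c[of k] by (simp add: content_cball unit_ball_vol_2)
      also have "\<dots> = pi * B\<^sup>2" using c[of k] by (simp add: power_divide)
      finally show ?thesis .
    qed
    then have "(\<Sum>k<K. \<integral>x. (norm (a k x))\<^sup>2 \<partial>lborel) \<le> (\<Sum>k<K. pi * B\<^sup>2)" by (intro sum_mono)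
    moreover have "(V_norm \<Omega> v)\<^sup>2 = (\<Sum>k<K. \<integral>x. (norm (a k x))\<^sup>2 \<partial>lborel)"
      unfolding V_norm_test[OF vt] sq by (simp add: Bochner_Integration.integral_sum ia sum_nonneg)
    ultimately have "(V_norm \<Omega> v)\<^sup>2 \<le> pi * B\<^sup>2 * real K" by (simp add: mult.commute)
    then show ?thesis using vt plateau by blast
  qed
  show thesis
    by (rule that[of "pi * B\<^sup>2"]) (use \<eta>(4) main in auto)
qed

lemma (in bounded_open) Y_functional_integrable:
  assumes v: "v \<in> Y_space \<Omega>" and g: "g \<in> Hm1 \<Omega>"
    and \<psi>: "\<psi> \<in> borel_measurable (lebesgue_on \<Xi>)" "integrable (lebesgue_on \<Xi>) (\<lambda>t. (\<psi> t)\<^sup>2)"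
  shows "integrable (lebesgue_on \<Xi>) (\<lambda>t. \<psi> t * g (v t))"
proof (rule integrable_mult_of_squares[OF \<psi>(1) Y_functional_measurable[OF g v] \<psi>(2)])
  note m = Y_functional_measurable[OF g v]
  show "integrable (lebesgue_on \<Xi>) (\<lambda>t. (g (v t))\<^sup>2)"
  proof (rule Bochner_Integration.integrable_bound)
    show "integrable (lebesgue_on \<Xi>) (\<lambda>t. (Hm1_norm \<Omega> g)\<^sup>2 * (V_norm \<Omega> (v t))\<^sup>2)"
      using Y_space_integrable(1)[OF v] by simp
    show "(\<lambda>t. (g (v t))\<^sup>2) \<in> borel_measurable (lebesgue_on \<Xi>)" using m by simp
    show "AE t in lebesgue_on \<Xi>. norm ((g (v t))\<^sup>2) \<le> norm ((Hm1_norm \<Omega> g)\<^sup>2 * (V_norm \<Omega> (v t))\<^sup>2)"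
      using Y_space_simple_approx(1)[OF v]
    proof eventually_elim
      case (elim t)
      from power_mono[OF Hm1_norm_bound[OF g elim] abs_ge_zero, of 2] show ?case
        by (simp add: power_mult_distrib)
    qed
  qed
qed

section \<open>Estimates for a single partition, with constants depending only on \<open>C\<close>,
  \<open>c\<close>, \<open>p\<close> and the bound of the operator\<close>

section \<open>Locally refined partitions\<close>

text \<open>One member of the family, with \<open>\<delta>\<close> suppressed and all hidden
  constants merged into \<open>C\<close>. The assumption \<open>small\<close> restricts attention to
  small \<open>H\<close>; it ensures that the ball of radius \<open>3 * C * H\<close>, which
  contains both patches, lies in the domain.\<close>

locale configuration =
  bounded_open \<Omega> + a: hat \<Omega> \<T>\<^sub>\<alpha> \<phi>\<^sub>\<alpha> + b: hat \<Omega> \<T>\<^sub>\<beta> \<phi>\<^sub>\<beta>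
  for \<Omega> :: "(real^2) set" and \<T>\<^sub>\<alpha> \<phi>\<^sub>\<alpha> \<T>\<^sub>\<beta> \<phi>\<^sub>\<beta> +
  fixes \<P> :: "prism set" and p q n :: nat and h H C r :: real and x0 :: "real^2"
  assumes C: "C \<ge> 1" and h: "h > 0" and H: "H > 0" and hH: "h \<le> H / (real p + 2)" and n: "real n * h = H"
    and partition: "prism_partition \<Omega> \<P>" and shape: "shape_regular_isotropic C \<P>"
    and mean: "(\<integral>x. \<phi>\<^sub>\<alpha> x \<partial>lebesgue_on \<Omega>) = (\<integral>x. \<phi>\<^sub>\<beta> x \<partial>lebesgue_on \<Omega>)"
    and mass: "(\<integral>x. \<phi>\<^sub>\<alpha> x \<partial>lebesgue_on \<Omega>) \<ge> H\<^sup>2 / C"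
    and supp\<alpha>: "supp \<phi>\<^sub>\<alpha> \<subseteq> cball x0 (C * H)" and small: "3 * C * H \<le> r" and ball: "cball x0 r \<subseteq> \<Omega>"
    and diam\<beta>: "diameter (supp \<phi>\<^sub>\<beta>) \<le> C * H" and dist: "setdist (supp \<phi>\<^sub>\<alpha>) (supp \<phi>\<^sub>\<beta>) \<le> C * H"
    and coarse: "restrict_partition \<P> ({0..H} \<times> supp \<phi>\<^sub>\<beta>) = (\<lambda>T. ({0..H}, T)) ` \<T>\<^sub>\<beta>"
    and fine: "\<And>I T. (I, T) \<in> restrict_partition \<P> ({0..H} \<times> supp \<phi>\<^sub>\<alpha>) \<Longrightarrow>
      (\<exists>i\<in>{1..n}. I = {(real i - 1) * h .. real i * h}) \<and> (\<exists>T\<^sub>0\<in>\<T>\<^sub>\<alpha>. T \<subseteq> T\<^sub>0) \<and>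
      diameter T \<in> {h / C .. C * h}"
begin

abbreviation "m \<equiv> p + 2"
definition "s = sqrt (\<integral>t. (osc' m h t)\<^sup>2 \<partial>lebesgue_on \<Xi>)"
definition "w t x = osc m h t * \<phi>\<^sub>\<alpha> x"
definition "F\<^sub>\<alpha> v = (\<integral>x. \<phi>\<^sub>\<alpha> x * v x \<partial>lebesgue_on \<Omega>)"
definition "F\<^sub>\<beta> v = (\<integral>x. \<phi>\<^sub>\<beta> x * v x \<partial>lebesgue_on \<Omega>)"

lemma mh_le_H: "real m * h \<le> H"
  using hH by (simp add: field_simps)

lemma supp_nonempty: "supp \<phi>\<^sub>\<alpha> \<noteq> {}" "supp \<phi>\<^sub>\<beta> \<noteq> {}"
proof -
  have "supp \<phi> \<noteq> {}" if "\<phi> z = 1" for \<phi> and z :: "real^2"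
    using that closure_subset[of "{x. \<phi> x \<noteq> 0}"] by (force simp: supp_def)
  then show "supp \<phi>\<^sub>\<alpha> \<noteq> {}" "supp \<phi>\<^sub>\<beta> \<noteq> {}" using a.vertex b.vertex by blast+
qed

text \<open>One \<open>C * H\<close> each for the radius around the first patch, the distance of the
  patches and the diameter of the second.\<close>

lemma supp\<beta>: "supp \<phi>\<^sub>\<beta> \<subseteq> cball x0 (3 * C * H)"
proof
  fix y assume y: "y \<in> supp \<phi>\<^sub>\<beta>"
  obtain u v where uv: "u \<in> supp \<phi>\<^sub>\<alpha>" "v \<in> supp \<phi>\<^sub>\<beta>" "dist u v = setdist (supp \<phi>\<^sub>\<alpha>) (supp \<phi>\<^sub>\<beta>)"
    using setdist_compact_closed[OF a.compact_supp compact_imp_closed[OF b.compact_supp] supp_nonempty] by metis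
  have "dist v y \<le> diameter (supp \<phi>\<^sub>\<beta>)"
    by (rule diameter_bounded_bound[OF compact_imp_bounded[OF b.compact_supp] uv(2) y])
  moreover have "dist x0 u \<le> C * H" using uv(1) supp\<alpha> by auto
  moreover have "dist x0 y \<le> dist x0 u + dist u v + dist v y"
    using dist_triangle[of x0 y u] dist_triangle[of u y v] by linarith
  ultimately show "y \<in> cball x0 (3 * C * H)" using uv(3) dist diam\<beta> by simp
qed

lemma CH_pos: "C * H > 0" using C H by simp

lemma cball_R_subset: "cball x0 (3 * C * H) \<subseteq> \<Omega>"
  using small ball subset_cball[of "3 * C * H" r x0] by blast

lemma supp_\<Omega>: "supp \<phi>\<^sub>\<alpha> \<subseteq> \<Omega>" "supp \<phi>\<^sub>\<beta> \<subseteq> \<Omega>"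
proof -
  have "cball x0 (C * H) \<subseteq> cball x0 (3 * C * H)" using CH_pos by (intro subset_cball) simp
  then show "supp \<phi>\<^sub>\<alpha> \<subseteq> \<Omega>" "supp \<phi>\<^sub>\<beta> \<subseteq> \<Omega>" using supp\<alpha> supp\<beta> cball_R_subset by blast+
qed

lemmas \<alpha>_H10 = a.H10(1)[OF supp_\<Omega>(1)]

lemma prismD:
  assumes "(I, T) \<in> \<P>"
  shows "2 simplex T" "\<exists>l u. l < u \<and> I = {l..u}" "I \<subseteq> {0..1}"
  using assms partition by (auto simp: prism_partition_def is_prism_def)

lemma coarse_prism: "T \<in> \<T>\<^sub>\<beta> \<Longrightarrow> ({0..H}, T) \<in> \<P>"
  using coarse by (auto simp: restrict_partition_def)

text \<open>The patch of the second hat function is nonempty, so the partition of the unit time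
  interval contains a prism with time interval \<open>{0..H}\<close>.\<close>

lemma H_le_1: "H \<le> 1"
proof -
  have "\<T>\<^sub>\<beta> \<noteq> {}" using b.vertex by auto
  then obtain T where "T \<in> \<T>\<^sub>\<beta>" by blast
  from prismD(3)[OF coarse_prism[OF this]] show ?thesis using H by auto
qed

lemma mh_le_1: "real m * h \<le> 1" using mh_le_H H_le_1 by linarith

lemma h_lt_1: "h < 1"
proof -
  have "2 * h \<le> real m * h" using h by (intro mult_right_mono) auto
  then show ?thesis using mh_le_1 h by linarith
qed

lemma m2: "m \<ge> 2" by simp

lemma s_square: "s\<^sup>2 = (\<integral>t. (osc' m h t)\<^sup>2 \<partial>lebesgue_on \<Xi>)"
  by (simp add: s_def)

lemma s_pos: "s > 0"
proof -
  have "0 < (\<integral>t. (osc' m h t)\<^sup>2 \<partial>lebesgue_on \<Xi>)"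
    using osc'_square_integral_ge(2)[OF h, of m] h_lt_1 h by linarith
  then show ?thesis by (simp only: s_def real_sqrt_gt_0_iff)
qed

lemma osc'_L2: "osc' m h \<in> borel_measurable (lebesgue_on \<Xi>)" "integrable (lebesgue_on \<Xi>) (\<lambda>t. (osc' m h t)\<^sup>2)"
  using measurable_Xi[OF osc'_measurable] osc'_square_integral_ge(1)[OF h] h_lt_1 by auto

lemma osc_L2: "osc m h \<in> borel_measurable (lebesgue_on \<Xi>)" "integrable (lebesgue_on \<Xi>) (\<lambda>t. (osc m h t)\<^sup>2)"
  using continuous_borel_measurable_lebesgue_on[OF continuous_osc] osc_square_integral_le(1)[OF m2 h mh_le_1] by auto

lemma w_Y: "w \<in> Y_space \<Omega>"
  and w_norm: "Y_norm \<Omega> w \<le> 2 ^ m * real m ^ 2 * h * s * V_norm \<Omega> \<phi>\<^sub>\<alpha>"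
proof -
  have w: "w = (\<lambda>t x. osc m h t * \<phi>\<^sub>\<alpha> x)" by (simp add: w_def[abs_def])
  note t = tensor_Y_space[OF \<alpha>_H10 osc_L2]
  show "w \<in> Y_space \<Omega>" unfolding w by (rule t(1))
  show "Y_norm \<Omega> w \<le> 2 ^ m * real m ^ 2 * h * s * V_norm \<Omega> \<phi>\<^sub>\<alpha>"
    unfolding w t(2) s_def using osc_square_integral_le(2)[OF m2 h mh_le_1]
    by (intro mult_right_mono V_norm_nonneg)
qed

lemma dt_w: "v \<in> Y_space \<Omega> \<Longrightarrow> dt_op \<Omega> w v = (\<integral>t. osc' m h t * F\<^sub>\<alpha> (v t) \<partial>lebesgue_on \<Xi>)"
  using dt_op_osc[OF m2 h mh_le_1 \<alpha>_H10] by (simp add: w_def[abs_def] F\<^sub>\<alpha>_def)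

lemma F_Hm1: "F\<^sub>\<alpha> \<in> Hm1 \<Omega>" "F\<^sub>\<beta> \<in> Hm1 \<Omega>"
  unfolding F\<^sub>\<alpha>_def[abs_def] F\<^sub>\<beta>_def[abs_def]
  by (intro integral_functional_Hm1 continuous_L2 a.cont b.cont)+

text \<open>A qualitative bound, required by \<open>dual_norm_ge\<close> before the dual norm over
  all of Y can be estimated from below.\<close>

lemma dt_w_bounded: "\<exists>K\<ge>0. \<forall>v\<in>Y_space \<Omega>. \<bar>dt_op \<Omega> w v\<bar> \<le> K * Y_norm \<Omega> v"
proof -
  obtain K where K: "K \<ge> 0" "\<And>v. v \<in> H10 \<Omega> \<Longrightarrow> \<bar>F\<^sub>\<alpha> v\<bar> \<le> K * V_norm \<Omega> v"
    using Hm1_bounded[OF F_Hm1(1)] by metis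
  have "\<bar>dt_op \<Omega> w v\<bar> \<le> K * s * Y_norm \<Omega> v" if "v \<in> Y_space \<Omega>" for v
    unfolding dt_w[OF that] s_def by (rule Y_functional_integral_le[OF that K osc'_L2])
  then show ?thesis using K(1) s_pos by (intro exI[of _ "K * s"]) auto
qed

subsection \<open>Energy of the hat function on the refined patch\<close>

text \<open>\<open>restrict_partition\<close> asks for a point in the interior of the prism, whereas
  \<open>t\<close> and the common point may lie on its boundary. Time is moved to the midpoint of
  the overlap with \<open>{0..H}\<close>, and the point in space inwards because a triangle is the
  closure of its interior.\<close>

lemma refined_prism_times:
  assumes "(I, T) \<in> \<P>" "t \<in> I" "0 < t" "t < H" "T \<inter> interior T\<^sub>0 \<noteq> {}" "T\<^sub>0 \<in> \<T>\<^sub>\<alpha>"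
  shows "(I, T) \<in> restrict_partition \<P> ({0..H} \<times> supp \<phi>\<^sub>\<alpha>)"
proof -
  obtain l u where lu: "l < u" "I = {l..u}" using prismD(2)[OF assms(1)] by blast
  define t' where "t' = (max l 0 + min u H) / 2"
  have t': "l < t'" "t' < u" "0 \<le> t'" "t' \<le> H" using lu assms(2-4) by (auto simp: t'_def)
  have "interior T \<inter> interior T\<^sub>0 \<noteq> {}"
  proof -
    have "closure (interior T) \<inter> interior T\<^sub>0 \<noteq> {}"
      using assms(5) triangle_geometry(5)[OF prismD(1)[OF assms(1)]] by simp
    then show ?thesis using open_Int_closure_eq_empty[of "interior T\<^sub>0" "interior T"] by blast
  qed
  then obtain x where x: "x \<in> interior T" "x \<in> interior T\<^sub>0" by blast
  have "(t', x) \<in> interior (I \<times> T)" using t' x lu by (simp add: interior_Times)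
  moreover have "x \<in> supp \<phi>\<^sub>\<alpha>" using x(2) a.interior_subset_supp[OF assms(6)] by blast
  ultimately show ?thesis using assms(1) t' by (auto simp: restrict_partition_def)
qed

text \<open>In the time slice at \<open>H / 2\<close> the tiles meeting the interior of
  \<open>T\<^sub>0\<close> form a finite, hence closed, cover of that interior and thus of all of
  \<open>T\<^sub>0\<close>, including its corners. A tile at \<open>c\<close> lies in some triangle
  of the patch, which can only be \<open>T\<^sub>0\<close>.\<close>

lemma corner_tile:
  assumes T0: "T\<^sub>0 \<in> \<T>\<^sub>\<alpha>" and c: "c \<in> T\<^sub>0"
  shows "\<exists>T y. T \<subseteq> T\<^sub>0 \<and> T \<subseteq> cball c (diameter T) \<and> h / C \<le> diameter T \<and> diameter T \<le> C * h \<and>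
    cball y (diameter T / C) \<subseteq> T"
proof -
  define t where "t = H / 2"
  have t: "0 < t" "t < H" "t < 1" using H H_le_1 by (auto simp: t_def)
  define \<F> where "\<F> = {T. \<exists>I. (I, T) \<in> \<P> \<and> t \<in> I \<and> T \<inter> interior T\<^sub>0 \<noteq> {}}"
  have fin: "finite \<F>"
  proof (rule finite_subset)
    show "\<F> \<subseteq> snd ` \<P>" by (force simp: \<F>_def)
    show "finite (snd ` \<P>)" using partition by (simp add: prism_partition_def)
  qed
  have cl: "closed (\<Union>\<F>)"
    using fin by (intro closed_Union) (auto simp: \<F>_def dest: prismD(1) triangle_geometry(3))
  have cover: "interior T\<^sub>0 \<subseteq> \<Union>\<F>"
  proof
    fix x assume x: "x \<in> interior T\<^sub>0"
    then have "x \<in> closure \<Omega>" using a.subset_closure T0 interior_subset by blast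
    then have "(t, x) \<in> closure (\<Xi> \<times> \<Omega>)" using t by (simp add: closure_Times)
    then have "(t, x) \<in> (\<Union>(I, T)\<in>\<P>. I \<times> T)" using partition by (simp add: prism_partition_def)
    then obtain I T where "(I, T) \<in> \<P>" "t \<in> I" "x \<in> T" by auto
    then show "x \<in> \<Union>\<F>" using x by (auto simp: \<F>_def)
  qed
  have "T\<^sub>0 \<subseteq> \<Union>\<F>"
    using closure_minimal[OF cover cl] a.geometry(5)[OF T0] by simp
  then obtain T where "T \<in> \<F>" "c \<in> T" using c by blast
  then obtain I where T: "(I, T) \<in> \<P>" "t \<in> I" "T \<inter> interior T\<^sub>0 \<noteq> {}" "c \<in> T"
    unfolding \<F>_def by blast
  have R: "(I, T) \<in> restrict_partition \<P> ({0..H} \<times> supp \<phi>\<^sub>\<alpha>)"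
    by (rule refined_prism_times[OF T(1,2) t(1,2) T(3) T0])
  obtain T1 where T1: "T1 \<in> \<T>\<^sub>\<alpha>" "T \<subseteq> T1" using fine[OF R] by blast
  then have "interior T\<^sub>0 \<inter> T1 \<noteq> {}" using T(3) by blast
  then have "T1 = T\<^sub>0" using a.interior_inject[OF T0 T1(1)] by simp
  have "compact T" by (rule triangle_geometry(2)[OF prismD(1)[OF T(1)]])
  then have "T \<subseteq> cball c (diameter T)"
    using diameter_bounded_bound[OF compact_imp_bounded _ _] T(4) by (auto intro!: diameter_bounded_bound compact_imp_bounded)
  moreover have "\<exists>y. cball y (diameter T / C) \<subseteq> T"
    using shape T(1) by (auto simp: shape_regular_isotropic_def)
  ultimately show ?thesis using fine[OF R] T1(2) \<open>T1 = T\<^sub>0\<close> by auto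
qed

text \<open>Each triangle contributes a bounded energy, since a tile at each corner contains a ball
  whose radius is its diameter divided by \<open>C\<close>. The number of triangles is bounded by
  counting such balls around the common vertex.\<close>

lemma energy: "(V_norm \<Omega> \<phi>\<^sub>\<alpha>)\<^sup>2 \<le> C ^ 6 * (pi * (1 + C)\<^sup>2)"
proof -
  have E: "(norm (a.gr T))\<^sup>2 * measure lebesgue T \<le> pi * (1 + C)\<^sup>2" if T: "T \<in> \<T>\<^sub>\<alpha>" for T
  proof (rule a.triangle_energy_le[OF T])
    fix c assume "c extreme_point_of T"
    then have "c \<in> T" by (simp add: extreme_point_of_def)
    from corner_tile[OF T this] obtain S y where S: "S \<subseteq> T" "S \<subseteq> cball c (diameter S)" "h / C \<le> diameter S"
      "cball y (diameter S / C) \<subseteq> S" by blast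
    have "h / C > 0" using h C by simp
    then have "diameter S / C > 0" using S(3) C by simp
    moreover have "diameter S \<le> C * (diameter S / C)" using C by simp
    ultimately show "\<exists>y \<rho> D. cball y \<rho> \<subseteq> T \<and> cball y \<rho> \<subseteq> cball c D \<and> D \<le> C * \<rho> \<and> \<rho> > 0"
      using S by (intro exI[of _ y] exI[of _ "diameter S / C"] exI[of _ "diameter S"]) auto
  qed (use C in simp)
  obtain z where z: "\<forall>T\<in>\<T>\<^sub>\<alpha>. z extreme_point_of T" using a.vertex by blast
  \<comment> \<open>Tiles at \<open>z\<close> have diameter between \<open>h / C\<close> and
    \<open>C * h\<close>; shape regularity costs a further factor \<open>C\<close> in the inscribed
    radius. The quotient of the two squares is \<open>C ^ 6\<close>.\<close>
  have "real (card \<T>\<^sub>\<alpha>) * (h / C\<^sup>2)\<^sup>2 \<le> (C * h)\<^sup>2"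
  proof (rule a.card_le[where z = z])
    fix T assume T: "T \<in> \<T>\<^sub>\<alpha>"
    then have "z \<in> T" using z by (auto simp: extreme_point_of_def)
    from corner_tile[OF T this] obtain S y where S: "S \<subseteq> T" "S \<subseteq> cball z (diameter S)" "h / C \<le> diameter S"
      "diameter S \<le> C * h" "cball y (diameter S / C) \<subseteq> S" by blast
    have "h / C\<^sup>2 = h / C / C" by (simp add: power2_eq_square)
    also have "\<dots> \<le> diameter S / C" using S(3) C by (intro divide_right_mono) auto
    finally have "ball y (h / C\<^sup>2) \<subseteq> cball y (diameter S / C)" by (auto simp: subset_iff)
    moreover have "cball z (diameter S) \<subseteq> cball z (C * h)" by (rule subset_cball[OF S(4)])
    ultimately show "\<exists>y. ball y (h / C\<^sup>2) \<subseteq> T \<and> ball y (h / C\<^sup>2) \<subseteq> cball z (C * h)"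
      using S(1,2,5) by blast
  qed (use h C in auto)
  then have "real (card \<T>\<^sub>\<alpha>) \<le> (C * h)\<^sup>2 / (h / C\<^sup>2)\<^sup>2"
    using h C by (simp add: pos_le_divide_eq)
  also have "\<dots> = C ^ 6" using h C by (simp add: power_divide power_mult_distrib field_simps flip: power_mult power_add)
  finally have "real (card \<T>\<^sub>\<alpha>) \<le> C ^ 6" .
  then have "real (card \<T>\<^sub>\<alpha>) * (pi * (1 + C)\<^sup>2) \<le> C ^ 6 * (pi * (1 + C)\<^sup>2)"
    by (intro mult_right_mono) auto
  then show ?thesis using a.V_norm_le[OF supp_\<Omega>(1) E] by linarith
qed

subsection \<open>The trial function is discrete\<close>

lemma w_Q: "w \<in> Q_space 1 1 \<P>"
proof -
  have "\<exists>c::nat \<Rightarrow> nat \<Rightarrow> nat \<Rightarrow> real. \<forall>t\<in>interior I. \<forall>x\<in>interior T.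
      w t x = (\<Sum>i\<le>1. \<Sum>j\<le>1. \<Sum>k\<le>1 - j. c i j k * t ^ i * (x $ 1) ^ j * (x $ 2) ^ k)"
    if IT: "(I, T) \<in> \<P>" for I T
  proof (cases "(I, T) \<in> restrict_partition \<P> ({0..H} \<times> supp \<phi>\<^sub>\<alpha>)")
    case True
    obtain i T0 where i: "i \<in> {1..n}" "I = {(real i - 1) * h .. real i * h}" and T0: "T0 \<in> \<T>\<^sub>\<alpha>" "T \<subseteq> T0"
      using fine[OF True] by blast
    define j where "j = i - 1"
    have j: "I = {real j * h..real (Suc j) * h}" using i by (auto simp: j_def of_nat_diff)
    obtain c0 c1 where c: "\<And>t. t \<in> I \<Longrightarrow> osc m h t = c0 + c1 * t"
      using osc_affine_on_cell[OF h, of j m] j by blast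
    obtain b0 where b0: "\<And>x. x \<in> T0 \<Longrightarrow> \<phi>\<^sub>\<alpha> x = a.gr T0 \<bullet> x + b0"
      using a.affine_on[OF T0(1)] by blast
    define g where "g = a.gr T0"
    define C' :: "nat \<Rightarrow> nat \<Rightarrow> nat \<Rightarrow> real" where
      "C' i j k = (if i = 0 then c0 else c1) * (if j = 0 then (if k = 0 then b0 else g $ 2) else g $ 1)" for i j k
    have "w t x = (\<Sum>i\<le>1. \<Sum>j\<le>1. \<Sum>k\<le>1 - j. C' i j k * t ^ i * (x $ 1) ^ j * (x $ 2) ^ k)"
      if "t \<in> interior I" "x \<in> interior T" for t x
    proof -
      have "w t x = (c0 + c1 * t) * (g $ 1 * x $ 1 + g $ 2 * x $ 2 + b0)"
        using c[of t] b0[of x] that interior_subset[of I] interior_subset[of T] T0(2)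
        by (auto simp: w_def g_def inner_vec_def UNIV_2 subset_iff)
      also have "\<dots> = (\<Sum>i\<le>1. \<Sum>j\<le>1. \<Sum>k\<le>1 - j. C' i j k * t ^ i * (x $ 1) ^ j * (x $ 2) ^ k)"
        by (simp add: C'_def algebra_simps)
      finally show ?thesis .
    qed
    then show ?thesis by blast
  next
    case False
    \<comment> \<open>On a prism outside the refined patch either \<open>x\<close> misses the
      support of the hat function or \<open>t\<close> misses that of the spline, so all coefficients
      are 0.\<close>
    then have e: "interior (I \<times> T) \<inter> ({0..H} \<times> supp \<phi>\<^sub>\<alpha>) = {}" using IT by (auto simp: restrict_partition_def)
    have "w t x = 0" if "t \<in> interior I" "x \<in> interior T" for t x
    proof (cases "t \<in> {0..H}")
      case True
      then have "x \<notin> supp \<phi>\<^sub>\<alpha>" using e that by (auto simp: interior_Times)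
      then show ?thesis by (simp add: w_def eq_0_outside_supp)
    next
      case False
      then have "osc m h t = 0"
        using osc_neg(1)[OF h, of t m] osc_beyond(1)[OF m2 h, of t] mh_le_H by force
      then show ?thesis by (simp add: w_def)
    qed
    then show ?thesis by (intro exI[of _ "\<lambda>i j k. 0"]) simp
  qed
  then show ?thesis unfolding Q_space_def by blast
qed

lemma w_X: "w \<in> X_disc \<Omega> \<P>"
proof -
  have "continuous_on (closure (\<Xi> \<times> \<Omega>)) (\<lambda>z. osc m h (fst z) * \<phi>\<^sub>\<alpha> (snd z))"
    by (intro continuous_on_mult continuous_on_compose2[OF continuous_osc] continuous_on_compose2[OF a.cont])
      (auto intro!: continuous_intros)
  then show ?thesis
    using w_Y w_Q by (simp add: X_disc_def w_def[abs_def] case_prod_unfold)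
qed

lemma w_nonzero: "\<exists>t\<in>\<Xi>. \<exists>x\<in>\<Omega>. w t x \<noteq> 0"
proof -
  obtain z where z: "\<phi>\<^sub>\<alpha> z = 1" using a.vertex by blast
  then have "z \<in> supp \<phi>\<^sub>\<alpha>" using eq_0_outside_supp by fastforce
  then have "z \<in> \<Omega>" using supp_\<Omega> by blast
  \<comment> \<open>At \<open>t = h\<close> only the truncated power with \<open>i = 0\<close> is
    nonzero.\<close>
  have "osc m h h = (\<Sum>i\<le>m. if i = 0 then h else 0)"
    unfolding osc_def
  proof (rule sum.cong[OF refl])
    fix i
    show "(-1) ^ i * real (m choose i) * max 0 (h - real i * h) = (if i = 0 then h else 0)"
    proof (cases "i = 0")
      case False
      then have "h \<le> real i * h" using h by (simp add: mult_le_cancel_right1)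
      then show ?thesis using False by simp
    qed (use h in simp)
  qed
  then have "osc m h h = h" by simp
  then have "w h z \<noteq> 0" using h z by (simp add: w_def)
  then show ?thesis using h h_lt_1 \<open>z \<in> \<Omega>\<close> by (intro bexI[of _ h] bexI[of _ z]) auto
qed

lemma trace_w: "L2_norm \<Omega> (trace0 w) = 0"
  using osc_neg(1)[OF h, of 0 m] by (simp add: trace0_def w_def[abs_def] L2_norm_def)

subsection \<open>The upper bound on discrete test functions\<close>

text \<open>\<open>Q_space\<close> prescribes \<open>v\<close> only inside open prisms, so the
  expansion of \<open>F\<^sub>\<beta> (v t)\<close> in powers of \<open>t\<close> holds for
  \<open>0 < t < H\<close> and is obtained by integrating over the interiors of the
  triangles.\<close>

lemma coarse_patch_orthogonal:
  assumes v: "v \<in> Y_disc \<Omega> p q \<P>"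
  shows "(\<integral>t. osc' m h t * F\<^sub>\<beta> (v t) \<partial>lebesgue_on \<Xi>) = 0"
proof -
  have "\<exists>c::nat \<Rightarrow> nat \<Rightarrow> nat \<Rightarrow> real. \<forall>t\<in>interior {0..H}. \<forall>x\<in>interior T.
     v t x = (\<Sum>i\<le>p. \<Sum>j\<le>q. \<Sum>k\<le>q - j. c i j k * t ^ i * (x $ 1) ^ j * (x $ 2) ^ k)" if "T \<in> \<T>\<^sub>\<beta>" for T
    using v coarse_prism[OF that] unfolding Y_disc_def Q_space_def by blast
  then have "\<forall>T\<in>\<T>\<^sub>\<beta>. \<exists>c::nat \<Rightarrow> nat \<Rightarrow> nat \<Rightarrow> real. \<forall>t\<in>interior {0..H}. \<forall>x\<in>interior T.
     v t x = (\<Sum>i\<le>p. \<Sum>j\<le>q. \<Sum>k\<le>q - j. c i j k * t ^ i * (x $ 1) ^ j * (x $ 2) ^ k)" by blast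
  from bchoice[OF this] obtain c :: "(real^2) set \<Rightarrow> nat \<Rightarrow> nat \<Rightarrow> nat \<Rightarrow> real" where
    c': "\<forall>T\<in>\<T>\<^sub>\<beta>. \<forall>t\<in>interior {0..H}. \<forall>x\<in>interior T.
     v t x = (\<Sum>i\<le>p. \<Sum>j\<le>q. \<Sum>k\<le>q - j. c T i j k * t ^ i * (x $ 1) ^ j * (x $ 2) ^ k)" ..
  have c: "v t x = (\<Sum>i\<le>p. \<Sum>j\<le>q. \<Sum>k\<le>q - j. c T i j k * t ^ i * (x $ 1) ^ j * (x $ 2) ^ k)"
    if "T \<in> \<T>\<^sub>\<beta>" "0 < t" "t < H" "x \<in> interior T" for T t x
  proof -
    have "t \<in> interior {0..H}" using that by simp
    then show ?thesis using c' that by blast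
  qed
  define \<pi> where "\<pi> T i x = (\<Sum>j\<le>q. \<Sum>k\<le>q - j. c T i j k * (x $ 1) ^ j * (x $ 2) ^ k)" for T i and x :: "real^2"
  have v\<pi>: "v t x = (\<Sum>i\<le>p. t ^ i * \<pi> T i x)" if "T \<in> \<T>\<^sub>\<beta>" "0 < t" "t < H" "x \<in> interior T" for T t x
    unfolding c[OF that] \<pi>_def by (simp add: sum_distrib_left mult_ac)
  have c\<pi>: "continuous_on UNIV (\<lambda>x. \<phi>\<^sub>\<beta> x * \<pi> T i x)" for T i
    unfolding \<pi>_def by (intro continuous_intros b.cont)
  \<comment> \<open>Collects the coefficient of \<open>t ^ i\<close> across all triangles; being 0
    on the edges affects a null set only.\<close>
  define f where "f i x = (\<Sum>T\<in>\<T>\<^sub>\<beta>. indicator (interior T) x *\<^sub>R (\<phi>\<^sub>\<beta> x * \<pi> T i x))" for i x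
  have f_int: "integrable (lebesgue_on \<Omega>) (f i)" for i
    unfolding f_def
  proof (intro Bochner_Integration.integrable_sum integrable_mult_indicator)
    fix T assume T: "T \<in> \<T>\<^sub>\<beta>"
    show "integrable (lebesgue_on \<Omega>) (\<lambda>x. \<phi>\<^sub>\<beta> x * \<pi> T i x)"
      by (rule L2_integrable[OF lmeasurable_\<Omega> continuous_L2[OF c\<pi>]])
    have "interior T \<subseteq> \<Omega>" using b.interior_subset_supp[OF T] supp_\<Omega>(2) by blast
    then show "interior T \<in> sets (lebesgue_on \<Omega>)"
      by (simp add: sets_restrict_space_iff lebesgue_openin)
  qed
  define \<B> where "\<B> i = (\<integral>x. f i x \<partial>lebesgue_on \<Omega>)" for i
  have F: "F\<^sub>\<beta> (v t) = (\<Sum>i\<le>p. t ^ i * \<B> i)" if t: "0 < t" "t < H" for t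
  proof -
    have i: "integrable (lebesgue_on \<Omega>) (\<lambda>x. \<Sum>i\<le>p. t ^ i * f i x)"
      using f_int by simp
    have eq: "AE x in lebesgue_on \<Omega>. (\<Sum>i\<le>p. t ^ i * f i x) = \<phi>\<^sub>\<beta> x * v t x"
      using AE_\<Omega>I[OF b.AE_interior_or_outside]
    proof eventually_elim
      case (elim x)
      show ?case
      proof (cases "x \<in> \<Union>\<T>\<^sub>\<beta>")
        case True
        then obtain T where T: "T \<in> \<T>\<^sub>\<beta>" "x \<in> interior T" using elim by blast
        have "f i x = \<phi>\<^sub>\<beta> x * \<pi> T i x" for i
          unfolding f_def by (rule b.sum_indicator_interior[OF T])
        then show ?thesis by (simp add: v\<pi>[OF T(1) t T(2)] sum_distrib_left mult_ac)
      next
        case False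
        then show ?thesis by (simp add: f_def b.zero_outside)
      qed
    qed
    have "F\<^sub>\<beta> (v t) = (\<integral>x. (\<Sum>i\<le>p. t ^ i * f i x) \<partial>lebesgue_on \<Omega>)"
      unfolding F\<^sub>\<beta>_def
      by (rule integral_cong_AE[OF borel_measurable_AE_lebesgue_on[OF sets_\<Omega> borel_measurable_integrable[OF i] eq]
            borel_measurable_integrable[OF i]])
        (use eq in eventually_elim, simp)
    then show ?thesis using f_int by (simp add: \<B>_def Bochner_Integration.integral_sum)
  qed
  note i = osc'_power_integrable
  \<comment> \<open>The time \<open>t = H\<close> is a null set, and for later times
    \<open>osc'\<close> is 0 whatever \<open>v\<close> does.\<close>
  have eq: "AE t in lebesgue_on \<Xi>. (\<Sum>i\<le>p. \<B> i * (osc' m h t * t ^ i)) = osc' m h t * F\<^sub>\<beta> (v t)"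
  proof -
    have "AE t in lebesgue. t \<noteq> H"
      by (rule AE_I[of _ _ "{H}"]) auto
    then have "AE t in lebesgue_on \<Xi>. t \<noteq> H" by (auto simp: AE_restrict_space_iff elim: eventually_mono)
    then show ?thesis
      using AE_space
    proof eventually_elim
      case (elim t)
      show ?case
      proof (cases "t < H")
        case True
        then show ?thesis using elim by (simp add: F sum_distrib_left mult_ac)
      next
        case False
        then have "osc' m h t = 0" using elim mh_le_H by (intro osc_beyond(2)[OF m2 h]) simp
        then show ?thesis by simp
      qed
    qed
  qed
  have i': "integrable (lebesgue_on \<Xi>) (\<lambda>t. \<Sum>i\<le>p. \<B> i * (osc' m h t * t ^ i))"
    using i by simp
  have "(\<integral>t. osc' m h t * F\<^sub>\<beta> (v t) \<partial>lebesgue_on \<Xi>) = (\<integral>t. (\<Sum>i\<le>p. \<B> i * (osc' m h t * t ^ i)) \<partial>lebesgue_on \<Xi>)"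
    by (rule integral_cong_AE[OF borel_measurable_AE_lebesgue_on[OF _ borel_measurable_integrable[OF i'] eq]
            borel_measurable_integrable[OF i']])
      (use eq in \<open>auto elim: eventually_mono\<close>)
  also have "\<dots> = (\<Sum>i\<le>p. \<B> i * (\<integral>t. osc' m h t * t ^ i \<partial>lebesgue_on \<Xi>))"
    using i by (simp add: Bochner_Integration.integral_sum)
  also have "\<dots> = 0"
  proof (rule sum.neutral, rule ballI)
    fix i assume "i \<in> {..p}"
    then have "Suc i < m" by simp
    from osc'_power_orthogonal[OF this h mh_le_1]
    show "\<B> i * (\<integral>t. osc' m h t * t ^ i \<partial>lebesgue_on \<Xi>) = 0" by (simp only: mult_zero_right)
  qed
  finally show ?thesis .
qed

text \<open>The mean-zero inequality on the ball of radius \<open>3 * C * H\<close>; the constant is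
  \<open>144 = 16 * 9\<close>.\<close>

lemma difference_functional:
  assumes v: "v \<in> H10 \<Omega>"
  shows "\<bar>F\<^sub>\<alpha> v - F\<^sub>\<beta> v\<bar> \<le> 144 * C\<^sup>2 * H\<^sup>2 * V_norm \<Omega> v"
proof -
  let ?g = "\<lambda>x. \<phi>\<^sub>\<alpha> x - \<phi>\<^sub>\<beta> x"
  have L: "\<phi>\<^sub>\<alpha> \<in> L2 \<Omega>" "\<phi>\<^sub>\<beta> \<in> L2 \<Omega>" by (intro continuous_L2 a.cont b.cont)+
  have vL: "v \<in> L2 \<Omega>" by (rule H1_L2[OF H10_H1[OF v]])
  have "\<bar>\<integral>x. ?g x * v x \<partial>lebesgue_on \<Omega>\<bar> \<le> 16 * (3 * C * H)\<^sup>2 * V_norm \<Omega> v"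
  proof (rule mean_zero_H10_bound[OF _ cball_R_subset _ _ _ _ v])
    show "3 * C * H > 0" using CH_pos by simp
    show "continuous_on UNIV ?g" by (intro continuous_intros a.cont b.cont)
    show "\<bar>?g x\<bar> \<le> 1" for x using a.bounds[of x] b.bounds[of x] by linarith
    show "?g x = 0" if "x \<notin> cball x0 (3 * C * H)" for x
    proof -
      have "x \<notin> supp \<phi>\<^sub>\<beta>" using that supp\<beta> by blast
      moreover have "x \<notin> supp \<phi>\<^sub>\<alpha>"
        using that supp\<alpha> subset_cball[of "C * H" "3 * C * H" x0] CH_pos by force
      ultimately show ?thesis by (simp add: eq_0_outside_supp)
    qed
    show "(\<integral>x. ?g x \<partial>lebesgue_on \<Omega>) = 0"
      using mean L2_integrable[OF lmeasurable_\<Omega> L(1)] L2_integrable[OF lmeasurable_\<Omega> L(2)] by simp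
  qed
  moreover have "(\<integral>x. ?g x * v x \<partial>lebesgue_on \<Omega>) = F\<^sub>\<alpha> v - F\<^sub>\<beta> v"
    using L2_integrable_mult[OF L(1) vL] L2_integrable_mult[OF L(2) vL] by (simp add: F\<^sub>\<alpha>_def F\<^sub>\<beta>_def left_diff_distrib)
  ultimately show ?thesis by (simp add: power_mult_distrib)
qed

lemma dt_w_discrete_le:
  assumes v: "v \<in> Y_disc \<Omega> p q \<P>"
  shows "\<bar>dt_op \<Omega> w v\<bar> \<le> 144 * C\<^sup>2 * H\<^sup>2 * s * Y_norm \<Omega> v"
proof -
  have vY: "v \<in> Y_space \<Omega>" using v by (simp add: Y_disc_def)
  have "dt_op \<Omega> w v = (\<integral>t. osc' m h t * F\<^sub>\<alpha> (v t) \<partial>lebesgue_on \<Xi>) - (\<integral>t. osc' m h t * F\<^sub>\<beta> (v t) \<partial>lebesgue_on \<Xi>)"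
    unfolding dt_w[OF vY] coarse_patch_orthogonal[OF v] by simp
  also have "\<dots> = (\<integral>t. osc' m h t * (F\<^sub>\<alpha> (v t) - F\<^sub>\<beta> (v t)) \<partial>lebesgue_on \<Xi>)"
    using Y_functional_integrable[OF vY F_Hm1(1) osc'_L2] Y_functional_integrable[OF vY F_Hm1(2) osc'_L2]
    by (simp add: right_diff_distrib)
  also have "\<bar>\<dots>\<bar> \<le> 144 * C\<^sup>2 * H\<^sup>2 * s * Y_norm \<Omega> v"
    unfolding s_def
    by (rule Y_functional_integral_le[OF vY _ _ osc'_L2, of _ "\<lambda>u. F\<^sub>\<alpha> u - F\<^sub>\<beta> u"])
      (use difference_functional in auto)
  finally show ?thesis .
qed

subsection \<open>The lower bound\<close>

text \<open>For the test function \<open>osc'\<close> times \<open>u\<close> both time integrals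
  give powers of \<open>s\<close>, leaving the quotient of \<open>F\<^sub>\<alpha> u\<close>, at
  least \<open>K * H\<^sup>2 / C\<close>, and the seminorm of \<open>u\<close>, at most
  \<open>sqrt (c * K)\<close>. A factor \<open>sqrt K\<close> survives.\<close>

lemma dt_w_lower:
  assumes c: "c > 0" and K: "K > 0" "C * H \<le> r / 2 ^ K"
    and log: "\<exists>v\<in>test_functions \<Omega>. (\<forall>x\<in>cball x0 (r / 2 ^ K). v x = real K) \<and> (V_norm \<Omega> v)\<^sup>2 \<le> c * real K"
  shows "\<exists>v\<in>Y_space \<Omega>. Y_norm \<Omega> v > 0 \<and> dt_op \<Omega> w v \<ge> H\<^sup>2 / (C * sqrt c) * sqrt (real K) * s * Y_norm \<Omega> v"
proof -
  obtain u where u: "u \<in> test_functions \<Omega>" "\<And>x. x \<in> cball x0 (r / 2 ^ K) \<Longrightarrow> u x = real K"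
    "(V_norm \<Omega> u)\<^sup>2 \<le> c * real K" using log by blast
  have uH: "u \<in> H10 \<Omega>" by (rule test_functions_H10[OF u(1)])
  have "F\<^sub>\<alpha> u = (\<integral>x. real K * \<phi>\<^sub>\<alpha> x \<partial>lebesgue_on \<Omega>)"
    unfolding F\<^sub>\<alpha>_def
  proof (rule Bochner_Integration.integral_cong[OF refl])
    fix x
    show "\<phi>\<^sub>\<alpha> x * u x = real K * \<phi>\<^sub>\<alpha> x"
    proof (cases "x \<in> supp \<phi>\<^sub>\<alpha>")
      case True
      then have "x \<in> cball x0 (r / 2 ^ K)" using supp\<alpha> subset_cball[OF K(2), of x0] by blast
      then show ?thesis by (simp add: u(2))
    qed (simp add: eq_0_outside_supp)
  qed
  also have "\<dots> = real K * (\<integral>x. \<phi>\<^sub>\<alpha> x \<partial>lebesgue_on \<Omega>)" by simp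
  also have "\<dots> \<ge> real K * (H\<^sup>2 / C)" using mass by (intro mult_left_mono) auto
  finally have Fu: "F\<^sub>\<alpha> u \<ge> real K * (H\<^sup>2 / C)" .
  have "real K * (H\<^sup>2 / C) > 0" using K(1) H C by simp
  then have Fpos: "F\<^sub>\<alpha> u > 0" using Fu by linarith
  \<comment> \<open>A zero seminorm would force \<open>F\<^sub>\<alpha> u = 0\<close> by boundedness
    of the functional.\<close>
  have Vpos: "V_norm \<Omega> u > 0"
  proof (rule ccontr)
    assume "\<not> V_norm \<Omega> u > 0"
    then have "V_norm \<Omega> u = 0" using V_norm_nonneg[of u] by linarith
    then show False using Hm1_norm_bound[OF F_Hm1(1) uH] Fpos by simp
  qed
  have Vle: "V_norm \<Omega> u \<le> sqrt c * sqrt (real K)"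
    using real_sqrt_le_mono[OF u(3)] by (simp add: real_sqrt_mult)
  define v where "v = (\<lambda>t x. osc' m h t * u x)"
  note t = tensor_Y_space[OF uH osc'_L2]
  have vY: "v \<in> Y_space \<Omega>" and vN: "Y_norm \<Omega> v = s * V_norm \<Omega> u"
    using t by (simp_all add: v_def s_def)
  have "dt_op \<Omega> w v = (\<integral>t. (osc' m h t)\<^sup>2 * F\<^sub>\<alpha> u \<partial>lebesgue_on \<Xi>)"
    unfolding dt_w[OF vY]
    by (rule Bochner_Integration.integral_cong[OF refl])
      (simp add: v_def Hm1D(2)[OF F_Hm1(1) uH] power2_eq_square)
  also have "\<dots> = s\<^sup>2 * F\<^sub>\<alpha> u" by (simp add: s_square)
  finally have dt: "dt_op \<Omega> w v = s\<^sup>2 * F\<^sub>\<alpha> u" .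
  have "H\<^sup>2 / (C * sqrt c) * sqrt (real K) * V_norm \<Omega> u \<le> H\<^sup>2 / (C * sqrt c) * sqrt (real K) * (sqrt c * sqrt (real K))"
    using C c by (intro mult_left_mono Vle) auto
  also have "\<dots> = real K * (H\<^sup>2 / C)" using c by (simp add: field_simps)
  also have "\<dots> \<le> F\<^sub>\<alpha> u" by (rule Fu)
  finally have "s\<^sup>2 * (H\<^sup>2 / (C * sqrt c) * sqrt (real K) * V_norm \<Omega> u) \<le> s\<^sup>2 * F\<^sub>\<alpha> u"
    by (rule mult_left_mono) simp
  then have "H\<^sup>2 / (C * sqrt c) * sqrt (real K) * s * Y_norm \<Omega> v \<le> dt_op \<Omega> w v"
    unfolding dt vN by (simp add: power2_eq_square mult_ac)
  moreover have "Y_norm \<Omega> v > 0" using s_pos Vpos by (simp add: vN)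
  ultimately show ?thesis using vY by blast
qed

lemma dual_norm_disc_le:
  assumes "\<And>v. v \<in> Y_disc \<Omega> p q \<P> \<Longrightarrow> \<bar>g v\<bar> \<le> K * Y_norm \<Omega> v" "K \<ge> 0"
  shows "dual_norm (Y_disc \<Omega> p q \<P>) (Y_norm \<Omega>) g \<le> K"
  by (rule dual_norm_le) (use assms in \<open>auto intro: order_trans[OF abs_ge_self]\<close>)

lemma dual_norm_Y_ge:
  assumes "\<exists>K\<ge>0. \<forall>v\<in>Y_space \<Omega>. \<bar>g v\<bar> \<le> K * Y_norm \<Omega> v"
    and "v \<in> Y_space \<Omega>" "Y_norm \<Omega> v > 0" "L * Y_norm \<Omega> v \<le> g v"
  shows "L \<le> dual_norm (Y_space \<Omega>) (Y_norm \<Omega>) g"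
proof -
  obtain K where K: "K \<ge> 0" "\<And>v. v \<in> Y_space \<Omega> \<Longrightarrow> \<bar>g v\<bar> \<le> K * Y_norm \<Omega> v" using assms(1) by blast
  have "L \<le> g v / Y_norm \<Omega> v" using assms(3,4) by (simp add: pos_le_divide_eq)
  also have "\<dots> \<le> dual_norm (Y_space \<Omega>) (Y_norm \<Omega>) g"
    by (rule dual_norm_ge[where K = K]) (use K assms in \<open>auto intro: order_trans[OF abs_ge_self]\<close>)
  finally show ?thesis .
qed

text \<open>The infimum is tested with \<open>w\<close>. Both \<open>s\<close> and
  \<open>H\<^sup>2\<close> cancel from the quotient, so only \<open>sqrt K\<close> is left in the
  denominator.\<close>

theorem gamma_dt_bounds:
  assumes c: "c > 0" and K: "K > 0" "C * H \<le> r / 2 ^ K"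
    and log: "\<exists>v\<in>test_functions \<Omega>. (\<forall>x\<in>cball x0 (r / 2 ^ K). v x = real K) \<and> (V_norm \<Omega> v)\<^sup>2 \<le> c * real K"
  shows "0 \<le> gamma_dt \<Omega> p q \<P>" "gamma_dt \<Omega> p q \<P> \<le> 144 * C ^ 3 * sqrt c / sqrt (real K)"
proof -
  let ?S = "{w \<in> X_disc \<Omega> \<P>. \<exists>v\<in>Y_space \<Omega>. dt_op \<Omega> w v \<noteq> 0}"
  let ?N = "\<lambda>w. dual_norm (Y_disc \<Omega> p q \<P>) (Y_norm \<Omega>) (dt_op \<Omega> w)"
  let ?D = "\<lambda>w. dual_norm (Y_space \<Omega>) (Y_norm \<Omega>) (dt_op \<Omega> w)"
  let ?L = "H\<^sup>2 / (C * sqrt c) * sqrt (real K) * s"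
  obtain v where v: "v \<in> Y_space \<Omega>" "Y_norm \<Omega> v > 0" "dt_op \<Omega> w v \<ge> ?L * Y_norm \<Omega> v"
    using dt_w_lower[OF assms] by blast
  have L: "?L > 0" using H C c K s_pos by simp
  then have "dt_op \<Omega> w v > 0" using v mult_pos_pos[OF L v(2)] by linarith
  then have wS: "w \<in> ?S" by (intro CollectI conjI w_X bexI[OF _ v(1)]) simp
  have D: "?L \<le> ?D w" by (rule dual_norm_Y_ge[OF dt_w_bounded v])
  have N: "?N w \<le> 144 * C\<^sup>2 * H\<^sup>2 * s"
    by (rule dual_norm_disc_le[OF dt_w_discrete_le]) (use C s_pos in auto)
  \<comment> \<open>Nonnegativity passes to the infimum only because the index set contains
    \<open>w\<close>; the infimum of an empty set of reals carries no information.\<close>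
  show "0 \<le> gamma_dt \<Omega> p q \<P>"
    unfolding gamma_dt_def by (rule cINF_greatest) (use wS in auto)
  have "gamma_dt \<Omega> p q \<P> \<le> ?N w / ?D w"
    unfolding gamma_dt_def by (rule cINF_lower[OF _ wS]) (auto intro!: bdd_belowI2[of _ 0])
  also have "\<dots> \<le> 144 * C\<^sup>2 * H\<^sup>2 * s / ?L"
    by (rule frac_le[OF _ N L D]) (use C s_pos in simp)
  also have "\<dots> = 144 * C ^ 3 * sqrt c / sqrt (real K)"
    using H C c K s_pos by (simp add: field_simps power3_eq_cube power2_eq_square)
  finally show "gamma_dt \<Omega> p q \<P> \<le> 144 * C ^ 3 * sqrt c / sqrt (real K)" .
qed

text \<open>\<open>A\<close> acts as a perturbation of size \<open>M' * h * s\<close>, added to the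
  numerator and subtracted from the denominator, with \<open>M'\<close> collecting the bound of
  \<open>A\<close>, the spline constants and the energy of the hat function. The trace terms vanish,
  so the square root undoes the squares.\<close>

theorem gamma_Be_bounds:
  assumes c: "c > 0" and K: "K > 0" "C * H \<le> r / 2 ^ K"
    and log: "\<exists>v\<in>test_functions \<Omega>. (\<forall>x\<in>cball x0 (r / 2 ^ K). v x = real K) \<and> (V_norm \<Omega> v)\<^sup>2 \<le> c * real K"
    and M: "M \<ge> 0" "AE t in lebesgue_on \<Xi>. \<forall>u\<in>H10 \<Omega>. \<forall>v\<in>H10 \<Omega>. \<bar>A t u v\<bar> \<le> M * V_norm \<Omega> u * V_norm \<Omega> v"
    and M': "M' = M * (2 ^ m * real m ^ 2 * sqrt (C ^ 6 * (pi * (1 + C)\<^sup>2)))"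
    and pos: "H\<^sup>2 / (C * sqrt c) * sqrt (real K) - M' * h > 0"
  shows "0 \<le> gamma_Be \<Omega> A p q \<P>"
    "gamma_Be \<Omega> A p q \<P> \<le> (144 * C\<^sup>2 * H\<^sup>2 + M' * h) / (H\<^sup>2 / (C * sqrt c) * sqrt (real K) - M' * h)"
proof -
  let ?S = "{w \<in> X_disc \<Omega> \<P>. \<exists>t\<in>\<Xi>. \<exists>x\<in>\<Omega>. w t x \<noteq> 0}"
  let ?N = "\<lambda>w. dual_norm (Y_disc \<Omega> p q \<P>) (Y_norm \<Omega>) (B_op \<Omega> A w)"
  let ?D = "\<lambda>w. dual_norm (Y_space \<Omega>) (Y_norm \<Omega>) (B_op \<Omega> A w)"
  let ?R = "\<lambda>w. ((?N w)\<^sup>2 + (L2_norm \<Omega> (trace0 w))\<^sup>2) / ((?D w)\<^sup>2 + (L2_norm \<Omega> (trace0 w))\<^sup>2)"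
  let ?E = "sqrt (C ^ 6 * (pi * (1 + C)\<^sup>2))"
  define L where "L = H\<^sup>2 / (C * sqrt c) * sqrt (real K)"
  have M'0: "M' \<ge> 0" using M C by (simp add: M')
  have VE: "V_norm \<Omega> \<phi>\<^sub>\<alpha> \<le> ?E"
    by (rule real_le_rsqrt[OF energy])
  have Aw: "\<bar>A_op A w v\<bar> \<le> M' * h * s * Y_norm \<Omega> v" if v: "v \<in> Y_space \<Omega>" for v
  proof -
    have "\<bar>A_op A w v\<bar> \<le> M * Y_norm \<Omega> w * Y_norm \<Omega> v" by (rule A_op_le[OF M w_Y v])
    also have "\<dots> \<le> M * (2 ^ m * real m ^ 2 * h * s * ?E) * Y_norm \<Omega> v"
    proof (intro mult_right_mono mult_left_mono M(1))
      have "Y_norm \<Omega> w \<le> 2 ^ m * real m ^ 2 * h * s * V_norm \<Omega> \<phi>\<^sub>\<alpha>" by (rule w_norm)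
      also have "\<dots> \<le> 2 ^ m * real m ^ 2 * h * s * ?E"
        using h s_pos by (intro mult_left_mono VE) auto
      finally show "Y_norm \<Omega> w \<le> 2 ^ m * real m ^ 2 * h * s * ?E" .
    qed simp
    also have "\<dots> = M' * h * s * Y_norm \<Omega> v" by (simp add: M' mult_ac)
    finally show ?thesis .
  qed
  obtain v where v: "v \<in> Y_space \<Omega>" "Y_norm \<Omega> v > 0" "dt_op \<Omega> w v \<ge> L * s * Y_norm \<Omega> v"
    using dt_w_lower[OF c K log] by (auto simp: L_def)
  have wS: "w \<in> ?S" using w_X w_nonzero by auto
  \<comment> \<open>As for the time derivative alone, finiteness of the dual norm must be known
    before it is bounded from below.\<close>
  have bounded: "\<exists>K\<ge>0. \<forall>v\<in>Y_space \<Omega>. \<bar>B_op \<Omega> A w v\<bar> \<le> K * Y_norm \<Omega> v"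
  proof -
    obtain K' where K': "K' \<ge> 0" "\<forall>v\<in>Y_space \<Omega>. \<bar>dt_op \<Omega> w v\<bar> \<le> K' * Y_norm \<Omega> v" using dt_w_bounded by blast
    have "\<bar>B_op \<Omega> A w v\<bar> \<le> (K' + M' * h * s) * Y_norm \<Omega> v" if "v \<in> Y_space \<Omega>" for v
      using K'(2) Aw[OF that] that abs_triangle_ineq[of "dt_op \<Omega> w v" "A_op A w v"]
      by (fastforce simp: B_op_def distrib_right)
    moreover have "K' + M' * h * s \<ge> 0" using K'(1) M'0 h s_pos by simp
    ultimately show ?thesis by blast
  qed
  have D: "(L - M' * h) * s \<le> ?D w"
  proof (rule dual_norm_Y_ge[OF bounded v(1,2)])
    show "(L - M' * h) * s * Y_norm \<Omega> v \<le> B_op \<Omega> A w v"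
      using v(3) Aw[OF v(1)] by (simp add: B_op_def left_diff_distrib)
  qed
  have Dpos: "(L - M' * h) * s > 0" using pos s_pos by (simp add: L_def)
  have N: "?N w \<le> (144 * C\<^sup>2 * H\<^sup>2 + M' * h) * s"
  proof (rule dual_norm_disc_le)
    fix v assume v: "v \<in> Y_disc \<Omega> p q \<P>"
    then have vY: "v \<in> Y_space \<Omega>" by (simp add: Y_disc_def)
    show "\<bar>B_op \<Omega> A w v\<bar> \<le> (144 * C\<^sup>2 * H\<^sup>2 + M' * h) * s * Y_norm \<Omega> v"
      using dt_w_discrete_le[OF v] Aw[OF vY] abs_triangle_ineq[of "dt_op \<Omega> w v" "A_op A w v"]
      by (simp add: B_op_def distrib_right)
  qed (use C M'0 h s_pos in simp)
  have ge: "0 \<le> (INF w\<in>?S. ?R w)" by (rule cINF_greatest) (use wS in auto)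
  then show "0 \<le> gamma_Be \<Omega> A p q \<P>" unfolding gamma_Be_def by (rule real_sqrt_ge_zero)
  have "(INF w\<in>?S. ?R w) \<le> ?R w"
    by (rule cINF_lower[OF _ wS]) (auto intro!: bdd_belowI2[of _ 0])
  also have "\<dots> = (?N w / ?D w)\<^sup>2" by (simp add: trace_w power_divide)
  finally have "gamma_Be \<Omega> A p q \<P> \<le> sqrt ((?N w / ?D w)\<^sup>2)"
    unfolding gamma_Be_def by (rule real_sqrt_le_mono)
  also have "\<dots> = ?N w / ?D w" by simp
  also have "\<dots> \<le> ((144 * C\<^sup>2 * H\<^sup>2 + M' * h) * s) / ((L - M' * h) * s)"
    by (rule frac_le[OF _ N Dpos D]) (use C M'0 h s_pos in simp)
  also have "\<dots> = (144 * C\<^sup>2 * H\<^sup>2 + M' * h) / (L - M' * h)" using s_pos by simp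
  finally show "gamma_Be \<Omega> A p q \<P> \<le> (144 * C\<^sup>2 * H\<^sup>2 + M' * h) / (H\<^sup>2 / (C * sqrt c) * sqrt (real K) - M' * h)"
    by (simp add: L_def)
qed

end

section \<open>Choice of the dyadic level and passage to the limit along the family\<close>

section \<open>The limits\<close>

text \<open>\<open>K\<close> is the integer part of the number of halvings that lead from
  \<open>r\<close> to \<open>C * H\<close>. Since \<open>ln 2 \<le> 1\<close> that number is at
  least \<open>\<bar>ln H\<bar>\<close> up to a constant, which for small \<open>H\<close> costs at
  most half of the logarithm.\<close>

lemma dyadic_scale_exists:
  fixes C r :: real
  assumes C: "C \<ge> 1" and r: "r > 0"
  shows "\<exists>H0>0. \<forall>H. 0 < H \<and> H < H0 \<longrightarrow> H < 1 \<and> 3 * C * H \<le> r \<and>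
    (\<exists>K::nat. K > 0 \<and> C * H \<le> r / 2 ^ K \<and> real K \<ge> \<bar>ln H\<bar> / 2)"
proof -
  \<comment> \<open>\<open>D\<close> bounds the loss from \<open>r / C\<close>, plus 1 for rounding
    down; the bound \<open>exp (- 2 * D)\<close> on \<open>H\<close> makes it at most half of
    \<open>\<bar>ln H\<bar>\<close>.\<close>
  define D where "D = 1 + \<bar>ln (r / C)\<bar> / ln 2"
  define H0 where "H0 = min (r / (3 * C)) (exp (- 2 * D))"
  have D: "D \<ge> 1" by (simp add: D_def)
  have "H0 > 0" using C r by (simp add: H0_def)
  moreover have "H < 1 \<and> 3 * C * H \<le> r \<and> (\<exists>K::nat. K > 0 \<and> C * H \<le> r / 2 ^ K \<and> real K \<ge> \<bar>ln H\<bar> / 2)"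
    if H: "0 < H" "H < H0" for H
  proof -
    have "H < r / (3 * C)" using H by (simp add: H0_def)
    then have 1: "3 * C * H \<le> r" using C by (simp add: field_simps)
    have "H < exp (- 2 * D)" using H by (simp add: H0_def)
    then have "ln H < - 2 * D" using H by (metis exp_gt_zero ln_exp ln_less_cancel_iff)
    then have l: "\<bar>ln H\<bar> > 2 * D" "ln H < 0" using D by auto
    then have "H < 1" using H(1) by simp
    define y where "y = log 2 (r / (C * H))"
    have "y = (ln (r / C) - ln H) / ln 2"
      using H C r by (simp add: y_def log_def ln_div ln_mult)
    also have "\<dots> = ln (r / C) / ln 2 + \<bar>ln H\<bar> / ln 2" using l by (simp add: diff_divide_distrib)
    also have "\<dots> \<ge> - (\<bar>ln (r / C)\<bar> / ln 2) + \<bar>ln H\<bar>"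
    proof (rule add_mono)
      have "- \<bar>ln (r / C)\<bar> / ln 2 \<le> ln (r / C) / ln 2" by (intro divide_right_mono) auto
      then show "- (\<bar>ln (r / C)\<bar> / ln 2) \<le> ln (r / C) / ln 2" by simp
      have "ln (2::real) \<le> 1" using ln_le_minus_one[of "2::real"] by simp
      then show "\<bar>ln H\<bar> \<le> \<bar>ln H\<bar> / ln 2" by (simp add: le_divide_eq mult_left_le)
    qed
    finally have y: "y \<ge> \<bar>ln H\<bar> - (D - 1)" by (simp add: D_def)
    have y0: "y \<ge> 0" using y l D by linarith
    define K where "K = nat \<lfloor>y\<rfloor>"
    have K1: "real K \<le> y" using y0 by (simp add: K_def)
    have K2: "real K \<ge> y - 1" using y0 by (simp add: K_def)
    have K3: "real K \<ge> \<bar>ln H\<bar> / 2" using K2 y l by linarith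
    then have "real K > 0" using l D by linarith
    then have "K > 0" by simp
    moreover have "C * H \<le> r / 2 ^ K"
    proof -
      have "2 ^ K = 2 powr (real K)" by (simp add: powr_realpow)
      also have "\<dots> \<le> 2 powr y" using K1 by simp
      also have "\<dots> = r / (C * H)" using H C r by (simp add: y_def)
      finally show ?thesis using H C by (simp add: field_simps)
    qed
    ultimately show ?thesis using 1 \<open>H < 1\<close> K3 by blast
  qed
  ultimately show ?thesis by blast
qed

text \<open>Constants independent of the index are rendered by one \<open>C\<close> common to all
  inequalities, and the limits are taken along preimages under \<open>H\<close>, and under the
  quotient involving \<open>h\<close>, of the right neighbourhoods of 0. The radius \<open>r\<close>
  is a version of the normalisation of the support and the unit ball that is free of translation and
  scale.\<close>

theorem mainTheorem9:
  fixes \<Omega> :: "(real^2) set" and A :: functional_family and p q :: nat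
    and \<P> :: "'i \<Rightarrow> prism set" and h H :: "'i \<Rightarrow> real"
    and \<phi>\<^sub>\<alpha> \<phi>\<^sub>\<beta> :: "'i \<Rightarrow> real^2 \<Rightarrow> real" and \<T>\<^sub>\<alpha> \<T>\<^sub>\<beta> :: "'i \<Rightarrow> (real^2) set set"
    and C r :: real
  assumes domain: "lipschitz_domain \<Omega>" "bounded \<Omega>" "polygonal \<Omega>"
    and A: "bounded_coercive_family \<Omega> A"
    and q: "q \<ge> 1"
    and const: "C \<ge> 1" "r > 0"
    and partition: "\<And>\<delta>. prism_partition \<Omega> (\<P> \<delta>)" "\<And>\<delta>. shape_regular_isotropic C (\<P> \<delta>)"
    and params: "\<And>\<delta>. h \<delta> > 0" "\<And>\<delta>. H \<delta> > 0" "\<And>\<delta>. h \<delta> \<le> H \<delta> / (real p + 2)"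
    and hat: "\<And>\<delta>. hat_function \<Omega> (\<T>\<^sub>\<alpha> \<delta>) (\<phi>\<^sub>\<alpha> \<delta>)" "\<And>\<delta>. hat_function \<Omega> (\<T>\<^sub>\<beta> \<delta>) (\<phi>\<^sub>\<beta> \<delta>)"
    and mean: "\<And>\<delta>. (\<integral>x. \<phi>\<^sub>\<alpha> \<delta> x \<partial>lebesgue_on \<Omega>) = (\<integral>x. \<phi>\<^sub>\<beta> \<delta> x \<partial>lebesgue_on \<Omega>)"
      "\<And>\<delta>. (\<integral>x. \<phi>\<^sub>\<alpha> \<delta> x \<partial>lebesgue_on \<Omega>) \<in> {(H \<delta>)\<^sup>2 / C .. C * (H \<delta>)\<^sup>2}"
    and diam: "\<And>\<delta>. diameter (supp (\<phi>\<^sub>\<alpha> \<delta>)) \<in> {H \<delta> / C .. C * H \<delta>}"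
      "\<And>\<delta>. diameter (supp (\<phi>\<^sub>\<beta> \<delta>)) \<in> {H \<delta> / C .. C * H \<delta>}"
    and dist: "\<And>\<delta>. setdist (supp (\<phi>\<^sub>\<alpha> \<delta>)) (supp (\<phi>\<^sub>\<beta> \<delta>)) \<le> C * H \<delta>"
    and away_from_boundary:
      "\<And>\<delta>. \<exists>x\<^sub>0. supp (\<phi>\<^sub>\<alpha> \<delta>) \<subseteq> cball x\<^sub>0 (C * H \<delta>) \<and> cball x\<^sub>0 r \<subseteq> \<Omega>"
    and coarse: "\<And>\<delta>. restrict_partition (\<P> \<delta>) ({0..H \<delta>} \<times> supp (\<phi>\<^sub>\<beta> \<delta>))
                        = (\<lambda>T. ({0..H \<delta>}, T)) ` \<T>\<^sub>\<beta> \<delta>"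
    and fine: "\<And>\<delta>. \<exists>n::nat. real n * h \<delta> = H \<delta> \<and>
      (\<forall>(I, T) \<in> restrict_partition (\<P> \<delta>) ({0..H \<delta>} \<times> supp (\<phi>\<^sub>\<alpha> \<delta>)).
         (\<exists>i\<in>{1..n}. I = {(real i - 1) * h \<delta> .. real i * h \<delta>}) \<and>
         (\<exists>T\<^sub>0\<in>\<T>\<^sub>\<alpha> \<delta>. T \<subseteq> T\<^sub>0) \<and> diameter T \<in> {h \<delta> / C .. C * h \<delta>})"
  shows "((\<lambda>\<delta>. gamma_dt \<Omega> p q (\<P> \<delta>)) \<longlongrightarrow> 0) (filtercomap H (at_right 0)) \<and>
         ((\<lambda>\<delta>. gamma_Be \<Omega> A p q (\<P> \<delta>)) \<longlongrightarrow> 0)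
           (inf (filtercomap H (at_right 0))
                (filtercomap (\<lambda>\<delta>. h \<delta> / ((H \<delta>)\<^sup>2 * sqrt \<bar>ln (H \<delta>)\<bar>)) (at_right 0)))"
proof -
  interpret \<Omega>: bounded_open \<Omega>
    using domain by unfold_locales (auto simp: lipschitz_domain_def)
  obtain c where c: "c > 0" and log: "\<And>\<Omega> x0 r K. bounded_open \<Omega> \<Longrightarrow> r > 0 \<Longrightarrow> cball x0 r \<subseteq> \<Omega> \<Longrightarrow>
      \<exists>v\<in>test_functions \<Omega>. (\<forall>x\<in>cball x0 (r / 2 ^ K). v x = real K) \<and> (V_norm \<Omega> v)\<^sup>2 \<le> c * real K"
    using log_test_function by metis
  obtain M0 where M0: "AE t in lebesgue_on \<Xi>. \<forall>u\<in>H10 \<Omega>. \<forall>v\<in>H10 \<Omega>. \<bar>A t u v\<bar> \<le> M0 * V_norm \<Omega> u * V_norm \<Omega> v"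
    using A unfolding bounded_coercive_family_def by blast
  \<comment> \<open>The bound in \<open>bounded_coercive_family\<close> comes without a
    sign.\<close>
  define M where "M = max M0 0"
  have M: "M \<ge> 0" "AE t in lebesgue_on \<Xi>. \<forall>u\<in>H10 \<Omega>. \<forall>v\<in>H10 \<Omega>. \<bar>A t u v\<bar> \<le> M * V_norm \<Omega> u * V_norm \<Omega> v"
  proof -
    have le: "M0 * V_norm \<Omega> u * V_norm \<Omega> v \<le> M * V_norm \<Omega> u * V_norm \<Omega> v" for u v
      by (intro mult_right_mono \<Omega>.V_norm_nonneg) (simp add: M_def)
    show "AE t in lebesgue_on \<Xi>. \<forall>u\<in>H10 \<Omega>. \<forall>v\<in>H10 \<Omega>. \<bar>A t u v\<bar> \<le> M * V_norm \<Omega> u * V_norm \<Omega> v"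
      using M0 by eventually_elim (blast intro: order_trans[OF _ le])
  qed (simp add: M_def)
  define M' where "M' = M * (2 ^ (p + 2) * real (p + 2) ^ 2 * sqrt (C ^ 6 * (pi * (1 + C)\<^sup>2)))"
  have M'0: "M' \<ge> 0" using M const by (simp add: M'_def)
  define b where "b = 1 / (C * sqrt c)"
  have b: "b > 0" using c const by (simp add: b_def)
  obtain H0 where H0: "H0 > 0" and scale: "\<And>H. 0 < H \<Longrightarrow> H < H0 \<Longrightarrow> H < 1 \<and> 3 * C * H \<le> r \<and>
    (\<exists>K::nat. K > 0 \<and> C * H \<le> r / 2 ^ K \<and> real K \<ge> \<bar>ln H\<bar> / 2)"
    using dyadic_scale_exists[OF const] by blast
  define l where "l \<delta> = sqrt \<bar>ln (H \<delta>)\<bar>" for \<delta>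
  define X where "X \<delta> = h \<delta> / ((H \<delta>)\<^sup>2 * sqrt \<bar>ln (H \<delta>)\<bar>)" for \<delta>

  \<comment> \<open>The estimate for the full operator is conditional: the denominator is positive
    only once \<open>X\<close> is small, which the second limit provides.\<close>
  have est: "l \<delta> > 0 \<and> 0 \<le> gamma_dt \<Omega> p q (\<P> \<delta>) \<and>
      gamma_dt \<Omega> p q (\<P> \<delta>) \<le> 144 * C ^ 3 * sqrt c * sqrt 2 / l \<delta> \<and>
      (M' * X \<delta> < b / sqrt 2 \<longrightarrow> 0 \<le> gamma_Be \<Omega> A p q (\<P> \<delta>) \<and>
        gamma_Be \<Omega> A p q (\<P> \<delta>) \<le> (144 * C\<^sup>2 / l \<delta> + M' * X \<delta>) / (b / sqrt 2 - M' * X \<delta>))"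
    if small: "H \<delta> < H0" for \<delta>
  proof -
    obtain n :: nat where n: "real n * h \<delta> = H \<delta>" and fine':
      "\<forall>(I, T) \<in> restrict_partition (\<P> \<delta>) ({0..H \<delta>} \<times> supp (\<phi>\<^sub>\<alpha> \<delta>)).
         (\<exists>i\<in>{1..n}. I = {(real i - 1) * h \<delta> .. real i * h \<delta>}) \<and>
         (\<exists>T\<^sub>0\<in>\<T>\<^sub>\<alpha> \<delta>. T \<subseteq> T\<^sub>0) \<and> diameter T \<in> {h \<delta> / C .. C * h \<delta>}"
      using fine[of \<delta>] by blast
    obtain x0 where x0: "supp (\<phi>\<^sub>\<alpha> \<delta>) \<subseteq> cball x0 (C * H \<delta>)" "cball x0 r \<subseteq> \<Omega>"
      using away_from_boundary[of \<delta>] by blast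
    obtain K :: nat where K: "K > 0" "C * H \<delta> \<le> r / 2 ^ K" "real K \<ge> \<bar>ln (H \<delta>)\<bar> / 2"
      and H1: "H \<delta> < 1" "3 * C * H \<delta> \<le> r"
      using scale[OF params(2) small] by blast
    interpret configuration \<Omega> "\<T>\<^sub>\<alpha> \<delta>" "\<phi>\<^sub>\<alpha> \<delta>" "\<T>\<^sub>\<beta> \<delta>" "\<phi>\<^sub>\<beta> \<delta>" "\<P> \<delta>" p q n "h \<delta>" "H \<delta>" C r x0
      by unfold_locales
        (use hat const params n partition mean(1) mean(2)[of \<delta>] x0 H1 diam(2)[of \<delta>] dist coarse fine' in auto)
    note log' = log[OF \<Omega>.bounded_open_axioms const(2) x0(2), of K]
    have lpos: "l \<delta> > 0" using H1(1) params(2)[of \<delta>] by (simp add: l_def)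
    have lK: "l \<delta> / sqrt 2 \<le> sqrt (real K)"
      using real_sqrt_le_mono[OF K(3)] by (simp add: l_def real_sqrt_divide)
    have "gamma_dt \<Omega> p q (\<P> \<delta>) \<le> 144 * C ^ 3 * sqrt c / sqrt (real K)"
      by (rule gamma_dt_bounds(2)[OF c K(1,2) log'])
    also have "\<dots> \<le> 144 * C ^ 3 * sqrt c / (l \<delta> / sqrt 2)"
      using lK lpos c const K(1) by (intro divide_left_mono) auto
    finally have dt: "gamma_dt \<Omega> p q (\<P> \<delta>) \<le> 144 * C ^ 3 * sqrt c * sqrt 2 / l \<delta>" by simp
    have "0 \<le> gamma_Be \<Omega> A p q (\<P> \<delta>) \<and>
        gamma_Be \<Omega> A p q (\<P> \<delta>) \<le> (144 * C\<^sup>2 / l \<delta> + M' * X \<delta>) / (b / sqrt 2 - M' * X \<delta>)"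
      if less: "M' * X \<delta> < b / sqrt 2"
    proof -
      \<comment> \<open>Dividing numerator and denominator by this scale expresses the bound through
        \<open>1 / l\<close> and \<open>X\<close> alone, the two quantities tending to 0.\<close>
      define s where "s = (H \<delta>)\<^sup>2 * l \<delta>"
      have s: "s > 0" using lpos params(2)[of \<delta>] by (simp add: s_def)
      have "X \<delta> = h \<delta> / s" by (simp add: X_def s_def l_def)
      then have hX: "M' * h \<delta> = M' * X \<delta> * s" using s by simp
      have ls: "b / sqrt 2 * s \<le> (H \<delta>)\<^sup>2 / (C * sqrt c) * sqrt (real K)"
      proof -
        have "b / sqrt 2 * s = b * (H \<delta>)\<^sup>2 * (l \<delta> / sqrt 2)" by (simp add: s_def)
        also have "\<dots> \<le> b * (H \<delta>)\<^sup>2 * sqrt (real K)" using b by (intro mult_left_mono lK) auto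
        finally show ?thesis by (simp add: b_def)
      qed
      have p0: "(b / sqrt 2 - M' * X \<delta>) * s > 0" using less s by simp
      have p1: "(b / sqrt 2 - M' * X \<delta>) * s \<le> (H \<delta>)\<^sup>2 / (C * sqrt c) * sqrt (real K) - M' * h \<delta>"
        using ls by (simp add: hX left_diff_distrib)
      then have pos: "(H \<delta>)\<^sup>2 / (C * sqrt c) * sqrt (real K) - M' * h \<delta> > 0" using p0 by linarith
      note Be = gamma_Be_bounds[OF c K(1,2) log' M M'_def pos]
      have "gamma_Be \<Omega> A p q (\<P> \<delta>) \<le> (144 * C\<^sup>2 * (H \<delta>)\<^sup>2 + M' * h \<delta>) /
          ((H \<delta>)\<^sup>2 / (C * sqrt c) * sqrt (real K) - M' * h \<delta>)" by (rule Be(2))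
      also have "\<dots> \<le> (144 * C\<^sup>2 * (H \<delta>)\<^sup>2 + M' * h \<delta>) / ((b / sqrt 2 - M' * X \<delta>) * s)"
        using p0 p1 M'0 params(1)[of \<delta>] by (intro frac_le) auto
      also have "144 * C\<^sup>2 * (H \<delta>)\<^sup>2 + M' * h \<delta> = (144 * C\<^sup>2 / l \<delta> + M' * X \<delta>) * s"
        unfolding hX using lpos by (simp add: s_def distrib_right)
      also have "(144 * C\<^sup>2 / l \<delta> + M' * X \<delta>) * s / ((b / sqrt 2 - M' * X \<delta>) * s)
          = (144 * C\<^sup>2 / l \<delta> + M' * X \<delta>) / (b / sqrt 2 - M' * X \<delta>)" using s by simp
      finally show ?thesis using Be(1) by blast
    qed
    then show ?thesis using lpos dt gamma_dt_bounds(1)[OF c K(1,2) log'] by blast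
  qed

  define F where "F = filtercomap H (at_right (0::real))"
  define F2 where "F2 = inf F (filtercomap X (at_right 0))"
  have H_lim: "filterlim H (at_right 0) F" by (simp add: F_def filterlim_filtercomap)
  have small: "\<forall>\<^sub>F \<delta> in F. H \<delta> < H0"
    by (rule eventually_compose_filterlim[OF _ H_lim]) (use H0 in \<open>auto simp: eventually_at_right intro: exI[of _ H0]\<close>)
  have l_lim: "filterlim l at_top F"
  proof -
    have "filterlim (\<lambda>x::real. \<bar>ln x\<bar>) at_top (at_right 0)"
      using filterlim_at_infinity_imp_norm_at_top[OF filterlim_at_bot_imp_at_infinity[OF ln_at_0]] by simp
    then have "filterlim (\<lambda>x::real. sqrt \<bar>ln x\<bar>) at_top (at_right 0)"
      by (rule filterlim_compose[OF sqrt_at_top])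
    then show ?thesis unfolding l_def using H_lim by (rule filterlim_compose)
  qed
  have inv_l: "((\<lambda>\<delta>. a / l \<delta>) \<longlongrightarrow> 0) F" for a
    by (rule tendsto_divide_0[OF tendsto_const]) (use l_lim filterlim_at_top_imp_at_infinity in blast)
  have "((\<lambda>\<delta>. gamma_dt \<Omega> p q (\<P> \<delta>)) \<longlongrightarrow> 0) F"
    by (rule tendsto_sandwich[OF _ _ tendsto_const inv_l[of "144 * C ^ 3 * sqrt c * sqrt 2"]])
      (use small est in \<open>auto elim: eventually_mono\<close>)
  moreover have "((\<lambda>\<delta>. gamma_Be \<Omega> A p q (\<P> \<delta>)) \<longlongrightarrow> 0) F2"
  proof -
    have le: "F2 \<le> F" by (simp add: F2_def)
    have "filterlim X (at_right 0) F2"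
      by (rule filterlim_mono[OF filterlim_filtercomap order_refl]) (simp add: F2_def)
    then have X_lim: "(X \<longlongrightarrow> 0) F2"
      by (simp add: filterlim_at)
    have lim: "((\<lambda>\<delta>. (144 * C\<^sup>2 / l \<delta> + M' * X \<delta>) / (b / sqrt 2 - M' * X \<delta>)) \<longlongrightarrow>
        (0 + M' * 0) / (b / sqrt 2 - M' * 0)) F2"
      by (intro tendsto_intros X_lim tendsto_mono[OF le inv_l]) (use b in simp)
    have "((\<lambda>\<delta>. M' * X \<delta>) \<longlongrightarrow> M' * 0) F2" by (intro tendsto_intros X_lim)
    then have "\<forall>\<^sub>F \<delta> in F2. M' * X \<delta> < b / sqrt 2"
      by (rule order_tendstoD(2)) (use b in simp)
    moreover have "\<forall>\<^sub>F \<delta> in F2. H \<delta> < H0" using small le by (rule filter_leD[rotated])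
    ultimately have ev: "\<forall>\<^sub>F \<delta> in F2. 0 \<le> gamma_Be \<Omega> A p q (\<P> \<delta>) \<and>
        gamma_Be \<Omega> A p q (\<P> \<delta>) \<le> (144 * C\<^sup>2 / l \<delta> + M' * X \<delta>) / (b / sqrt 2 - M' * X \<delta>)"
      by eventually_elim (use est in blast)
    show ?thesis
      by (rule tendsto_sandwich[OF _ _ tendsto_const lim[simplified]])
        (use ev in \<open>auto elim: eventually_mono\<close>)
  qed
  ultimately show ?thesis
    by (simp add: F_def F2_def X_def[abs_def])
qed

end
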